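(* Consider the system described in the context. Let $\tilde c$ be an upper bound on both $\|w_0\|_\infty$ and $\|v(0,\cdot)\|_\infty$. There exist constants $\tilde c'>0$ (a conservative estimate is $\tilde c'=\frac{1}{2\max\{1,l_{g^u}\}}e^{-\gamma_2}$, with $\gamma_2$ as defined in the context) and $c'>0$, such that if $\|u_t(\cdot,0)\|_\infty\le\tilde c'$, $\|\partial_tg^u\|_\infty\le\tilde c'$ and $\|v_t(0,\cdot)\|_\infty\le\tilde c'$, then the system has a unique global solution in $\mathcal X^{\kappa_1\tilde c,c'}_{[0,1]\times[0,\infty)}$, where $$\kappa_1=\max\{1,l_{g^u}\}\exp(l_F\,l_{\Lambda^{-1}}).$$
   Context: System. On $x\in[0,1]$, $t\ge0$, with state $w=(u,v)^T$: $w_t(x,t)=\Lambda(x,w(x,t))\,w_x(x,t)+F(x,w(x,t))$, $u(0,t)=g^u(v(0,t),t)$, $v(1,t)=U(t)$, $w(\cdot,0)=w_0=(u_0,v_0)^T$. Here $\Lambda=\operatorname{diag}(-\lambda^u,\lambda^v)$ with $\lambda^u,\lambda^v>0$ on $[0,1]\times\mathbb R^2$, $F=(f^u,f^v)^T$, and $U$ is the control input. Standing assumptions. $\Lambda$, $F$, $g^u$ are uniformly Lipschitz in their arguments, with finite constants $l_\Lambda=\operatorname{ess\,sup}_{x,w}\max\{\|\partial_u\Lambda(x,w)\|_\infty,\|\partial_v\Lambda(x,w)\|_\infty\}$, $l_F=\operatorname{ess\,sup}_{x,w}\|\partial_wF(x,w)\|_\infty$, $l_{g^u}=\operatorname{ess\,sup}_{v,t}|\partial_vg^u(v,t)|$,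 and $l_{\Lambda^{-1}}=\sup_{x,w}\|\Lambda(x,w)^{-1}\|_\infty<\infty$ (over $x\in[0,1]$, $w\in\mathbb R^2$, $v\in\mathbb R$, $t\ge0$). Also $F(x,0)=0$ and $g^u(0,t)=0$ for all $x,t$. Initial condition and input are Lipschitz and compatible: $u_0(0)=g^u(v_0(0),0)$ and $U(t)=\lim_{x\to1}v(x,t)$ for all $t\ge0$. Norms of functions are (essential) sup norms; $v(0,\cdot)$ is the boundary trace of $v$ at $x=0$; $\|\partial_tg^u\|_\infty$ is the essential supremum over all arguments. Constant $\gamma_2$. Define, as functions of $(x,z)\in[0,1]\times\mathbb R^2$ (with $z$ in place of the state $(u,v)$), $c_1=\frac{\partial_u\lambda^u}{\lambda^u}$, $c_2=\frac{\partial_v\lambda^u}{\lambda^u}$, $c_3=\partial_uf^u-\frac{\partial_u\lambda^u}{\lambda^u}f^u$, $c_4=\partial_vf^u-\frac{\partial_v\lambda^u}{\lambda^u}f^u$, $c_5=\frac{\partial_u\lambda^v}{\lambda^v}$, $c_6=\frac{\partial_v\lambda^v}{\lambda^v}$, $c_7=\partial_uf^v-\frac{\partial_u\lambda^v}{\lambda^v}f^v$, $c_8=\partial_vf^v-\frac{\partial_v\lambda^v}{\lambda^v}f^v$. Then $$\gamma_2=\sup_{x\in[0,1],\,\|z\|\le\kappa_1\tilde c}\max\left\{\left|\tfrac{c_1+c_2}{\lambda^u}\right|,\left|\tfrac{c_3+c_4}{\lambda^u}\right|,\left|\tfrac{c_5+c_6}{\lambda^v}\right|,\left|\tfrac{c_7+c_8}{\lambda^v}\right|\right\},$$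 all functions being evaluated at $(x,z)$. Function space and solutions. $\mathcal X^{c,c'}_{\mathcal A}$ is the set of Lipschitz functions $h$ on $\mathcal A$ with $\sup_{\mathcal A}\|h\|_\infty\le c$ and minimal Lipschitz constant (w.r.t. max-norms) at most $c'$. Solutions are broad solutions: Lipschitz functions satisfying the integral equations obtained by integrating the PDE along characteristics (they satisfy the PDE almost everywhere), together with the initial and boundary conditions. Viewpoint. The roles of $x$ and $t$ are reversed: the system is regarded as the initial-boundary value problem $w_x=\Lambda(x,w)^{-1}(w_t-F(x,w))$ in the positive $x$-direction on $[0,1]\times[0,\infty)$, with initial data at $x=0$, a boundary condition for $u$ at $t=0$, and an open boundary for $v$ at $t=\infty$.
   Formalization: In γ_2 each |c_i+c_j| is replaced by |c_i|+|c_j| (and sup by essential sup), since with |c_i+c_j| the estimate for c̃' fails: F=0, g^u=0, v=0, λ^v=1, λ^u=1/(2−sat(K(u−v))) gives γ_2=0, yet for large K characteristics cross before x=1. *)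

theory Defs
  imports "HOL-Analysis.Analysis"
begin

(* A coefficient is a curried function h x a b of the position x and the state (a, b) = (u, v);
   a state component is a curried function u x t.  Norms of states and of space-time points are
   maximum norms. *)

(* Essential supremum over S of the absolute value of f, for f essentially bounded on S. *)
definition ess_sup_on :: "'a::euclidean_space set \<Rightarrow> ('a \<Rightarrow> real) \<Rightarrow> real" where
  "ess_sup_on S f = Inf {c. 0 \<le> c \<and> (AE p in lborel. p \<in> S \<longrightarrow> \<bar>f p\<bar> \<le> c)}"

(* All functions below are Lipschitz, hence differentiable almost everywhere in each argument; the
   values of deriv elsewhere do not affect the essential suprema. *)
definition d_u :: "(real \<Rightarrow> real \<Rightarrow> real \<Rightarrow> real) \<Rightarrow> real \<Rightarrow> real \<Rightarrow> real \<Rightarrow> real" where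
  "d_u h x a b = deriv (\<lambda>s. h x s b) a"

definition d_v :: "(real \<Rightarrow> real \<Rightarrow> real \<Rightarrow> real) \<Rightarrow> real \<Rightarrow> real \<Rightarrow> real \<Rightarrow> real" where
  "d_v h x a b = deriv (\<lambda>s. h x a s) b"

definition lipschitz_coeff :: "(real \<Rightarrow> real \<Rightarrow> real \<Rightarrow> real) \<Rightarrow> bool" where
  "lipschitz_coeff h \<longleftrightarrow> (\<exists>L. L-lipschitz_on ({0..1} \<times> UNIV) (\<lambda>(x, a, b). h x a b))"

(* The matrix norm induced by the maximum norm is the maximal absolute row sum. *)
definition l_F :: "(real \<Rightarrow> real \<Rightarrow> real \<Rightarrow> real) \<Rightarrow> (real \<Rightarrow> real \<Rightarrow> real \<Rightarrow> real) \<Rightarrow> real" where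
  "l_F fu fv = ess_sup_on ({0..1} \<times> UNIV)
     (\<lambda>(x, a, b). max (\<bar>d_u fu x a b\<bar> + \<bar>d_v fu x a b\<bar>) (\<bar>d_u fv x a b\<bar> + \<bar>d_v fv x a b\<bar>))"

definition inv_Lambda_norm ::
  "(real \<Rightarrow> real \<Rightarrow> real \<Rightarrow> real) \<Rightarrow> (real \<Rightarrow> real \<Rightarrow> real \<Rightarrow> real) \<Rightarrow> real \<times> real \<times> real \<Rightarrow> real" where
  "inv_Lambda_norm lu lv = (\<lambda>(x, a, b). max \<bar>1 / lu x a b\<bar> \<bar>1 / lv x a b\<bar>)"

definition l_inv_Lambda ::
  "(real \<Rightarrow> real \<Rightarrow> real \<Rightarrow> real) \<Rightarrow> (real \<Rightarrow> real \<Rightarrow> real \<Rightarrow> real) \<Rightarrow> real" where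
  "l_inv_Lambda lu lv = (SUP p \<in> {0..1} \<times> UNIV. inv_Lambda_norm lu lv p)"

(* g b t is the boundary value u(0,t) when v(0,t) = b. *)
definition l_gu :: "(real \<Rightarrow> real \<Rightarrow> real) \<Rightarrow> real" where
  "l_gu g = ess_sup_on (UNIV \<times> {0..}) (\<lambda>(b, t). deriv (\<lambda>s. g s t) b)"

definition dt_gu_norm :: "(real \<Rightarrow> real \<Rightarrow> real) \<Rightarrow> real" where
  "dt_gu_norm g = ess_sup_on (UNIV \<times> {0..}) (\<lambda>(b, t). deriv (\<lambda>s. g b s) t)"

definition kappa1 ::
  "(real \<Rightarrow> real \<Rightarrow> real \<Rightarrow> real) \<Rightarrow> (real \<Rightarrow> real \<Rightarrow> real \<Rightarrow> real) \<Rightarrow>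
   (real \<Rightarrow> real \<Rightarrow> real \<Rightarrow> real) \<Rightarrow> (real \<Rightarrow> real \<Rightarrow> real \<Rightarrow> real) \<Rightarrow> real \<Rightarrow> real" where
  "kappa1 lu lv fu fv lg = max 1 lg * exp (l_F fu fv * l_inv_Lambda lu lv)"

(* With l = lu, f = fu this is (|c1| + |c2|) / lu, respectively (|c3| + |c4|) / lu, where
   d/dx u_t = (c1 u_t^2 + c2 u_t v_t + c3 u_t + c4 v_t) / lu along the u-characteristics of the
   system differentiated in t; with l = lv, f = fv it gives c5, ..., c8. *)
definition quad_rate ::
  "(real \<Rightarrow> real \<Rightarrow> real \<Rightarrow> real) \<Rightarrow> real \<Rightarrow> real \<Rightarrow> real \<Rightarrow> real" where
  "quad_rate l x a b =
     (\<bar>d_u l x a b / l x a b\<bar> + \<bar>d_v l x a b / l x a b\<bar>) / l x a b"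

definition lin_rate ::
  "(real \<Rightarrow> real \<Rightarrow> real \<Rightarrow> real) \<Rightarrow> (real \<Rightarrow> real \<Rightarrow> real \<Rightarrow> real) \<Rightarrow> real \<Rightarrow> real \<Rightarrow> real \<Rightarrow> real" where
  "lin_rate l f x a b =
     (\<bar>d_u f x a b - d_u l x a b / l x a b * f x a b\<bar>
      + \<bar>d_v f x a b - d_v l x a b / l x a b * f x a b\<bar>) / l x a b"

(* The coefficient pairs enter through |ci| + |cj|, not through |ci + cj|.  The latter does not
   control the growth of (u_t, v_t): for fu = fv = 0, lv = 1, g = 0, v = 0 and
   lu = 1 / (2 - max (-1) (min 1 (K * (u - v)))) one has c1 + c2 = 0, yet for large K initial data
   with |u_t| = 1/2 form a shock at a distance of order 1/K.  Both expressions agree where the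
   two coefficients of each pair have the same sign. *)
definition gamma2 ::
  "(real \<Rightarrow> real \<Rightarrow> real \<Rightarrow> real) \<Rightarrow> (real \<Rightarrow> real \<Rightarrow> real \<Rightarrow> real) \<Rightarrow>
   (real \<Rightarrow> real \<Rightarrow> real \<Rightarrow> real) \<Rightarrow> (real \<Rightarrow> real \<Rightarrow> real \<Rightarrow> real) \<Rightarrow> real \<Rightarrow> real" where
  "gamma2 lu lv fu fv R = ess_sup_on {(x, a, b). x \<in> {0..1} \<and> max \<bar>a\<bar> \<bar>b\<bar> \<le> R}
     (\<lambda>(x, a, b). max (max (quad_rate lu x a b) (lin_rate lu fu x a b))
                       (max (quad_rate lv x a b) (lin_rate lv fv x a b)))"

(* u_t at t = 0, computed from the initial condition (u0, v0) by the differential equation *)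
definition ut_initial ::
  "(real \<Rightarrow> real \<Rightarrow> real \<Rightarrow> real) \<Rightarrow> (real \<Rightarrow> real \<Rightarrow> real \<Rightarrow> real) \<Rightarrow>
   (real \<Rightarrow> real) \<Rightarrow> (real \<Rightarrow> real) \<Rightarrow> real \<Rightarrow> real" where
  "ut_initial lu fu u0 v0 x = - lu x (u0 x) (v0 x) * deriv u0 x + fu x (u0 x) (v0 x)"

(* The function space on [0,1] x [0,\<infinity>): sup norm at most c, Lipschitz constant at most c'. *)
definition in_X :: "real \<Rightarrow> real \<Rightarrow> (real \<Rightarrow> real \<Rightarrow> real) \<Rightarrow> (real \<Rightarrow> real \<Rightarrow> real) \<Rightarrow> bool" where
  "in_X c c' u v \<longleftrightarrow>
     (\<forall>x\<in>{0..1}. \<forall>t\<ge>0. max \<bar>u x t\<bar> \<bar>v x t\<bar> \<le> c) \<and>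
     (\<forall>x\<in>{0..1}. \<forall>y\<in>{0..1}. \<forall>t\<ge>0. \<forall>s\<ge>0.
        max \<bar>u x t - u y s\<bar> \<bar>v x t - v y s\<bar> \<le> c' * max \<bar>x - y\<bar> \<bar>t - s\<bar>)"

(* \<xi> is a characteristic of speed sp on the time interval [a,b] that stays in [0,X]. *)
definition characteristic ::
  "real \<Rightarrow> (real \<Rightarrow> real \<Rightarrow> real \<Rightarrow> real) \<Rightarrow> (real \<Rightarrow> real \<Rightarrow> real) \<Rightarrow> (real \<Rightarrow> real \<Rightarrow> real) \<Rightarrow>
   (real \<Rightarrow> real) \<Rightarrow> real \<Rightarrow> real \<Rightarrow> bool" where
  "characteristic X sp u v \<xi> a b \<longleftrightarrow> 0 \<le> a \<and> a \<le> b \<and>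
     (\<forall>t\<in>{a..b}. \<xi> t \<in> {0..X} \<and>
        (\<xi> has_real_derivative sp (\<xi> t) (u (\<xi> t) t) (v (\<xi> t) t)) (at t within {a..b}))"

(* Broad solutions on [0,X] x [0,\<infinity>) of u_t = - lu u_x + fu, v_t = lv v_x + fv: the integral
   equation is required on every characteristic segment in the domain; initial and boundary
   conditions are imposed separately below. *)
definition broad_solution ::
  "(real \<Rightarrow> real \<Rightarrow> real \<Rightarrow> real) \<Rightarrow> (real \<Rightarrow> real \<Rightarrow> real \<Rightarrow> real) \<Rightarrow>
   (real \<Rightarrow> real \<Rightarrow> real \<Rightarrow> real) \<Rightarrow> (real \<Rightarrow> real \<Rightarrow> real \<Rightarrow> real) \<Rightarrow>
   real \<Rightarrow> (real \<Rightarrow> real \<Rightarrow> real) \<Rightarrow> (real \<Rightarrow> real \<Rightarrow> real) \<Rightarrow> bool" where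
  "broad_solution lu lv fu fv X u v \<longleftrightarrow>
     (\<exists>L. L-lipschitz_on ({0..X} \<times> {0..}) (\<lambda>(x, t). (u x t, v x t))) \<and>
     (\<forall>\<xi> a b. characteristic X lu u v \<xi> a b \<longrightarrow>
        ((\<lambda>t. fu (\<xi> t) (u (\<xi> t) t) (v (\<xi> t) t)) has_integral (u (\<xi> b) b - u (\<xi> a) a)) {a..b}) \<and>
     (\<forall>\<xi> a b. characteristic X (\<lambda>x a b. - lv x a b) u v \<xi> a b \<longrightarrow>
        ((\<lambda>t. fv (\<xi> t) (u (\<xi> t) t) (v (\<xi> t) t)) has_integral (v (\<xi> b) b - v (\<xi> a) a)) {a..b})"

definition system_solution ::
  "(real \<Rightarrow> real \<Rightarrow> real \<Rightarrow> real) \<Rightarrow> (real \<Rightarrow> real \<Rightarrow> real \<Rightarrow> real) \<Rightarrow>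
   (real \<Rightarrow> real \<Rightarrow> real \<Rightarrow> real) \<Rightarrow> (real \<Rightarrow> real \<Rightarrow> real \<Rightarrow> real) \<Rightarrow> (real \<Rightarrow> real \<Rightarrow> real) \<Rightarrow>
   (real \<Rightarrow> real) \<Rightarrow> (real \<Rightarrow> real) \<Rightarrow> (real \<Rightarrow> real) \<Rightarrow>
   (real \<Rightarrow> real \<Rightarrow> real) \<Rightarrow> (real \<Rightarrow> real \<Rightarrow> real) \<Rightarrow> bool" where
  "system_solution lu lv fu fv g u0 v0 U u v \<longleftrightarrow>
     broad_solution lu lv fu fv 1 u v \<and>
     (\<forall>t\<ge>0. u 0 t = g (v 0 t) t \<and> v 1 t = U t) \<and>
     (\<forall>x\<in>{0..1}. u x 0 = u0 x \<and> v x 0 = v0 x)"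

(* The problem in the positive x-direction on [0,X] x [0,\<infinity>): v(0,\<cdot>) = phi is given at x = 0,
   u is given at t = 0, and there is no condition on v at t = 0 or at x = X. *)
definition x_solution ::
  "(real \<Rightarrow> real \<Rightarrow> real \<Rightarrow> real) \<Rightarrow> (real \<Rightarrow> real \<Rightarrow> real \<Rightarrow> real) \<Rightarrow>
   (real \<Rightarrow> real \<Rightarrow> real \<Rightarrow> real) \<Rightarrow> (real \<Rightarrow> real \<Rightarrow> real \<Rightarrow> real) \<Rightarrow> (real \<Rightarrow> real \<Rightarrow> real) \<Rightarrow>
   (real \<Rightarrow> real) \<Rightarrow> (real \<Rightarrow> real) \<Rightarrow> real \<Rightarrow>
   (real \<Rightarrow> real \<Rightarrow> real) \<Rightarrow> (real \<Rightarrow> real \<Rightarrow> real) \<Rightarrow> bool" where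
  "x_solution lu lv fu fv g u0 phi X u v \<longleftrightarrow>
     broad_solution lu lv fu fv X u v \<and>
     (\<forall>t\<ge>0. v 0 t = phi t \<and> u 0 t = g (phi t) t) \<and>
     (\<forall>x\<in>{0..X}. u x 0 = u0 x)"

(* Once v(0,\<cdot>) = phi and u0 are fixed, the problem in the x-direction determines v0 and U.  The
   data fit together if every solution of that problem, as far in x as it exists, has v0 as its
   initial value and, if it reaches x = 1, has U as its value of v there.  Existence of a solution
   up to x = 1 is not assumed. *)
definition compatible_data ::
  "(real \<Rightarrow> real \<Rightarrow> real \<Rightarrow> real) \<Rightarrow> (real \<Rightarrow> real \<Rightarrow> real \<Rightarrow> real) \<Rightarrow>
   (real \<Rightarrow> real \<Rightarrow> real \<Rightarrow> real) \<Rightarrow> (real \<Rightarrow> real \<Rightarrow> real \<Rightarrow> real) \<Rightarrow> (real \<Rightarrow> real \<Rightarrow> real) \<Rightarrow>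
   (real \<Rightarrow> real) \<Rightarrow> (real \<Rightarrow> real) \<Rightarrow> (real \<Rightarrow> real) \<Rightarrow> (real \<Rightarrow> real) \<Rightarrow> bool" where
  "compatible_data lu lv fu fv g u0 v0 U phi \<longleftrightarrow>
     u0 0 = g (v0 0) 0 \<and> phi 0 = v0 0 \<and>
     (\<forall>X u v. 0 < X \<and> X \<le> 1 \<and> x_solution lu lv fu fv g u0 phi X u v \<longrightarrow>
        (\<forall>x\<in>{0..X}. v x 0 = v0 x) \<and> (X = 1 \<longrightarrow> (\<forall>t\<ge>0. v 1 t = U t)))"

end

theory Submission
  imports Defs "HOL-Analysis.Analysis"
begin

text \<open>With \<open>x\<close> as the evolution variable the system reads \<open>u_x = - M u_t + P\<close>, \<open>v_x = M' v_t - P'\<close>, where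
  \<open>M\<close>, \<open>M'\<close> are the reciprocals of the speeds and \<open>P\<close>, \<open>P'\<close> the sources divided by the speeds. All four
  are \<open>gamma2\<close>-Lipschitz in the state for the maximum norm, so a bound \<open>y\<close> on the Lipschitz constants in \<open>t\<close>
  obeys the Riccati inequality \<open>y' \<le> gamma2 (y + y\<^sup>2)\<close>; starting from \<open>y(0) = exp (- gamma2)\<close> it
  remains finite up to \<open>x = 1\<close>. Solutions are limits of an explicit Euler scheme in \<open>x\<close> whose layers satisfy the
  discrete version of this inequality. At the corner the argument needs a bound on \<open>u_t(\<cdot>,0)\<close>, which
  the differential equation expresses through \<open>v(\<cdot>,0)\<close>; compatibility identifies \<open>v(\<cdot>,0)\<close> with \<open>v0\<close>, but
  only as far as a solution exists, so the bound is continued in \<open>x\<close> by steps of a uniform length. Uniqueness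
  follows from a contraction on short time slabs.

  The constants are essential suprema of partial derivatives, so Lipschitz bounds are recovered from them by
  averaging over small squares and the fundamental theorem of calculus for Lipschitz functions, the latter from
  almost everywhere differentiability (Vitali covering).\<close>

text \<open>The equation y' = k (y + y^2), y(0) = y0, blows up at x = ln (1 + 1 / y0) / k. For y0 =
  exp (- k) this is ln (1 + exp k) / k > 1, hence the factor exp (- gamma2). The denominator 2 max
  {1, l_gu} arises because the boundary value of u has Lipschitz constant at most (l_gu + 1) ct'; it
  also puts ct' strictly below exp (- gamma2), and this margin absorbs the mesh error in u_t(., 0).
  A v-step in x reads values at later times, so the open boundary at t = \<infinity> asks for no
  condition and all bounds are uniform in t. The difficulty sits at t = 0: compatibility speaks of
  exact solutions, but the bound on u_t(., 0) is needed for discrete layers, before a limit is known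
  to exist. The circle is broken by a cruder bound that ignores v(., 0). It carries the layers a
  fixed distance beyond any X already reached; there a limit exists, compatibility applies, and the
  Riccati bound replaces the crude one. That bound does not deteriorate with the number of
  continuations.\<close>

section \<open>Almost everywhere differentiability of Lipschitz functions\<close>

text \<open>Vitali covering: the intervals on which \<open>g\<close> stretches lengths by at most
  \<open>p\<close> cover \<open>E\<close> finely, so countably many disjoint ones cover it up to a
  null set. Monotonicity keeps their images disjoint, the Lipschitz bound keeps the null set null,
  and the lengths add up within \<open>U\<close>.\<close>

lemma emeasure_image_le_of_small_growth:
  fixes g :: "real \<Rightarrow> real"
  assumes mono: "strict_mono g"
    and lip: "\<And>x y. \<bar>g x - g y\<bar> \<le> c * \<bar>x - y\<bar>"
    and p: "0 \<le> p" and EU: "E \<subseteq> U" "open U"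
    and small: "\<And>x d. x \<in> E \<Longrightarrow> 0 < d \<Longrightarrow>
      \<exists>u v. u \<le> x \<and> x \<le> v \<and> u < v \<and> v - u < d \<and> g v - g u \<le> p * (v - u)"
  shows "emeasure lebesgue (g ` E) \<le> ennreal p * emeasure lebesgue U"
proof -
  define K where "K = {(u, v). u < v \<and> {u..v} \<subseteq> U \<and> g v - g u \<le> p * (v - u)}"
  define a where "a = (\<lambda>(u, v). (u + v) / 2 :: real)"
  define r where "r = (\<lambda>(u, v). (v - u) / 2 :: real)"
  have cb: "cball (a (u, v)) (r (u, v)) = {u..v}" for u v
    by (simp add: a_def r_def cball_eq_atLeastAtMost field_simps)
  have 1: "0 < r i" if "i \<in> K" for i using that by (auto simp: K_def r_def)
  have 2: "\<exists>i. i \<in> K \<and> x \<in> cball (a i) (r i) \<and> r i < d" if x: "x \<in> E" "0 < d" for x d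
  proof -
    obtain e where e: "e > 0" "ball x e \<subseteq> U" using x EU by (meson open_contains_ball subsetD)
    obtain u v where uv: "u \<le> x" "x \<le> v" "u < v" "v - u < min d e" "g v - g u \<le> p * (v - u)"
      using small[OF x(1), of "min d e"] x(2) e(1) by (metis min_less_iff_conj)
    have "{u..v} \<subseteq> ball x e" using uv by (auto simp: dist_real_def)
    then have "(u, v) \<in> K" using uv e by (auto simp: K_def)
    moreover have "x \<in> cball (a (u, v)) (r (u, v))" using uv by (simp add: cb)
    moreover have "r (u, v) < d" using uv by (auto simp: r_def)
    ultimately show ?thesis by blast
  qed
  obtain C where C: "countable C" "C \<subseteq> K"
     "pairwise (\<lambda>i j. disjnt (cball (a i) (r i)) (cball (a j) (r j))) C"
     "negligible (E - (\<Union>i \<in> C. cball (a i) (r i)))"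
    by (rule Vitali_covering_theorem_cballs[of K r E a, OF 1 2])
  let ?I = "\<lambda>i. {fst i..snd i}" and ?J = "\<lambda>i. {g (fst i)..g (snd i)}"
  have cb': "cball (a i) (r i) = ?I i" for i using cb[of "fst i" "snd i"] by simp
  have lt: "fst i < snd i" if "i \<in> C" for i using that C by (auto simp: K_def)
  have dI: "disjoint_family_on ?I C"
    using C(3) by (auto simp: disjoint_family_on_def pairwise_def cb' disjnt_def)
  have dJ: "disjoint_family_on ?J C"
    unfolding disjoint_family_on_def
  proof (intro ballI impI)
    fix i j assume *: "i \<in> C" "j \<in> C" "i \<noteq> j"
    have "?I i \<inter> ?I j = {}" using dI * by (simp add: disjoint_family_on_def)
    moreover have "fst i < snd i" "fst j < snd j" using lt * by auto
    ultimately have "snd i < fst j \<or> snd j < fst i"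
      by (simp add: Int_atLeastAtMost) (linarith)
    then have "g (snd i) < g (fst j) \<or> g (snd j) < g (fst i)"
      using mono by (auto simp: strict_mono_def)
    then show "?J i \<inter> ?J j = {}" by auto
  qed
  let ?N = "E - (\<Union>i \<in> C. ?I i)"
  have N: "negligible (g ` ?N)"
  proof (rule negligible_locally_Lipschitz_image)
    show "negligible ?N" using C(4) by (simp add: cb')
    show "\<exists>T B. open T \<and> x \<in> T \<and> (\<forall>y\<in>?N \<inter> T. norm (g y - g x) \<le> B * norm (y - x))" for x
      using lip by (intro exI[of _ UNIV] exI[of _ c]) auto
  qed simp
  have sub: "g ` E \<subseteq> g ` ?N \<union> (\<Union>i\<in>C. ?J i)"
  proof (rule image_subsetI)
    fix x assume x: "x \<in> E"
    show "g x \<in> g ` ?N \<union> (\<Union>i\<in>C. ?J i)"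
    proof (cases "x \<in> ?N")
      case False
      then obtain i where "i \<in> C" "x \<in> ?I i" using x by blast
      then have "g x \<in> ?J i" using mono by (simp add: strict_mono_less_eq)
      then show ?thesis using \<open>i \<in> C\<close> by blast
    qed blast
  qed
  have Jm: "(\<Union>i\<in>C. ?J i) \<in> sets lebesgue" using C(1) by (intro sets.countable_UN') auto
  have nN: "g ` ?N \<in> null_sets lebesgue" using N by (simp add: negligible_iff_null_sets)
  have "emeasure lebesgue (g ` E) \<le> emeasure lebesgue ((\<Union>i\<in>C. ?J i) \<union> g ` ?N)"
    using sub Jm nN by (intro emeasure_mono) (auto dest: null_setsD2)
  also have "\<dots> = emeasure lebesgue (\<Union>i\<in>C. ?J i)"
    by (rule emeasure_Un_null_set[OF Jm nN])
  also have "\<dots> = (\<integral>\<^sup>+ i. emeasure lebesgue (?J i) \<partial>count_space C)"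
    using C(1) dJ by (intro emeasure_UN_countable) auto
  also have "\<dots> \<le> (\<integral>\<^sup>+ i. ennreal p * emeasure lebesgue (?I i) \<partial>count_space C)"
  proof (rule nn_integral_mono)
    fix i assume "i \<in> space (count_space C)"
    then have "i \<in> K" using C by auto
    then have *: "fst i < snd i" "g (snd i) - g (fst i) \<le> p * (snd i - fst i)" by (auto simp: K_def)
    then have "g (fst i) \<le> g (snd i)" using mono by (simp add: strict_mono_less_eq)
    then show "emeasure lebesgue (?J i) \<le> ennreal p * emeasure lebesgue (?I i)"
      using * p by (simp add: ennreal_mult'[symmetric] ennreal_leI)
  qed
  also have "\<dots> = ennreal p * (\<integral>\<^sup>+ i. emeasure lebesgue (?I i) \<partial>count_space C)"
    by (rule nn_integral_cmult) auto
  also have "(\<integral>\<^sup>+ i. emeasure lebesgue (?I i) \<partial>count_space C) = emeasure lebesgue (\<Union>i\<in>C. ?I i)"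
    using C(1) dI by (intro emeasure_UN_countable[symmetric]) auto
  also have "\<dots> \<le> emeasure lebesgue U"
  proof (rule emeasure_mono)
    have "?I i \<subseteq> U" if "i \<in> C" for i using that C(2) by (auto simp: K_def subset_eq)
    then show "(\<Union>i\<in>C. ?I i) \<subseteq> U" by blast
  qed (use EU in auto)
  finally show ?thesis by (simp add: mult_left_mono)
qed

text \<open>Points at which, at arbitrarily small scales, some difference quotient in direction
  \<open>e\<close> lies below \<open>p\<close> and another one above \<open>q\<close>. The direction
  is a parameter so that slices of these sets in a product are again sets of this kind, as needed
  for Fubini arguments. Failure of differentiability is covered by the union over rational
  \<open>p < q\<close>.\<close>

definition osc_set :: "('a::euclidean_space \<Rightarrow> real) \<Rightarrow> 'a \<Rightarrow> real \<Rightarrow> real \<Rightarrow> 'a set" where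
  "osc_set h e p q = {z. \<forall>n::nat.
     (\<exists>k. k \<noteq> 0 \<and> \<bar>k\<bar> < 1 / Suc n \<and> (h (z + k *\<^sub>R e) - h z) / k < p) \<and>
     (\<exists>k. k \<noteq> 0 \<and> \<bar>k\<bar> < 1 / Suc n \<and> q < (h (z + k *\<^sub>R e) - h z) / k)}"

definition nondiff_set :: "('a::euclidean_space \<Rightarrow> real) \<Rightarrow> 'a \<Rightarrow> 'a set" where
  "nondiff_set h e = (\<Union>p\<in>\<rat>. \<Union>q\<in>\<rat> \<inter> {p<..}. osc_set h e p q)"

text \<open>For each \<open>k\<close> the two conditions are open, and a union over uncountably many
  \<open>k\<close> stays open; only the scales \<open>n\<close> are intersected, countably
  often.\<close>

lemma borel_osc_set:
  assumes "continuous_on UNIV h"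
  shows "osc_set h e p q \<in> sets borel"
proof -
  have c: "continuous_on UNIV (\<lambda>z. (h (z + k *\<^sub>R e) - h z) / k)" for k
  proof -
    have "continuous_on UNIV (\<lambda>z. h (z + k *\<^sub>R e))"
      by (rule continuous_on_compose2[OF assms]) (auto intro!: continuous_intros)
    then show ?thesis using assms by (simp add: divide_inverse continuous_intros)
  qed
  have o1: "open {z. (h (z + k *\<^sub>R e) - h z) / k < p}" for k
    using c by (rule open_Collect_less) simp_all
  have o2: "open {z. q < (h (z + k *\<^sub>R e) - h z) / k}" for k
    by (rule open_Collect_less[OF _ c]) simp
  have "osc_set h e p q =
    (\<Inter>n::nat. (\<Union>k\<in>{k. k \<noteq> 0 \<and> \<bar>k\<bar> < 1 / Suc n}. {z. (h (z + k *\<^sub>R e) - h z) / k < p}) \<inter>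
      (\<Union>k\<in>{k. k \<noteq> 0 \<and> \<bar>k\<bar> < 1 / Suc n}. {z. q < (h (z + k *\<^sub>R e) - h z) / k}))"
    unfolding osc_set_def by auto
  also have "\<dots> \<in> sets borel"
    using o1 o2 by (intro sets.countable_INT'' borel_open open_Int open_UN) auto
  finally show ?thesis .
qed

lemma borel_nondiff_set:
  "continuous_on UNIV h \<Longrightarrow> nondiff_set h e \<in> sets borel"
  unfolding nondiff_set_def
  by (intro sets.countable_UN'' borel_osc_set countable_rat countable_Int1)

text \<open>Adding \<open>(L + 1) * x\<close> gives an expanding homeomorphism \<open>g\<close> with
  1-Lipschitz inverse \<open>G\<close>. Near points of \<open>E\<close> there are short intervals on
  which \<open>g\<close> has slope at most \<open>p' = p + L + 1\<close>, and others on which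
  \<open>G\<close> has slope at most \<open>1 / q'\<close>. Hence |g(E)| \<le> p' |E| and q' |E|
  \<le> |g(E)|, which for \<open>p' < q'\<close> and finite |E| forces |E| = 0.\<close>

lemma Lipschitz_osc_set_null:
  fixes f :: "real \<Rightarrow> real"
  assumes lip: "\<And>x y. \<bar>f x - f y\<bar> \<le> L * \<bar>x - y\<bar>" and pq: "p < q"
  shows "osc_set f 1 p q \<inter> {a<..<b} \<in> null_sets lborel"
proof -
  have L0: "0 \<le> L" using lip[of 0 1] abs_ge_zero[of "f 0 - f 1"] by simp
  have cf: "continuous_on UNIV f"
  proof (rule lipschitz_on_continuous_on)
    show "L-lipschitz_on UNIV f" using lip L0 by (auto intro!: lipschitz_onI simp: dist_real_def)
  qed
  define E where "E = osc_set f 1 p q \<inter> {a<..<b}"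
  define g where "g = (\<lambda>x. f x + (L + 1) * x)"
  have gexp: "y - x \<le> g y - g x" if "x \<le> y" for x y
    using lip[of y x] that by (auto simp: g_def algebra_simps abs_if split: if_splits)
  have glip: "\<bar>g x - g y\<bar> \<le> (2*L+1) * \<bar>x - y\<bar>" for x y
  proof -
    have "g x - g y = (f x - f y) + (L+1)*(x-y)" by (simp add: g_def algebra_simps)
    also have "\<bar>\<dots>\<bar> \<le> L * \<bar>x-y\<bar> + (L+1)*\<bar>x-y\<bar>"
      using lip[of x y] L0 by (intro order_trans[OF abs_triangle_ineq]) (auto simp: abs_mult)
    finally show ?thesis by (simp add: algebra_simps)
  qed
  have gmono: "strict_mono g"
    using gexp by (auto simp: strict_mono_def) (smt (verit))
  have cg: "continuous_on UNIV g" unfolding g_def using cf by (intro continuous_intros)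
  have surj: "\<exists>x. g x = y" for y
  proof -
    let ?r = "\<bar>y - g 0\<bar>"
    have "g (- ?r) \<le> y" "y \<le> g ?r" using gexp[of "- ?r" 0] gexp[of 0 "?r"] by auto
    then show ?thesis using IVT'[of g "- ?r" y ?r] continuous_on_subset[OF cg] by force
  qed
  define G where "G = inv g"
  have gG: "g (G y) = y" for y unfolding G_def by (meson surj surj_f_inv_f surjI surj_def)
  have Gg: "G (g x) = x" for x unfolding G_def using gmono by (simp add: inv_f_f strict_mono_imp_inj_on)
  have Glip: "\<bar>G x - G y\<bar> \<le> 1 * \<bar>x - y\<bar>" for x y
    using gexp[of "G x" "G y"] gexp[of "G y" "G x"] unfolding gG by (cases "G x \<le> G y") auto
  have Gmono: "strict_mono G"
  proof (rule strict_monoI)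
    fix x y :: real assume "x < y"
    then have "g (G x) < g (G y)" by (simp add: gG)
    then show "G x < G y" using gmono by (simp add: strict_mono_less)
  qed
  have cG: "continuous_on UNIV G"
    by (rule lipschitz_on_continuous_on[of 1]) (use Glip in \<open>auto intro!: lipschitz_onI simp: dist_real_def\<close>)
  have Eb: "E \<in> sets borel" unfolding E_def using borel_osc_set[OF cf] by auto
  have gEeq: "g ` E = G -` E" using gG Gg by (auto simp: image_iff) metis
  have "G -` E \<inter> space borel \<in> sets borel"
    by (rule measurable_sets[OF borel_measurable_continuous_onI[OF cG] Eb])
  then have gEb: "g ` E \<in> sets borel" by (simp add: gEeq)
  have GgE: "G ` g ` E = E" using Gg by (force simp: image_iff)
  define p' q' where "p' = p + L + 1" and "q' = q + L + 1"
  have sl: "(g (x + k) - g x) / k = (f (x + k) - f x) / k + (L + 1)" if "k \<noteq> 0" for x k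
    using that by (simp add: g_def field_simps)
  have lo: "\<exists>u v. u \<le> x \<and> x \<le> v \<and> u < v \<and> v - u < d \<and> g v - g u \<le> p' * (v - u)"
    if x: "x \<in> E" "0 < d" for x d
  proof -
    obtain n where n: "1 / Suc n < d" using x(2) nat_approx_posE by blast
    obtain k where k: "k \<noteq> 0" "\<bar>k\<bar> < 1 / Suc n" "(f (x + k) - f x) / k < p"
      using x(1) by (auto simp: E_def osc_set_def)
    have s: "(g (x + k) - g x) / k < p'" using k sl by (simp add: p'_def)
    show ?thesis
    proof (cases "k > 0")
      case True
      then have "g (x + k) - g x \<le> p' * k" using s by (simp add: field_simps)
      then show ?thesis using True k n by (intro exI[of _ x] exI[of _ "x+k"]) auto
    next
      case False
      then have "k < 0" using k by simp
      then have "g x - g (x + k) \<le> p' * (- k)" using s by (simp add: field_simps)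
      then show ?thesis using \<open>k < 0\<close> k n by (intro exI[of _ "x+k"] exI[of _ x]) auto
    qed
  qed
  have hi: "\<exists>u v. u \<le> x \<and> x \<le> v \<and> u < v \<and> v - u < d \<and> q' * (v - u) \<le> g v - g u"
    if x: "x \<in> E" "0 < d" for x d
  proof -
    obtain n where n: "1 / Suc n < d" using x(2) nat_approx_posE by blast
    obtain k where k: "k \<noteq> 0" "\<bar>k\<bar> < 1 / Suc n" "q < (f (x + k) - f x) / k"
      using x(1) by (auto simp: E_def osc_set_def)
    have s: "q' < (g (x + k) - g x) / k" using k sl by (simp add: q'_def)
    show ?thesis
    proof (cases "k > 0")
      case True
      then have "q' * k \<le> g (x + k) - g x" using s by (simp add: field_simps)
      then show ?thesis using True k n by (intro exI[of _ x] exI[of _ "x+k"]) auto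
    next
      case False
      then have "k < 0" using k by simp
      then have "q' * (- k) \<le> g x - g (x + k)" using s by (simp add: field_simps)
      then show ?thesis using \<open>k < 0\<close> k n by (intro exI[of _ "x+k"] exI[of _ x]) auto
    qed
  qed
  have "emeasure lborel E = 0"
  proof (cases "E = {}")
    case False
    then obtain x where "x \<in> E" by auto
    then obtain u v where "u < v" "g v - g u \<le> p' * (v - u)" using lo[of x 1] by auto
    \<comment> \<open>\<open>g\<close> expands, so one interval of slope at most \<open>p'\<close>
      already forces \<open>1 \<le> p'\<close>.\<close>
    moreover have "v - u \<le> g v - g u" using gexp \<open>u < v\<close> by simp
    ultimately have p1: "1 \<le> p'" by (smt (verit) mult_le_cancel_right1)
    then have q1: "1 \<le> q'" and pq': "p' < q'" using pq by (auto simp: p'_def q'_def)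
    have fin: "emeasure lebesgue E < \<infinity>"
    proof -
      have "bounded E" unfolding E_def by (rule bounded_subset[OF bounded_closed_interval[of a b]]) auto
      then show ?thesis using emeasure_bounded_finite[of E] Eb by simp
    qed
    have step1: "emeasure lebesgue (g ` E) \<le> ennreal p' * (emeasure lebesgue E + ennreal e)" if e: "e > 0" for e
    proof -
      obtain U where U: "open U" "E \<subseteq> U" "U - E \<in> lmeasurable" "emeasure lebesgue (U - E) < ennreal e"
        using sets_lebesgue_outer_open[of E e] Eb e by auto
      have "emeasure lebesgue (g ` E) \<le> ennreal p' * emeasure lebesgue U"
        using gmono glip p1 U gEb lo
        by (intro emeasure_image_le_of_small_growth[where c = "2*L+1"]) auto
      also have "emeasure lebesgue U = emeasure lebesgue E + emeasure lebesgue (U - E)"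
        using U Eb by (subst plus_emeasure) (auto simp: Un_absorb1 fmeasurableD)
      also have "\<dots> \<le> emeasure lebesgue E + ennreal e" using U by (intro add_left_mono) auto
      finally show ?thesis by (simp add: mult_left_mono)
    qed
    have step2: "emeasure lebesgue E \<le> ennreal (1/q') * (emeasure lebesgue (g ` E) + ennreal e)" if e: "e > 0" for e
    proof -
      obtain U where U: "open U" "g ` E \<subseteq> U" "U - g ` E \<in> lmeasurable" "emeasure lebesgue (U - g ` E) < ennreal e"
        using sets_lebesgue_outer_open[of "g ` E" e] gEb e by auto
      have "emeasure lebesgue (G ` g ` E) \<le> ennreal (1/q') * emeasure lebesgue U"
      proof (rule emeasure_image_le_of_small_growth[OF Gmono Glip _ U(2,1)])
        show "0 \<le> 1/q'" using q1 by simp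
        fix y d assume y: "y \<in> g ` E" "(0::real) < d"
        then obtain x where x: "x \<in> E" "y = g x" by auto
        \<comment> \<open>\<open>g\<close> stretches by at most 2 L + 1, so the image of this
          interval is shorter than \<open>d\<close>.\<close>
        obtain u v where uv: "u \<le> x" "x \<le> v" "u < v" "v - u < d / (2*L+1)" "q' * (v - u) \<le> g v - g u"
          using hi[OF x(1), of "d / (2*L+1)"] y L0 by auto
        have "g v - g u < d"
          using glip[of v u] uv L0 by (simp add: field_simps)
        then show "\<exists>u v. u \<le> y \<and> y \<le> v \<and> u < v \<and> v - u < d \<and> G v - G u \<le> 1 / q' * (v - u)"
          using uv gmono q1 x
          by (intro exI[of _ "g u"] exI[of _ "g v"]) (auto simp: strict_mono_less_eq strict_mono_less Gg field_simps)
      qed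
      also have "emeasure lebesgue U = emeasure lebesgue (g ` E) + emeasure lebesgue (U - g ` E)"
        using U gEb by (subst plus_emeasure) (auto simp: Un_absorb1 fmeasurableD)
      also have "\<dots> \<le> emeasure lebesgue (g ` E) + ennreal e" using U by (intro add_left_mono) auto
      finally show ?thesis by (simp add: GgE mult_left_mono)
    qed
    have fin': "emeasure lebesgue (g ` E) < \<infinity>"
      using step1[of 1] fin p1
      by (metis ennreal_mult_eq_top_iff ennreal_neq_top ennreal_add_eq_top infinity_ennreal_def less_top top.extremum_unique zero_less_one)
    define m m' where "m = measure lebesgue E" and "m' = measure lebesgue (g ` E)"
    have em: "emeasure lebesgue E = ennreal m" "emeasure lebesgue (g ` E) = ennreal m'"
      unfolding m_def m'_def using fin fin' by (auto simp: emeasure_eq_ennreal_measure less_top)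
    have m0: "0 \<le> m" "0 \<le> m'" by (auto simp: m_def m'_def)
    have "m' \<le> p' * (m + e)" if "e > 0" for e
      using step1[OF that] p1 m0 that by (simp add: em ennreal_mult'[symmetric] flip: ennreal_plus)
    have A: "m' \<le> p' * m"
    proof (rule field_le_epsilon)
      fix e :: real assume "e > 0"
      then have "m' \<le> p' * (m + e / p')" using p1 by (intro \<open>\<And>e. e > 0 \<Longrightarrow> m' \<le> p' * (m + e)\<close>) auto
      then show "m' \<le> p' * m + e" using p1 by (simp add: algebra_simps)
    qed
    have "m \<le> 1/q' * (m' + e)" if "e > 0" for e
      using step2[OF that] q1 m0 that by (simp add: em ennreal_mult'[symmetric] del: ennreal_1 times_divide_eq_left flip: ennreal_plus)
    then have "q' * m \<le> m' + e" if "e > 0" for e using that q1 by (fastforce simp: field_simps)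
    then have B: "q' * m \<le> m'" by (rule field_le_epsilon)
    have "(q' - p') * m \<le> 0" using A B by (simp add: algebra_simps)
    then have "m = 0" using pq' m0 by (simp add: mult_le_0_iff)
    then show ?thesis using em Eb by simp
  qed simp
  then show ?thesis using Eb by (auto simp: E_def null_sets_def)
qed

lemma Lipschitz_nondiff_set_null:
  fixes f :: "real \<Rightarrow> real"
  assumes lip: "\<And>x y. \<bar>f x - f y\<bar> \<le> L * \<bar>x - y\<bar>"
  shows "nondiff_set f 1 \<in> null_sets lborel"
proof -
  have "osc_set f 1 p q \<in> null_sets lborel" if "p < q" for p q
  proof -
    have "osc_set f 1 p q = (\<Union>n::nat. osc_set f 1 p q \<inter> {- real n<..<real n})"
    proof -
      have "\<exists>n::nat. x \<in> {- real n<..<real n}" for x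
        using reals_Archimedean2[of "\<bar>x\<bar>"] by (auto simp: abs_less_iff) (metis minus_less_iff)
      then show ?thesis by blast
    qed
    also have "\<dots> \<in> null_sets lborel"
      using Lipschitz_osc_set_null[OF lip that] by (intro null_sets_UN) auto
    finally show ?thesis .
  qed
  then show ?thesis unfolding nondiff_set_def
    by (intro null_sets_UN' countable_rat countable_Int1) auto
qed

text \<open>The quotients lie in [-L, L], so their lower and upper limits at 0 are finite. If these
  differed, two rationals strictly between them would put \<open>z\<close> into an
  \<open>osc_set\<close>.\<close>

lemma differentiable_outside_nondiff_set:
  fixes h :: "'a::euclidean_space \<Rightarrow> real"
  assumes lip: "\<And>k. \<bar>h (z + k *\<^sub>R e) - h z\<bar> \<le> L * \<bar>k\<bar>" and z: "z \<notin> nondiff_set h e"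
  shows "(\<lambda>k. h (z + k *\<^sub>R e)) field_differentiable at 0"
proof -
  define Q where "Q = (\<lambda>k. (h (z + k *\<^sub>R e) - h z) / k)"
  have Qb: "\<bar>Q k\<bar> \<le> L" if "k \<noteq> 0" for k using lip[of k] that by (simp add: Q_def field_simps)
  let ?F = "at (0::real)"
  let ?li = "Liminf ?F (\<lambda>k. ereal (Q k))" and ?ls = "Limsup ?F (\<lambda>k. ereal (Q k))"
  have ev: "eventually (\<lambda>k. \<bar>Q k\<bar> \<le> L) ?F"
    using Qb by (auto simp: eventually_at intro!: exI[of _ 1])
  have nb: "?F \<noteq> bot" by simp
  have lo: "ereal (-L) \<le> ?li"
    by (intro Liminf_bounded eventually_mono[OF ev]) auto
  have hi: "?ls \<le> ereal L"
    by (intro Limsup_bounded eventually_mono[OF ev]) auto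
  have le: "?li \<le> ?ls" by (rule Liminf_le_Limsup[OF nb])
  have "\<not> ?li < ?ls"
  proof
    assume "?li < ?ls"
    then obtain p0 where p0: "?li < ereal (real_of_rat p0)" "ereal (real_of_rat p0) < ?ls"
      using ereal_dense3 by blast
    then obtain q0 where q0: "ereal (real_of_rat p0) < ereal (real_of_rat q0)" "ereal (real_of_rat q0) < ?ls"
      using ereal_dense3 by blast
    have f1: "\<exists>k. k \<noteq> 0 \<and> \<bar>k\<bar> < d \<and> Q k < real_of_rat q0" if "d > 0" for d
    proof (rule ccontr)
      assume "\<not> ?thesis"
      then have "eventually (\<lambda>k. ereal (real_of_rat q0) \<le> ereal (Q k)) ?F"
        using that by (auto simp: eventually_at intro!: exI[of _ d])
      then have "ereal (real_of_rat q0) \<le> ?li" by (rule Liminf_bounded)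
      then show False using p0 q0 by (metis less_trans not_less)
    qed
    obtain r0 where r0: "ereal (real_of_rat q0) < ereal (real_of_rat r0)" "ereal (real_of_rat r0) < ?ls"
      using ereal_dense3 q0 by blast
    have f2: "\<exists>k. k \<noteq> 0 \<and> \<bar>k\<bar> < d \<and> real_of_rat r0 < Q k" if "d > 0" for d
    proof (rule ccontr)
      assume "\<not> ?thesis"
      then have "eventually (\<lambda>k. ereal (Q k) \<le> ereal (real_of_rat r0)) ?F"
        using that by (auto simp: eventually_at intro!: exI[of _ d])
      then have "?ls \<le> ereal (real_of_rat r0)" by (rule Limsup_bounded)
      then show False using r0 by (metis not_less)
    qed
    have "z \<in> osc_set h e (real_of_rat q0) (real_of_rat r0)"
      using f1 f2 by (auto simp: osc_set_def Q_def)
    then show False using z r0 by (auto simp: nondiff_set_def)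
  qed
  then have eq: "?li = ?ls" using le by simp
  obtain c where c: "?li = ereal c"
    using lo hi unfolding eq[symmetric] by (cases ?li) auto
  have "((\<lambda>k. ereal (Q k)) \<longlongrightarrow> ereal c) ?F"
    using tendsto_iff_Liminf_eq_Limsup[OF nb] c eq by metis
  then have "(Q \<longlongrightarrow> c) ?F" by simp
  then have "((\<lambda>k. h (z + k *\<^sub>R e)) has_field_derivative c) (at 0)"
    by (simp add: has_field_derivative_iff Q_def)
  then show ?thesis by (auto simp: field_differentiable_def)
qed

section \<open>Null sets in products\<close>

lemma null_sets_lborel_pairI:
  fixes N :: "('a::euclidean_space \<times> 'b::euclidean_space) set"
  assumes N: "N \<in> sets borel" and ae: "AE x in lborel. AE y in lborel. (x, y) \<notin> N"
  shows "N \<in> null_sets lborel"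
proof -
  have N': "N \<in> sets ((lborel :: 'a measure) \<Otimes>\<^sub>M (lborel :: 'b measure))"
    unfolding lborel_prod using N by simp
  have "AE z in (lborel :: 'a measure) \<Otimes>\<^sub>M (lborel :: 'b measure). z \<notin> N"
  proof (rule lborel_pair.AE_pair_measure)
    show "{z \<in> space (lborel \<Otimes>\<^sub>M lborel). z \<notin> N} \<in> sets ((lborel :: 'a measure) \<Otimes>\<^sub>M (lborel :: 'b measure))"
      using sets.compl_sets[OF N'] by (simp add: set_diff_eq)
  qed (use ae in simp)
  then have "AE z in lborel. z \<notin> N" unfolding lborel_prod .
  then show ?thesis using N by (simp add: AE_iff_null_sets)
qed

lemma null_sets_lborel_pairI2:
  fixes N :: "('a::euclidean_space \<times> 'b::euclidean_space) set"
  assumes N: "N \<in> sets borel" and ae: "AE y in lborel. AE x in lborel. (x, y) \<notin> N"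
  shows "N \<in> null_sets lborel"
proof -
  have N': "N \<in> sets ((lborel :: 'a measure) \<Otimes>\<^sub>M (lborel :: 'b measure))"
    unfolding lborel_prod using N by simp
  have "AE x in (lborel :: 'a measure). AE y in (lborel :: 'b measure). (x, y) \<notin> N"
    using ae
  proof (subst lborel_pair.AE_commute)
    show "{z \<in> space (lborel \<Otimes>\<^sub>M lborel). (fst z, snd z) \<notin> N} \<in> sets ((lborel :: 'a measure) \<Otimes>\<^sub>M (lborel :: 'b measure))"
      using sets.compl_sets[OF N'] by (simp add: set_diff_eq)
  qed simp
  then show ?thesis by (rule null_sets_lborel_pairI[OF N])
qed

lemma AE_lborel_pairD:
  fixes Q :: "'a::euclidean_space \<times> 'b::euclidean_space \<Rightarrow> bool"
  assumes "AE z in lborel. Q z"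
  shows "AE x in lborel. AE y in lborel. Q (x, y)"
  using assms lborel_pair.AE_pair[of Q] unfolding lborel_prod by blast

text \<open>A Borel version of the derivative of a continuous function: a limit of difference
  quotients along 1/(n + 1), measurable also across points where no derivative exists, and equal to
  \<open>deriv\<close> where it does.\<close>

definition seq_deriv :: "(real \<Rightarrow> real) \<Rightarrow> real \<Rightarrow> real" where
  "seq_deriv f x = lim (\<lambda>n. (f (x + 1 / real (Suc n)) - f x) * real (Suc n))"

lemma LIMSEQ_difference_quotient:
  fixes f :: "real \<Rightarrow> real"
  assumes "(f has_real_derivative D) (at x)"
  shows "(\<lambda>n. (f (x + 1 / real (Suc n)) - f x) * real (Suc n)) \<longlonglongrightarrow> D"
proof -
  have "((\<lambda>h. (f (x + h) - f x) / h) \<longlongrightarrow> D) (at 0)" using assms by (simp add: DERIV_def)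
  moreover have "filterlim (\<lambda>n. 1 / real (Suc n)) (at 0) sequentially"
    unfolding filterlim_at using LIMSEQ_inverse_real_of_nat by (simp add: inverse_eq_divide del: of_nat_Suc)
  ultimately have "(\<lambda>n. (f (x + 1 / real (Suc n)) - f x) / (1 / real (Suc n))) \<longlonglongrightarrow> D"
    by (rule filterlim_compose)
  then show ?thesis by simp
qed

lemma seq_deriv_eq_deriv:
  assumes "f field_differentiable at x"
  shows "seq_deriv f x = deriv f x"
  using assms LIMSEQ_difference_quotient[of f "deriv f x" x]
  unfolding seq_deriv_def by (simp add: DERIV_deriv_iff_field_differentiable limI)

lemma field_differentiable_outside_nondiff_set:
  fixes f :: "real \<Rightarrow> real"
  assumes lip: "\<And>x y. \<bar>f x - f y\<bar> \<le> L * \<bar>x - y\<bar>" and "x \<notin> nondiff_set f 1"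
  shows "f field_differentiable at x"
proof -
  have "(\<lambda>k. f (x + k *\<^sub>R 1)) field_differentiable at 0"
    using lip[of "x + k" x for k] assms(2) by (intro differentiable_outside_nondiff_set[where L = L]) auto
  then obtain D where "((\<lambda>k. f (x + k)) has_field_derivative D) (at 0)" by (auto simp: field_differentiable_def)
  then have "(f has_field_derivative D) (at (0 + x))"
    by (subst DERIV_shift) (simp add: add.commute)
  then show ?thesis by (auto simp: field_differentiable_def)
qed

lemma Lipschitz_AE_differentiable:
  fixes f :: "real \<Rightarrow> real"
  assumes lip: "\<And>x y. \<bar>f x - f y\<bar> \<le> L * \<bar>x - y\<bar>"
  shows "AE x in lborel. f field_differentiable at x"
  using AE_not_in[OF Lipschitz_nondiff_set_null[OF lip]]
  by (rule AE_mp) (auto intro!: AE_I2 field_differentiable_outside_nondiff_set[OF lip])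

lemma abs_difference_quotient_le:
  fixes f :: "real \<Rightarrow> real"
  assumes lip: "\<And>x y. \<bar>f x - f y\<bar> \<le> L * \<bar>x - y\<bar>"
  shows "\<bar>(f (x + 1 / real (Suc n)) - f x) * real (Suc n)\<bar> \<le> L"
proof -
  have "\<bar>f (x + 1 / real (Suc n)) - f x\<bar> \<le> L / real (Suc n)"
    using lip[of "x + 1 / real (Suc n)" x] by simp
  then show ?thesis by (simp add: abs_mult pos_le_divide_eq del: of_nat_Suc)
qed

lemma abs_deriv_le_Lipschitz:
  fixes f :: "real \<Rightarrow> real"
  assumes lip: "\<And>x y. \<bar>f x - f y\<bar> \<le> L * \<bar>x - y\<bar>" and D: "f field_differentiable at x"
  shows "\<bar>deriv f x\<bar> \<le> L"
proof -
  have "(\<lambda>n. (f (x + 1 / real (Suc n)) - f x) * real (Suc n)) \<longlonglongrightarrow> deriv f x"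
    using D LIMSEQ_difference_quotient by (simp add: DERIV_deriv_iff_field_differentiable)
  then have "(\<lambda>n. \<bar>(f (x + 1 / real (Suc n)) - f x) * real (Suc n)\<bar>) \<longlonglongrightarrow> \<bar>deriv f x\<bar>"
    by (rule tendsto_rabs)
  then show ?thesis
  proof (rule LIMSEQ_le_const2, intro exI allI impI)
    fix n
    show "\<bar>(f (x + 1 / real (Suc n)) - f x) * real (Suc n)\<bar> \<le> L"
      by (rule abs_difference_quotient_le[OF lip])
  qed
qed

lemma integrable_const_Icc:
  "integrable lborel (\<lambda>x. c * indicator {a..b :: real} x :: real)"
  by (rule integrable_mult_right) (simp add: integrable_indicator_iff emeasure_lborel_Icc_eq)

text \<open>The integral of a difference quotient over [a, b] is known exactly from an
  antiderivative \<open>F\<close> of \<open>f\<close>: it is the quotient of \<open>F\<close> at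
  \<open>b\<close> minus that at \<open>a\<close>, and tends to \<open>f b - f a\<close>. Dominated
  convergence with the bound \<open>L\<close> moves the limit inside.\<close>

lemma Lipschitz_FTC:
  fixes f :: "real \<Rightarrow> real"
  assumes lip: "\<And>x y. \<bar>f x - f y\<bar> \<le> L * \<bar>x - y\<bar>" and ab: "a \<le> b"
  shows "(\<integral>x. seq_deriv f x * indicator {a..b} x \<partial>lborel) = f b - f a"
proof -
  have L0: "0 \<le> L" using lip[of 0 1] abs_ge_zero[of "f 0 - f 1"] by simp
  have cf: "continuous_on UNIV f"
  proof (rule lipschitz_on_continuous_on)
    show "L-lipschitz_on UNIV f" using lip L0 by (auto intro!: lipschitz_onI simp: dist_real_def)
  qed
  define A where "A = (\<lambda>n x. (f (x + 1 / real (Suc n)) - f x) * real (Suc n))"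
  have cA: "continuous_on UNIV (A n)" for n
    unfolding A_def by (intro continuous_intros continuous_on_compose2[OF cf]) auto
  have [measurable]: "A n \<in> borel_measurable borel" for n
    by (rule borel_measurable_continuous_onI[OF cA])
  have [measurable]: "seq_deriv f \<in> borel_measurable borel"
  proof -
    have "seq_deriv f = (\<lambda>x. lim (\<lambda>n. A n x))" by (simp add: seq_deriv_def A_def fun_eq_iff)
    then show ?thesis using borel_measurable_lim_metric[of A borel] by simp
  qed
  obtain F where F: "\<And>x. x \<in> {a - 1..b + 2} \<Longrightarrow> (F has_vector_derivative f x) (at x within {a-1..b+2})"
    using antiderivative_continuous[of "a-1" "b+2" f] continuous_on_subset[OF cf] by auto
  have F': "(F has_real_derivative f x) (at x)" if "a - 1 < x" "x < b + 2" for x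
    using F[of x] that at_within_Icc_at[of "a-1" x "b+2"] by (simp add: has_real_derivative_iff_has_vector_derivative)
  have intA: "(\<integral>x. A n x * indicator {a..b} x \<partial>lborel) =
      (F (b + 1 / real (Suc n)) - F b) * real (Suc n) - (F (a + 1 / real (Suc n)) - F a) * real (Suc n)" for n
  proof -
    have n: "1 / real (Suc n) \<le> 1" by simp
    have "(\<integral>x. A n x * indicator {a..b} x \<partial>lborel) =
      (F (b + 1 / real (Suc n)) - F b) * real (Suc n) - (F (a + 1 / real (Suc n)) - F a) * real (Suc n)"
    proof (rule integral_FTC_Icc_real[OF ab])
      fix x assume x: "a \<le> x" "x \<le> b"
      have "0 \<le> 1 / real (Suc n)" by simp
      then have "a - 1 < x + 1 / real (Suc n)" "x + 1 / real (Suc n) < b + 2" using x n by linarith+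
      then have "((\<lambda>x. F (x + 1 / real (Suc n))) has_real_derivative f (x + 1 / real (Suc n))) (at x)"
        using F'[of "x + 1 / real (Suc n)"] DERIV_shift by blast
      then show "((\<lambda>x. (F (x + 1 / real (Suc n)) - F x) * real (Suc n)) has_real_derivative A n x) (at x)"
        unfolding A_def using F'[of x] x by (auto intro!: derivative_eq_intros)
      show "isCont (A n) x" using cA by (simp add: continuous_on_eq_continuous_at)
    qed
    then show ?thesis .
  qed
  have "(\<lambda>n. \<integral>x. A n x * indicator {a..b} x \<partial>lborel) \<longlonglongrightarrow> f b - f a"
    unfolding intA using F'[of a] F'[of b] ab by (intro tendsto_diff LIMSEQ_difference_quotient) auto
  moreover have "(\<lambda>n. \<integral>x. A n x * indicator {a..b} x \<partial>lborel) \<longlonglongrightarrow> (\<integral>x. seq_deriv f x * indicator {a..b} x \<partial>lborel)"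
  proof (rule integral_dominated_convergence)
    show "integrable lborel (\<lambda>x. L * indicator {a..b} x :: real)"
      by (rule integrable_const_Icc)
    show "AE x in lborel. norm (A n x * indicator {a..b} x) \<le> L * indicator {a..b} x" for n
    proof (rule AE_I2)
      fix x
      have "\<bar>A n x\<bar> \<le> L" unfolding A_def by (rule abs_difference_quotient_le[OF lip])
      then show "norm (A n x * indicator {a..b} x) \<le> L * indicator {a..b} x"
        by (simp add: indicator_def abs_mult)
    qed
    show "AE x in lborel. (\<lambda>n. A n x * indicator {a..b} x) \<longlonglongrightarrow> seq_deriv f x * indicator {a..b} x"
      using Lipschitz_AE_differentiable[OF lip]
    proof (rule AE_mp, intro AE_I2 impI)
      fix x assume "f field_differentiable at x"
      then have "(\<lambda>n. A n x) \<longlonglongrightarrow> seq_deriv f x"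
        unfolding A_def seq_deriv_eq_deriv[OF \<open>f field_differentiable at x\<close>]
        by (intro LIMSEQ_difference_quotient) (simp add: DERIV_deriv_iff_field_differentiable)
      then show "(\<lambda>n. A n x * indicator {a..b} x) \<longlonglongrightarrow> seq_deriv f x * indicator {a..b} x"
        by (intro tendsto_intros)
    qed
  qed simp_all
  ultimately show ?thesis by (rule LIMSEQ_unique[symmetric])
qed

text \<open>Freezing \<open>f\<close> outside [a, b] produces a Lipschitz function on the line with
  the same derivative in the interior, to which \<open>Lipschitz_FTC\<close> applies.\<close>

lemma Lipschitz_if_AE_deriv_bounded:
  fixes f :: "real \<Rightarrow> real"
  assumes lip: "\<And>x y. x \<in> {a..b} \<Longrightarrow> y \<in> {a..b} \<Longrightarrow> \<bar>f x - f y\<bar> \<le> L * \<bar>x - y\<bar>" and ab: "a \<le> b"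
    and ae: "AE x in lborel. x \<in> {a<..<b} \<longrightarrow> \<bar>deriv f x\<bar> \<le> C"
  shows "\<bar>f b - f a\<bar> \<le> C * (b - a)"
proof (cases "a = b")
  case False
  define F where "F = (\<lambda>x. f (max a (min b x)))"
  have Fl: "\<bar>F x - F y\<bar> \<le> \<bar>L\<bar> * \<bar>x - y\<bar>" for x y
  proof -
    have "\<bar>F x - F y\<bar> \<le> L * \<bar>max a (min b x) - max a (min b y)\<bar>"
      unfolding F_def using ab by (intro lip) auto
    also have "\<dots> \<le> \<bar>L\<bar> * \<bar>x - y\<bar>" by (intro mult_mono) auto
    finally show ?thesis .
  qed
  have eq: "\<forall>\<^sub>F y in nhds x. F y = f y" if "x \<in> {a<..<b}" for x
    using that by (intro eventually_nhds[THEN iffD2] exI[of _ "{a<..<b}"]) (auto simp: F_def)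
  have "AE x in lborel. \<bar>seq_deriv F x * indicator {a..b} x\<bar> \<le> C * indicator {a..b} x"
    using Lipschitz_AE_differentiable[OF Fl] ae AE_lborel_singleton[of a] AE_lborel_singleton[of b]
  proof eventually_elim
    case (elim x)
    show ?case
    proof (cases "x \<in> {a<..<b}")
      case True
      have "seq_deriv F x = deriv F x" using elim by (intro seq_deriv_eq_deriv) auto
      also have "\<dots> = deriv f x" by (rule deriv_cong_ev[OF eq[OF True] refl])
      finally show ?thesis using elim True by (auto simp: indicator_def)
    next
      case False
      then have "x \<notin> {a..b}" using elim by auto
      then show ?thesis by simp
    qed
  qed
  then have "(\<integral>x. \<bar>seq_deriv F x * indicator {a..b} x\<bar> \<partial>lborel) \<le> (\<integral>x. C * indicator {a..b} x \<partial>lborel)"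
    by (intro integral_mono_AE' integrable_const_Icc) auto
  moreover have "\<bar>\<integral>x. seq_deriv F x * indicator {a..b} x \<partial>lborel\<bar> \<le> (\<integral>x. \<bar>seq_deriv F x * indicator {a..b} x\<bar> \<partial>lborel)"
    by (rule integral_abs_bound)
  moreover have "(\<integral>x. C * indicator {a..b} x \<partial>lborel) = C * (b - a)" using ab by simp
  moreover have "(\<integral>x. seq_deriv F x * indicator {a..b} x \<partial>lborel) = f b - f a"
    using Lipschitz_FTC[OF Fl ab] ab by (simp add: F_def)
  ultimately show ?thesis by linarith
qed simp

section \<open>Lipschitz constants from essential bounds on gradients\<close>

text \<open>Over \<open>N\<close> equal steps the quadratic errors add up to K / N, which vanishes
  as \<open>N\<close> grows.\<close>

lemma subdivision_bound:
  fixes T :: "real \<Rightarrow> real"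
  assumes step: "\<And>s h. 0 \<le> s \<Longrightarrow> 0 \<le> h \<Longrightarrow> s + h \<le> 1 \<Longrightarrow> \<bar>T (s + h) - T s\<bar> \<le> A * h + K * h\<^sup>2"
  shows "\<bar>T 1 - T 0\<bar> \<le> A"
proof (rule field_le_epsilon)
  fix e :: real assume "e > 0"
  then obtain N :: nat where N: "K / e < real N" "0 < N"
    using reals_Archimedean2[of "max 0 (K / e)"] by (metis max_less_iff_conj of_nat_0_less_iff)
  have "\<bar>T (real i / N) - T 0\<bar> \<le> i * (A / N + K / N\<^sup>2)" if "i \<le> N" for i
    using that
  proof (induction i)
    case (Suc i)
    have "\<bar>T (real i / N + 1 / N) - T (real i / N)\<bar> \<le> A * (1 / N) + K * (1 / N)\<^sup>2"
      using Suc.prems N by (intro step) (auto simp: field_simps)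
    moreover have "real i / N + 1 / N = real (Suc i) / N" by (simp add: add_divide_distrib)
    ultimately have "\<bar>T (real (Suc i) / N) - T (real i / N)\<bar> \<le> A / N + K / N\<^sup>2"
      by (simp add: power_divide)
    moreover have "\<bar>T (real i / N) - T 0\<bar> \<le> i * (A / N + K / N\<^sup>2)"
      using Suc.IH Suc.prems by simp
    moreover have "real (Suc i) * (A / N + K / N\<^sup>2) = (A / N + K / N\<^sup>2) + i * (A / N + K / N\<^sup>2)"
      by (simp add: distrib_right)
    ultimately show ?case by linarith
  qed simp
  from this[of N] have "\<bar>T 1 - T 0\<bar> \<le> N * (A / N + K / N\<^sup>2)" using N by simp
  also have "\<dots> = A + K / N" using N by (simp add: power2_eq_square distrib_left)
  also have "\<dots> \<le> A + e" using N \<open>e > 0\<close> by (simp add: field_simps)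
  finally show "\<bar>T 1 - T 0\<bar> \<le> A + e" .
qed

section \<open>Lipschitz bounds in the plane by averaging over squares\<close>

locale lipschitz2 =
  fixes h :: "real \<Rightarrow> real \<Rightarrow> real" and L :: real
  assumes lip: "\<And>a b a' b'. \<bar>h a b - h a' b'\<bar> \<le> L * (\<bar>a - a'\<bar> + \<bar>b - b'\<bar>)"
begin

lemma L_nonneg: "0 \<le> L"
  using lip[of 0 0 1 0] abs_ge_zero[of "h 0 0 - h 1 0"] by simp

lemma lip_fst: "\<bar>h a b - h a' b\<bar> \<le> L * \<bar>a - a'\<bar>" and lip_snd: "\<bar>h a b - h a b'\<bar> \<le> L * \<bar>b - b'\<bar>"
  using lip[of a b a' b] lip[of a b a b'] by auto

lemma cont: "continuous_on UNIV (\<lambda>z. h (fst z) (snd z))"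
proof (rule lipschitz_on_continuous_on, rule lipschitz_onI)
  fix z z' :: "real \<times> real"
  have "\<bar>fst z - fst z'\<bar> \<le> dist z z'" "\<bar>snd z - snd z'\<bar> \<le> dist z z'"
    using dist_fst_le[of z z'] dist_snd_le[of z z'] by (auto simp: dist_real_def)
  then have "L * (\<bar>fst z - fst z'\<bar> + \<bar>snd z - snd z'\<bar>) \<le> L * (2 * dist z z')"
    using L_nonneg by (intro mult_left_mono) auto
  then show "dist (h (fst z) (snd z)) (h (fst z') (snd z')) \<le> (2 * L) * dist z z'"
    using lip[of "fst z" "snd z" "fst z'" "snd z'"] by (simp add: dist_real_def)
qed (use L_nonneg in simp)

lemma cont_compose: "continuous_on S f \<Longrightarrow> continuous_on S g \<Longrightarrow> continuous_on S (\<lambda>x. h (f x) (g x))"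
  using continuous_on_compose2[OF cont, of S "\<lambda>x. (f x, g x)"] by (simp add: continuous_on_Pair)

lemma null_nondiff_fst: "nondiff_set (\<lambda>z. h (fst z) (snd z)) (1, 0) \<in> null_sets lborel"
proof -
  let ?N = "nondiff_set (\<lambda>z. h (fst z) (snd z)) (1, 0)"
  have mem: "(a, b) \<in> ?N \<longleftrightarrow> a \<in> nondiff_set (\<lambda>s. h s b) 1" for a b
    by (simp add: nondiff_set_def osc_set_def)
  show ?thesis
  proof (rule null_sets_lborel_pairI2[OF borel_nondiff_set[OF cont]], rule AE_I2)
    show "AE x in lborel. (x, y) \<notin> ?N" for y
      unfolding mem by (rule AE_not_in[OF Lipschitz_nondiff_set_null[of _ L]]) (rule lip_fst)
  qed
qed

lemma AE_differentiable_fst: "AE z in lborel. (\<lambda>s. h s (snd z)) field_differentiable at (fst z)"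
proof -
  let ?N = "nondiff_set (\<lambda>z. h (fst z) (snd z)) (1, 0)"
  have mem: "(a, b) \<in> ?N \<longleftrightarrow> a \<in> nondiff_set (\<lambda>s. h s b) 1" for a b
    by (simp add: nondiff_set_def osc_set_def)
  show ?thesis using null_nondiff_fst
  proof (rule AE_not_in[THEN AE_mp], intro AE_I2 impI)
    fix z assume "z \<notin> ?N"
    then show "(\<lambda>s. h s (snd z)) field_differentiable at (fst z)"
      using mem[of "fst z" "snd z"] by (intro field_differentiable_outside_nondiff_set[OF lip_fst]) simp
  qed
qed

lemma null_nondiff_snd: "nondiff_set (\<lambda>z. h (fst z) (snd z)) (0, 1) \<in> null_sets lborel"
proof -
  let ?N = "nondiff_set (\<lambda>z. h (fst z) (snd z)) (0, 1)"
  have mem: "(a, b) \<in> ?N \<longleftrightarrow> b \<in> nondiff_set (h a) 1" for a b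
    by (simp add: nondiff_set_def osc_set_def)
  show ?thesis
  proof (rule null_sets_lborel_pairI[OF borel_nondiff_set[OF cont]], rule AE_I2)
    show "AE y in lborel. (x, y) \<notin> ?N" for x
      unfolding mem by (rule AE_not_in[OF Lipschitz_nondiff_set_null[of _ L]]) (rule lip_snd)
  qed
qed

lemma AE_differentiable_snd: "AE z in lborel. h (fst z) field_differentiable at (snd z)"
proof -
  let ?N = "nondiff_set (\<lambda>z. h (fst z) (snd z)) (0, 1)"
  have mem: "(a, b) \<in> ?N \<longleftrightarrow> b \<in> nondiff_set (h a) 1" for a b
    by (simp add: nondiff_set_def osc_set_def)
  show ?thesis using null_nondiff_snd
  proof (rule AE_not_in[THEN AE_mp], intro AE_I2 impI)
    fix z assume "z \<notin> ?N"
    then show "h (fst z) field_differentiable at (snd z)"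
      using mem[of "fst z" "snd z"] by (intro field_differentiable_outside_nondiff_set[OF lip_snd]) simp
  qed
qed

text \<open>A segment may lie inside the null set on which the gradient bound fails, so the bound is
  used on squares. By Fubini and the fundamental theorem on each line, the expression estimated is
  the integral of p D1 + q D2 over the square; the maximum norm of (p, q) is dual to the sum norm of
  the gradient.\<close>

lemma square_mean_bound:
  assumes e: "0 < e"
    and ae: "AE z in lborel. z \<in> {a<..<a + e} \<times> {b<..<b + e} \<longrightarrow>
      \<bar>deriv (\<lambda>s. h s (snd z)) (fst z)\<bar> + \<bar>deriv (h (fst z)) (snd z)\<bar> \<le> C"
  shows "\<bar>p * (\<integral>r. (h (a + e) r - h a r) * indicator {b..b+e} r \<partial>lborel) +
      q * (\<integral>s. (h s (b + e) - h s b) * indicator {a..a+e} s \<partial>lborel)\<bar> \<le> max \<bar>p\<bar> \<bar>q\<bar> * C * e\<^sup>2"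
proof -
  define D1 where "D1 = (\<lambda>z. seq_deriv (\<lambda>s. h s (snd z)) (fst z))"
  define D2 where "D2 = (\<lambda>z. seq_deriv (h (fst z)) (snd z))"
  let ?B = "{a..a+e} \<times> {b..b+e}"
  define A1 where "A1 = (\<lambda>n z. (h (fst z + 1 / real (Suc n)) (snd z) - h (fst z) (snd z)) * real (Suc n))"
  define A2 where "A2 = (\<lambda>n z. (h (fst z) (snd z + 1 / real (Suc n)) - h (fst z) (snd z)) * real (Suc n))"
  have "A1 n \<in> borel_measurable borel" "A2 n \<in> borel_measurable borel" for n
    unfolding A1_def A2_def by (intro borel_measurable_continuous_onI continuous_intros cont_compose)+
  moreover have "D1 = (\<lambda>z. lim (\<lambda>n. A1 n z))" "D2 = (\<lambda>z. lim (\<lambda>n. A2 n z))"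
    by (simp_all add: D1_def D2_def A1_def A2_def seq_deriv_def fun_eq_iff)
  ultimately have [measurable]: "D1 \<in> borel_measurable borel" "D2 \<in> borel_measurable borel"
    using borel_measurable_lim_metric[of A1 borel] borel_measurable_lim_metric[of A2 borel] by simp_all
  have Bm[measurable]: "?B \<in> sets borel" by (intro borel_Times) auto
  have emB: "emeasure lborel ?B = ennreal (e\<^sup>2)"
  proof -
    have "emeasure ((lborel :: real measure) \<Otimes>\<^sub>M (lborel :: real measure)) ?B = ennreal e * ennreal e"
      using e by (subst lborel.emeasure_pair_measure_Times) auto
    then show ?thesis using e unfolding lborel_prod by (simp add: ennreal_mult'[symmetric] power2_eq_square)
  qed
  have intB: "integrable lborel (\<lambda>z. c * indicator ?B z :: real)" for c
    using emB by (intro integrable_mult_right) (simp add: integrable_indicator_iff)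
  have b1: "AE z in lborel. D1 z = deriv (\<lambda>s. h s (snd z)) (fst z) \<and> \<bar>D1 z\<bar> \<le> L"
    using AE_differentiable_fst
  proof eventually_elim
    case (elim z)
    then have "D1 z = deriv (\<lambda>s. h s (snd z)) (fst z)" unfolding D1_def by (rule seq_deriv_eq_deriv)
    then show ?case using abs_deriv_le_Lipschitz[OF lip_fst elim] by simp
  qed
  have b2: "AE z in lborel. D2 z = deriv (h (fst z)) (snd z) \<and> \<bar>D2 z\<bar> \<le> L"
    using AE_differentiable_snd
  proof eventually_elim
    case (elim z)
    then have "D2 z = deriv (h (fst z)) (snd z)" unfolding D2_def by (rule seq_deriv_eq_deriv)
    then show ?case using abs_deriv_le_Lipschitz[OF lip_snd elim] by simp
  qed
  have i1: "integrable lborel (\<lambda>z. D1 z * indicator ?B z)"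
  proof (rule Bochner_Integration.integrable_bound[OF intB[of L]])
    show "AE z in lborel. norm (D1 z * indicator ?B z) \<le> norm (L * indicator ?B z)"
      using b1 by eventually_elim (auto simp: indicator_def)
  qed simp
  have i2: "integrable lborel (\<lambda>z. D2 z * indicator ?B z)"
  proof (rule Bochner_Integration.integrable_bound[OF intB[of L]])
    show "AE z in lborel. norm (D2 z * indicator ?B z) \<le> norm (L * indicator ?B z)"
      using b2 by eventually_elim (auto simp: indicator_def)
  qed simp
  have ind: "indicator ?B (s, r) = (indicator {a..a+e} s * indicator {b..b+e} r :: real)" for s r
    by (simp add: indicator_times)
  have I1: "(\<integral>z. D1 z * indicator ?B z \<partial>lborel) = (\<integral>r. (h (a + e) r - h a r) * indicator {b..b+e} r \<partial>lborel)"
  proof -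
    have "(\<integral>z. D1 z * indicator ?B z \<partial>lborel) = (\<integral>r. (\<integral>s. D1 (s, r) * indicator ?B (s, r) \<partial>lborel) \<partial>lborel)"
    proof -
      have "(\<lambda>(s, r). D1 (s, r) * indicator ?B (s, r) :: real) = (\<lambda>z. D1 z * indicator ?B z)" by auto
      then show ?thesis
        using lborel_pair.integral_snd[of "\<lambda>s r. D1 (s, r) * indicator ?B (s, r)"] i1 unfolding lborel_prod by simp
    qed
    also have "\<dots> = (\<integral>r. (h (a + e) r - h a r) * indicator {b..b+e} r \<partial>lborel)"
    proof (rule Bochner_Integration.integral_cong[OF refl])
      fix r
      have "(\<integral>s. D1 (s, r) * indicator ?B (s, r) \<partial>lborel) =
        (\<integral>s. (seq_deriv (\<lambda>s. h s r) s * indicator {a..a+e} s) * indicator {b..b+e} r \<partial>lborel)"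
        unfolding ind by (simp add: D1_def mult.assoc)
      also have "\<dots> = (\<integral>s. (seq_deriv (\<lambda>s. h s r) s * indicator {a..a+e} s) \<partial>lborel) * indicator {b..b+e} r"
        by simp
      finally show "(\<integral>s. D1 (s, r) * indicator ?B (s, r) \<partial>lborel) = (h (a + e) r - h a r) * indicator {b..b+e} r"
        using Lipschitz_FTC[OF lip_fst, of a "a + e" r] e by simp
    qed
    finally show ?thesis .
  qed
  have I2: "(\<integral>z. D2 z * indicator ?B z \<partial>lborel) = (\<integral>s. (h s (b + e) - h s b) * indicator {a..a+e} s \<partial>lborel)"
  proof -
    have "(\<integral>z. D2 z * indicator ?B z \<partial>lborel) = (\<integral>s. (\<integral>r. D2 (s, r) * indicator ?B (s, r) \<partial>lborel) \<partial>lborel)"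
      using lborel_pair.integral_fst'[of "\<lambda>z. D2 z * indicator ?B z"] i2 unfolding lborel_prod by simp
    also have "\<dots> = (\<integral>s. (h s (b + e) - h s b) * indicator {a..a+e} s \<partial>lborel)"
    proof (rule Bochner_Integration.integral_cong[OF refl])
      fix s
      have "(\<integral>r. D2 (s, r) * indicator ?B (s, r) \<partial>lborel) =
        (\<integral>r. (seq_deriv (h s) r * indicator {b..b+e} r) * indicator {a..a+e} s \<partial>lborel)"
        unfolding ind by (simp add: D2_def ac_simps)
      also have "\<dots> = (\<integral>r. (seq_deriv (h s) r * indicator {b..b+e} r) \<partial>lborel) * indicator {a..a+e} s"
        by simp
      finally show "(\<integral>r. D2 (s, r) * indicator ?B (s, r) \<partial>lborel) = (h s (b + e) - h s b) * indicator {a..a+e} s"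
        using Lipschitz_FTC[OF lip_snd, of b "b + e" s] e by simp
    qed
    finally show ?thesis .
  qed
  \<comment> \<open>The hypothesis concerns the open square; the lines through its sides are
    null.\<close>
  have nb: "AE z in lborel. z \<notin> {a, a+e} \<times> (UNIV::real set)" "AE z in lborel. z \<notin> (UNIV::real set) \<times> {b, b+e}"
  proof -
    have ct: "{a, a+e} \<times> (UNIV::real set) \<in> sets borel" "(UNIV::real set) \<times> {b, b+e} \<in> sets borel"
      by (intro borel_Times; simp)+
    show "AE z in lborel. z \<notin> {a, a+e} \<times> (UNIV::real set)"
      by (rule AE_not_in[OF null_sets_lborel_pairI2[OF ct(1)]], rule AE_I2,
          rule AE_mp[OF AE_lborel_singleton[of a]], rule AE_mp[OF AE_lborel_singleton[of "a+e"]]) auto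
    show "AE z in lborel. z \<notin> (UNIV::real set) \<times> {b, b+e}"
      by (rule AE_not_in[OF null_sets_lborel_pairI[OF ct(2)]], rule AE_I2,
          rule AE_mp[OF AE_lborel_singleton[of b]], rule AE_mp[OF AE_lborel_singleton[of "b+e"]]) auto
  qed
  let ?m = "max \<bar>p\<bar> \<bar>q\<bar>"
  have ae2: "AE z in lborel. \<bar>p * (D1 z * indicator ?B z) + q * (D2 z * indicator ?B z)\<bar> \<le> ?m * C * indicator ?B z"
    using b1 b2 ae nb
  proof eventually_elim
    case (elim z)
    show ?case
    proof (cases "z \<in> ?B")
      case True
      then have "z \<in> {a<..<a + e} \<times> {b<..<b + e}" using elim by (auto simp: less_le)
      then have le: "\<bar>D1 z\<bar> + \<bar>D2 z\<bar> \<le> C" using elim by auto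
      have "\<bar>p * D1 z + q * D2 z\<bar> \<le> \<bar>p\<bar> * \<bar>D1 z\<bar> + \<bar>q\<bar> * \<bar>D2 z\<bar>"
        by (metis abs_mult abs_triangle_ineq)
      also have "\<dots> \<le> ?m * \<bar>D1 z\<bar> + ?m * \<bar>D2 z\<bar>"
        by (intro add_mono mult_right_mono) auto
      also have "\<dots> \<le> ?m * C" using mult_left_mono[OF le, of ?m] by (simp add: distrib_left max.coboundedI1)
      finally show ?thesis using True by simp
    qed simp
  qed
  have "(\<integral>z. \<bar>p * (D1 z * indicator ?B z) + q * (D2 z * indicator ?B z)\<bar> \<partial>lborel) \<le> (\<integral>z. ?m * C * indicator ?B z \<partial>lborel)"
  proof (rule integral_mono_AE'[OF intB ae2])
    show "AE z in lborel. 0 \<le> ?m * C * indicator ?B z"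
      using ae2 by eventually_elim (meson order_trans abs_ge_zero)
  qed
  moreover have "\<bar>\<integral>z. p * (D1 z * indicator ?B z) + q * (D2 z * indicator ?B z) \<partial>lborel\<bar> \<le>
    (\<integral>z. \<bar>p * (D1 z * indicator ?B z) + q * (D2 z * indicator ?B z)\<bar> \<partial>lborel)"
    by (rule integral_abs_bound)
  moreover have "(\<integral>z. ?m * C * indicator ?B z \<partial>lborel) = ?m * C * e\<^sup>2"
    using emB by (simp add: measure_def)
  moreover have "(\<integral>z. p * (D1 z * indicator ?B z) + q * (D2 z * indicator ?B z) \<partial>lborel) =
    p * (\<integral>z. D1 z * indicator ?B z \<partial>lborel) + q * (\<integral>z. D2 z * indicator ?B z \<partial>lborel)"
    using i1 i2 by simp
  ultimately show ?thesis unfolding I1 I2 by linarith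
qed

text \<open>The average of \<open>h\<close> over the square of side \<open>e\<close> with lower left
  corner (a, b), times \<open>e\<^sup>2\<close>: a smoothing whose increments do not see null
  sets.\<close>

definition box_integral :: "real \<Rightarrow> real \<Rightarrow> real \<Rightarrow> real" where
  "box_integral e a b = integral {0..e} (\<lambda>r. integral {0..e} (\<lambda>s. h (a + s) (b + r)))"

lemma cont_pair: "continuous_on S (\<lambda>(x, y). h (f x y) (g x y))"
  if "continuous_on S (\<lambda>z. f (fst z) (snd z))" "continuous_on S (\<lambda>z. g (fst z) (snd z))"
  using cont_compose[OF that] by (simp add: case_prod_unfold)

lemma box_integral_swap:
  "box_integral e a b = integral {0..e} (\<lambda>s. integral {0..e} (\<lambda>r. h (a + s) (b + r)))"
proof -
  have "continuous_on (cbox (0, 0) (e, e)) (\<lambda>(r, s). h (a + s) (b + r))"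
    by (rule cont_pair) (auto intro!: continuous_intros)
  then show ?thesis
    using integral_swap_continuous[of 0 0 e e "\<lambda>r s. h (a + s) (b + r)"]
    by (simp add: box_integral_def)
qed

lemma abs_integral_diff_le:
  fixes f g :: "real \<Rightarrow> real"
  assumes "0 \<le> e" "continuous_on {0..e} f" "continuous_on {0..e} g"
    and le: "\<And>s. s \<in> {0..e} \<Longrightarrow> \<bar>f s - g s\<bar> \<le> B"
  shows "\<bar>integral {0..e} f - integral {0..e} g\<bar> \<le> B * e"
proof -
  have "integral {0..e} f - integral {0..e} g = integral {0..e} (\<lambda>s. f s - g s)"
    using assms by (intro Henstock_Kurzweil_Integration.integral_diff[symmetric] integrable_continuous_real)
  then show ?thesis
    using integral_bound[of 0 e "\<lambda>s. f s - g s" B] assms by (auto intro!: continuous_intros)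
qed

text \<open>Translating the interval by \<open>p\<close> trades a piece at one end for a piece at
  the other; each is \<open>p\<close> times the end value up to
  \<open>L * p\<^sup>2\<close>.\<close>

lemma integral_translate_diff:
  fixes k :: "real \<Rightarrow> real"
  assumes k: "\<And>x y. \<bar>k x - k y\<bar> \<le> L * \<bar>x - y\<bar>" and e: "0 \<le> e"
  shows "\<bar>integral {0..e} (\<lambda>s. k (a + p + s)) - integral {0..e} (\<lambda>s. k (a + s)) - p * (k (a + e) - k a)\<bar> \<le> 2 * L * p\<^sup>2"
proof -
  have ck: "continuous_on S k" for S
    by (rule lipschitz_on_continuous_on[of L])
      (use k L_nonneg in \<open>auto intro!: lipschitz_onI simp: dist_real_def\<close>)
  define lo hi where "lo = a - \<bar>p\<bar> - 1" and "hi = a + e + \<bar>p\<bar> + 1"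
  obtain F where F: "\<And>x. x \<in> {lo..hi} \<Longrightarrow> (F has_vector_derivative k x) (at x within {lo..hi})"
    using antiderivative_continuous[OF ck, of lo hi] by metis
  have F': "(F has_real_derivative k x) (at x)" if "lo < x" "x < hi" for x
    using F[of x] that at_within_Icc_at[of lo x hi] by (simp add: has_real_derivative_iff_has_vector_derivative)
  have I: "integral {0..e} (\<lambda>s. k (c + s)) = F (c + e) - F c" if "\<bar>c - a\<bar> \<le> \<bar>p\<bar>" for c
  proof (rule integral_unique)
    have "((\<lambda>s. k (c + s)) has_integral (F (c + e) - F (c + 0))) {0..e}"
    proof (rule fundamental_theorem_of_calculus[OF e])
      fix s assume "s \<in> {0..e}"
      then have "lo < c + s" "c + s < hi" using that by (auto simp: lo_def hi_def)
      then have "((\<lambda>s. F (c + s)) has_real_derivative k (c + s)) (at s)"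
        using F'[of "c + s"] DERIV_shift[of F "k (c + s)" s c] by (simp add: add.commute)
      then show "((\<lambda>s. F (c + s)) has_vector_derivative k (c + s)) (at s within {0..e})"
        by (simp add: has_real_derivative_iff_has_vector_derivative has_vector_derivative_at_within)
    qed
    then show "((\<lambda>s. k (c + s)) has_integral (F (c + e) - F c)) {0..e}" by simp
  qed
  have T: "\<bar>F (c + p) - F c - p * k c\<bar> \<le> L * p\<^sup>2" if c: "a \<le> c" "c \<le> a + e" for c
  proof -
    have "norm ((\<lambda>x. F x - k c * x) (c + p) - (\<lambda>x. F x - k c * x) c) \<le> (L * \<bar>p\<bar>) * norm ((c + p) - c)"
    proof (rule field_differentiable_bound[of "closed_segment c (c + p)" _ "\<lambda>x. k x - k c"])
      fix x assume x: "x \<in> closed_segment c (c + p)"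
      then have xc: "\<bar>x - c\<bar> \<le> \<bar>p\<bar>" by (auto simp: closed_segment_eq_real_ivl split: if_splits)
      then have "lo < x" "x < hi" using c by (auto simp: lo_def hi_def)
      then have "((\<lambda>x. F x - k c * x) has_real_derivative k x - k c * 1) (at x)"
        by (intro DERIV_diff F' DERIV_cmult DERIV_ident)
      then show "((\<lambda>x. F x - k c * x) has_real_derivative k x - k c) (at x within closed_segment c (c + p))"
        by (simp add: has_field_derivative_at_within)
      show "norm (k x - k c) \<le> L * \<bar>p\<bar>"
        using k[of x c] mult_left_mono[OF xc L_nonneg] by simp
    qed auto
    then show ?thesis by (simp add: algebra_simps power2_eq_square abs_mult[symmetric])
  qed
  have "integral {0..e} (\<lambda>s. k (a + p + s)) - integral {0..e} (\<lambda>s. k (a + s)) - p * (k (a + e) - k a) =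
    (F (a + e + p) - F (a + e) - p * k (a + e)) - (F (a + p) - F a - p * k a)"
    using I[of "a + p"] I[of a] by (simp add: algebra_simps)
  then show ?thesis using T[of "a + e"] T[of a] e by linarith
qed

lemma cont_integral:
  "continuous_on S (\<lambda>r. integral {0..e} (\<lambda>s. h (a + s) (b + r)))"
  "continuous_on S (\<lambda>s. integral {0..e} (\<lambda>r. h (a + s) (b + r)))" if "0 \<le> e"
proof -
  show "continuous_on S (\<lambda>r. integral {0..e} (\<lambda>s. h (a + s) (b + r)))"
  proof (rule lipschitz_on_continuous_on[of "L * e"], rule lipschitz_onI)
    fix r r'
    have "\<bar>integral {0..e} (\<lambda>s. h (a + s) (b + r)) - integral {0..e} (\<lambda>s. h (a + s) (b + r'))\<bar> \<le> L * \<bar>r - r'\<bar> * e"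
      using lip_snd[of _ "b + r" "b + r'"] that
      by (intro abs_integral_diff_le) (auto intro!: cont_compose continuous_intros)
    then show "dist (integral {0..e} (\<lambda>s. h (a + s) (b + r))) (integral {0..e} (\<lambda>s. h (a + s) (b + r'))) \<le> L * e * dist r r'"
      by (simp add: dist_real_def algebra_simps)
  qed (use L_nonneg that in simp)
  show "continuous_on S (\<lambda>s. integral {0..e} (\<lambda>r. h (a + s) (b + r)))"
  proof (rule lipschitz_on_continuous_on[of "L * e"], rule lipschitz_onI)
    fix r r'
    have "\<bar>integral {0..e} (\<lambda>s. h (a + r) (b + s)) - integral {0..e} (\<lambda>s. h (a + r') (b + s))\<bar> \<le> L * \<bar>r - r'\<bar> * e"
      using lip_fst[of "a + r" _ "a + r'"] that
      by (intro abs_integral_diff_le) (auto intro!: cont_compose continuous_intros)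
    then show "dist (integral {0..e} (\<lambda>s. h (a + r) (b + s))) (integral {0..e} (\<lambda>s. h (a + r') (b + s))) \<le> L * e * dist r r'"
      by (simp add: dist_real_def algebra_simps)
  qed (use L_nonneg that in simp)
qed

text \<open>To first order the move (p, q) changes the box integral by
  \<open>p * ?P + q * ?Q\<close>, made of differences between opposite sides and bounded by
  \<open>square_mean_bound\<close>. All other contributions are quadratic in (p, q), which is what
  \<open>subdivision_bound\<close> tolerates.\<close>

lemma box_integral_step:
  assumes e: "0 < e"
    and ae: "AE z in lborel. z \<in> {a<..<a + e} \<times> {b<..<b + e} \<longrightarrow>
      \<bar>deriv (\<lambda>s. h s (snd z)) (fst z)\<bar> + \<bar>deriv (h (fst z)) (snd z)\<bar> \<le> C"
  shows "\<bar>box_integral e (a + p) (b + q) - box_integral e a b\<bar> \<le>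
    max \<bar>p\<bar> \<bar>q\<bar> * C * e\<^sup>2 + 2 * L * e * (p\<^sup>2 + q\<^sup>2 + \<bar>p\<bar> * \<bar>q\<bar>)"
proof -
  have e0: "0 \<le> e" using e by simp
  let ?P = "integral {0..e} (\<lambda>r. h (a + e) (b + r) - h a (b + r))"
  let ?Q = "integral {0..e} (\<lambda>s. h (a + s) (b + e) - h (a + s) b)"
  have leb: "integral {0..e} (\<lambda>s. f (c + s)) = (\<integral>s. f s * indicator {c..c+e} s \<partial>lborel)"
    if f: "continuous_on UNIV f" for f :: "real \<Rightarrow> real" and c
  proof -
    have "integral {0..e} (\<lambda>s. f (c + s)) = integral {c..c+e} f"
      using integral_shift_real_ivl[of c "c" "c+e" f] by (simp add: add.commute)
    also have "\<dots> = (LBINT x:{c..c+e}. f x)"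
      using f by (intro set_borel_integral_eq_integral(2)[symmetric] borel_integrable_atLeastAtMost')
        (auto intro: continuous_on_subset)
    finally show ?thesis by (simp add: set_lebesgue_integral_def mult.commute)
  qed
  have K: "\<bar>p * ?P + q * ?Q\<bar> \<le> max \<bar>p\<bar> \<bar>q\<bar> * C * e\<^sup>2"
    using square_mean_bound[OF e ae, of p q]
      leb[of "\<lambda>r. h (a + e) r - h a r" b] leb[of "\<lambda>s. h s (b + e) - h s b" a]
    by (simp add: cont_compose continuous_on_diff)
  let ?P' = "integral {0..e} (\<lambda>r. h (a + e) (b + q + r) - h a (b + q + r))"
  have 1: "\<bar>box_integral e (a + p) (b + q) - box_integral e a (b + q) - p * ?P'\<bar> \<le> 2 * L * p\<^sup>2 * e"
  proof -
    have "integral {0..e} (\<lambda>r. integral {0..e} (\<lambda>s. h (a + s) (b + q + r)) + p * (h (a + e) (b + q + r) - h a (b + q + r)))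
      = box_integral e a (b + q) + p * ?P'"
      unfolding box_integral_def
      by (subst Henstock_Kurzweil_Integration.integral_add)
        (auto intro!: integrable_continuous_real cont_integral e0 continuous_intros cont_compose)
    moreover have "\<bar>integral {0..e} (\<lambda>r. integral {0..e} (\<lambda>s. h (a + p + s) (b + q + r))) -
      integral {0..e} (\<lambda>r. integral {0..e} (\<lambda>s. h (a + s) (b + q + r)) + p * (h (a + e) (b + q + r) - h a (b + q + r)))\<bar>
      \<le> 2 * L * p\<^sup>2 * e"
    proof (rule abs_integral_diff_le[OF e0])
      fix r
      show "\<bar>integral {0..e} (\<lambda>s. h (a + p + s) (b + q + r)) -
        (integral {0..e} (\<lambda>s. h (a + s) (b + q + r)) + p * (h (a + e) (b + q + r) - h a (b + q + r)))\<bar> \<le> 2 * L * p\<^sup>2"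
        using integral_translate_diff[of "\<lambda>x. h x (b + q + r)" e a p, OF lip_fst e0] by simp
    qed (auto intro!: cont_integral e0 continuous_intros cont_compose)
    ultimately show ?thesis unfolding box_integral_def by linarith
  qed
  have 2: "\<bar>box_integral e a (b + q) - box_integral e a b - q * ?Q\<bar> \<le> 2 * L * q\<^sup>2 * e"
  proof -
    have "integral {0..e} (\<lambda>s. integral {0..e} (\<lambda>r. h (a + s) (b + r)) + q * (h (a + s) (b + e) - h (a + s) b))
      = box_integral e a b + q * ?Q"
      unfolding box_integral_swap
      by (subst Henstock_Kurzweil_Integration.integral_add)
        (auto intro!: integrable_continuous_real cont_integral e0 continuous_intros cont_compose)
    moreover have "\<bar>integral {0..e} (\<lambda>s. integral {0..e} (\<lambda>r. h (a + s) (b + q + r))) -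
      integral {0..e} (\<lambda>s. integral {0..e} (\<lambda>r. h (a + s) (b + r)) + q * (h (a + s) (b + e) - h (a + s) b))\<bar>
      \<le> 2 * L * q\<^sup>2 * e"
    proof (rule abs_integral_diff_le[OF e0])
      fix s
      show "\<bar>integral {0..e} (\<lambda>r. h (a + s) (b + q + r)) -
        (integral {0..e} (\<lambda>r. h (a + s) (b + r)) + q * (h (a + s) (b + e) - h (a + s) b))\<bar> \<le> 2 * L * q\<^sup>2"
        using integral_translate_diff[of "h (a + s)" e b q, OF lip_snd e0] by simp
    qed (auto intro!: cont_integral e0 continuous_intros cont_compose)
    ultimately show ?thesis unfolding box_integral_swap by linarith
  qed
  \<comment> \<open>The horizontal move takes place at height \<open>b + q\<close>; bringing its
    side difference back to height \<open>b\<close> costs a term of order |p| |q|.\<close>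
  have 3: "\<bar>?P' - ?P\<bar> \<le> 2 * L * \<bar>q\<bar> * e"
  proof (rule abs_integral_diff_le[OF e0])
    fix r
    show "\<bar>h (a + e) (b + q + r) - h a (b + q + r) - (h (a + e) (b + r) - h a (b + r))\<bar> \<le> 2 * L * \<bar>q\<bar>"
      using lip_snd[of "a + e" "b + q + r" "b + r"] lip_snd[of a "b + q + r" "b + r"] by (simp add: abs_if split: if_splits)
  qed (auto intro!: continuous_intros cont_compose)
  have 4: "\<bar>p * ?P' - p * ?P\<bar> \<le> \<bar>p\<bar> * (2 * L * \<bar>q\<bar> * e)"
    using mult_left_mono[OF 3, of "\<bar>p\<bar>"] by (simp add: abs_mult right_diff_distrib[symmetric])
  have tri: "\<bar>X - Z\<bar> \<le> k4 + k3 + k1 + k2"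
    if "\<bar>X - Y - u'\<bar> \<le> k1" "\<bar>Y - Z - w\<bar> \<le> k2" "\<bar>u' - u\<bar> \<le> k3" "\<bar>u + w\<bar> \<le> k4"
    for X Y Z u u' w k1 k2 k3 k4 :: real
    using that by linarith
  have "\<bar>box_integral e (a + p) (b + q) - box_integral e a b\<bar> \<le> max \<bar>p\<bar> \<bar>q\<bar> * C * e\<^sup>2
     + \<bar>p\<bar> * (2 * L * \<bar>q\<bar> * e) + 2 * L * p\<^sup>2 * e + 2 * L * q\<^sup>2 * e"
    by (rule tri[OF 1 2 4 K])
  then show ?thesis by (simp add: algebra_simps)
qed

text \<open>Box integrals at the two points are compared along the segment by
  \<open>subdivision_bound\<close>; divided by \<open>e\<^sup>2\<close> they approximate
  \<open>h\<close> within 2 L e, with \<open>e\<close> as small as desired.\<close>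

lemma lipschitz_max_norm_of_AE:
  assumes ae: "AE z in lborel. z \<in> {\<alpha><..<\<beta>} \<times> {\<alpha>'<..<\<beta>'} \<longrightarrow>
      \<bar>deriv (\<lambda>s. h s (snd z)) (fst z)\<bar> + \<bar>deriv (h (fst z)) (snd z)\<bar> \<le> C"
    and z0: "a \<in> {\<alpha><..<\<beta>}" "b \<in> {\<alpha>'<..<\<beta>'}" and z1: "a' \<in> {\<alpha><..<\<beta>}" "b' \<in> {\<alpha>'<..<\<beta>'}"
  shows "\<bar>h a' b' - h a b\<bar> \<le> C * max \<bar>a' - a\<bar> \<bar>b' - b\<bar>"
proof (rule field_le_epsilon)
  fix d :: real assume d: "d > 0"
  \<comment> \<open>The squares extend to the upper right of their base points, so only the upper
    ends of the rectangle restrict \<open>e\<close>; the first entry gives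
    \<open>4 * L * e \<le> d\<close>.\<close>
  define e where "e = min (min (d / (4 * L + 1)) (min (\<beta> - a) (\<beta> - a'))) (min (\<beta>' - b) (\<beta>' - b'))"
  have e: "0 < e" using d z0 z1 L_nonneg by (auto simp: e_def)
  let ?p = "a' - a" and ?q = "b' - b"
  let ?m = "max \<bar>?p\<bar> \<bar>?q\<bar>"
  have J: "\<bar>box_integral e x y - e\<^sup>2 * h x y\<bar> \<le> 2 * L * e * e\<^sup>2" for x y
  proof -
    have "\<bar>box_integral e x y - integral {0..e} (\<lambda>r. e * h x y)\<bar> \<le> (2 * L * e * e) * e"
      unfolding box_integral_def
    proof (rule abs_integral_diff_le)
      fix r assume r: "r \<in> {0..e}"
      have "\<bar>integral {0..e} (\<lambda>s. h (x + s) (y + r)) - integral {0..e} (\<lambda>s. h x y)\<bar> \<le> (2 * L * e) * e"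
      proof (rule abs_integral_diff_le)
        fix s assume "s \<in> {0..e}"
        then have "L * (\<bar>x + s - x\<bar> + \<bar>y + r - y\<bar>) \<le> L * (e + e)" using r L_nonneg by (intro mult_left_mono) auto
        then show "\<bar>h (x + s) (y + r) - h x y\<bar> \<le> 2 * L * e" using lip[of "x + s" "y + r" x y] by simp
      qed (use e in \<open>auto intro!: cont_compose continuous_intros\<close>)
      then show "\<bar>integral {0..e} (\<lambda>s. h (x + s) (y + r)) - e * h x y\<bar> \<le> 2 * L * e * e"
        using e by simp
    qed (use e in \<open>auto intro!: cont_integral continuous_intros\<close>)
    then show ?thesis using e by (simp add: power2_eq_square mult.assoc)
  qed
  have "\<bar>box_integral e (a + 1 * ?p) (b + 1 * ?q) - box_integral e (a + 0 * ?p) (b + 0 * ?q)\<bar> \<le> ?m * C * e\<^sup>2"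
  proof (rule subdivision_bound[where K = "2 * L * e * (?p\<^sup>2 + ?q\<^sup>2 + \<bar>?p\<bar> * \<bar>?q\<bar>)"])
    fix s t :: real assume st: "0 \<le> s" "0 \<le> t" "s + t \<le> 1"
    have sub: "{a + s * ?p<..<a + s * ?p + e} \<times> {b + s * ?q<..<b + s * ?q + e} \<subseteq> {\<alpha><..<\<beta>} \<times> {\<alpha>'<..<\<beta>'}"
    proof -
      have s: "0 \<le> s" "s \<le> 1" using st by auto
      have cv: "min x y \<le> x + s * (y - x) \<and> x + s * (y - x) \<le> max x y" for x y
        using s by (smt (verit, ccfv_SIG) mult_left_le_one_le mult_minus_right mult_nonneg_nonneg)
      have "e \<le> \<beta> - a" "e \<le> \<beta> - a'" "e \<le> \<beta>' - b" "e \<le> \<beta>' - b'" by (auto simp: e_def)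
      then show ?thesis using cv[of a a'] cv[of b b'] z0 z1 by auto
    qed
    have f1: "\<bar>box_integral e ((a + s * ?p) + t * ?p) ((b + s * ?q) + t * ?q) - box_integral e (a + s * ?p) (b + s * ?q)\<bar> \<le>
      max \<bar>t * ?p\<bar> \<bar>t * ?q\<bar> * C * e\<^sup>2 + 2 * L * e * ((t * ?p)\<^sup>2 + (t * ?q)\<^sup>2 + \<bar>t * ?p\<bar> * \<bar>t * ?q\<bar>)"
      by (rule box_integral_step[OF e], rule AE_mp[OF ae], rule AE_I2) (use sub in blast)
    have f2: "max \<bar>t * ?p\<bar> \<bar>t * ?q\<bar> = t * ?m" using st by (simp add: abs_mult max_mult_distrib_left)
    have f3: "(t * ?p)\<^sup>2 + (t * ?q)\<^sup>2 + \<bar>t * ?p\<bar> * \<bar>t * ?q\<bar> = (?p\<^sup>2 + ?q\<^sup>2 + \<bar>?p\<bar> * \<bar>?q\<bar>) * t\<^sup>2"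
      using st by (simp add: abs_mult power_mult_distrib) (simp add: algebra_simps power2_eq_square)
    show "\<bar>box_integral e (a + (s + t) * ?p) (b + (s + t) * ?q) - box_integral e (a + s * ?p) (b + s * ?q)\<bar> \<le>
      ?m * C * e\<^sup>2 * t + 2 * L * e * (?p\<^sup>2 + ?q\<^sup>2 + \<bar>?p\<bar> * \<bar>?q\<bar>) * t\<^sup>2"
    proof -
      have "a + (s + t) * ?p = (a + s * ?p) + t * ?p" "b + (s + t) * ?q = (b + s * ?q) + t * ?q"
        by (simp_all add: algebra_simps)
      moreover have "t * ?m * C * e\<^sup>2 = ?m * C * e\<^sup>2 * t"
        "2 * L * e * ((?p\<^sup>2 + ?q\<^sup>2 + \<bar>?p\<bar> * \<bar>?q\<bar>) * t\<^sup>2) = 2 * L * e * (?p\<^sup>2 + ?q\<^sup>2 + \<bar>?p\<bar> * \<bar>?q\<bar>) * t\<^sup>2"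
        by (simp_all only: mult_ac)
      ultimately show ?thesis using f1 unfolding f2 f3 by (simp only:)
    qed
  qed
  then have "\<bar>box_integral e a' b' - box_integral e a b\<bar> \<le> ?m * C * e\<^sup>2" by simp
  then have "\<bar>e\<^sup>2 * h a' b' - e\<^sup>2 * h a b\<bar> \<le> ?m * C * e\<^sup>2 + 4 * L * e * e\<^sup>2"
    using J[of a' b'] J[of a b] by linarith
  moreover have "\<bar>e\<^sup>2 * h a' b' - e\<^sup>2 * h a b\<bar> = e\<^sup>2 * \<bar>h a' b' - h a b\<bar>"
    by (simp add: right_diff_distrib[symmetric] abs_mult)
  moreover have "?m * C * e\<^sup>2 + 4 * L * e * e\<^sup>2 = e\<^sup>2 * (?m * C + 4 * L * e)"
    by (simp add: distrib_left mult_ac)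
  ultimately have "e\<^sup>2 * \<bar>h a' b' - h a b\<bar> \<le> e\<^sup>2 * (?m * C + 4 * L * e)" by simp
  then have "\<bar>h a' b' - h a b\<bar> \<le> ?m * C + 4 * L * e" using e by simp
  also have "4 * L * e \<le> d"
  proof -
    have "4 * L * e \<le> 4 * L * (d / (4 * L + 1))" using L_nonneg by (intro mult_left_mono) (auto simp: e_def)
    also have "\<dots> \<le> d" using L_nonneg d by (simp add: field_simps)
    finally show ?thesis .
  qed
  finally show "\<bar>h a' b' - h a b\<bar> \<le> C * ?m + d" by (simp add: mult.commute)
qed

end

section \<open>Essential suprema and coefficients in three variables\<close>

lemma AE_lborel_pairD2:
  fixes Q :: "'a::euclidean_space \<times> 'b::euclidean_space \<Rightarrow> bool"
  assumes "AE z in lborel. Q z"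
  shows "AE y in lborel. AE x in lborel. Q (x, y)"
proof -
  \<comment> \<open>Commuting the quantifiers asks for measurability, so \<open>Q\<close> is
    replaced by membership in the complement of a measurable null set.\<close>
  obtain N where N: "N \<in> null_sets lborel" "{z \<in> space lborel. \<not> Q z} \<subseteq> N"
    using assms unfolding eventually_ae_filter by auto
  have Ns: "N \<in> sets ((lborel :: 'a measure) \<Otimes>\<^sub>M (lborel :: 'b measure))"
    using N(1) unfolding lborel_prod by auto
  have "AE x in (lborel :: 'a measure). AE y in (lborel :: 'b measure). (x, y) \<notin> N"
    using AE_lborel_pairD[OF AE_not_in[OF N(1)]] .
  then have "AE y in (lborel :: 'b measure). AE x in (lborel :: 'a measure). (x, y) \<notin> N"
  proof (subst (asm) lborel_pair.AE_commute)
    show "{z \<in> space (lborel \<Otimes>\<^sub>M lborel). (fst z, snd z) \<notin> N} \<in> sets ((lborel :: 'a measure) \<Otimes>\<^sub>M (lborel :: 'b measure))"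
      using sets.compl_sets[OF Ns] by (simp add: set_diff_eq)
  qed simp
  then show ?thesis
  proof eventually_elim
    case (elim y)
    then show ?case
    proof eventually_elim
      case (elim x)
      then show ?case using N(2) by auto
    qed
  qed
qed

lemma AE_lborel_ex_Ioo:
  fixes P :: "real \<Rightarrow> bool"
  assumes "AE x in lborel. P x" "a < b"
  shows "\<exists>x\<in>{a<..<b}. P x"
proof (rule ccontr)
  assume *: "\<not> ?thesis"
  have "AE x in lborel. x \<notin> {a<..<b}" by (rule AE_mp[OF assms(1)], rule AE_I2) (use * in auto)
  then have "{a<..<b} \<in> null_sets lborel" by (simp add: AE_iff_null_sets)
  then show False using \<open>a < b\<close> by (auto simp: null_sets_def)
qed

text \<open>The infimum is attained because the exceptional sets for the bounds exceeding it by 1/(n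
  + 1) have a null union. The hypothesis provides one bound, so that the infimum is taken over a
  nonempty set.\<close>

lemma ess_sup_on_props:
  assumes "AE p in lborel. p \<in> S \<longrightarrow> \<bar>f p\<bar> \<le> c"
  shows ess_sup_on_nonneg: "0 \<le> ess_sup_on S f"
    and AE_le_ess_sup_on: "AE p in lborel. p \<in> S \<longrightarrow> \<bar>f p\<bar> \<le> ess_sup_on S f"
proof -
  let ?C = "{c. 0 \<le> c \<and> (AE p in lborel. p \<in> S \<longrightarrow> \<bar>f p\<bar> \<le> c)}"
  have "AE p in lborel. p \<in> S \<longrightarrow> \<bar>f p\<bar> \<le> \<bar>c\<bar>" using assms by eventually_elim auto
  then have "\<bar>c\<bar> \<in> ?C" by simp
  then have ne: "?C \<noteq> {}" by blast
  have bdd: "bdd_below ?C" by (rule bdd_belowI[of _ 0]) auto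
  show "0 \<le> ess_sup_on S f" unfolding ess_sup_on_def using ne by (rule cInf_greatest) auto
  have "AE p in lborel. p \<in> S \<longrightarrow> \<bar>f p\<bar> \<le> ess_sup_on S f + 1 / real (Suc n)" for n
  proof -
    have "Inf ?C < ess_sup_on S f + 1 / real (Suc n)" unfolding ess_sup_on_def by simp
    then obtain c where c: "c \<in> ?C" "c < ess_sup_on S f + 1 / real (Suc n)"
      using cInf_lessD[OF ne] by blast
    then have "AE p in lborel. p \<in> S \<longrightarrow> \<bar>f p\<bar> \<le> c" by simp
    then show ?thesis by eventually_elim (use c in auto)
  qed
  then have "AE p in lborel. \<forall>n. p \<in> S \<longrightarrow> \<bar>f p\<bar> \<le> ess_sup_on S f + 1 / real (Suc n)"
    unfolding AE_all_countable by blast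
  then show "AE p in lborel. p \<in> S \<longrightarrow> \<bar>f p\<bar> \<le> ess_sup_on S f"
  proof eventually_elim
    case (elim p)
    show ?case
    proof
      assume p: "p \<in> S"
      have "(\<lambda>n. ess_sup_on S f + 1 / real (Suc n)) \<longlonglongrightarrow> ess_sup_on S f + 0"
        using LIMSEQ_inverse_real_of_nat by (intro tendsto_intros) (simp add: inverse_eq_divide)
      then show "\<bar>f p\<bar> \<le> ess_sup_on S f"
        using elim p by (intro LIMSEQ_le_const[of _ _ "\<bar>f p\<bar>"]) auto
    qed
  qed
qed

lemma abs_clamp_le: "\<bar>max c (min d x) - max c (min d y)\<bar> \<le> \<bar>x - y\<bar>" for x :: real
  by (simp add: max_def min_def abs_if)

locale lipschitz3 =
  fixes k :: "real \<Rightarrow> real \<Rightarrow> real \<Rightarrow> real" and A :: real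
  assumes lip3: "\<And>x a b x' a' b'. \<bar>k x a b - k x' a' b'\<bar> \<le> A * (\<bar>x - x'\<bar> + \<bar>a - a'\<bar> + \<bar>b - b'\<bar>)"
begin

lemma A_nonneg: "0 \<le> A"
  using lip3[of 0 0 0 0 0 1] abs_ge_zero[of "k 0 0 0 - k 0 0 1"] by simp

lemma slice: "lipschitz2 (k x) A"
proof
  show "\<bar>k x a b - k x a' b'\<bar> \<le> A * (\<bar>a - a'\<bar> + \<bar>b - b'\<bar>)" for a b a' b'
    using lip3[of x a b x a' b'] by simp
qed

lemma cont3: "continuous_on UNIV (\<lambda>z. k (fst z) (fst (snd z)) (snd (snd z)))"
proof (rule lipschitz_on_continuous_on, rule lipschitz_onI)
  fix z z' :: "real \<times> real \<times> real"
  have "\<bar>fst z - fst z'\<bar> \<le> dist z z'" "dist (snd z) (snd z') \<le> dist z z'"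
    using dist_fst_le[of z z'] dist_snd_le[of z z'] by (auto simp: dist_real_def)
  moreover have "\<bar>fst (snd z) - fst (snd z')\<bar> \<le> dist (snd z) (snd z')" "\<bar>snd (snd z) - snd (snd z')\<bar> \<le> dist (snd z) (snd z')"
    using dist_fst_le[of "snd z" "snd z'"] dist_snd_le[of "snd z" "snd z'"] by (auto simp: dist_real_def)
  ultimately have "A * (\<bar>fst z - fst z'\<bar> + \<bar>fst (snd z) - fst (snd z')\<bar> + \<bar>snd (snd z) - snd (snd z')\<bar>) \<le> A * (3 * dist z z')"
    using A_nonneg by (intro mult_left_mono) auto
  then show "dist (k (fst z) (fst (snd z)) (snd (snd z))) (k (fst z') (fst (snd z')) (snd (snd z'))) \<le> (3 * A) * dist z z'"
    using lip3[of "fst z" "fst (snd z)" "snd (snd z)" "fst z'" "fst (snd z')" "snd (snd z')"] by (simp add: dist_real_def)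
qed (use A_nonneg in simp)

lemma AE_differentiable3:
  "AE z in lborel. (\<lambda>s. k (fst z) s (snd (snd z))) field_differentiable at (fst (snd z)) \<and>
    k (fst z) (fst (snd z)) field_differentiable at (snd (snd z))"
proof -
  let ?k = "\<lambda>z. k (fst z) (fst (snd z)) (snd (snd z))"
  let ?N = "nondiff_set ?k (0, 1, 0)" and ?N' = "nondiff_set ?k (0, 0, 1)"
  have mem: "(x, z) \<in> ?N \<longleftrightarrow> z \<in> nondiff_set (\<lambda>z. k x (fst z) (snd z)) (1, 0)"
    "(x, z) \<in> ?N' \<longleftrightarrow> z \<in> nondiff_set (\<lambda>z. k x (fst z) (snd z)) (0, 1)" for x z
    by (simp_all add: nondiff_set_def osc_set_def)
  have mem1: "(x, a, b) \<in> ?N \<longleftrightarrow> a \<in> nondiff_set (\<lambda>s. k x s b) 1"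
    "(x, a, b) \<in> ?N' \<longleftrightarrow> b \<in> nondiff_set (k x a) 1" for x a b
    by (simp_all add: nondiff_set_def osc_set_def)
  have "?N \<in> null_sets lborel"
    by (rule null_sets_lborel_pairI[OF borel_nondiff_set[OF cont3]], rule AE_I2, unfold mem)
      (rule AE_not_in[OF lipschitz2.null_nondiff_fst[OF slice]])
  moreover have "?N' \<in> null_sets lborel"
    by (rule null_sets_lborel_pairI[OF borel_nondiff_set[OF cont3]], rule AE_I2, unfold mem)
      (rule AE_not_in[OF lipschitz2.null_nondiff_snd[OF slice]])
  ultimately have "AE z in lborel. z \<notin> ?N \<and> z \<notin> ?N'"
    using AE_not_in by (intro AE_conjI)
  then show ?thesis
  proof eventually_elim
    case (elim z)
    obtain x a b where z: "z = (x, a, b)" by (metis prod_cases3)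
    have "(\<lambda>s. k x s b) field_differentiable at a"
      using elim mem1 z by (intro field_differentiable_outside_nondiff_set[OF lipschitz2.lip_fst[OF slice]]) auto
    moreover have "k x a field_differentiable at b"
      using elim mem1 z by (intro field_differentiable_outside_nondiff_set[OF lipschitz2.lip_snd[OF slice]]) auto
    ultimately show ?case by (simp add: z)
  qed
qed

text \<open>The slice at the given \<open>x\<close> may be exceptional, and the two states may lie
  on the boundary of the box. Both are repaired by small moves: to a nearby good slice
  \<open>y\<close>, and to states scaled by \<open>1 - d\<close>. By \<open>lip3\<close> the cost is
  of order \<open>d\<close>.\<close>

lemma lipschitz_max_norm_of_AE3:
  assumes R: "0 < R"
    and ae: "AE z in lborel. fst z \<in> {0<..<1} \<and> fst (snd z) \<in> {-R<..<R} \<and> snd (snd z) \<in> {-R<..<R} \<longrightarrow>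
      \<bar>deriv (\<lambda>s. k (fst z) s (snd (snd z))) (fst (snd z))\<bar> + \<bar>deriv (k (fst z) (fst (snd z))) (snd (snd z))\<bar> \<le> C"
    and x: "x \<in> {0..1}" and ab: "\<bar>a\<bar> \<le> R" "\<bar>b\<bar> \<le> R" "\<bar>a'\<bar> \<le> R" "\<bar>b'\<bar> \<le> R"
  shows "\<bar>k x a' b' - k x a b\<bar> \<le> C * max \<bar>a' - a\<bar> \<bar>b' - b\<bar>"
proof (rule field_le_epsilon)
  fix e :: real assume e: "0 < e"
  let ?m = "max \<bar>a' - a\<bar> \<bar>b' - b\<bar>"
  \<comment> \<open>Collects the factors of \<open>d\<close> in the final estimate; the added 1
    makes the divisor positive.\<close>
  define K where "K = 2 * A * (2 * R + 1) + \<bar>C\<bar> * ?m + 1"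
  have K: "0 < K" using A_nonneg R by (auto simp: K_def intro!: add_nonneg_pos)
  define d where "d = min (1/2) (e / K)"
  have d: "0 < d" "d < 1" "d * K \<le> e"
    using e K by (auto simp: d_def min_def pos_divide_le_eq not_le less_imp_le field_simps)
  have "AE x in lborel. x \<in> {0<..<1} \<longrightarrow> (AE z in lborel. fst z \<in> {-R<..<R} \<and> snd z \<in> {-R<..<R} \<longrightarrow>
     \<bar>deriv (\<lambda>s. k x s (snd z)) (fst z)\<bar> + \<bar>deriv (k x (fst z)) (snd z)\<bar> \<le> C)"
    using AE_lborel_pairD[OF ae] by eventually_elim auto
  moreover have "max 0 (x - d) < min 1 (x + d)" using x d by auto
  ultimately obtain y where "y \<in> {max 0 (x - d)<..<min 1 (x + d)}"
    and y': "y \<in> {0<..<1} \<longrightarrow> (AE z in lborel. fst z \<in> {-R<..<R} \<and> snd z \<in> {-R<..<R} \<longrightarrow>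
     \<bar>deriv (\<lambda>s. k y s (snd z)) (fst z)\<bar> + \<bar>deriv (k y (fst z)) (snd z)\<bar> \<le> C)"
    using AE_lborel_ex_Ioo by blast
  then have y: "y \<in> {0<..<1}" "\<bar>x - y\<bar> \<le> d" by auto
  let ?t = "1 - d"
  have t: "\<bar>?t * c\<bar> < R" "\<bar>c - ?t * c\<bar> \<le> d * R" if "\<bar>c\<bar> \<le> R" for c
  proof -
    have "?t * \<bar>c\<bar> \<le> ?t * R" using that d by (intro mult_left_mono) auto
    also have "\<dots> < R" using d R by simp
    finally show "\<bar>?t * c\<bar> < R" using d by (simp add: abs_mult)
    have "c - ?t * c = d * c" by (simp add: algebra_simps)
    then show "\<bar>c - ?t * c\<bar> \<le> d * R" using that d by (simp add: abs_mult)
  qed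
  have tI: "?t * c \<in> {-R<..<R}" if "\<bar>c\<bar> \<le> R" for c
    using t(1)[OF that] by (auto simp: abs_less_iff)
  have "\<bar>k y (?t * a') (?t * b') - k y (?t * a) (?t * b)\<bar> \<le> C * max \<bar>?t * a' - ?t * a\<bar> \<bar>?t * b' - ?t * b\<bar>"
  proof (rule lipschitz2.lipschitz_max_norm_of_AE[OF slice])
    show "AE z in lborel. z \<in> {-R<..<R} \<times> {-R<..<R} \<longrightarrow>
     \<bar>deriv (\<lambda>s. k y s (snd z)) (fst z)\<bar> + \<bar>deriv (k y (fst z)) (snd z)\<bar> \<le> C"
      using y'[rule_format, OF y(1)] by eventually_elim (auto simp: mem_Times_iff)
  qed (use tI ab in auto)
  also have "max \<bar>?t * a' - ?t * a\<bar> \<bar>?t * b' - ?t * b\<bar> = ?t * ?m"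
    using d by (simp add: right_diff_distrib[symmetric] abs_mult max_mult_distrib_left)
  also have "C * (?t * ?m) = C * ?m - d * (C * ?m)" by (simp add: algebra_simps)
  also have "\<dots> \<le> C * ?m + d * (\<bar>C\<bar> * ?m)"
  proof -
    have m: "0 \<le> ?m" by (meson abs_ge_zero max.coboundedI1)
    have "- (C * ?m) \<le> \<bar>C * ?m\<bar>" by (rule abs_ge_minus_self)
    also have "\<dots> = \<bar>C\<bar> * ?m" unfolding abs_mult using m by (simp only: abs_of_nonneg)
    finally have "d * (- (C * ?m)) \<le> d * (\<bar>C\<bar> * ?m)" using d by (intro mult_left_mono) simp_all
    then show ?thesis by (simp only: mult_minus_right)
  qed
  finally have 1: "\<bar>k y (?t * a') (?t * b') - k y (?t * a) (?t * b)\<bar> \<le> C * ?m + d * (\<bar>C\<bar> * ?m)" .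
  have 2: "\<bar>k x p q - k y (?t * p) (?t * q)\<bar> \<le> d * (A * (2 * R + 1))" if "\<bar>p\<bar> \<le> R" "\<bar>q\<bar> \<le> R" for p q
  proof -
    have "\<bar>k x p q - k y (?t * p) (?t * q)\<bar> \<le> A * (\<bar>x - y\<bar> + \<bar>p - ?t * p\<bar> + \<bar>q - ?t * q\<bar>)" by (rule lip3)
    also have "\<dots> \<le> A * (d + d * R + d * R)"
      using t(2)[OF that(1)] t(2)[OF that(2)] y A_nonneg by (intro mult_left_mono add_mono) auto
    finally show ?thesis by (simp add: algebra_simps)
  qed
  have "\<bar>k x a' b' - k x a b\<bar> \<le> C * ?m + d * (\<bar>C\<bar> * ?m) + 2 * (d * (A * (2 * R + 1)))"
    using 1 2[OF ab(1,2)] 2[OF ab(3,4)] by linarith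
  also have "d * (\<bar>C\<bar> * ?m) + 2 * (d * (A * (2 * R + 1))) = d * (K - 1)"
    unfolding K_def by (simp add: algebra_simps)
  then have "C * ?m + d * (\<bar>C\<bar> * ?m) + 2 * (d * (A * (2 * R + 1))) \<le> C * ?m + e"
    using d(1,3) by (simp add: right_diff_distrib)
  finally show "\<bar>k x a' b' - k x a b\<bar> \<le> C * ?m + e" .
qed

end

text \<open>Constant continuation from the box [0,1] x [-R,R]^2. It turns functions that are
  Lipschitz for \<open>x \<in> {0..1}\<close> into globally Lipschitz ones, and does the same for
  quotients \<open>f / l\<close>, where boundedness of \<open>f\<close> on the box is used. State
  derivatives inside the box are unchanged.\<close>

definition clamp_coeff :: "real \<Rightarrow> (real \<Rightarrow> real \<Rightarrow> real \<Rightarrow> real) \<Rightarrow> real \<Rightarrow> real \<Rightarrow> real \<Rightarrow> real" where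
  "clamp_coeff R h x a b = h (max 0 (min 1 x)) (max (-R) (min R a)) (max (-R) (min R b))"

lemma clamp_coeff_eq:
  "x \<in> {0..1} \<Longrightarrow> \<bar>a\<bar> \<le> R \<Longrightarrow> \<bar>b\<bar> \<le> R \<Longrightarrow> clamp_coeff R h x a b = h x a b"
  by (simp add: clamp_coeff_def min_absorb2 max_absorb2 abs_le_iff)

lemma deriv_clamp_coeff:
  assumes "x \<in> {0..1}" "\<bar>a\<bar> < R" "\<bar>b\<bar> < R"
  shows "deriv (\<lambda>s. clamp_coeff R h x s b) a = d_u h x a b"
    "deriv (clamp_coeff R h x a) b = d_v h x a b"
    "(\<lambda>s. clamp_coeff R h x s b) field_differentiable at a \<longleftrightarrow> (\<lambda>s. h x s b) field_differentiable at a"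
    "clamp_coeff R h x a field_differentiable at b \<longleftrightarrow> h x a field_differentiable at b"
proof -
  have 1: "eventually (\<lambda>s. clamp_coeff R h x s b = h x s b) (nhds a)"
    using assms by (intro eventually_nhds[THEN iffD2] exI[of _ "{-R<..<R}"]) (auto simp: clamp_coeff_eq abs_less_iff)
  have 2: "eventually (\<lambda>s. clamp_coeff R h x a s = h x a s) (nhds b)"
    using assms by (intro eventually_nhds[THEN iffD2] exI[of _ "{-R<..<R}"]) (auto simp: clamp_coeff_eq abs_less_iff)
  show "deriv (\<lambda>s. clamp_coeff R h x s b) a = d_u h x a b"
    unfolding d_u_def by (rule deriv_cong_ev[OF 1 refl])
  show "deriv (clamp_coeff R h x a) b = d_v h x a b"
    unfolding d_v_def by (rule deriv_cong_ev[OF 2 refl])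
  show "(\<lambda>s. clamp_coeff R h x s b) field_differentiable at a \<longleftrightarrow> (\<lambda>s. h x s b) field_differentiable at a"
    unfolding field_differentiable_def using DERIV_cong_ev[OF refl 1 refl] by blast
  show "clamp_coeff R h x a field_differentiable at b \<longleftrightarrow> h x a field_differentiable at b"
    unfolding field_differentiable_def using DERIV_cong_ev[OF refl 2 refl] by blast
qed

lemma lipschitz_coeff_imp_lipschitz3:
  assumes "lipschitz_coeff h"
  obtains L where "0 \<le> L" "\<And>x a b x' a' b'. x \<in> {0..1} \<Longrightarrow> x' \<in> {0..1} \<Longrightarrow>
      \<bar>h x a b - h x' a' b'\<bar> \<le> L * (\<bar>x - x'\<bar> + \<bar>a - a'\<bar> + \<bar>b - b'\<bar>)"
    "\<And>R. lipschitz3 (clamp_coeff R h) L"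
proof -
  obtain L where L: "L-lipschitz_on ({0..1} \<times> UNIV) (\<lambda>(x, a, b). h x a b)"
    using assms by (auto simp: lipschitz_coeff_def)
  have L0: "0 \<le> L" using L by (rule lipschitz_on_nonneg)
  have dst: "dist (x, a, b) (x', a', b') \<le> \<bar>x - x'\<bar> + \<bar>a - a'\<bar> + \<bar>b - b'\<bar>" for x a b x' a' b' :: real
  proof -
    have "dist (x, a, b) (x', a', b') \<le> dist x x' + dist (a, b) (a', b')"
      unfolding dist_Pair_Pair[of x] by (rule sqrt_sum_squares_le_sum) auto
    also have "dist (a, b) (a', b') \<le> dist a a' + dist b b'"
      unfolding dist_Pair_Pair by (rule sqrt_sum_squares_le_sum) auto
    finally show ?thesis by (simp add: dist_real_def add.assoc)
  qed
  have l: "\<bar>h x a b - h x' a' b'\<bar> \<le> L * (\<bar>x - x'\<bar> + \<bar>a - a'\<bar> + \<bar>b - b'\<bar>)"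
    if "x \<in> {0..1}" "x' \<in> {0..1}" for x a b x' a' b'
  proof -
    have "dist (h x a b) (h x' a' b') \<le> L * dist (x, a, b) (x', a', b')"
      using lipschitz_onD[OF L, of "(x, a, b)" "(x', a', b')"] that by auto
    also have "\<dots> \<le> L * (\<bar>x - x'\<bar> + \<bar>a - a'\<bar> + \<bar>b - b'\<bar>)"
      using dst L0 by (rule mult_left_mono)
    finally show ?thesis by (simp add: dist_real_def)
  qed
  have "lipschitz3 (clamp_coeff R h) L" for R
  proof
    fix x a b x' a' b'
    have "\<bar>clamp_coeff R h x a b - clamp_coeff R h x' a' b'\<bar> \<le>
      L * (\<bar>max 0 (min 1 x) - max 0 (min 1 x')\<bar> + \<bar>max (-R) (min R a) - max (-R) (min R a')\<bar> + \<bar>max (-R) (min R b) - max (-R) (min R b')\<bar>)"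
      unfolding clamp_coeff_def by (rule l) auto
    also have "\<dots> \<le> L * (\<bar>x - x'\<bar> + \<bar>a - a'\<bar> + \<bar>b - b'\<bar>)"
      using L0 by (intro mult_left_mono add_mono abs_clamp_le)
    finally show "\<bar>clamp_coeff R h x a b - clamp_coeff R h x' a' b'\<bar> \<le> L * (\<bar>x - x'\<bar> + \<bar>a - a'\<bar> + \<bar>b - b'\<bar>)" .
  qed
  then show ?thesis using that L0 l by blast
qed

text \<open>The clamps with natural bounds \<open>n\<close> exhaust the state space, so only
  countably many null sets are discarded.\<close>

lemma lipschitz_coeff_AE_differentiable:
  assumes "lipschitz_coeff h"
  shows "\<exists>L. AE z in lborel. fst z \<in> {0..1} \<longrightarrow>
    (\<lambda>s. h (fst z) s (snd (snd z))) field_differentiable at (fst (snd z)) \<and>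
    h (fst z) (fst (snd z)) field_differentiable at (snd (snd z)) \<and>
    \<bar>d_u h (fst z) (fst (snd z)) (snd (snd z))\<bar> \<le> L \<and> \<bar>d_v h (fst z) (fst (snd z)) (snd (snd z))\<bar> \<le> L"
proof -
  obtain L where L: "0 \<le> L" "\<And>R. lipschitz3 (clamp_coeff R h) L"
    using lipschitz_coeff_imp_lipschitz3[OF assms] by metis
  have "AE z in lborel. \<forall>n::nat. (\<lambda>s. clamp_coeff n h (fst z) s (snd (snd z))) field_differentiable at (fst (snd z)) \<and>
    clamp_coeff n h (fst z) (fst (snd z)) field_differentiable at (snd (snd z))"
    unfolding AE_all_countable using lipschitz3.AE_differentiable3[OF L(2)] by blast
  then show ?thesis
  proof (intro exI[of _ L], eventually_elim)
    case (elim z)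
    obtain x a b where z: "z = (x, a, b)" by (metis prod_cases3)
    obtain n :: nat where n: "max \<bar>a\<bar> \<bar>b\<bar> < n" using reals_Archimedean2 by blast
    then have n': "\<bar>a\<bar> < n" "\<bar>b\<bar> < n" by auto
    have d: "(\<lambda>s. clamp_coeff n h x s b) field_differentiable at a" "clamp_coeff n h x a field_differentiable at b"
      using spec[OF elim(2), of n] by (auto simp: z)
    have "\<bar>deriv (\<lambda>s. clamp_coeff n h x s b) a\<bar> \<le> L" "\<bar>deriv (clamp_coeff n h x a) b\<bar> \<le> L"
      using abs_deriv_le_Lipschitz[OF lipschitz2.lip_fst[OF lipschitz3.slice[OF L(2)]] d(1)]
        abs_deriv_le_Lipschitz[OF lipschitz2.lip_snd[OF lipschitz3.slice[OF L(2)]] d(2)] by auto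
    then show ?case using d deriv_clamp_coeff[of x a n b h] n' by (auto simp: z)
  qed
qed

lemma abs_add_mult_le: "\<bar>p * q + r * s\<bar> \<le> \<bar>p\<bar> * \<bar>q\<bar> + \<bar>r\<bar> * \<bar>s\<bar>" for p q r s :: real
  by (metis abs_mult abs_triangle_ineq)

lemma lipschitz_l_F:
  assumes fu: "lipschitz_coeff fu" and fv: "lipschitz_coeff fv" and x: "x \<in> {0..1}"
  shows "\<bar>fu x a' b' - fu x a b\<bar> \<le> l_F fu fv * max \<bar>a' - a\<bar> \<bar>b' - b\<bar>" (is ?U)
    and "\<bar>fv x a' b' - fv x a b\<bar> \<le> l_F fu fv * max \<bar>a' - a\<bar> \<bar>b' - b\<bar>" (is ?V)
    and "0 \<le> l_F fu fv"
proof -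
  let ?r = "\<lambda>(x, a, b). max (\<bar>d_u fu x a b\<bar> + \<bar>d_v fu x a b\<bar>) (\<bar>d_u fv x a b\<bar> + \<bar>d_v fv x a b\<bar>)"
  obtain Lu Lv where L: "AE z in lborel. fst z \<in> {0..1} \<longrightarrow>
    (\<lambda>s. fu (fst z) s (snd (snd z))) field_differentiable at (fst (snd z)) \<and>
    fu (fst z) (fst (snd z)) field_differentiable at (snd (snd z)) \<and>
    \<bar>d_u fu (fst z) (fst (snd z)) (snd (snd z))\<bar> \<le> Lu \<and> \<bar>d_v fu (fst z) (fst (snd z)) (snd (snd z))\<bar> \<le> Lu"
    "AE z in lborel. fst z \<in> {0..1} \<longrightarrow>
    (\<lambda>s. fv (fst z) s (snd (snd z))) field_differentiable at (fst (snd z)) \<and>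
    fv (fst z) (fst (snd z)) field_differentiable at (snd (snd z)) \<and>
    \<bar>d_u fv (fst z) (fst (snd z)) (snd (snd z))\<bar> \<le> Lv \<and> \<bar>d_v fv (fst z) (fst (snd z)) (snd (snd z))\<bar> \<le> Lv"
    using lipschitz_coeff_AE_differentiable[OF fu] lipschitz_coeff_AE_differentiable[OF fv] by blast
  have b: "AE z in lborel. z \<in> {0..1} \<times> UNIV \<longrightarrow> \<bar>?r z\<bar> \<le> max (2 * Lu) (2 * Lv)"
    using L
  proof eventually_elim
    case (elim z)
    obtain x a b where z: "z = (x, a, b)" by (metis prod_cases3)
    show ?case
    proof
      assume "z \<in> {0..1} \<times> UNIV"
      then have "\<bar>d_u fu x a b\<bar> + \<bar>d_v fu x a b\<bar> \<le> 2 * Lu" "\<bar>d_u fv x a b\<bar> + \<bar>d_v fv x a b\<bar> \<le> 2 * Lv"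
        using elim by (simp_all add: z)
      then have "?r z \<le> max (2 * Lu) (2 * Lv)" unfolding z prod.case by (rule max.mono)
      moreover have "0 \<le> ?r z" unfolding z prod.case le_max_iff_disj by simp
      ultimately show "\<bar>?r z\<bar> \<le> max (2 * Lu) (2 * Lv)" by (simp only: abs_of_nonneg)
    qed
  qed
  show "0 \<le> l_F fu fv" unfolding l_F_def using b by (rule ess_sup_on_nonneg)
  have "AE z in lborel. z \<in> {0..1} \<times> UNIV \<longrightarrow> \<bar>?r z\<bar> \<le> l_F fu fv"
    unfolding l_F_def using b by (rule AE_le_ess_sup_on)
  then have r: "AE z in lborel. z \<in> {0..1} \<times> UNIV \<longrightarrow> ?r z \<le> l_F fu fv"
    by eventually_elim (meson abs_le_D1)
  \<comment> \<open>\<open>l_F\<close> is a supremum over the whole state space, so the box can be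
    chosen around the two states at hand.\<close>
  define R where "R = max (max \<bar>a\<bar> \<bar>b\<bar>) (max \<bar>a'\<bar> \<bar>b'\<bar>) + 1"
  have R: "0 < R" "\<bar>a\<bar> \<le> R" "\<bar>b\<bar> \<le> R" "\<bar>a'\<bar> \<le> R" "\<bar>b'\<bar> \<le> R" by (auto simp: R_def)
  obtain K where K: "lipschitz3 (clamp_coeff R fu) K" using lipschitz_coeff_imp_lipschitz3[OF fu] by metis
  obtain K' where K': "lipschitz3 (clamp_coeff R fv) K'" using lipschitz_coeff_imp_lipschitz3[OF fv] by metis
  have "\<bar>clamp_coeff R fu x a' b' - clamp_coeff R fu x a b\<bar> \<le> l_F fu fv * max \<bar>a' - a\<bar> \<bar>b' - b\<bar>"
    by (rule lipschitz3.lipschitz_max_norm_of_AE3[OF K R(1) AE_mp[OF r] x R(2-5)], rule AE_I2)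
      (clarsimp simp: deriv_clamp_coeff abs_less_iff)
  then show ?U unfolding clamp_coeff_eq[OF x R(2,3)] clamp_coeff_eq[OF x R(4,5)] .
  have "\<bar>clamp_coeff R fv x a' b' - clamp_coeff R fv x a b\<bar> \<le> l_F fu fv * max \<bar>a' - a\<bar> \<bar>b' - b\<bar>"
    by (rule lipschitz3.lipschitz_max_norm_of_AE3[OF K' R(1) AE_mp[OF r] x R(2-5)], rule AE_I2)
      (clarsimp simp: deriv_clamp_coeff abs_less_iff)
  then show ?V unfolding clamp_coeff_eq[OF x R(2,3)] clamp_coeff_eq[OF x R(4,5)] .
qed

text \<open>\<open>quad_rate l\<close> and \<open>lin_rate l f\<close> are the sums of the absolute values of the partial derivatives of
  \<open>1 / l\<close> and \<open>f / l\<close> in the state; this is why \<open>gamma2\<close> bounds the Lipschitz constants of both.\<close>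

locale speed_source =
  fixes l f :: "real \<Rightarrow> real \<Rightarrow> real \<Rightarrow> real" and c R :: real
  assumes l: "lipschitz_coeff l" and f: "lipschitz_coeff f"
    and pos: "\<And>x a b. x \<in> {0..1} \<Longrightarrow> 0 < l x a b"
    and recip_le: "\<And>x a b. x \<in> {0..1} \<Longrightarrow> 1 / l x a b \<le> c"
    and R0: "0 \<le> R"
begin

lemma clamped_bounds:
  obtains Fm where "0 \<le> Fm" "\<And>x a b. x \<in> {0..1} \<Longrightarrow> \<bar>a\<bar> \<le> R \<Longrightarrow> \<bar>b\<bar> \<le> R \<Longrightarrow> \<bar>f x a b\<bar> \<le> Fm"
proof -
  obtain L where L: "0 \<le> L" "\<And>x a b x' a' b'. x \<in> {0..1} \<Longrightarrow> x' \<in> {0..1} \<Longrightarrow>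
      \<bar>f x a b - f x' a' b'\<bar> \<le> L * (\<bar>x - x'\<bar> + \<bar>a - a'\<bar> + \<bar>b - b'\<bar>)"
    using lipschitz_coeff_imp_lipschitz3[OF f] by metis
  have "\<bar>f x a b\<bar> \<le> \<bar>f 0 0 0\<bar> + L * (1 + R + R)" if "x \<in> {0..1}" "\<bar>a\<bar> \<le> R" "\<bar>b\<bar> \<le> R" for x a b
  proof -
    have "\<bar>f x a b - f 0 0 0\<bar> \<le> L * (\<bar>x - 0\<bar> + \<bar>a - 0\<bar> + \<bar>b - 0\<bar>)" using that by (intro L) auto
    also have "\<dots> \<le> L * (1 + R + R)" using that L(1) by (intro mult_left_mono add_mono) auto
    finally show ?thesis by linarith
  qed
  then show ?thesis using that[of "\<bar>f 0 0 0\<bar> + L * (1 + R + R)"] L(1) R0 by auto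
qed

lemma c_pos: "0 < c"
  by (rule less_le_trans[OF _ recip_le[of 0 0 0]]) (use pos[of 0 0 0] in auto)

lemma recip_diff: "\<bar>1 / l x a b - 1 / l x' a' b'\<bar> \<le> c\<^sup>2 * \<bar>l x a b - l x' a' b'\<bar>"
  if "x \<in> {0..1}" "x' \<in> {0..1}"
proof -
  have p: "0 < l x a b" "0 < l x' a' b'" using pos that by auto
  have eq: "1 / l x a b - 1 / l x' a' b' = (l x' a' b' - l x a b) * ((1 / l x a b) * (1 / l x' a' b'))"
    using p by (simp add: field_simps)
  have "\<bar>1 / l x a b - 1 / l x' a' b'\<bar> = \<bar>l x a b - l x' a' b'\<bar> * ((1 / l x a b) * (1 / l x' a' b'))"
    unfolding eq using p by (simp add: abs_mult abs_minus_commute)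
  also have "\<dots> \<le> \<bar>l x a b - l x' a' b'\<bar> * (c * c)"
    using recip_le that p c_pos by (intro mult_left_mono mult_mono) auto
  finally show ?thesis by (simp add: power2_eq_square mult.commute)
qed

lemma clamp_coeff_lipschitz3:
  shows "\<exists>A. lipschitz3 (clamp_coeff R (\<lambda>x a b. 1 / l x a b)) A"
    and "\<exists>A. lipschitz3 (clamp_coeff R (\<lambda>x a b. f x a b / l x a b)) A"
proof -
  obtain L where L: "0 \<le> L" "lipschitz3 (clamp_coeff R l) L"
    using lipschitz_coeff_imp_lipschitz3[OF l] by metis
  obtain Lf where Lf: "0 \<le> Lf" "lipschitz3 (clamp_coeff R f) Lf"
    using lipschitz_coeff_imp_lipschitz3[OF f] by metis
  obtain Fm where Fm: "0 \<le> Fm" "\<And>x a b. x \<in> {0..1} \<Longrightarrow> \<bar>a\<bar> \<le> R \<Longrightarrow> \<bar>b\<bar> \<le> R \<Longrightarrow> \<bar>f x a b\<bar> \<le> Fm"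
    using clamped_bounds by blast
  have cl: "max 0 (min 1 x) \<in> {0..1}" for x :: real by auto
  have cR: "\<bar>max (-R) (min R a)\<bar> \<le> R" for a using R0 by auto
  have 1: "\<bar>clamp_coeff R (\<lambda>x a b. 1 / l x a b) x a b - clamp_coeff R (\<lambda>x a b. 1 / l x a b) x' a' b'\<bar>
      \<le> (c\<^sup>2 * L) * (\<bar>x - x'\<bar> + \<bar>a - a'\<bar> + \<bar>b - b'\<bar>)" for x a b x' a' b'
  proof -
    have "\<bar>clamp_coeff R (\<lambda>x a b. 1 / l x a b) x a b - clamp_coeff R (\<lambda>x a b. 1 / l x a b) x' a' b'\<bar>
      \<le> c\<^sup>2 * \<bar>clamp_coeff R l x a b - clamp_coeff R l x' a' b'\<bar>"
      unfolding clamp_coeff_def by (intro recip_diff cl)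
    also have "\<dots> \<le> c\<^sup>2 * (L * (\<bar>x - x'\<bar> + \<bar>a - a'\<bar> + \<bar>b - b'\<bar>))"
      by (intro mult_left_mono lipschitz3.lip3[OF L(2)]) simp
    finally show ?thesis by (simp add: mult.assoc)
  qed
  show "\<exists>A. lipschitz3 (clamp_coeff R (\<lambda>x a b. 1 / l x a b)) A"
    by (rule exI[of _ "c\<^sup>2 * L"], rule lipschitz3.intro, rule 1)
  have 2: "\<bar>clamp_coeff R (\<lambda>x a b. f x a b / l x a b) x a b - clamp_coeff R (\<lambda>x a b. f x a b / l x a b) x' a' b'\<bar>
      \<le> (c * Lf + Fm * (c\<^sup>2 * L)) * (\<bar>x - x'\<bar> + \<bar>a - a'\<bar> + \<bar>b - b'\<bar>)" (is "\<bar>?q - ?q'\<bar> \<le> _ * ?d") for x a b x' a' b'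
  proof -
    let ?f = "clamp_coeff R f x a b" and ?f' = "clamp_coeff R f x' a' b'"
    let ?m = "clamp_coeff R (\<lambda>x a b. 1 / l x a b) x a b" and ?m' = "clamp_coeff R (\<lambda>x a b. 1 / l x a b) x' a' b'"
    have m: "0 \<le> ?m" "?m \<le> c" unfolding clamp_coeff_def using recip_le[OF cl] pos[OF cl] by (auto simp: less_imp_le)
    have f': "\<bar>?f'\<bar> \<le> Fm" unfolding clamp_coeff_def by (intro Fm cl cR)
    have eq: "?q - ?q' = (?f - ?f') * ?m + ?f' * (?m - ?m')"
      unfolding clamp_coeff_def by (simp add: algebra_simps)
    have "\<bar>?q - ?q'\<bar> \<le> \<bar>?f - ?f'\<bar> * \<bar>?m\<bar> + \<bar>?f'\<bar> * \<bar>?m - ?m'\<bar>"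
      unfolding eq by (rule abs_add_mult_le)
    also have "\<dots> \<le> (Lf * ?d) * c + Fm * ((c\<^sup>2 * L) * ?d)"
      using m f' Fm(1) 1[of x a b x' a' b'] lipschitz3.lip3[OF Lf(2), of x a b x' a' b'] Lf(1) c_pos
      by (intro add_mono mult_mono) auto
    finally show ?thesis by (simp add: algebra_simps)
  qed
  show "\<exists>A. lipschitz3 (clamp_coeff R (\<lambda>x a b. f x a b / l x a b)) A"
    by (rule exI[of _ "c * Lf + Fm * (c\<^sup>2 * L)"], rule lipschitz3.intro, rule 2)
qed

text \<open>Finiteness behind \<open>gamma2\<close>: it makes the infimum in the essential supremum
  range over a nonempty set. The rate \<open>lin_rate\<close> contains \<open>f\<close> itself,
  which is bounded because the states are.\<close>

lemma AE_rates_bounded: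
  "\<exists>K. AE z in lborel. z \<in> {(x, a, b). x \<in> {0..1} \<and> max \<bar>a\<bar> \<bar>b\<bar> \<le> R} \<longrightarrow>
    (case z of (x, a, b) \<Rightarrow> 0 \<le> quad_rate l x a b \<and> quad_rate l x a b \<le> K \<and> 0 \<le> lin_rate l f x a b \<and> lin_rate l f x a b \<le> K)"
proof -
  obtain L where L: "AE z in lborel. fst z \<in> {0..1} \<longrightarrow>
    (\<lambda>s. l (fst z) s (snd (snd z))) field_differentiable at (fst (snd z)) \<and>
    l (fst z) (fst (snd z)) field_differentiable at (snd (snd z)) \<and>
    \<bar>d_u l (fst z) (fst (snd z)) (snd (snd z))\<bar> \<le> L \<and> \<bar>d_v l (fst z) (fst (snd z)) (snd (snd z))\<bar> \<le> L"
    using lipschitz_coeff_AE_differentiable[OF l] by blast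
  obtain Lf where Lf: "AE z in lborel. fst z \<in> {0..1} \<longrightarrow>
    (\<lambda>s. f (fst z) s (snd (snd z))) field_differentiable at (fst (snd z)) \<and>
    f (fst z) (fst (snd z)) field_differentiable at (snd (snd z)) \<and>
    \<bar>d_u f (fst z) (fst (snd z)) (snd (snd z))\<bar> \<le> Lf \<and> \<bar>d_v f (fst z) (fst (snd z)) (snd (snd z))\<bar> \<le> Lf"
    using lipschitz_coeff_AE_differentiable[OF f] by blast
  obtain Fm where Fm: "0 \<le> Fm" "\<And>x a b. x \<in> {0..1} \<Longrightarrow> \<bar>a\<bar> \<le> R \<Longrightarrow> \<bar>b\<bar> \<le> R \<Longrightarrow> \<bar>f x a b\<bar> \<le> Fm"
    using clamped_bounds by blast
  define K1 where "K1 = (\<bar>L\<bar> * c + \<bar>L\<bar> * c) * c"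
  define K2 where "K2 = ((\<bar>Lf\<bar> + \<bar>L\<bar> * c * Fm) + (\<bar>Lf\<bar> + \<bar>L\<bar> * c * Fm)) * c"
  show ?thesis
  proof (rule exI[of _ "max K1 K2"])
    show "AE z in lborel. z \<in> {(x, a, b). x \<in> {0..1} \<and> max \<bar>a\<bar> \<bar>b\<bar> \<le> R} \<longrightarrow>
      (case z of (x, a, b) \<Rightarrow> 0 \<le> quad_rate l x a b \<and> quad_rate l x a b \<le> max K1 K2 \<and> 0 \<le> lin_rate l f x a b \<and> lin_rate l f x a b \<le> max K1 K2)"
      using L Lf
    proof eventually_elim
      case (elim z)
      obtain x a b where z: "z = (x, a, b)" by (metis prod_cases3)
      show ?case
      proof (cases "x \<in> {0..1} \<and> max \<bar>a\<bar> \<bar>b\<bar> \<le> R")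
        case True
        then have xab: "x \<in> {0..1}" "\<bar>a\<bar> \<le> R" "\<bar>b\<bar> \<le> R" by auto
        have p: "0 < l x a b" "1 / l x a b \<le> c" using pos recip_le xab by auto
        have d: "\<bar>d_u l x a b\<bar> \<le> \<bar>L\<bar>" "\<bar>d_v l x a b\<bar> \<le> \<bar>L\<bar>" "\<bar>d_u f x a b\<bar> \<le> \<bar>Lf\<bar>" "\<bar>d_v f x a b\<bar> \<le> \<bar>Lf\<bar>"
          using elim xab by (auto simp: z)
        have q: "\<bar>w / l x a b\<bar> \<le> W * c" if "\<bar>w\<bar> \<le> W" for w W
        proof -
          have "\<bar>w / l x a b\<bar> = \<bar>w\<bar> * (1 / l x a b)" using p by (simp add: abs_divide)
          also have "\<dots> \<le> W * c" using that p by (intro mult_mono) auto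
          finally show ?thesis .
        qed
        have s: "\<bar>w - g / l x a b * f x a b\<bar> \<le> \<bar>Lf\<bar> + \<bar>L\<bar> * c * Fm" if "\<bar>w\<bar> \<le> \<bar>Lf\<bar>" "\<bar>g\<bar> \<le> \<bar>L\<bar>" for w g
        proof -
          have "\<bar>g / l x a b * f x a b\<bar> \<le> \<bar>L\<bar> * c * Fm"
            unfolding abs_mult using q[OF that(2)] Fm(2)[OF xab] c_pos by (intro mult_mono) auto
          then show ?thesis using that by linarith
        qed
        have "\<bar>\<bar>d_u l x a b / l x a b\<bar> + \<bar>d_v l x a b / l x a b\<bar>\<bar> \<le> \<bar>L\<bar> * c + \<bar>L\<bar> * c"
          using add_mono[OF q[OF d(1)] q[OF d(2)]] by simp
        from q[OF this] have "quad_rate l x a b \<le> K1"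
          unfolding quad_rate_def K1_def by (rule abs_le_D1)
        moreover
        have "\<bar>\<bar>d_u f x a b - d_u l x a b / l x a b * f x a b\<bar> + \<bar>d_v f x a b - d_v l x a b / l x a b * f x a b\<bar>\<bar>
          \<le> (\<bar>Lf\<bar> + \<bar>L\<bar> * c * Fm) + (\<bar>Lf\<bar> + \<bar>L\<bar> * c * Fm)"
          using add_mono[OF s[OF d(3,1)] s[OF d(4,2)]] by simp
        from q[OF this] have "lin_rate l f x a b \<le> K2"
          unfolding lin_rate_def K2_def by (rule abs_le_D1)
        moreover have "0 \<le> quad_rate l x a b" "0 \<le> lin_rate l f x a b"
          using p by (auto simp: quad_rate_def lin_rate_def intro!: divide_nonneg_pos add_nonneg_nonneg)
        ultimately show ?thesis by (simp add: z le_max_iff_disj)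
      next
        case False
        then show ?thesis by (auto simp: z)
      qed
    qed
  qed
qed

lemma lipschitz_rate:
  assumes ae: "AE z in lborel. z \<in> {(x, a, b). x \<in> {0..1} \<and> max \<bar>a\<bar> \<bar>b\<bar> \<le> R} \<longrightarrow>
    (case z of (x, a, b) \<Rightarrow> quad_rate l x a b \<le> K \<and> lin_rate l f x a b \<le> K)"
    and x: "x \<in> {0..1}" and ab: "\<bar>a\<bar> \<le> R" "\<bar>b\<bar> \<le> R" "\<bar>a'\<bar> \<le> R" "\<bar>b'\<bar> \<le> R"
  shows "\<bar>1 / l x a' b' - 1 / l x a b\<bar> \<le> K * max \<bar>a' - a\<bar> \<bar>b' - b\<bar>" (is ?Q)
    and "\<bar>f x a' b' / l x a' b' - f x a b / l x a b\<bar> \<le> K * max \<bar>a' - a\<bar> \<bar>b' - b\<bar>" (is ?P)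
proof -
  have "?Q \<and> ?P"
  \<comment> \<open>For \<open>R = 0\<close> the box of states is a null set and the hypothesis says
    nothing, but then the two states coincide.\<close>
  proof (cases "R = 0")
    case True
    then show ?thesis using ab by simp
  next
    case False
    then have R: "0 < R" using R0 by simp
    obtain L Lf where L: "AE z in lborel. fst z \<in> {0..1} \<longrightarrow>
      (\<lambda>s. l (fst z) s (snd (snd z))) field_differentiable at (fst (snd z)) \<and>
      l (fst z) (fst (snd z)) field_differentiable at (snd (snd z)) \<and>
      \<bar>d_u l (fst z) (fst (snd z)) (snd (snd z))\<bar> \<le> L \<and> \<bar>d_v l (fst z) (fst (snd z)) (snd (snd z))\<bar> \<le> L"
      "AE z in lborel. fst z \<in> {0..1} \<longrightarrow>
      (\<lambda>s. f (fst z) s (snd (snd z))) field_differentiable at (fst (snd z)) \<and>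
      f (fst z) (fst (snd z)) field_differentiable at (snd (snd z)) \<and>
      \<bar>d_u f (fst z) (fst (snd z)) (snd (snd z))\<bar> \<le> Lf \<and> \<bar>d_v f (fst z) (fst (snd z)) (snd (snd z))\<bar> \<le> Lf"
      using lipschitz_coeff_AE_differentiable[OF l] lipschitz_coeff_AE_differentiable[OF f] by blast
    let ?k = "clamp_coeff R (\<lambda>x a b. 1 / l x a b)" and ?h = "clamp_coeff R (\<lambda>x a b. f x a b / l x a b)"
    have aeb: "AE z in lborel. fst z \<in> {0<..<1} \<and> fst (snd z) \<in> {-R<..<R} \<and> snd (snd z) \<in> {-R<..<R} \<longrightarrow>
      \<bar>deriv (\<lambda>s. ?k (fst z) s (snd (snd z))) (fst (snd z))\<bar> + \<bar>deriv (?k (fst z) (fst (snd z))) (snd (snd z))\<bar> \<le> K \<and>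
      \<bar>deriv (\<lambda>s. ?h (fst z) s (snd (snd z))) (fst (snd z))\<bar> + \<bar>deriv (?h (fst z) (fst (snd z))) (snd (snd z))\<bar> \<le> K"
      using L ae
    proof eventually_elim
      case (elim z)
      obtain x a b where z: "z = (x, a, b)" by (metis prod_cases3)
      show ?case
      proof (cases "x \<in> {0<..<1} \<and> a \<in> {-R<..<R} \<and> b \<in> {-R<..<R}")
        case True
        then have xab: "x \<in> {0..1}" "\<bar>a\<bar> < R" "\<bar>b\<bar> < R" by auto
        have p: "0 < l x a b" using pos xab by auto
        have D: "((\<lambda>s. l x s b) has_real_derivative d_u l x a b) (at a)" "((\<lambda>s. l x a s) has_real_derivative d_v l x a b) (at b)"
          "((\<lambda>s. f x s b) has_real_derivative d_u f x a b) (at a)" "((\<lambda>s. f x a s) has_real_derivative d_v f x a b) (at b)"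
          using elim xab by (auto simp: z d_u_def d_v_def DERIV_deriv_iff_field_differentiable)
        have e1: "deriv (\<lambda>s. ?k x s b) a = - (d_u l x a b / l x a b) / l x a b"
          unfolding deriv_clamp_coeff(1)[OF xab] d_u_def[of "\<lambda>x a b. 1 / l x a b"]
          by (rule DERIV_imp_deriv) (use D p in \<open>auto intro!: derivative_eq_intros simp: divide_simps\<close>)
        have e2: "deriv (?k x a) b = - (d_v l x a b / l x a b) / l x a b"
          unfolding deriv_clamp_coeff(2)[OF xab] d_v_def[of "\<lambda>x a b. 1 / l x a b"]
          by (rule DERIV_imp_deriv) (use D p in \<open>auto intro!: derivative_eq_intros simp: divide_simps\<close>)
        have e3: "deriv (\<lambda>s. ?h x s b) a = (d_u f x a b - d_u l x a b / l x a b * f x a b) / l x a b"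
          unfolding deriv_clamp_coeff(1)[OF xab] d_u_def[of "\<lambda>x a b. f x a b / l x a b"]
          by (rule DERIV_imp_deriv) (use D p in \<open>auto intro!: derivative_eq_intros simp: divide_simps\<close>)
        have e4: "deriv (?h x a) b = (d_v f x a b - d_v l x a b / l x a b * f x a b) / l x a b"
          unfolding deriv_clamp_coeff(2)[OF xab] d_v_def[of "\<lambda>x a b. f x a b / l x a b"]
          by (rule DERIV_imp_deriv) (use D p in \<open>auto intro!: derivative_eq_intros simp: divide_simps\<close>)
        have "\<bar>deriv (\<lambda>s. ?k x s b) a\<bar> + \<bar>deriv (?k x a) b\<bar> = quad_rate l x a b"
          unfolding e1 e2 quad_rate_def using p by (simp add: abs_divide add_divide_distrib)
        moreover have "\<bar>deriv (\<lambda>s. ?h x s b) a\<bar> + \<bar>deriv (?h x a) b\<bar> = lin_rate l f x a b"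
          unfolding e3 e4 lin_rate_def using p by (simp add: abs_divide add_divide_distrib)
        moreover have "quad_rate l x a b \<le> K \<and> lin_rate l f x a b \<le> K" using elim xab by (auto simp: z)
        ultimately show ?thesis by (simp add: z)
      next
        case False
        then show ?thesis by (auto simp: z)
      qed
    qed
    obtain A A' where A: "lipschitz3 ?k A" "lipschitz3 ?h A'" using clamp_coeff_lipschitz3 by blast
    have "\<bar>?k x a' b' - ?k x a b\<bar> \<le> K * max \<bar>a' - a\<bar> \<bar>b' - b\<bar>"
      by (rule lipschitz3.lipschitz_max_norm_of_AE3[OF A(1) R AE_mp[OF aeb] x ab], rule AE_I2) auto
    moreover have "\<bar>?h x a' b' - ?h x a b\<bar> \<le> K * max \<bar>a' - a\<bar> \<bar>b' - b\<bar>"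
      by (rule lipschitz3.lipschitz_max_norm_of_AE3[OF A(2) R AE_mp[OF aeb] x ab], rule AE_I2) auto
    ultimately show ?thesis
      unfolding clamp_coeff_eq[OF x ab(1,2)] clamp_coeff_eq[OF x ab(3,4)] by blast
  qed
  then show ?Q ?P by auto
qed

end

lemma lipschitz_gamma2:
  assumes u: "speed_source lu fu c R" and v: "speed_source lv fv c R"
  shows "0 \<le> gamma2 lu lv fu fv R"
    and "F \<in> {\<lambda>x a b. 1 / lu x a b, \<lambda>x a b. 1 / lv x a b, \<lambda>x a b. fu x a b / lu x a b, \<lambda>x a b. fv x a b / lv x a b} \<Longrightarrow>
      x \<in> {0..1} \<Longrightarrow> \<bar>a\<bar> \<le> R \<Longrightarrow> \<bar>b\<bar> \<le> R \<Longrightarrow> \<bar>a'\<bar> \<le> R \<Longrightarrow> \<bar>b'\<bar> \<le> R \<Longrightarrow>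
      \<bar>F x a' b' - F x a b\<bar> \<le> gamma2 lu lv fu fv R * max \<bar>a' - a\<bar> \<bar>b' - b\<bar>"
proof -
  let ?B = "{(x, a, b). x \<in> {0..1} \<and> max \<bar>a\<bar> \<bar>b\<bar> \<le> R}"
  let ?r = "\<lambda>(x, a, b). max (max (quad_rate lu x a b) (lin_rate lu fu x a b))
                       (max (quad_rate lv x a b) (lin_rate lv fv x a b))"
  let ?g = "gamma2 lu lv fu fv R"
  obtain Ku where Ku: "AE z in lborel. z \<in> ?B \<longrightarrow> (case z of (x, a, b) \<Rightarrow>
    0 \<le> quad_rate lu x a b \<and> quad_rate lu x a b \<le> Ku \<and> 0 \<le> lin_rate lu fu x a b \<and> lin_rate lu fu x a b \<le> Ku)"
    using speed_source.AE_rates_bounded[OF u] by blast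
  obtain Kv where Kv: "AE z in lborel. z \<in> ?B \<longrightarrow> (case z of (x, a, b) \<Rightarrow>
    0 \<le> quad_rate lv x a b \<and> quad_rate lv x a b \<le> Kv \<and> 0 \<le> lin_rate lv fv x a b \<and> lin_rate lv fv x a b \<le> Kv)"
    using speed_source.AE_rates_bounded[OF v] by blast
  have b: "AE z in lborel. z \<in> ?B \<longrightarrow> \<bar>?r z\<bar> \<le> max Ku Kv"
    using Ku Kv
  proof eventually_elim
    case (elim z)
    obtain x a b where z: "z = (x, a, b)" by (metis prod_cases3)
    show ?case
    proof
      assume "z \<in> ?B"
      with elim have *: "0 \<le> quad_rate lu x a b" "quad_rate lu x a b \<le> Ku" "lin_rate lu fu x a b \<le> Ku"
        "quad_rate lv x a b \<le> Kv" "lin_rate lv fv x a b \<le> Kv"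
        by (simp_all add: z)
      then have "0 \<le> ?r z" unfolding z prod.case le_max_iff_disj by simp
      moreover have "?r z \<le> max Ku Kv"
        unfolding z prod.case by (intro max.boundedI) (use * in \<open>simp_all add: le_max_iff_disj\<close>)
      ultimately show "\<bar>?r z\<bar> \<le> max Ku Kv" by (simp only: abs_of_nonneg)
    qed
  qed
  show "0 \<le> ?g" unfolding gamma2_def using b by (rule ess_sup_on_nonneg)
  have "AE z in lborel. z \<in> ?B \<longrightarrow> \<bar>?r z\<bar> \<le> ?g"
    unfolding gamma2_def using b by (rule AE_le_ess_sup_on)
  then have r: "AE z in lborel. z \<in> ?B \<longrightarrow> ?r z \<le> ?g"
    by eventually_elim (meson abs_le_D1)
  have ru: "AE z in lborel. z \<in> ?B \<longrightarrow> (case z of (x, a, b) \<Rightarrow> quad_rate lu x a b \<le> ?g \<and> lin_rate lu fu x a b \<le> ?g)"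
    using r by eventually_elim clarsimp
  have rv: "AE z in lborel. z \<in> ?B \<longrightarrow> (case z of (x, a, b) \<Rightarrow> quad_rate lv x a b \<le> ?g \<and> lin_rate lv fv x a b \<le> ?g)"
    using r by eventually_elim clarsimp
  assume F: "F \<in> {\<lambda>x a b. 1 / lu x a b, \<lambda>x a b. 1 / lv x a b, \<lambda>x a b. fu x a b / lu x a b, \<lambda>x a b. fv x a b / lv x a b}"
    and *: "x \<in> {0..1}" "\<bar>a\<bar> \<le> R" "\<bar>b\<bar> \<le> R" "\<bar>a'\<bar> \<le> R" "\<bar>b'\<bar> \<le> R"
  consider "F = (\<lambda>x a b. 1 / lu x a b)" | "F = (\<lambda>x a b. 1 / lv x a b)"
    | "F = (\<lambda>x a b. fu x a b / lu x a b)" | "F = (\<lambda>x a b. fv x a b / lv x a b)"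
    using F by blast
  then show "\<bar>F x a' b' - F x a b\<bar> \<le> ?g * max \<bar>a' - a\<bar> \<bar>b' - b\<bar>"
  proof cases
    case 1 then show ?thesis by (simp only: speed_source.lipschitz_rate(1)[OF u ru *])
  next
    case 2 then show ?thesis by (simp only: speed_source.lipschitz_rate(1)[OF v rv *])
  next
    case 3 then show ?thesis by (simp only: speed_source.lipschitz_rate(2)[OF u ru *])
  next
    case 4 then show ?thesis by (simp only: speed_source.lipschitz_rate(2)[OF v rv *])
  qed
qed

section \<open>Boundary function and boundary trace\<close>

lemma boundary_lipschitz:
  assumes g: "L-lipschitz_on (UNIV \<times> {0..}) (\<lambda>(b, t). g b t)"
  shows "0 \<le> l_gu g" and "0 \<le> dt_gu_norm g"
    and "0 \<le> t \<Longrightarrow> \<bar>g b t - g b' t\<bar> \<le> l_gu g * \<bar>b - b'\<bar>"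
    and "0 \<le> t \<Longrightarrow> 0 \<le> t' \<Longrightarrow> \<bar>g b t - g b t'\<bar> \<le> dt_gu_norm g * \<bar>t - t'\<bar>"
proof -
  have L0: "0 \<le> L" using g by (rule lipschitz_on_nonneg)
  \<comment> \<open>Constant continuation to negative times gives a Lipschitz function on the whole
    plane, to which the almost everywhere results apply.\<close>
  define G where "G = (\<lambda>b t. g b (max 0 t))"
  have gl: "\<bar>g b t - g b' t'\<bar> \<le> L * (\<bar>b - b'\<bar> + \<bar>t - t'\<bar>)" if "0 \<le> t" "0 \<le> t'" for b t b' t'
  proof -
    have "\<bar>g b t - g b' t'\<bar> \<le> L * dist (b, t) (b', t')"
      using lipschitz_onD[OF g, of "(b, t)" "(b', t')"] that by (simp add: dist_real_def)
    also have "\<dots> \<le> L * (\<bar>b - b'\<bar> + \<bar>t - t'\<bar>)"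
      using L0 unfolding dist_Pair_Pair dist_real_def
      by (intro mult_left_mono order_trans[OF sqrt_sum_squares_le_sum_abs]) auto
    finally show ?thesis .
  qed
  interpret G: lipschitz2 G L
  proof
    show "\<bar>G a b - G a' b'\<bar> \<le> L * (\<bar>a - a'\<bar> + \<bar>b - b'\<bar>)" for a b a' b'
    proof -
      have "\<bar>G a b - G a' b'\<bar> \<le> L * (\<bar>a - a'\<bar> + \<bar>max 0 b - max 0 b'\<bar>)" unfolding G_def by (rule gl) auto
      also have "\<dots> \<le> L * (\<bar>a - a'\<bar> + \<bar>b - b'\<bar>)" using L0 by (intro mult_left_mono) auto
      finally show ?thesis .
    qed
  qed
  \<comment> \<open>On the line t = 0 the time derivatives of \<open>G\<close> and \<open>g\<close>
    may differ; it is null.\<close>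
  have nz: "AE z in lborel. snd (z :: real \<times> real) \<noteq> 0" 
  proof -
    have "(UNIV :: real set) \<times> {0::real} \<in> null_sets lborel"
    proof (rule null_sets_lborel_pairI)
      show "(UNIV :: real set) \<times> {0::real} \<in> sets borel" by (intro borel_Times) simp_all
      show "AE x in lborel. AE y in lborel. (x, y) \<notin> (UNIV :: real set) \<times> {0::real}"
        using AE_lborel_singleton[of "0::real"] by simp
    qed
    from AE_not_in[OF this] show ?thesis by eventually_elim (simp add: mem_Times_iff)
  qed
  have dt: "deriv (\<lambda>s. G b s) t = deriv (\<lambda>s. g b s) t" if "0 < t" for b t
    using that by (intro deriv_cong_ev eventually_nhds[THEN iffD2] exI[of _ "{0<..}"]) (auto simp: G_def)
  have db: "deriv (\<lambda>s. G s t) b = deriv (\<lambda>s. g s t) b" if "0 \<le> t" for b t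
    using that by (simp add: G_def)
  have b1: "AE z in lborel. z \<in> UNIV \<times> {0..} \<longrightarrow> \<bar>(\<lambda>(b, t). deriv (\<lambda>s. g s t) b) z\<bar> \<le> L"
    using G.AE_differentiable_fst by eventually_elim
      (auto simp: db[symmetric] intro: abs_deriv_le_Lipschitz[OF G.lip_fst])
  have b2: "AE z in lborel. z \<in> UNIV \<times> {0..} \<longrightarrow> \<bar>(\<lambda>(b, t). deriv (\<lambda>s. g b s) t) z\<bar> \<le> L"
    using G.AE_differentiable_snd nz by eventually_elim
      (auto simp: dt[symmetric] less_le intro: abs_deriv_le_Lipschitz[OF G.lip_snd])
  show l0: "0 \<le> l_gu g" unfolding l_gu_def using b1 by (rule ess_sup_on_nonneg)
  show d0: "0 \<le> dt_gu_norm g" unfolding dt_gu_norm_def using b2 by (rule ess_sup_on_nonneg)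
  have r1: "AE t in lborel. AE b in lborel. 0 \<le> t \<longrightarrow> \<bar>deriv (\<lambda>s. G s t) b\<bar> \<le> l_gu g"
    using AE_lborel_pairD2[OF AE_le_ess_sup_on[OF b1]] unfolding l_gu_def[symmetric]
  proof eventually_elim
    case (elim t)
    then show ?case by eventually_elim (auto simp: db)
  qed
  have r2: "AE b in lborel. AE t in lborel. 0 < t \<longrightarrow> \<bar>deriv (\<lambda>s. G b s) t\<bar> \<le> dt_gu_norm g"
    using AE_lborel_pairD[OF AE_le_ess_sup_on[OF b2]] unfolding dt_gu_norm_def[symmetric]
  proof eventually_elim
    case (elim t)
    then show ?case by eventually_elim (auto simp: dt)
  qed
  show "\<bar>g b t - g b' t\<bar> \<le> l_gu g * \<bar>b - b'\<bar>" if t: "0 \<le> t"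
  proof (rule field_le_epsilon)
    fix e :: real assume e: "0 < e"
    \<comment> \<open>The derivative bound holds on almost every line only. A good line
      \<open>s\<close> within \<open>d\<close> of \<open>t\<close> takes the place of
      \<open>t\<close>, at the cost of 2 L d.\<close>
    define d where "d = e / (2 * L + 1)"
    have d: "0 < d" "2 * L * d \<le> e" using e L0 by (auto simp: d_def field_simps)
    obtain s where s: "t < s" "s < t + d" "AE b in lborel. 0 \<le> s \<longrightarrow> \<bar>deriv (\<lambda>r. G r s) b\<bar> \<le> l_gu g"
      using AE_lborel_ex_Ioo[OF r1, of t "t + d"] d by auto
    have "AE b in lborel. \<bar>deriv (\<lambda>r. G r s) b\<bar> \<le> l_gu g" using s(3) by eventually_elim (use t s in auto)
    then have ae: "AE x in lborel. x \<in> {min b b'<..<max b b'} \<longrightarrow> \<bar>deriv (\<lambda>r. G r s) x\<bar> \<le> l_gu g"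
      by eventually_elim auto
    have "\<bar>G (max b b') s - G (min b b') s\<bar> \<le> l_gu g * (max b b' - min b b')"
      by (rule Lipschitz_if_AE_deriv_bounded[of _ _ "\<lambda>r. G r s", OF G.lip_fst _ ae]) auto
    then have "\<bar>G b s - G b' s\<bar> \<le> l_gu g * \<bar>b - b'\<bar>"
      by (cases "b \<le> b'") (auto simp: abs_minus_commute)
    moreover have "\<bar>G b t - G b s\<bar> \<le> L * d" "\<bar>G b' t - G b' s\<bar> \<le> L * d"
      using s L0 by (auto intro!: order_trans[OF G.lip_snd] mult_left_mono)
    ultimately have "\<bar>G b t - G b' t\<bar> \<le> l_gu g * \<bar>b - b'\<bar> + e" using d by linarith
    then show "\<bar>g b t - g b' t\<bar> \<le> l_gu g * \<bar>b - b'\<bar> + e" using t by (simp add: G_def)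
  qed
  show "\<bar>g b t - g b t'\<bar> \<le> dt_gu_norm g * \<bar>t - t'\<bar>" if t: "0 \<le> t" "0 \<le> t'"
  proof (rule field_le_epsilon)
    fix e :: real assume e: "0 < e"
    define d where "d = e / (2 * L + 1)"
    have d: "0 < d" "2 * L * d \<le> e" using e L0 by (auto simp: d_def field_simps)
    obtain s where s: "b < s" "s < b + d" "AE t in lborel. 0 < t \<longrightarrow> \<bar>deriv (\<lambda>r. G s r) t\<bar> \<le> dt_gu_norm g"
      using AE_lborel_ex_Ioo[OF r2, of b "b + d"] d by auto
    have ae: "AE x in lborel. x \<in> {min t t'<..<max t t'} \<longrightarrow> \<bar>deriv (G s) x\<bar> \<le> dt_gu_norm g"
      using s(3) by eventually_elim (use t in auto)
    have "\<bar>G s (max t t') - G s (min t t')\<bar> \<le> dt_gu_norm g * (max t t' - min t t')"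
      by (rule Lipschitz_if_AE_deriv_bounded[of _ _ "G s", OF G.lip_snd _ ae]) auto
    then have "\<bar>G s t - G s t'\<bar> \<le> dt_gu_norm g * \<bar>t - t'\<bar>"
      by (cases "t \<le> t'") (auto simp: abs_minus_commute)
    moreover have "\<bar>G b t - G s t\<bar> \<le> L * d" "\<bar>G b t' - G s t'\<bar> \<le> L * d"
      using s L0 by (auto intro!: order_trans[OF G.lip_fst] mult_left_mono)
    ultimately have "\<bar>G b t - G b t'\<bar> \<le> dt_gu_norm g * \<bar>t - t'\<bar> + e" using d by linarith
    then show "\<bar>g b t - g b t'\<bar> \<le> dt_gu_norm g * \<bar>t - t'\<bar> + e" using t by (simp add: G_def)
  qed
qed

lemma trace_lipschitz:
  assumes phi: "L-lipschitz_on {0..} phi" and t: "0 \<le> t" "0 \<le> s"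
  shows "\<bar>phi t - phi s\<bar> \<le> ess_sup_on {0..} (deriv phi) * \<bar>t - s\<bar>"
proof -
  have L0: "0 \<le> L" using phi by (rule lipschitz_on_nonneg)
  have pl: "\<bar>phi t - phi s\<bar> \<le> L * \<bar>t - s\<bar>" if "0 \<le> t" "0 \<le> s" for t s
    using lipschitz_onD[OF phi, of t s] that by (simp add: dist_real_def)
  define P where "P = (\<lambda>t. phi (max 0 t))"
  have Pl: "\<bar>P x - P y\<bar> \<le> L * \<bar>x - y\<bar>" for x y
  proof -
    have "\<bar>P x - P y\<bar> \<le> L * \<bar>max 0 x - max 0 y\<bar>" unfolding P_def by (rule pl) auto
    also have "\<dots> \<le> L * \<bar>x - y\<bar>" using L0 by (intro mult_left_mono) auto
    finally show ?thesis .
  qed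
  have dP: "deriv P t = deriv phi t" if "0 < t" for t
    using that by (intro deriv_cong_ev eventually_nhds[THEN iffD2] exI[of _ "{0<..}"]) (auto simp: P_def)
  have "AE t in lborel. t \<in> {0..} \<longrightarrow> \<bar>deriv phi t\<bar> \<le> L"
    using Lipschitz_AE_differentiable[OF Pl] AE_lborel_singleton[of 0] by eventually_elim
      (auto simp: dP[symmetric] less_le intro: abs_deriv_le_Lipschitz[OF Pl])
  from AE_le_ess_sup_on[OF this]
  have ae: "AE x in lborel. x \<in> {min t s<..<max t s} \<longrightarrow> \<bar>deriv phi x\<bar> \<le> ess_sup_on {0..} (deriv phi)"
    by eventually_elim (use t in auto)
  have "\<bar>phi (max t s) - phi (min t s)\<bar> \<le> ess_sup_on {0..} (deriv phi) * (max t s - min t s)"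
    using t by (intro Lipschitz_if_AE_deriv_bounded[of _ _ phi, OF pl _ ae]) auto
  then show ?thesis by (cases "t \<le> s") (auto simp: abs_minus_commute)
qed

section \<open>The Euler scheme in the direction of \<open>x\<close>\<close>

definition lip_nonneg :: "(real \<Rightarrow> real) \<Rightarrow> real \<Rightarrow> bool" where
  "lip_nonneg f Y \<longleftrightarrow> (\<forall>t\<ge>0. \<forall>s\<ge>0. \<bar>f t - f s\<bar> \<le> Y * \<bar>t - s\<bar>)"

lemma lip_nonnegD: "lip_nonneg f Y \<Longrightarrow> 0 \<le> t \<Longrightarrow> 0 \<le> s \<Longrightarrow> \<bar>f t - f s\<bar> \<le> Y * \<bar>t - s\<bar>"
  by (simp add: lip_nonneg_def)

lemma lip_nonneg_mono: "lip_nonneg f Y \<Longrightarrow> Y \<le> Z \<Longrightarrow> lip_nonneg f Z"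
  unfolding lip_nonneg_def by (meson abs_ge_zero mult_right_mono order_trans)

definition extend_linear :: "real \<Rightarrow> (real \<Rightarrow> real) \<Rightarrow> real \<Rightarrow> real" where
  "extend_linear q f t = (if 0 \<le> t then f t else f 0 + t * q)"

lemma extend_linear_nonneg [simp]: "0 \<le> t \<Longrightarrow> extend_linear q f t = f t"
  by (simp add: extend_linear_def)

lemma extend_linear_lip:
  assumes "lip_nonneg f Y" "Y \<le> Z" "\<bar>q\<bar> \<le> Z"
  shows "\<bar>extend_linear q f t - extend_linear q f s\<bar> \<le> Z * \<bar>t - s\<bar>"
proof -
  have *: "\<bar>extend_linear q f t - extend_linear q f s\<bar> \<le> Z * (t - s)" if "s \<le> t" for s t
  proof -
    consider "0 \<le> s" | "s < 0" "0 \<le> t" | "t < 0" using that by linarith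
    then show ?thesis
    proof cases
      case 1
      then show ?thesis
        using lip_nonnegD[OF lip_nonneg_mono[OF assms(1,2)], of t s] that by simp
    next
      case 2
      have "\<bar>f t - f 0\<bar> \<le> Z * t"
        using lip_nonnegD[OF lip_nonneg_mono[OF assms(1,2)], of t 0] 2 by simp
      moreover have "\<bar>s * q\<bar> \<le> (- s) * Z" using 2 assms(3) by (simp add: abs_mult)
      moreover have "Z * (t - s) = Z * t + (- s) * Z" by (simp add: algebra_simps)
      moreover have "extend_linear q f t - extend_linear q f s = (f t - f 0) - s * q"
        using 2 by (simp add: extend_linear_def)
      ultimately show ?thesis by linarith
    next
      case 3
      have "\<bar>(t - s) * q\<bar> \<le> (t - s) * Z" using that assms(3) by (simp add: abs_mult mult_left_mono)
      moreover have "extend_linear q f t - extend_linear q f s = (t - s) * q"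
        using 3 that by (simp add: extend_linear_def algebra_simps)
      ultimately show ?thesis by (simp only: mult.commute)
    qed
  qed
  show ?thesis using *[of s t] *[of t s] by (cases "s \<le> t") (auto simp: abs_minus_commute)
qed

text \<open>The discrete form of y' \<le> g (y + y^2): the foot \<open>t - s * d * M t\<close> moves
  at rate at most \<open>1 + d * g * Z\<close>, which multiplied by \<open>Z\<close> yields the
  quadratic term, and the source yields the linear one. \<open>Z\<close> dominates both the constant
  \<open>Y\<close> of the layer and the slope \<open>q\<close> of its continuation.\<close>

lemma one_step_lip:
  fixes s :: real
  assumes f: "lip_nonneg f Y" "Y \<le> Z" "\<bar>q\<bar> \<le> Z" and Y0: "0 \<le> Y" and s: "\<bar>s\<bar> = 1"
    and d: "0 \<le> d" and g: "0 \<le> g"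
    and M: "\<bar>M t - M t'\<bar> \<le> g * (Y * \<bar>t - t'\<bar>)" and P: "\<bar>P t - P t'\<bar> \<le> g * (Y * \<bar>t - t'\<bar>)"
  shows "\<bar>(extend_linear q f (t - s * d * M t) + s * d * P t) - (extend_linear q f (t' - s * d * M t') + s * d * P t')\<bar>
    \<le> (Z + d * g * (Z\<^sup>2 + Z)) * \<bar>t - t'\<bar>"
proof -
  have Z0: "0 \<le> Z" using f Y0 by linarith
  let ?h = "\<bar>t - t'\<bar>"
  have "\<bar>s * d * (M t - M t')\<bar> = d * \<bar>M t - M t'\<bar>" using s d by (simp add: abs_mult)
  also have "\<dots> \<le> d * (g * (Y * ?h))" using M d by (rule mult_left_mono)
  also have "\<dots> \<le> d * (g * (Z * ?h))" using f d g by (intro mult_left_mono mult_right_mono) auto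
  finally have dM: "\<bar>s * d * (M t - M t')\<bar> \<le> d * g * Z * ?h" by (simp add: mult.assoc)
  have "\<bar>s * d * (P t - P t')\<bar> = d * \<bar>P t - P t'\<bar>" using s d by (simp add: abs_mult)
  also have "\<dots> \<le> d * (g * (Y * ?h))" using P d by (rule mult_left_mono)
  also have "\<dots> \<le> d * (g * (Z * ?h))" using f d g by (intro mult_left_mono mult_right_mono) auto
  finally have dP: "\<bar>s * d * (P t - P t')\<bar> \<le> d * g * Z * ?h" by (simp add: mult.assoc)
  have "(t - s * d * M t) - (t' - s * d * M t') = (t - t') - s * d * (M t - M t')" by (simp add: algebra_simps)
  then have "\<bar>(t - s * d * M t) - (t' - s * d * M t')\<bar> \<le> ?h + d * g * Z * ?h" using dM by linarith
  then have "Z * \<bar>(t - s * d * M t) - (t' - s * d * M t')\<bar> \<le> Z * (?h + d * g * Z * ?h)"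
    using Z0 by (rule mult_left_mono)
  then have 1: "\<bar>extend_linear q f (t - s * d * M t) - extend_linear q f (t' - s * d * M t')\<bar> \<le> Z * (?h + d * g * Z * ?h)"
    using extend_linear_lip[OF f] order_trans by blast
  have 2: "\<bar>s * d * P t - s * d * P t'\<bar> \<le> d * g * Z * ?h" using dP by (simp add: right_diff_distrib)
  have "Z * (?h + d * g * Z * ?h) + d * g * Z * ?h = (Z + d * g * (Z\<^sup>2 + Z)) * ?h"
    by (simp add: algebra_simps power2_eq_square)
  then show ?thesis using 1 2 by linarith
qed

text \<open>Many steps of length \<open>d\<close> agree with one step of length
  \<open>k * d\<close>, coefficients frozen at layer \<open>n\<close>, up to a quadratic error. The
  induction peels off the last small step, so the hypothesis is used at its foot \<open>t'\<close>.
  For \<open>s = 1\<close> the condition \<open>l * (k * d) \<le> t\<close> keeps all feet at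
  nonnegative times, where the recursion \<open>step\<close> holds.\<close>

lemma multi_step_consistency:
  fixes f M P :: "nat \<Rightarrow> real \<Rightarrow> real" and s :: real
  assumes step: "\<And>n t. n < N \<Longrightarrow> 0 \<le> t \<Longrightarrow> 0 \<le> t - s * d * M n t \<Longrightarrow>
      f (Suc n) t = f n (t - s * d * M n t) + s * d * P n t"
    and s: "s = 1 \<or> s = -1" and d: "0 \<le> d" and Z: "0 \<le> Z" and E: "0 \<le> E"
    and M: "\<And>n t. 0 \<le> M n t" "\<And>n t. M n t \<le> l"
    and fl: "\<And>n. n \<le> N \<Longrightarrow> lip_nonneg (f n) Z"
    and lipM: "\<And>n k t t'. n + k \<le> N \<Longrightarrow> 0 \<le> t \<Longrightarrow> 0 \<le> t' \<Longrightarrow> \<bar>M (n + k) t' - M n t\<bar> \<le> E * (k * d + \<bar>t' - t\<bar>)"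
    and lipP: "\<And>n k t t'. n + k \<le> N \<Longrightarrow> 0 \<le> t \<Longrightarrow> 0 \<le> t' \<Longrightarrow> \<bar>P (n + k) t' - P n t\<bar> \<le> E * (k * d + \<bar>t' - t\<bar>)"
  shows "n + k \<le> N \<Longrightarrow> 0 \<le> t \<Longrightarrow> (s = 1 \<Longrightarrow> l * (k * d) \<le> t) \<Longrightarrow>
    \<bar>f (n + k) t - f n (t - s * (k * d) * M n t) - s * (k * d) * P n t\<bar> \<le> (Z + 1) * (E * (1 + l)) * (k * d)\<^sup>2"
proof (induction k arbitrary: t)
  case 0
  then show ?case by simp
next
  case (Suc k)
  have l0: "0 \<le> l" using M[of 0 0] by linarith
  let ?M = "M (n + k) t" and ?P = "P (n + k) t"
  define t' where "t' = t - s * d * ?M"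
  let ?K = "real k * d"
  have K: "0 \<le> ?K" using d by simp
  have Kd: "real (Suc k) * d = ?K + d" by (simp add: algebra_simps)
  have dM: "0 \<le> d * M i x" "d * M i x \<le> l * d" for i x
    using mult_left_mono[OF M(2) d, of i x] mult_nonneg_nonneg[OF d M(1)] by (simp_all add: mult.commute)
  have KM: "0 \<le> ?K * M i x" "?K * M i x \<le> l * ?K" for i x
    using mult_left_mono[OF M(2) K, of i x] mult_nonneg_nonneg[OF K M(1)] by (auto simp: mult.commute)
  have t'1: "0 \<le> t'" "s = 1 \<Longrightarrow> l * ?K \<le> t'"
  proof -
    have "l * ?K + l * d \<le> t" if "s = 1" using Suc.prems(3)[OF that] unfolding Kd by (simp add: algebra_simps)
    moreover have "0 \<le> l * ?K" using l0 K by simp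
    ultimately show "0 \<le> t'" "s = 1 \<Longrightarrow> l * ?K \<le> t'"
      using s dM[of "n+k" t] Suc.prems(2) by (auto simp: t'_def)
  qed
  have tt': "\<bar>t' - t\<bar> \<le> l * d" using s dM[of "n+k" t] by (auto simp: t'_def)
  have st: "f (n + Suc k) t = f (n + k) t' + s * d * ?P"
    using step[of "n + k" t] Suc.prems t'1(1) by (simp add: t'_def)
  have IH: "\<bar>f (n + k) t' - f n (t' - s * ?K * M n t') - s * ?K * P n t'\<bar> \<le> (Z + 1) * (E * (1 + l)) * ?K\<^sup>2"
    using Suc.IH[of t'] Suc.prems t'1 by simp
  let ?e = "E * (1 + l) * ?K * d"
  \<comment> \<open>Both \<open>M\<close> and \<open>P\<close> feel the \<open>k\<close> layers
    between \<open>n\<close> and \<open>n + k\<close> and the shift from \<open>t\<close> to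
    \<open>t'\<close>; one estimate serves both.\<close>
  have comb: "\<bar>s * d * (F (n + k) t - F n t) + s * ?K * (F n t' - F n t)\<bar> \<le> ?e"
    if F: "\<And>n k t t'. n + k \<le> N \<Longrightarrow> 0 \<le> t \<Longrightarrow> 0 \<le> t' \<Longrightarrow> \<bar>F (n + k) t' - F n t\<bar> \<le> E * (k * d + \<bar>t' - t\<bar>)" for F
  proof -
    have "\<bar>F (n + k) t - F n t\<bar> \<le> E * ?K" using F[of n k t t] Suc.prems by simp
    then have a: "d * \<bar>F (n + k) t - F n t\<bar> \<le> d * (E * ?K)" using d by (rule mult_left_mono)
    have "\<bar>F n t' - F n t\<bar> \<le> E * \<bar>t' - t\<bar>" using F[of n 0 t t'] Suc.prems t'1 by simp
    also have "\<dots> \<le> E * (l * d)" using tt' E by (rule mult_left_mono)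
    finally have b: "?K * \<bar>F n t' - F n t\<bar> \<le> ?K * (E * (l * d))" using K by (rule mult_left_mono)
    have s1: "\<bar>s\<bar> = 1" using s by auto
    have "\<bar>s * d * (F (n + k) t - F n t) + s * ?K * (F n t' - F n t)\<bar> \<le>
      \<bar>s * d * (F (n + k) t - F n t)\<bar> + \<bar>s * ?K * (F n t' - F n t)\<bar>" by (rule abs_triangle_ineq)
    also have "\<dots> = d * \<bar>F (n + k) t - F n t\<bar> + ?K * \<bar>F n t' - F n t\<bar>"
      using s1 d K by (simp add: abs_mult)
    also have "\<dots> \<le> d * (E * ?K) + ?K * (E * (l * d))" using a b by linarith
    also have "\<dots> = ?e" by (simp add: algebra_simps)
    finally show ?thesis .
  qed
  let ?a = "t' - s * ?K * M n t'" and ?b = "t - s * (?K + d) * M n t"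
  have ab0: "0 \<le> ?a" "0 \<le> ?b"
  proof -
    show "0 \<le> ?a" using s t'1 KM[of n t'] by auto
    have "s = 1 \<Longrightarrow> l * ?K + l * d \<le> t" using Suc.prems(3) unfolding Kd by (simp add: algebra_simps)
    then show "0 \<le> ?b" using s KM[of n t] dM[of n t] Suc.prems(2) by (auto simp: algebra_simps)
  qed
  have "?b - ?a = s * d * (M (n + k) t - M n t) + s * ?K * (M n t' - M n t)"
    by (simp add: t'_def algebra_simps)
  then have "\<bar>?a - ?b\<bar> \<le> ?e" using comb[OF lipM] by (simp add: abs_minus_commute)
  then have f1: "\<bar>f n ?a - f n ?b\<bar> \<le> Z * ?e"
    using lip_nonnegD[OF fl ab0, of n] Suc.prems(1) mult_left_mono[OF _ Z, of "\<bar>?a - ?b\<bar>" ?e] by simp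
  have "s * ?K * P n t' + s * d * ?P - s * (?K + d) * P n t
    = s * d * (P (n + k) t - P n t) + s * ?K * (P n t' - P n t)" by (simp add: algebra_simps)
  then have f2: "\<bar>s * ?K * P n t' + s * d * ?P - s * (?K + d) * P n t\<bar> \<le> ?e" using comb[OF lipP] by simp
  have "f (n + Suc k) t - f n ?b - s * (?K + d) * P n t =
    (f (n + k) t' - f n ?a - s * ?K * P n t') + (f n ?a - f n ?b) + (s * ?K * P n t' + s * d * ?P - s * (?K + d) * P n t)"
    unfolding st by simp
  then have "\<bar>f (n + Suc k) t - f n ?b - s * (?K + d) * P n t\<bar> \<le> (Z + 1) * (E * (1 + l)) * ?K\<^sup>2 + Z * ?e + ?e"
    using IH f1 f2 by linarith
  also have "\<dots> = (Z + 1) * (E * (1 + l)) * (?K\<^sup>2 + ?K * d)" by (simp add: algebra_simps)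
  also have "\<dots> \<le> (Z + 1) * (E * (1 + l)) * (?K + d)\<^sup>2"
    using Z E l0 K d by (intro mult_left_mono) (auto simp: power2_eq_square algebra_simps)
  finally show ?case unfolding Kd .
qed

text \<open>Induction step for the recursion e(n + 1) \<le> (1 + h K) e(n) + b with e(0) \<le> a;
  every additive error is charged with the full exponential.\<close>

lemma gronwall_discrete_step:
  fixes K h a b :: real
  assumes "0 \<le> K" "0 \<le> h" "0 \<le> a" "0 \<le> b"
  shows "(1 + h * K) * (exp (K * (n * h)) * (a + real n * b)) + b \<le> exp (K * (Suc n * h)) * (a + real (Suc n) * b)"
proof -
  have e: "exp (K * (real (Suc n) * h)) = exp (K * (n * h)) * exp (h * K)"
    by (simp add: exp_add[symmetric] algebra_simps)
  have "(1 + h * K) * (exp (K * (n * h)) * (a + n * b)) \<le> exp (h * K) * (exp (K * (n * h)) * (a + n * b))"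
    using assms exp_ge_add_one_self[of "h * K"] by (intro mult_right_mono) auto
  moreover have "1 * b \<le> exp (K * (Suc n * h)) * b"
    using assms by (intro mult_right_mono) auto
  ultimately show ?thesis unfolding e by (simp add: algebra_simps)
qed

text \<open>Only dyadic meshes are compared, since the points of a coarse mesh recur in all finer
  ones. Rounding \<open>x\<close> down to the mesh costs one step of the Lipschitz bound in x; hence
  \<open>C\<close> beside \<open>D\<close> in the rate.\<close>

lemma mesh_limit:
  fixes W :: "nat \<Rightarrow> nat \<Rightarrow> real \<Rightarrow> real"
  assumes lip: "\<And>k n. k0 \<le> k \<Longrightarrow> real n / 2 ^ k \<le> X \<Longrightarrow> lip_nonneg (W k n) Z"
    and xs: "\<And>k n t. k0 \<le> k \<Longrightarrow> real (Suc n) / 2 ^ k \<le> X \<Longrightarrow> 0 \<le> t \<Longrightarrow> \<bar>W k (Suc n) t - W k n t\<bar> \<le> C / 2 ^ k"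
    and cmp: "\<And>k j n t. k0 \<le> k \<Longrightarrow> real n / 2 ^ k \<le> X \<Longrightarrow> 0 \<le> t \<Longrightarrow> \<bar>W k n t - W (k + j) (2 ^ j * n) t\<bar> \<le> D / 2 ^ k"
    and C: "0 \<le> C" and Z: "0 \<le> Z"
  obtains w where "\<And>k x t. k0 \<le> k \<Longrightarrow> 0 \<le> x \<Longrightarrow> x \<le> X \<Longrightarrow> 0 \<le> t \<Longrightarrow> \<bar>W k (nat \<lfloor>x * 2 ^ k\<rfloor>) t - w x t\<bar> \<le> (C + D) / 2 ^ k"
    "\<And>x y t s. x \<in> {0..X} \<Longrightarrow> y \<in> {0..X} \<Longrightarrow> 0 \<le> t \<Longrightarrow> 0 \<le> s \<Longrightarrow> \<bar>w x t - w y s\<bar> \<le> C * \<bar>x - y\<bar> + Z * \<bar>t - s\<bar>"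
proof -
  define ix where "ix = (\<lambda>k (x::real). nat \<lfloor>x * 2 ^ k\<rfloor>)"
  have ix: "real (ix k x) \<le> x * 2 ^ k" "x * 2 ^ k < real (ix k x) + 1" if "0 \<le> x" for k x
  proof -
    have "0 \<le> x * 2 ^ k" using that by simp
    then have "real (ix k x) = of_int \<lfloor>x * 2 ^ k\<rfloor>" unfolding ix_def by (simp add: of_nat_nat)
    then show "real (ix k x) \<le> x * 2 ^ k" "x * 2 ^ k < real (ix k x) + 1" by linarith+
  qed
  have ixX: "real (ix k x) / 2 ^ k \<le> x" if "0 \<le> x" for k x
    using ix(1)[OF that, of k] by (simp add: pos_divide_le_eq)
  have xm: "\<bar>W k (n + i) t - W k n t\<bar> \<le> real i * (C / 2 ^ k)" if k: "k0 \<le> k" "0 \<le> t" and ni: "real (n + i) / 2 ^ k \<le> X" for k n i t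
    using ni
  proof (induction i)
    case (Suc i)
    have le: "real (n + i) / 2 ^ k \<le> X"
      by (rule order_trans[OF _ Suc.prems]) (simp add: divide_right_mono)
    have "real (Suc (n + i)) / 2 ^ k \<le> X" using Suc.prems by simp
    from xs[OF k(1) this k(2)] have "\<bar>W k (n + Suc i) t - W k (n + i) t\<bar> \<le> C / 2 ^ k" by simp
    moreover have "real (Suc i) * (C / 2 ^ k) = real i * (C / 2 ^ k) + C / 2 ^ k"
      by (simp only: of_nat_Suc distrib_right mult_1_left add.commute)
    ultimately show ?case using Suc.IH[OF le] by linarith
  qed simp
  have cau: "\<bar>W k (ix k x) t - W (k + j) (ix (k + j) x) t\<bar> \<le> (C + D) / 2 ^ k"
    if k: "k0 \<le> k" "0 \<le> t" and x: "0 \<le> x" "x \<le> X" for k j x t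
  proof -
    \<comment> \<open>The mesh point of level k below \<open>x\<close>, renumbered on level k + j.
      The mesh point below \<open>x\<close> on the finer level lies at most 2^j indices
      further.\<close>
    let ?n = "2 ^ j * ix k x"
    have "real ?n \<le> 2 ^ j * (x * 2 ^ k)" using ix(1)[OF x(1), of k] by simp
    also have "\<dots> = x * 2 ^ (k + j)" by (simp add: power_add)
    also have "\<dots> < real (ix (k + j) x) + 1" by (rule ix(2)[OF x(1)])
    finally have le: "?n \<le> ix (k + j) x" by linarith
    have "real (ix (k + j) x) \<le> 2 ^ j * (x * 2 ^ k)" using ix(1)[OF x(1), of "k + j"] by (simp add: power_add mult_ac)
    also have "\<dots> \<le> 2 ^ j * (real (ix k x) + 1)" using ix(2)[OF x(1), of k] by simp
    finally have le2: "real (ix (k + j) x - ?n) \<le> 2 ^ j" using le by (simp add: of_nat_diff algebra_simps)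
    have ex: "?n + (ix (k + j) x - ?n) = ix (k + j) x" using le by simp
    have "\<bar>W (k + j) (ix (k + j) x) t - W (k + j) ?n t\<bar> \<le> real (ix (k + j) x - ?n) * (C / 2 ^ (k + j))"
      using xm[of "k + j" t ?n "ix (k + j) x - ?n"] k ixX[OF x(1), of "k + j"] x unfolding ex by simp
    also have "\<dots> \<le> 2 ^ j * (C / 2 ^ (k + j))" using le2 C by (intro mult_right_mono) auto
    also have "\<dots> = C / 2 ^ k" by (simp add: power_add)
    finally have "\<bar>W (k + j) (ix (k + j) x) t - W (k + j) ?n t\<bar> \<le> C / 2 ^ k" .
    moreover have "\<bar>W k (ix k x) t - W (k + j) ?n t\<bar> \<le> D / 2 ^ k"
      using cmp[OF k(1) _ k(2), of "ix k x"] ixX[OF x(1), of k] x by simp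
    ultimately show ?thesis by (simp add: add_divide_distrib)
  qed
  have p0: "(\<lambda>k. B / 2 ^ k) \<longlonglongrightarrow> 0" for B :: real
  proof -
    have "(\<lambda>k. B * (1 / 2) ^ k) \<longlonglongrightarrow> B * 0" by (intro tendsto_intros LIMSEQ_power_zero) simp
    then show ?thesis by (simp add: power_one_over)
  qed
  define w where "w = (\<lambda>x t. lim (\<lambda>k. W k (ix k x) t))"
  have conv: "(\<lambda>k. W k (ix k x) t) \<longlonglongrightarrow> w x t" if x: "0 \<le> x" "x \<le> X" and t: "0 \<le> t" for x t
  proof -
    have "Cauchy (\<lambda>k. W k (ix k x) t)"
    proof (rule metric_CauchyI)
      fix e :: real assume "0 < e"
      then have "eventually (\<lambda>k. (C + D) / 2 ^ k < e / 2) sequentially" using order_tendstoD(2)[OF p0[of "C + D"], of "e/2"] by simp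
      then obtain k1 where k1: "\<And>k. k1 \<le> k \<Longrightarrow> (C + D) / 2 ^ k < e / 2" by (auto simp: eventually_sequentially)
      let ?k = "max k0 k1"
      have near: "\<bar>W ?k (ix ?k x) t - W m (ix m x) t\<bar> < e / 2" if "?k \<le> m" for m
      proof -
        have "\<bar>W ?k (ix ?k x) t - W m (ix m x) t\<bar> \<le> (C + D) / 2 ^ ?k"
          using cau[of ?k t x "m - ?k"] x t that by simp
        also have "\<dots> < e / 2" by (rule k1) simp
        finally show ?thesis .
      qed
      show "\<exists>M. \<forall>m\<ge>M. \<forall>n\<ge>M. dist (W m (ix m x) t) (W n (ix n x) t) < e"
      proof (intro exI allI impI)
        fix m n assume "?k \<le> m" "?k \<le> n"
        then show "dist (W m (ix m x) t) (W n (ix n x) t) < e"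
          using near[of m] near[of n] unfolding dist_real_def by linarith
      qed
    qed
    then show ?thesis unfolding w_def using Cauchy_convergent convergent_LIMSEQ_iff by blast
  qed
  have close: "\<bar>W k (ix k x) t - w x t\<bar> \<le> (C + D) / 2 ^ k" if k: "k0 \<le> k" "0 \<le> x" "x \<le> X" "0 \<le> t" for k x t
  proof (rule LIMSEQ_le_const2)
    show "(\<lambda>j. \<bar>W k (ix k x) t - W (k + j) (ix (k + j) x) t\<bar>) \<longlonglongrightarrow> \<bar>W k (ix k x) t - w x t\<bar>"
      using LIMSEQ_ignore_initial_segment[OF conv[OF k(2-4)], of k]
      by (intro tendsto_intros) (simp add: add.commute)
    show "\<exists>N. \<forall>j\<ge>N. \<bar>W k (ix k x) t - W (k + j) (ix (k + j) x) t\<bar> \<le> (C + D) / 2 ^ k" using cau k by blast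
  qed
  have lipw: "\<bar>w x t - w y s\<bar> \<le> C * (y - x) + Z * \<bar>t - s\<bar>"
    if xy: "0 \<le> x" "x \<le> y" "y \<le> X" and ts: "0 \<le> t" "0 \<le> s" for x y t s
  proof (rule LIMSEQ_le)
    show "(\<lambda>k. \<bar>W k (ix k x) t - W k (ix k y) s\<bar>) \<longlonglongrightarrow> \<bar>w x t - w y s\<bar>"
      using xy ts by (intro tendsto_intros conv) auto
    have "(\<lambda>k. C * (y - x) + C / 2 ^ k + Z * \<bar>t - s\<bar>) \<longlonglongrightarrow> C * (y - x) + 0 + Z * \<bar>t - s\<bar>"
      by (intro tendsto_intros p0)
    then show "(\<lambda>k. C * (y - x) + C / 2 ^ k + Z * \<bar>t - s\<bar>) \<longlonglongrightarrow> C * (y - x) + Z * \<bar>t - s\<bar>" by simp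
    show "\<exists>N. \<forall>k\<ge>N. \<bar>W k (ix k x) t - W k (ix k y) s\<bar> \<le> C * (y - x) + C / 2 ^ k + Z * \<bar>t - s\<bar>"
    proof (intro exI allI impI)
      fix k assume k: "k0 \<le> k"
      have le: "ix k x \<le> ix k y" unfolding ix_def using xy by (intro nat_mono floor_mono mult_right_mono) auto
      have y0: "0 \<le> y" using xy by simp
      have "\<bar>W k (ix k y) s - W k (ix k x) s\<bar> \<le> real (ix k y - ix k x) * (C / 2 ^ k)"
        using xm[OF k ts(2), of "ix k x" "ix k y - ix k x"] le ixX[OF y0, of k] xy by simp
      also have "\<dots> \<le> ((y - x) * 2 ^ k + 1) * (C / 2 ^ k)"
        using ix[OF xy(1), of k] ix[OF y0, of k] le C
        by (intro mult_right_mono) (auto simp: of_nat_diff algebra_simps)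
      also have "\<dots> = C * (y - x) + C / 2 ^ k" by (simp add: field_simps)
      finally have "\<bar>W k (ix k y) s - W k (ix k x) s\<bar> \<le> C * (y - x) + C / 2 ^ k" .
      moreover have "\<bar>W k (ix k x) t - W k (ix k x) s\<bar> \<le> Z * \<bar>t - s\<bar>"
        using lip_nonnegD[OF lip[OF k] ts, of "ix k x"] ixX[OF xy(1), of k] xy by simp
      ultimately show "\<bar>W k (ix k x) t - W k (ix k y) s\<bar> \<le> C * (y - x) + C / 2 ^ k + Z * \<bar>t - s\<bar>" by linarith
    qed
  qed
  show ?thesis
  proof (rule that)
    show "\<bar>W k (nat \<lfloor>x * 2 ^ k\<rfloor>) t - w x t\<bar> \<le> (C + D) / 2 ^ k" if "k0 \<le> k" "0 \<le> x" "x \<le> X" "0 \<le> t" for k x t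
      using close[OF that] by (simp add: ix_def)
    show "\<bar>w x t - w y s\<bar> \<le> C * \<bar>x - y\<bar> + Z * \<bar>t - s\<bar>"
      if "x \<in> {0..X}" "y \<in> {0..X}" "0 \<le> t" "0 \<le> s" for x y t s
      using lipw[of x y t s] lipw[of y x s t] that
      by (cases "x \<le> y") (auto simp: abs_minus_commute)
  qed
qed

text \<open>Two Lipschitz constants are kept apart: \<open>g\<close>, in the state with the maximum
  norm, drives the Riccati growth, while \<open>A\<close>, in all variables, enters only error
  bounds and limits. \<open>Mu\<close> has a positive lower bound because \<open>slope\<close>
  divides by it. The coefficients are bounded on the whole space, as the clamped ones are.\<close>

locale x_problem =
  fixes Mu Mv Pu Pv :: "real \<Rightarrow> real \<Rightarrow> real \<Rightarrow> real" and A g m l Pm lf K0 y0 L0 :: real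
    and u0 ub phi :: "real \<Rightarrow> real"
  assumes A0: "0 \<le> A" and g0: "0 \<le> g" and m0: "0 < m" and Pm0: "0 \<le> Pm" and lf0: "0 \<le> lf"
    and K00: "0 \<le> K0" and y00: "0 \<le> y0" and L00: "0 \<le> L0"
    and Mu_bounds: "\<And>x a b. m \<le> Mu x a b" "\<And>x a b. Mu x a b \<le> l"
    and Mv_bounds: "\<And>x a b. 0 \<le> Mv x a b" "\<And>x a b. Mv x a b \<le> l"
    and P_bounds: "\<And>x a b. \<bar>Pu x a b\<bar> \<le> Pm" "\<And>x a b. \<bar>Pv x a b\<bar> \<le> Pm"
    and lipA: "F \<in> {Mu, Mv, Pu, Pv} \<Longrightarrow> \<bar>F x a b - F x' a' b'\<bar> \<le> A * (\<bar>x - x'\<bar> + \<bar>a - a'\<bar> + \<bar>b - b'\<bar>)"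
    and lipg: "F \<in> {Mu, Mv, Pu, Pv} \<Longrightarrow> \<bar>F x a b - F x a' b'\<bar> \<le> g * max \<bar>a - a'\<bar> \<bar>b - b'\<bar>"
    and growth: "\<And>x a b. \<bar>Pu x a b\<bar> \<le> lf * max \<bar>a\<bar> \<bar>b\<bar>" "\<And>x a b. \<bar>Pv x a b\<bar> \<le> lf * max \<bar>a\<bar> \<bar>b\<bar>"
    and u0_lip: "\<And>x y. \<bar>u0 x - u0 y\<bar> \<le> L0 * \<bar>x - y\<bar>" and u0_bound: "\<And>x. \<bar>u0 x\<bar> \<le> K0"
    and ub_lip: "lip_nonneg ub y0" and phi_lip: "lip_nonneg phi y0"
    and ub_bound: "\<And>t. 0 \<le> t \<Longrightarrow> \<bar>ub t\<bar> \<le> K0" and phi_bound: "\<And>t. 0 \<le> t \<Longrightarrow> \<bar>phi t\<bar> \<le> K0"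
    and corner: "ub 0 = u0 0"
begin

lemma l_pos: "0 < l"
  using Mu_bounds[of 0 0 0] m0 by linarith

text \<open>The layers live on \<open>t \<ge> 0\<close>, but the foot of a backward \<open>u\<close>-step may be negative. The layer is continued
  linearly to \<open>t < 0\<close> with the slope for which the next layer takes exactly the value \<open>u0\<close> at \<open>t = 0\<close>; this
  slope is a discretisation of \<open>u_t(x,0) = - lu u0' + fu\<close>.\<close>

definition slope :: "real \<Rightarrow> nat \<Rightarrow> real \<Rightarrow> real \<Rightarrow> real" where
  "slope d n a b = (Pu (real n * d) a b - (u0 (real (Suc n) * d) - u0 (real n * d)) / d) / Mu (real n * d) a b"

text \<open>The factors \<open>1\<close> and \<open>-1\<close> are kept so that both components are instances of lemmas with a sign
  parameter \<open>s\<close>.\<close>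

primrec layer :: "real \<Rightarrow> nat \<Rightarrow> (real \<Rightarrow> real) \<times> (real \<Rightarrow> real)" where
  "layer d 0 = (ub, phi)"
| "layer d (Suc n) = (let u = fst (layer d n); v = snd (layer d n) in
     (\<lambda>t. extend_linear (slope d n (u 0) (v 0)) u (t - 1 * d * Mu (real n * d) (u t) (v t)) + 1 * d * Pu (real n * d) (u t) (v t),
      \<lambda>t. extend_linear 0 v (t - (-1) * d * Mv (real n * d) (u t) (v t)) + (-1) * d * Pv (real n * d) (u t) (v t)))"

abbreviation "U d n \<equiv> fst (layer d n)"
abbreviation "V d n \<equiv> snd (layer d n)"
abbreviation "sl d n \<equiv> slope d n (U d n 0) (V d n 0)"

lemma U_Suc: "U d (Suc n) t = extend_linear (sl d n) (U d n) (t - 1 * d * Mu (real n * d) (U d n t) (V d n t))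
    + 1 * d * Pu (real n * d) (U d n t) (V d n t)"
  by (simp add: Let_def)

lemma V_Suc: "V d (Suc n) t = extend_linear 0 (V d n) (t - (-1) * d * Mv (real n * d) (U d n t) (V d n t))
    + (-1) * d * Pv (real n * d) (U d n t) (V d n t)"
  by (simp add: Let_def)

declare layer.simps(2) [simp del]

text \<open>As \<open>Mu\<close> is positive, the foot of the step from t = 0 is strictly negative,
  so the linear branch is taken, and \<open>slope\<close> is the solution of the resulting linear
  equation for the value \<open>u0\<close>.\<close>

lemma U_at_0: assumes "0 < d" shows "U d n 0 = u0 (real n * d)"
proof (induction n)
  case 0
  then show ?case using corner by simp
next
  case (Suc n)
  let ?M = "Mu (real n * d) (U d n 0) (V d n 0)" and ?P = "Pu (real n * d) (U d n 0) (V d n 0)"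
  have M: "0 < ?M" using Mu_bounds(1)[of "real n * d" "U d n 0" "V d n 0"] m0 by linarith
  then have "\<not> 0 \<le> 0 - 1 * d * ?M" using mult_pos_pos[OF assms, of ?M] by linarith
  then have "U d (Suc n) 0 = U d n 0 + (0 - 1 * d * ?M) * sl d n + 1 * d * ?P"
    unfolding U_Suc extend_linear_def by simp
  also have "\<dots> = U d n 0 - d * (?M * sl d n) + d * ?P" by simp
  also have "?M * sl d n = ?P - (u0 (real (Suc n) * d) - u0 (real n * d)) / d" using M by (simp add: slope_def)
  also have "U d n 0 - d * (?P - (u0 (real (Suc n) * d) - u0 (real n * d)) / d) + d * ?P = U d n 0 + (u0 (real (Suc n) * d) - u0 (real n * d))"
  proof -
    have "a - d * (p - w / d) + d * p = a + w" for a p w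
      using assms by (simp add: right_diff_distrib)
    then show ?thesis .
  qed
  also have "\<dots> = u0 (real (Suc n) * d)" unfolding Suc.IH by simp
  finally show ?case .
qed

definition "B = (Pm + L0) / m"

text \<open>A bound that does not refer to \<open>V\<close>: it holds however far the layers have
  been controlled, and \<open>good_extend\<close> takes its uniform step length from it.\<close>

lemma slope_bound: assumes "0 < d" shows "\<bar>slope d n a b\<bar> \<le> B"
proof -
  have "\<bar>u0 (real (Suc n) * d) - u0 (real n * d)\<bar> \<le> L0 * d"
    using u0_lip[of "real (Suc n) * d" "real n * d"] assms by (simp add: algebra_simps)
  then have "\<bar>(u0 (real (Suc n) * d) - u0 (real n * d)) / d\<bar> \<le> L0" using assms by (simp add: pos_divide_le_eq)
  then have "\<bar>Pu (real n * d) a b - (u0 (real (Suc n) * d) - u0 (real n * d)) / d\<bar> \<le> Pm + L0"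
    using P_bounds(1)[of "real n * d" a b] by linarith
  moreover have "m \<le> Mu (real n * d) a b" by (rule Mu_bounds)
  ultimately show ?thesis unfolding slope_def B_def abs_divide using m0 by (intro frac_le) auto
qed

lemma lipg_state:
  assumes F: "F \<in> {Mu, Mv, Pu, Pv}" and "lip_nonneg (U d n) Y" "lip_nonneg (V d n) Y" "0 \<le> t" "0 \<le> t'"
  shows "\<bar>F x (U d n t) (V d n t) - F x (U d n t') (V d n t')\<bar> \<le> g * (Y * \<bar>t - t'\<bar>)"
proof -
  have "g * max \<bar>U d n t - U d n t'\<bar> \<bar>V d n t - V d n t'\<bar> \<le> g * (Y * \<bar>t - t'\<bar>)"
    using assms(2-) g0 by (intro mult_left_mono) (auto intro: lip_nonnegD)
  then show ?thesis using lipg[OF F] order_trans by blast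
qed

lemma layer_lip_step:
  assumes d: "0 < d" and Y: "0 \<le> Y" "lip_nonneg (U d n) Y" "lip_nonneg (V d n) Y"
    and Z: "Y \<le> Z" "\<bar>sl d n\<bar> \<le> Z"
  shows "lip_nonneg (U d (Suc n)) (Z + d * g * (Z\<^sup>2 + Z))" "lip_nonneg (V d (Suc n)) (Z + d * g * (Z\<^sup>2 + Z))"
proof -
  show "lip_nonneg (U d (Suc n)) (Z + d * g * (Z\<^sup>2 + Z))"
    unfolding lip_nonneg_def U_Suc using d g0 Y Z
    by (intro allI impI one_step_lip[of _ Y] lipg_state) auto
  have "\<bar>0 :: real\<bar> \<le> Z" using Y Z by linarith
  then show "lip_nonneg (V d (Suc n)) (Z + d * g * (Z\<^sup>2 + Z))"
    unfolding lip_nonneg_def V_Suc using d g0 Y Z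
    by (intro allI impI one_step_lip[of _ Y] lipg_state) auto
qed

lemma layer_x_step:
  assumes d: "0 < d" and Z: "0 \<le> Z" "\<bar>sl d n\<bar> \<le> Z" "lip_nonneg (U d n) Z" "lip_nonneg (V d n) Z" and t: "0 \<le> t"
  shows "\<bar>U d (Suc n) t - U d n t\<bar> \<le> (Z * l + Pm) * d" "\<bar>V d (Suc n) t - V d n t\<bar> \<le> (Z * l + Pm) * d"
proof -
  have Z0: "0 \<le> Z" by (rule Z(1))
  have gen: "\<bar>(extend_linear q f (t - s * d * M) + s * d * P) - f t\<bar> \<le> (Z * l + Pm) * d"
    if f: "lip_nonneg f Z" "\<bar>q\<bar> \<le> Z" and s: "\<bar>s\<bar> = 1" and M: "0 \<le> M" "M \<le> l" and P: "\<bar>P\<bar> \<le> Pm" for q f s M P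
  proof -
    have "\<bar>extend_linear q f (t - s * d * M) - extend_linear q f t\<bar> \<le> Z * \<bar>(t - s * d * M) - t\<bar>"
      by (rule extend_linear_lip[OF f(1) order_refl f(2)])
    also have "\<bar>(t - s * d * M) - t\<bar> = d * M" using s d M by (simp add: abs_mult)
    also have "Z * (d * M) \<le> Z * (d * l)" using M Z0 d by (intro mult_left_mono) auto
    finally have 1: "\<bar>extend_linear q f (t - s * d * M) - f t\<bar> \<le> Z * (d * l)" using t by simp
    have "\<bar>s * d * P\<bar> = d * \<bar>P\<bar>" using s d by (simp add: abs_mult)
    also have "\<dots> \<le> d * Pm" using P d by (intro mult_left_mono) auto
    finally have 2: "\<bar>s * d * P\<bar> \<le> d * Pm" .
    have "(Z * l + Pm) * d = Z * (d * l) + d * Pm" by (simp add: algebra_simps)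
    then show ?thesis using 1 2 by linarith
  qed
  show "\<bar>U d (Suc n) t - U d n t\<bar> \<le> (Z * l + Pm) * d" unfolding U_Suc
  proof (rule gen)
    show "0 \<le> Mu (real n * d) (U d n t) (V d n t)" using Mu_bounds(1) m0 less_imp_le order_trans by blast
  qed (use Z Mu_bounds P_bounds in auto)
  show "\<bar>V d (Suc n) t - V d n t\<bar> \<le> (Z * l + Pm) * d" unfolding V_Suc
    using Mv_bounds Z Z0 P_bounds by (intro gen) auto
qed

text \<open>A discrete Gronwall estimate. Where the foot of a \<open>u\<close>-step is negative,
  \<open>U\<close> is not estimated through the continued layer but compared with its value
  \<open>u0\<close> at t = 0, less than \<open>l * d\<close> away in time; this is the origin of
  \<open>Z * l * d\<close>.\<close>

lemma layer_bound:
  assumes d: "0 < d" and Z: "0 \<le> Z" and lip: "\<And>n. n \<le> N \<Longrightarrow> lip_nonneg (U d n) Z \<and> lip_nonneg (V d n) Z"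
  shows "n \<le> N \<Longrightarrow> 0 \<le> t \<Longrightarrow> \<bar>U d n t\<bar> \<le> exp (lf * (real n * d)) * (K0 + Z * l * d) \<and> \<bar>V d n t\<bar> \<le> exp (lf * (real n * d)) * (K0 + Z * l * d)"
proof (induction n arbitrary: t)
  case 0
  have "0 \<le> Z * l * d" using Z l_pos d by simp
  then show ?case using 0 ub_bound[of t] phi_bound[of t] by simp
next
  case (Suc n)
  let ?K = "K0 + Z * l * d" and ?E = "\<lambda>n. exp (lf * (real n * d)) * (K0 + Z * l * d)"
  have K: "0 \<le> ?K" using K00 Z l_pos d by simp
  have E: "?E n + d * (lf * ?E n) \<le> ?E (Suc n)"
    using gronwall_discrete_step[of lf d ?K 0 n] lf0 d K by (simp add: algebra_simps)
  have ge: "?K \<le> ?E (Suc n)"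
    using mult_right_mono[OF one_le_exp_iff[THEN iffD2, of "lf * (real (Suc n) * d)"] K] lf0 d by simp
  have IH: "\<bar>U d n s\<bar> \<le> ?E n" "\<bar>V d n s\<bar> \<le> ?E n" if "0 \<le> s" for s
    using Suc.IH[of s] Suc.prems that by auto
  have P: "\<bar>d * Pu x (U d n t) (V d n t)\<bar> \<le> d * (lf * ?E n)" "\<bar>d * Pv x (U d n t) (V d n t)\<bar> \<le> d * (lf * ?E n)" for x
    using IH[OF Suc.prems(2)] lf0 d
    by (auto simp: abs_mult intro!: mult_left_mono order_trans[OF growth(1)] order_trans[OF growth(2)])
  have "\<bar>U d (Suc n) t\<bar> \<le> ?E (Suc n)"
  proof (cases "0 \<le> t - 1 * d * Mu (real n * d) (U d n t) (V d n t)")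
    case True
    have "\<bar>U d (Suc n) t\<bar> \<le> ?E n + d * (lf * ?E n)"
      unfolding U_Suc extend_linear_nonneg[OF True] using IH(1)[OF True] P(1)[of "real n * d"] by linarith
    then show ?thesis using E by linarith
  next
    case False
    have "d * Mu (real n * d) (U d n t) (V d n t) \<le> d * l" using Mu_bounds d by (intro mult_left_mono) auto
    then have "t \<le> l * d" using False by (simp add: mult.commute)
    then have "Z * t \<le> Z * (l * d)" using Z by (rule mult_left_mono)
    then have "\<bar>U d (Suc n) t - U d (Suc n) 0\<bar> \<le> Z * l * d"
      using lip_nonnegD[of "U d (Suc n)" Z t 0] lip[OF Suc.prems(1)] Suc.prems(2) by (simp add: mult.assoc)
    then have "\<bar>U d (Suc n) t\<bar> \<le> ?K" using u0_bound[of "real (Suc n) * d"] unfolding U_at_0[OF d] by linarith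
    then show ?thesis using ge by linarith
  qed
  moreover have "\<bar>V d (Suc n) t\<bar> \<le> ?E (Suc n)"
  proof -
    have nn: "0 \<le> t - (-1) * d * Mv (real n * d) (U d n t) (V d n t)"
      using Suc.prems(2) d Mv_bounds(1) by simp
    have "\<bar>V d (Suc n) t\<bar> \<le> ?E n + d * (lf * ?E n)"
      unfolding V_Suc extend_linear_nonneg[OF nn] using IH(2)[OF nn] P(2)[of "real n * d"] by linarith
    then show ?thesis using E by linarith
  qed
  ultimately show ?case by blast
qed

text \<open>\<open>E Z\<close> is a Lipschitz constant in (x, t) of the coefficients evaluated along
  the layers, which vary at rate \<open>Z * l + Pm\<close> in x and \<open>Z\<close> in t;
  \<open>Cc Z\<close> is the constant that \<open>multi_step_consistency\<close> makes of
  it.\<close>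

definition "E Z = A * (1 + 2 * (Z * l + Pm) + 2 * Z)"
definition "Cc Z = (Z + 1) * (E Z * (1 + l))"

lemma E_nonneg: "0 \<le> Z \<Longrightarrow> 0 \<le> E Z" using A0 l_pos Pm0 by (simp add: E_def)

lemma layer_consistent:
  assumes d: "0 < d" and Z0: "0 \<le> Z" and lip: "\<And>n. n \<le> N \<Longrightarrow> lip_nonneg (U d n) Z \<and> lip_nonneg (V d n) Z"
    and sl: "\<And>n. n < N \<Longrightarrow> \<bar>sl d n\<bar> \<le> Z"
    and nk: "n + k \<le> N" and t: "0 \<le> t"
  shows "l * (real k * d) \<le> t \<Longrightarrow>
      \<bar>U d (n + k) t - U d n (t - 1 * (real k * d) * Mu (real n * d) (U d n t) (V d n t)) - 1 * (real k * d) * Pu (real n * d) (U d n t) (V d n t)\<bar>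
      \<le> Cc Z * (real k * d)\<^sup>2" (is "_ \<Longrightarrow> ?u")
    and "\<bar>V d (n + k) t - V d n (t - (-1) * (real k * d) * Mv (real n * d) (U d n t) (V d n t)) - (-1) * (real k * d) * Pv (real n * d) (U d n t) (V d n t)\<bar>
      \<le> Cc Z * (real k * d)\<^sup>2" (is ?v)
proof -
  have xs: "\<bar>U d (n + k) t - U d n t\<bar> \<le> (Z * l + Pm) * (real k * d) \<and> \<bar>V d (n + k) t - V d n t\<bar> \<le> (Z * l + Pm) * (real k * d)"
    if "n + k \<le> N" "0 \<le> t" for n k t
    using that(1)
  proof (induction k)
    case (Suc k)
    have *: "(Z * l + Pm) * (real (Suc k) * d) = (Z * l + Pm) * (real k * d) + (Z * l + Pm) * d" by (simp add: algebra_simps)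
    have "\<bar>U d (n + Suc k) t - U d (n + k) t\<bar> \<le> (Z * l + Pm) * d" "\<bar>V d (n + Suc k) t - V d (n + k) t\<bar> \<le> (Z * l + Pm) * d"
      using layer_x_step[OF d Z0 sl _ _ that(2), of "n + k"] lip[of "n + k"] Suc.prems by simp_all
    moreover have "\<bar>U d (n + k) t - U d n t\<bar> \<le> (Z * l + Pm) * (real k * d)" "\<bar>V d (n + k) t - V d n t\<bar> \<le> (Z * l + Pm) * (real k * d)"
      using Suc by simp_all
    ultimately show ?case unfolding * by linarith
  qed simp
  have FL: "\<bar>F (real (n + k) * d) (U d (n + k) t') (V d (n + k) t') - F (real n * d) (U d n t) (V d n t)\<bar> \<le> E Z * (real k * d + \<bar>t' - t\<bar>)"
    if F: "F \<in> {Mu, Mv, Pu, Pv}" and nk: "n + k \<le> N" "0 \<le> t" "0 \<le> t'" for F n k t t'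
  proof -
    let ?X = "Z * l + Pm" and ?s = "\<bar>t' - t\<bar>"
    have kd: "0 \<le> real k * d" using d by simp
    have X0: "0 \<le> ?X" using Z0 l_pos Pm0 by simp
    have a: "\<bar>U d (n + k) t' - U d n t\<bar> \<le> ?X * (real k * d) + Z * ?s" and b: "\<bar>V d (n + k) t' - V d n t\<bar> \<le> ?X * (real k * d) + Z * ?s"
      using xs[OF nk(1,3)] lip_nonnegD[of "U d n" Z t' t] lip_nonnegD[of "V d n" Z t' t] lip[of n] nk by auto
    have c: "\<bar>real (n + k) * d - real n * d\<bar> = real k * d" using d by (simp add: algebra_simps)
    have "A * (\<bar>real (n + k) * d - real n * d\<bar> + \<bar>U d (n + k) t' - U d n t\<bar> + \<bar>V d (n + k) t' - V d n t\<bar>)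
      \<le> A * ((1 + 2 * ?X + 2 * Z) * (real k * d + ?s))"
    proof (intro mult_left_mono A0)
      have aux: "kk + p + q \<le> (1 + 2 * x + 2 * z) * (kk + s)"
        if "p \<le> x * kk + z * s" "q \<le> x * kk + z * s" "0 \<le> x * s" "0 \<le> z * kk" "0 \<le> s" for kk p q x z s :: real
        using that by (simp add: algebra_simps)
      show "\<bar>real (n + k) * d - real n * d\<bar> + \<bar>U d (n + k) t' - U d n t\<bar> + \<bar>V d (n + k) t' - V d n t\<bar> \<le> (1 + 2 * ?X + 2 * Z) * (real k * d + ?s)"
        unfolding c by (rule aux[OF a b]) (use X0 Z0 kd in simp_all)
    qed
    then show ?thesis using lipA[OF F] order_trans unfolding E_def by (simp only: mult.assoc) blast
  qed
  have Mu0: "0 \<le> Mu x a b" for x a b using Mu_bounds(1)[of x a b] m0 by linarith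
  show ?u if "l * (real k * d) \<le> t"
    unfolding Cc_def
  proof (rule multi_step_consistency[where f = "U d" and M = "\<lambda>n t. Mu (real n * d) (U d n t) (V d n t)"
        and P = "\<lambda>n t. Pu (real n * d) (U d n t) (V d n t)" and N = N])
    show "U d (Suc n) t = U d n (t - 1 * d * Mu (real n * d) (U d n t) (V d n t)) + 1 * d * Pu (real n * d) (U d n t) (V d n t)"
      if "0 \<le> t - 1 * d * Mu (real n * d) (U d n t) (V d n t)" for n t
      unfolding U_Suc extend_linear_nonneg[OF that] ..
  qed (use d Z0 E_nonneg lip nk t that Mu0 Mu_bounds FL in auto)
  show ?v
    unfolding Cc_def
  proof (rule multi_step_consistency[where f = "V d" and M = "\<lambda>n t. Mv (real n * d) (U d n t) (V d n t)"
        and P = "\<lambda>n t. Pv (real n * d) (U d n t) (V d n t)" and N = N])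
    show "V d (Suc n) t = V d n (t - (-1) * d * Mv (real n * d) (U d n t) (V d n t)) + (-1) * d * Pv (real n * d) (U d n t) (V d n t)"
      if "0 \<le> t - (-1) * d * Mv (real n * d) (U d n t) (V d n t)" for n t
      unfolding V_Suc extend_linear_nonneg[OF that] ..
  qed (use d Z0 E_nonneg lip nk t Mv_bounds FL in auto)
qed

section \<open>Comparison of meshes and passage to the limit\<close>

text \<open>Two families that are consistent up to \<open>h\<^sup>2\<close> per step of length \<open>h\<close> stay \<open>O(h)\<close> close. In the layer
  \<open>t < l h\<close>, where the backward characteristic may leave the domain, both are within \<open>O(h)\<close> of the
  common boundary value; this error is not accumulated.\<close>

lemma consistent_families_close:
  fixes u v u' v' :: "nat \<Rightarrow> real \<Rightarrow> real"
  assumes h: "0 < h" and Z: "0 \<le> Z" and C: "0 \<le> C"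
    and lip: "\<And>n. n \<le> N \<Longrightarrow> lip_nonneg (u n) Z \<and> lip_nonneg (v n) Z \<and> lip_nonneg (u' n) Z"
    and b: "\<And>n. n \<le> N \<Longrightarrow> u n 0 = u' n 0"
    and i: "\<And>t. 0 \<le> t \<Longrightarrow> u 0 t = u' 0 t \<and> v 0 t = v' 0 t"
    and cu: "\<And>n t. n < N \<Longrightarrow> l * h \<le> t \<Longrightarrow> \<bar>u (Suc n) t - u n (t - h * Mu (real n * h) (u n t) (v n t)) - h * Pu (real n * h) (u n t) (v n t)\<bar> \<le> C * h\<^sup>2"
    and cv: "\<And>n t. n < N \<Longrightarrow> 0 \<le> t \<Longrightarrow> \<bar>v (Suc n) t - v n (t + h * Mv (real n * h) (u n t) (v n t)) + h * Pv (real n * h) (u n t) (v n t)\<bar> \<le> C * h\<^sup>2"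
    and cu': "\<And>n t. n < N \<Longrightarrow> l * h \<le> t \<Longrightarrow> \<bar>u' (Suc n) t - u' n (t - h * Mu (real n * h) (u' n t) (v' n t)) - h * Pu (real n * h) (u' n t) (v' n t)\<bar> \<le> C * h\<^sup>2"
    and cv': "\<And>n t. n < N \<Longrightarrow> 0 \<le> t \<Longrightarrow> \<bar>v' (Suc n) t - v' n (t + h * Mv (real n * h) (u' n t) (v' n t)) + h * Pv (real n * h) (u' n t) (v' n t)\<bar> \<le> C * h\<^sup>2"
  shows "n \<le> N \<Longrightarrow> 0 \<le> t \<Longrightarrow>
    \<bar>u n t - u' n t\<bar> \<le> exp (2 * A * (Z + 1) * (real n * h)) * (2 * Z * l * h + real n * (2 * C * h\<^sup>2)) \<and>
    \<bar>v n t - v' n t\<bar> \<le> exp (2 * A * (Z + 1) * (real n * h)) * (2 * Z * l * h + real n * (2 * C * h\<^sup>2))"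
proof (induction n arbitrary: t)
  case 0
  have "0 \<le> 2 * Z * l * h" using Z l_pos h by simp
  then show ?case using i[of t] 0 by simp
next
  case (Suc n)
  \<comment> \<open>The coefficients of the two families differ by at most
    \<open>2 * A * ?e n\<close>; through the foot this counts with factor \<open>Z\<close>, through
    the source with factor 1.\<close>
  let ?K = "2 * A * (Z + 1)"
  let ?e = "\<lambda>n. exp (?K * (real n * h)) * (2 * Z * l * h + real n * (2 * C * h\<^sup>2))"
  have K: "0 \<le> ?K" using A0 Z by simp
  have nz: "0 \<le> 2 * Z * l * h" "0 \<le> 2 * C * h\<^sup>2" using Z l_pos h C by simp_all
  have n0: "0 \<le> 2 * Z * l * h + real i * (2 * C * h\<^sup>2)" for i
    using nz(1) mult_nonneg_nonneg[OF of_nat_0_le_iff nz(2), of i] by linarith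
  have e0: "0 \<le> ?e n" using n0[of n] by (intro mult_nonneg_nonneg) simp_all
  have step: "(1 + h * ?K) * ?e n + 2 * C * h\<^sup>2 \<le> ?e (Suc n)"
    using gronwall_discrete_step[of ?K h "2 * Z * l * h" "2 * C * h\<^sup>2" n] K h nz by simp
  have IH: "\<bar>u n s - u' n s\<bar> \<le> ?e n" "\<bar>v n s - v' n s\<bar> \<le> ?e n" if "0 \<le> s" for s
    using Suc.IH[of s] Suc.prems that by auto
  have t: "0 \<le> t" and n: "n < N" using Suc.prems by auto
  have FF: "h * \<bar>F (real n * h) (u n t) (v n t) - F (real n * h) (u' n t) (v' n t)\<bar> \<le> h * (2 * A * ?e n)" if "F \<in> {Mu, Mv, Pu, Pv}" for F
  proof -
    have "\<bar>F (real n * h) (u n t) (v n t) - F (real n * h) (u' n t) (v' n t)\<bar> \<le>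
      A * (\<bar>real n * h - real n * h\<bar> + \<bar>u n t - u' n t\<bar> + \<bar>v n t - v' n t\<bar>)" by (rule lipA[OF that])
    also have "\<dots> \<le> A * (0 + ?e n + ?e n)" using IH[OF t] A0 by (intro mult_left_mono add_mono) auto
    finally show ?thesis using h by (intro mult_left_mono) auto
  qed
  have gen: "\<bar>w - w'\<bar> \<le> ?e (Suc n)"
    if f: "lip_nonneg f Z" and ff: "\<And>s. 0 \<le> s \<Longrightarrow> \<bar>f s - f' s\<bar> \<le> ?e n" and sg: "\<bar>s\<bar> = 1"
      and cw: "\<bar>w - f (t - s * h * M) - s * h * P\<bar> \<le> C * h\<^sup>2" and cw': "\<bar>w' - f' (t - s * h * M') - s * h * P'\<bar> \<le> C * h\<^sup>2"
      and MM: "h * \<bar>M - M'\<bar> \<le> h * (2 * A * ?e n)" and PP: "h * \<bar>P - P'\<bar> \<le> h * (2 * A * ?e n)"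
      and nn: "0 \<le> t - s * h * M" "0 \<le> t - s * h * M'"
    for f f' s w w' M M' P P'
  proof -
    have eqM: "\<bar>(t - s * h * M) - (t - s * h * M')\<bar> = h * \<bar>M - M'\<bar>"
    proof -
      have "(t - s * h * M) - (t - s * h * M') = - (s * h * (M - M'))" by (simp add: algebra_simps)
      then show ?thesis using sg h by (simp add: abs_mult)
    qed
    have eqP: "\<bar>s * h * P - s * h * P'\<bar> = h * \<bar>P - P'\<bar>"
      using sg h by (simp add: right_diff_distrib[symmetric] abs_mult)
    have "\<bar>f (t - s * h * M) - f (t - s * h * M')\<bar> \<le> Z * (h * \<bar>M - M'\<bar>)"
      using lip_nonnegD[OF f nn] unfolding eqM .
    also have "\<dots> \<le> Z * (h * (2 * A * ?e n))" using MM Z by (rule mult_left_mono)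
    finally have 1: "\<bar>f (t - s * h * M) - f (t - s * h * M')\<bar> \<le> Z * (h * (2 * A * ?e n))" .
    have "(1 + h * ?K) * ?e n + 2 * C * h\<^sup>2 = C * h\<^sup>2 + C * h\<^sup>2 + Z * (h * (2 * A * ?e n)) + ?e n + h * (2 * A * ?e n)"
      by (simp add: algebra_simps)
    then have sm: "C * h\<^sup>2 + C * h\<^sup>2 + Z * (h * (2 * A * ?e n)) + ?e n + h * (2 * A * ?e n) \<le> ?e (Suc n)"
      using step by linarith
    have tri: "\<bar>w - w'\<bar> \<le> T" if "\<bar>w - a - p\<bar> \<le> c" "\<bar>w' - a' - p'\<bar> \<le> c" "\<bar>a - b\<bar> \<le> z" "\<bar>b - a'\<bar> \<le> e"
      "\<bar>p - p'\<bar> \<le> r" "c + c + z + e + r \<le> T" for w w' a a' b p p' c z e r T :: real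
      using that by linarith
    show ?thesis by (rule tri[OF cw cw' 1 ff[OF nn(2)] PP[folded eqP] sm])
  qed
  have "\<bar>u (Suc n) t - u' (Suc n) t\<bar> \<le> ?e (Suc n)"
  proof (cases "l * h \<le> t")
    case True
    have hM: "h * Mu x a b \<le> t" for x a b
    proof -
      have "h * Mu x a b \<le> h * l" using Mu_bounds h by (intro mult_left_mono) auto
      then show ?thesis using True by (simp add: mult.commute)
    qed
    show ?thesis
      using lip[of n] n IH(1) cu[OF n True] cu'[OF n True] hM FF
      by (intro gen[where s = 1 and f = "u n" and f' = "u' n" and M = "Mu (real n * h) (u n t) (v n t)" and M' = "Mu (real n * h) (u' n t) (v' n t)"
          and P = "Pu (real n * h) (u n t) (v n t)" and P' = "Pu (real n * h) (u' n t) (v' n t)"]) auto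
  next
    case False
    then have "Z * t \<le> Z * (l * h)" using Z by (intro mult_left_mono) auto
    then have zt: "Z * t \<le> Z * l * h" by (simp add: mult.assoc)
    have "\<bar>u (Suc n) t - u (Suc n) 0\<bar> \<le> Z * t" "\<bar>u' (Suc n) t - u' (Suc n) 0\<bar> \<le> Z * t"
      using lip[OF Suc.prems(1)] lip_nonnegD[of _ Z t 0] t by auto
    then have "\<bar>u (Suc n) t - u' (Suc n) t\<bar> \<le> 2 * Z * l * h" using b[OF Suc.prems(1)] zt by linarith
    also have "\<dots> \<le> 1 * (2 * Z * l * h + real (Suc n) * (2 * C * h\<^sup>2))" using nz by simp
    also have "\<dots> \<le> ?e (Suc n)"
    proof (rule mult_right_mono)
      show "1 \<le> exp (?K * (real (Suc n) * h))" using K h by simp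
    qed (rule n0)
    finally show ?thesis .
  qed
  moreover have "\<bar>v (Suc n) t - v' (Suc n) t\<bar> \<le> ?e (Suc n)"
  proof -
    have hM: "0 \<le> h * Mv x a b" for x a b using Mv_bounds h by simp
    show ?thesis
      using lip[of n] n IH(2) cv[OF n t] cv'[OF n t] hM FF t
      by (intro gen[where s = "-1" and f = "v n" and f' = "v' n" and M = "Mv (real n * h) (u n t) (v n t)" and M' = "Mv (real n * h) (u' n t) (v' n t)"
          and P = "Pv (real n * h) (u n t) (v n t)" and P' = "Pv (real n * h) (u' n t) (v' n t)"]) auto
  qed
  ultimately show ?case by blast
qed

text \<open>Control up to \<open>X\<close>, uniform over all sufficiently fine dyadic meshes. Slopes
  are included only for steps that end within \<open>X\<close>.\<close>

definition good :: "real \<Rightarrow> real \<Rightarrow> nat \<Rightarrow> bool" where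
  "good X Z k0 \<longleftrightarrow> 0 \<le> Z \<and> (\<forall>k\<ge>k0.
    (\<forall>n. real n / 2 ^ k \<le> X \<longrightarrow> lip_nonneg (U (1 / 2 ^ k) n) Z \<and> lip_nonneg (V (1 / 2 ^ k) n) Z) \<and>
    (\<forall>n. real (Suc n) / 2 ^ k \<le> X \<longrightarrow> \<bar>sl (1 / 2 ^ k) n\<bar> \<le> Z))"

text \<open>The differential equations are expressed by first order expansions in \<open>x\<close> with quadratic error. The one
  for \<open>u\<close> is restricted to \<open>t > l h\<close>, where the foot of the step cannot leave the domain.\<close>

definition limit_solution :: "real \<Rightarrow> real \<Rightarrow> (real \<Rightarrow> real \<Rightarrow> real) \<Rightarrow> (real \<Rightarrow> real \<Rightarrow> real) \<Rightarrow> bool" where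
  "limit_solution X Z u v \<longleftrightarrow>
    (\<forall>x\<in>{0..X}. \<forall>y\<in>{0..X}. \<forall>t\<ge>0. \<forall>s\<ge>0.
      \<bar>u x t - u y s\<bar> \<le> (Z * l + Pm) * \<bar>x - y\<bar> + Z * \<bar>t - s\<bar> \<and> \<bar>v x t - v y s\<bar> \<le> (Z * l + Pm) * \<bar>x - y\<bar> + Z * \<bar>t - s\<bar>) \<and>
    (\<forall>x\<in>{0..X}. u x 0 = u0 x) \<and> (\<forall>t\<ge>0. u 0 t = ub t \<and> v 0 t = phi t) \<and>
    (\<forall>x\<in>{0..X}. \<forall>t\<ge>0. max \<bar>u x t\<bar> \<bar>v x t\<bar> \<le> exp (lf * x) * K0) \<and>
    (\<forall>x h t. 0 \<le> x \<longrightarrow> 0 \<le> h \<longrightarrow> x + h \<le> X \<longrightarrow> l * h < t \<longrightarrow>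
      \<bar>u (x + h) t - u x (t - 1 * h * Mu x (u x t) (v x t)) - 1 * h * Pu x (u x t) (v x t)\<bar> \<le> Cc Z * h\<^sup>2) \<and>
    (\<forall>x h t. 0 \<le> x \<longrightarrow> 0 \<le> h \<longrightarrow> x + h \<le> X \<longrightarrow> 0 \<le> t \<longrightarrow>
      \<bar>v (x + h) t - v x (t - (-1) * h * Mv x (u x t) (v x t)) - (-1) * h * Pv x (u x t) (v x t)\<bar> \<le> Cc Z * h\<^sup>2)"

lemma limit_solutionD:
  assumes "limit_solution X Z u v"
  shows "x \<in> {0..X} \<Longrightarrow> y \<in> {0..X} \<Longrightarrow> 0 \<le> t \<Longrightarrow> 0 \<le> s \<Longrightarrow> \<bar>u x t - u y s\<bar> \<le> (Z * l + Pm) * \<bar>x - y\<bar> + Z * \<bar>t - s\<bar>"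
    and "x \<in> {0..X} \<Longrightarrow> y \<in> {0..X} \<Longrightarrow> 0 \<le> t \<Longrightarrow> 0 \<le> s \<Longrightarrow> \<bar>v x t - v y s\<bar> \<le> (Z * l + Pm) * \<bar>x - y\<bar> + Z * \<bar>t - s\<bar>"
    and "x \<in> {0..X} \<Longrightarrow> u x 0 = u0 x" and "0 \<le> t \<Longrightarrow> u 0 t = ub t \<and> v 0 t = phi t"
    and "x \<in> {0..X} \<Longrightarrow> 0 \<le> t \<Longrightarrow> max \<bar>u x t\<bar> \<bar>v x t\<bar> \<le> exp (lf * x) * K0"
    and "0 \<le> x \<Longrightarrow> 0 \<le> h \<Longrightarrow> x + h \<le> X \<Longrightarrow> l * h < t \<Longrightarrow>
      \<bar>u (x + h) t - u x (t - 1 * h * Mu x (u x t) (v x t)) - 1 * h * Pu x (u x t) (v x t)\<bar> \<le> Cc Z * h\<^sup>2"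
    and "0 \<le> x \<Longrightarrow> 0 \<le> h \<Longrightarrow> x + h \<le> X \<Longrightarrow> 0 \<le> t \<Longrightarrow>
      \<bar>v (x + h) t - v x (t - (-1) * h * Mv x (u x t) (v x t)) - (-1) * h * Pv x (u x t) (v x t)\<bar> \<le> Cc Z * h\<^sup>2"
proof -
  note c1 = assms[unfolded limit_solution_def]
  note c2 = c1[THEN conjunct2] note c3 = c2[THEN conjunct2] note c4 = c3[THEN conjunct2] note c5 = c4[THEN conjunct2]
  note r = c1[THEN conjunct1, rule_format, THEN conjunct1] c1[THEN conjunct1, rule_format, THEN conjunct2]
    c2[THEN conjunct1, rule_format] c3[THEN conjunct1, rule_format] c4[THEN conjunct1, rule_format]
    c5[THEN conjunct1, rule_format] c5[THEN conjunct2, rule_format]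
  show "x \<in> {0..X} \<Longrightarrow> y \<in> {0..X} \<Longrightarrow> 0 \<le> t \<Longrightarrow> 0 \<le> s \<Longrightarrow> \<bar>u x t - u y s\<bar> \<le> (Z * l + Pm) * \<bar>x - y\<bar> + Z * \<bar>t - s\<bar>" by (rule r(1))
  show "x \<in> {0..X} \<Longrightarrow> y \<in> {0..X} \<Longrightarrow> 0 \<le> t \<Longrightarrow> 0 \<le> s \<Longrightarrow> \<bar>v x t - v y s\<bar> \<le> (Z * l + Pm) * \<bar>x - y\<bar> + Z * \<bar>t - s\<bar>" by (rule r(2))
  show "x \<in> {0..X} \<Longrightarrow> u x 0 = u0 x" by (rule r(3))
  show "0 \<le> t \<Longrightarrow> u 0 t = ub t \<and> v 0 t = phi t" by (rule r(4))
  show "x \<in> {0..X} \<Longrightarrow> 0 \<le> t \<Longrightarrow> max \<bar>u x t\<bar> \<bar>v x t\<bar> \<le> exp (lf * x) * K0" by (rule r(5))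
  show "0 \<le> x \<Longrightarrow> 0 \<le> h \<Longrightarrow> x + h \<le> X \<Longrightarrow> l * h < t \<Longrightarrow>
      \<bar>u (x + h) t - u x (t - 1 * h * Mu x (u x t) (v x t)) - 1 * h * Pu x (u x t) (v x t)\<bar> \<le> Cc Z * h\<^sup>2" by (rule r(6))
  show "0 \<le> x \<Longrightarrow> 0 \<le> h \<Longrightarrow> x + h \<le> X \<Longrightarrow> 0 \<le> t \<Longrightarrow>
      \<bar>v (x + h) t - v x (t - (-1) * h * Mv x (u x t) (v x t)) - (-1) * h * Pv x (u x t) (v x t)\<bar> \<le> Cc Z * h\<^sup>2" by (rule r(7))
qed

lemma Cc_nonneg: "0 \<le> Z \<Longrightarrow> 0 \<le> Cc Z"
  using E_nonneg[of Z] l_pos by (simp add: Cc_def)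

lemma tendsto_coeff:
  assumes F: "F \<in> {Mu, Mv, Pu, Pv}" and "(a \<longlongrightarrow> a') G" "(b \<longlongrightarrow> b') G" "(c \<longlongrightarrow> c') G"
  shows "((\<lambda>k. F (a k) (b k) (c k)) \<longlongrightarrow> F a' b' c') G"
proof -
  have "((\<lambda>k. F (a k) (b k) (c k) - F a' b' c') \<longlongrightarrow> 0) G"
  proof (rule Lim_null_comparison)
    show "\<forall>\<^sub>F k in G. norm (F (a k) (b k) (c k) - F a' b' c') \<le> A * (\<bar>a k - a'\<bar> + \<bar>b k - b'\<bar> + \<bar>c k - c'\<bar>)"
      using lipA[OF F] by (intro always_eventually allI) simp
    have "((\<lambda>k. A * (\<bar>a k - a'\<bar> + \<bar>b k - b'\<bar> + \<bar>c k - c'\<bar>)) \<longlongrightarrow> A * (\<bar>a' - a'\<bar> + \<bar>b' - b'\<bar> + \<bar>c' - c'\<bar>)) G"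
      by (intro tendsto_intros assms)
    then show "((\<lambda>k. A * (\<bar>a k - a'\<bar> + \<bar>b k - b'\<bar> + \<bar>c k - c'\<bar>)) \<longlongrightarrow> 0) G" by simp
  qed
  then show ?thesis by (simp add: LIM_zero_iff)
qed

text \<open>Every 2^j-th layer of the finer scheme forms a family of step 1/2^k that is consistent
  with the same constant by \<open>layer_consistent\<close>, so both meshes fit
  \<open>consistent_families_close\<close>.\<close>

lemma schemes_close:
  assumes good: "good X Z k0" and X: "X \<le> 1" and k: "k0 \<le> k" and n: "real n / 2 ^ k \<le> X" and t: "0 \<le> t"
  shows "\<bar>U (1 / 2 ^ k) n t - U (1 / 2 ^ (k + j)) (2 ^ j * n) t\<bar> \<le> exp (2 * A * (Z + 1)) * (2 * Z * l + 2 * Cc Z) / 2 ^ k \<and>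
    \<bar>V (1 / 2 ^ k) n t - V (1 / 2 ^ (k + j)) (2 ^ j * n) t\<bar> \<le> exp (2 * A * (Z + 1)) * (2 * Z * l + 2 * Cc Z) / 2 ^ k"
proof -
  let ?h = "1 / 2 ^ k :: real" and ?d = "1 / 2 ^ (k + j) :: real"
  have Z: "0 \<le> Z" using good by (simp add: good_def)
  have C: "0 \<le> Cc Z" using Cc_nonneg[OF Z] .
  have h: "0 < ?h" "0 < ?d" by simp_all
  have dh: "real (2 ^ j) * ?d = ?h" by (simp add: power_add)
  have idx: "real (2 ^ j * i) * ?d = real i * ?h" for i by (simp add: power_add)
  have g1: "lip_nonneg (U ?h i) Z \<and> lip_nonneg (V ?h i) Z" if "i \<le> n" for i
  proof -
    have "real i / 2 ^ k \<le> X" by (rule order_trans[OF _ n]) (simp add: that divide_right_mono)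
    then show ?thesis using good k by (simp add: good_def)
  qed
  have g2: "\<bar>sl ?h i\<bar> \<le> Z" if "i < n" for i
  proof -
    have "real (Suc i) / 2 ^ k \<le> X" by (rule order_trans[OF _ n]) (use that in \<open>simp add: divide_right_mono\<close>)
    then show ?thesis using good k by (simp add: good_def)
  qed
  have nX: "real (2 ^ j * n) / 2 ^ (k + j) \<le> X" using n by (simp add: power_add)
  have g3: "lip_nonneg (U ?d i) Z \<and> lip_nonneg (V ?d i) Z" if "i \<le> 2 ^ j * n" for i
  proof -
    have "real i / 2 ^ (k + j) \<le> X"
      by (rule order_trans[OF divide_right_mono nX]) (use that of_nat_mono in \<open>auto simp del: of_nat_mult\<close>)
    then show ?thesis using good k by (simp add: good_def)
  qed
  have g4: "\<bar>sl ?d i\<bar> \<le> Z" if "i < 2 ^ j * n" for i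
  proof -
    have "Suc i \<le> 2 ^ j * n" using that by simp
    then have "real (Suc i) / 2 ^ (k + j) \<le> X"
      by (intro order_trans[OF divide_right_mono nX]) (use of_nat_mono in \<open>auto simp del: of_nat_mult of_nat_Suc\<close>)
    then show ?thesis using good k by (simp add: good_def)
  qed
  \<comment> \<open>\<open>real n * ?h\<close> is at most 1, so the \<open>n\<close> quadratic
    errors add up to order \<open>?h\<close>.\<close>
  have fin: "exp (2 * A * (Z + 1) * (real n * ?h)) * (2 * Z * l * ?h + real n * (2 * Cc Z * ?h\<^sup>2))
      \<le> exp (2 * A * (Z + 1)) * (2 * Z * l + 2 * Cc Z) / 2 ^ k"
  proof -
    have nh: "real n * ?h \<le> 1" using order_trans[OF n X] by simp
    have "2 * Z * l * ?h + real n * (2 * Cc Z * ?h\<^sup>2) = (2 * Z * l + 2 * Cc Z * (real n * ?h)) * ?h"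
      by (simp add: power2_eq_square algebra_simps)
    also have "\<dots> \<le> (2 * Z * l + 2 * Cc Z) * ?h"
    proof (rule mult_right_mono)
      show "2 * Z * l + 2 * Cc Z * (real n * ?h) \<le> 2 * Z * l + 2 * Cc Z"
        using mult_left_mono[OF nh, of "2 * Cc Z"] C by simp
    qed simp
    finally have 1: "2 * Z * l * ?h + real n * (2 * Cc Z * ?h\<^sup>2) \<le> (2 * Z * l + 2 * Cc Z) * ?h" .
    have 2: "exp (2 * A * (Z + 1) * (real n * ?h)) \<le> exp (2 * A * (Z + 1))"
      using mult_left_mono[OF nh, of "2 * A * (Z + 1)"] A0 Z by simp
    have 0: "0 \<le> 2 * Z * l * ?h + real n * (2 * Cc Z * ?h\<^sup>2)" using Z C l_pos by simp
    show ?thesis using mult_mono[OF 2 1 _ 0] by (simp add: mult.assoc)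
  qed
  have "\<bar>U ?h n t - U ?d (2 ^ j * n) t\<bar> \<le> exp (2 * A * (Z + 1) * (real n * ?h)) * (2 * Z * l * ?h + real n * (2 * Cc Z * ?h\<^sup>2)) \<and>
    \<bar>V ?h n t - V ?d (2 ^ j * n) t\<bar> \<le> exp (2 * A * (Z + 1) * (real n * ?h)) * (2 * Z * l * ?h + real n * (2 * Cc Z * ?h\<^sup>2))"
  proof (rule consistent_families_close[where u = "U ?h" and v = "V ?h" and u' = "\<lambda>i. U ?d (2 ^ j * i)" and v' = "\<lambda>i. V ?d (2 ^ j * i)" and N = n])
    fix i assume "i \<le> n"
    then have "2 ^ j * i \<le> 2 ^ j * n" by simp
    from g3[OF this] g1[OF \<open>i \<le> n\<close>]
    show "lip_nonneg (U ?h i) Z \<and> lip_nonneg (V ?h i) Z \<and> lip_nonneg (U ?d (2 ^ j * i)) Z" by blast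
    show "U ?h i 0 = U ?d (2 ^ j * i) 0" unfolding U_at_0[OF h(1)] U_at_0[OF h(2)] idx ..
  next
    fix i and s :: real assume i: "i < n" and s: "l * ?h \<le> s"
    have s0: "0 \<le> s" using s l_pos h by (meson less_imp_le mult_nonneg_nonneg order_trans)
    show "\<bar>U ?h (Suc i) s - U ?h i (s - ?h * Mu (real i * ?h) (U ?h i s) (V ?h i s)) - ?h * Pu (real i * ?h) (U ?h i s) (V ?h i s)\<bar> \<le> Cc Z * ?h\<^sup>2"
      using layer_consistent(1)[OF h(1) Z g1 g2, where n = i and k = 1 and t = s] i s s0 by simp
    have i': "2 ^ j * i + 2 ^ j \<le> 2 ^ j * n" using mult_le_mono2[of "Suc i" n "2 ^ j"] i by simp
    show "\<bar>U ?d (2 ^ j * Suc i) s - U ?d (2 ^ j * i) (s - ?h * Mu (real i * ?h) (U ?d (2 ^ j * i) s) (V ?d (2 ^ j * i) s))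
       - ?h * Pu (real i * ?h) (U ?d (2 ^ j * i) s) (V ?d (2 ^ j * i) s)\<bar> \<le> Cc Z * ?h\<^sup>2"
      using layer_consistent(1)[OF h(2) Z g3 g4 i' s0] s unfolding dh idx by (simp add: add.commute)
  next
    fix i and s :: real assume i: "i < n" and s0: "0 \<le> s"
    show "\<bar>V ?h (Suc i) s - V ?h i (s + ?h * Mv (real i * ?h) (U ?h i s) (V ?h i s)) + ?h * Pv (real i * ?h) (U ?h i s) (V ?h i s)\<bar> \<le> Cc Z * ?h\<^sup>2"
      using layer_consistent(2)[OF h(1) Z g1 g2, where n = i and k = 1 and t = s] i s0 by simp
    have i': "2 ^ j * i + 2 ^ j \<le> 2 ^ j * n" using mult_le_mono2[of "Suc i" n "2 ^ j"] i by simp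
    show "\<bar>V ?d (2 ^ j * Suc i) s - V ?d (2 ^ j * i) (s + ?h * Mv (real i * ?h) (U ?d (2 ^ j * i) s) (V ?d (2 ^ j * i) s))
       + ?h * Pv (real i * ?h) (U ?d (2 ^ j * i) s) (V ?d (2 ^ j * i) s)\<bar> \<le> Cc Z * ?h\<^sup>2"
      using layer_consistent(2)[OF h(2) Z g3 g4 i' s0] unfolding dh idx by (simp add: add.commute)
  qed (use h Z C t in simp_all)
  then show ?thesis using fin by linarith
qed

text \<open>Besides the limit, the rate for \<open>V\<close> at mesh points is exported: it
  transfers the identity v(x, 0) = v0 x, known for limits only, back to the layers.\<close>

lemma limit_exists:
  assumes good: "good X Z k0" and X: "0 \<le> X" "X \<le> 1"
  obtains u v D where "limit_solution X Z u v" "0 \<le> D"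
    "\<And>k n t. k0 \<le> k \<Longrightarrow> real n / 2 ^ k \<le> X \<Longrightarrow> 0 \<le> t \<Longrightarrow> \<bar>V (1 / 2 ^ k) n t - v (real n / 2 ^ k) t\<bar> \<le> D / 2 ^ k"
proof -
  have Z: "0 \<le> Z" using good by (simp add: good_def)
  define C where "C = Z * l + Pm"
  have C0: "0 \<le> C" using Z l_pos Pm0 by (simp add: C_def)
  define D0 where "D0 = exp (2 * A * (Z + 1)) * (2 * Z * l + 2 * Cc Z)"
  have D0: "0 \<le> D0" using Z l_pos Cc_nonneg[OF Z] by (simp add: D0_def)
  have gl: "lip_nonneg (U (1 / 2 ^ k) n) Z" "lip_nonneg (V (1 / 2 ^ k) n) Z" if "k0 \<le> k" "real n / 2 ^ k \<le> X" for k n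
    using good that by (auto simp: good_def)
  have gs: "\<bar>sl (1 / 2 ^ k) n\<bar> \<le> Z" if "k0 \<le> k" "real (Suc n) / 2 ^ k \<le> X" for k n
    using good that unfolding good_def by blast
  have xs: "\<bar>U (1 / 2 ^ k) (Suc n) t - U (1 / 2 ^ k) n t\<bar> \<le> C / 2 ^ k \<and> \<bar>V (1 / 2 ^ k) (Suc n) t - V (1 / 2 ^ k) n t\<bar> \<le> C / 2 ^ k"
    if "k0 \<le> k" "real (Suc n) / 2 ^ k \<le> X" "0 \<le> t" for k n t
  proof -
    have "real n / 2 ^ k \<le> X" by (rule order_trans[OF divide_right_mono that(2)]) auto
    then show ?thesis
      using layer_x_step[OF _ Z gs[OF that(1,2)] gl[OF that(1)] that(3)] by (simp add: C_def)
  qed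
  obtain u where u: "\<And>k x t. k0 \<le> k \<Longrightarrow> 0 \<le> x \<Longrightarrow> x \<le> X \<Longrightarrow> 0 \<le> t \<Longrightarrow> \<bar>U (1 / 2 ^ k) (nat \<lfloor>x * 2 ^ k\<rfloor>) t - u x t\<bar> \<le> (C + D0) / 2 ^ k"
    "\<And>x y t s. x \<in> {0..X} \<Longrightarrow> y \<in> {0..X} \<Longrightarrow> 0 \<le> t \<Longrightarrow> 0 \<le> s \<Longrightarrow> \<bar>u x t - u y s\<bar> \<le> C * \<bar>x - y\<bar> + Z * \<bar>t - s\<bar>"
    by (rule mesh_limit[of k0 X "\<lambda>k n. U (1 / 2 ^ k) n" Z C D0])
      (use gl xs schemes_close[OF good X(2)] C0 Z in \<open>auto simp: D0_def\<close>)
  obtain v where v: "\<And>k x t. k0 \<le> k \<Longrightarrow> 0 \<le> x \<Longrightarrow> x \<le> X \<Longrightarrow> 0 \<le> t \<Longrightarrow> \<bar>V (1 / 2 ^ k) (nat \<lfloor>x * 2 ^ k\<rfloor>) t - v x t\<bar> \<le> (C + D0) / 2 ^ k"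
    "\<And>x y t s. x \<in> {0..X} \<Longrightarrow> y \<in> {0..X} \<Longrightarrow> 0 \<le> t \<Longrightarrow> 0 \<le> s \<Longrightarrow> \<bar>v x t - v y s\<bar> \<le> C * \<bar>x - y\<bar> + Z * \<bar>t - s\<bar>"
    by (rule mesh_limit[of k0 X "\<lambda>k n. V (1 / 2 ^ k) n" Z C D0])
      (use gl xs schemes_close[OF good X(2)] C0 Z in \<open>auto simp: D0_def\<close>)
  define ix where "ix = (\<lambda>k (x::real). nat \<lfloor>x * 2 ^ k\<rfloor>)"
  have ix: "real (ix k x) / 2 ^ k \<le> x" "x < real (ix k x) / 2 ^ k + 1 / 2 ^ k" if "0 \<le> x" for k x
  proof -
    have "0 \<le> x * 2 ^ k" using that by simp
    then have "real (ix k x) = of_int \<lfloor>x * 2 ^ k\<rfloor>" unfolding ix_def by (simp add: of_nat_nat)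
    then have "real (ix k x) \<le> x * 2 ^ k" "x * 2 ^ k < real (ix k x) + 1" by linarith+
    then show "real (ix k x) / 2 ^ k \<le> x" "x < real (ix k x) / 2 ^ k + 1 / 2 ^ k"
      by (simp_all add: pos_divide_le_eq pos_less_divide_eq add_divide_distrib[symmetric])
  qed
  have p0: "(\<lambda>k. b / 2 ^ k) \<longlonglongrightarrow> 0" for b :: real
  proof -
    have "(\<lambda>k. b * (1 / 2) ^ k) \<longlonglongrightarrow> b * 0" by (intro tendsto_intros LIMSEQ_power_zero) simp
    then show ?thesis by (simp add: power_one_over)
  qed
  have ixl: "(\<lambda>k. real (ix k x) / 2 ^ k) \<longlonglongrightarrow> x" if "0 \<le> x" for x
  proof (rule tendsto_sandwich)
    show "(\<lambda>k. x - 1 / 2 ^ k) \<longlonglongrightarrow> x" using tendsto_diff[OF tendsto_const p0[of 1], of x] by simp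
    show "\<forall>\<^sub>F k in sequentially. x - 1 / 2 ^ k \<le> real (ix k x) / 2 ^ k"
      using ix(2)[OF that] by (intro always_eventually allI) (simp add: diff_le_eq less_imp_le)
    show "\<forall>\<^sub>F k in sequentially. real (ix k x) / 2 ^ k \<le> x" using ix(1)[OF that] by simp
  qed simp
  have conv: "(\<lambda>k. W (1 / 2 ^ k) (ix k x) (tk k)) \<longlonglongrightarrow> w x t"
    if W: "\<And>k x t. k0 \<le> k \<Longrightarrow> 0 \<le> x \<Longrightarrow> x \<le> X \<Longrightarrow> 0 \<le> t \<Longrightarrow> \<bar>W (1 / 2 ^ k) (nat \<lfloor>x * 2 ^ k\<rfloor>) t - w x t\<bar> \<le> (C + D0) / 2 ^ k"
      "\<And>x y t s. x \<in> {0..X} \<Longrightarrow> y \<in> {0..X} \<Longrightarrow> 0 \<le> t \<Longrightarrow> 0 \<le> s \<Longrightarrow> \<bar>w x t - w y s\<bar> \<le> C * \<bar>x - y\<bar> + Z * \<bar>t - s\<bar>"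
      and x: "0 \<le> x" "x \<le> X" and t: "tk \<longlonglongrightarrow> t" "0 \<le> t" "\<forall>\<^sub>F k in sequentially. 0 \<le> tk k"
    for W :: "real \<Rightarrow> nat \<Rightarrow> real \<Rightarrow> real" and w :: "real \<Rightarrow> real \<Rightarrow> real" and x t tk
  proof -
    have "(\<lambda>k. W (1 / 2 ^ k) (ix k x) (tk k) - w x t) \<longlonglongrightarrow> 0"
    proof (rule Lim_null_comparison)
      show "\<forall>\<^sub>F k in sequentially. norm (W (1 / 2 ^ k) (ix k x) (tk k) - w x t) \<le> (C + D0) / 2 ^ k + Z * \<bar>tk k - t\<bar>"
        using t(3) eventually_ge_at_top[of k0]
      proof eventually_elim
        case (elim k)
        then show ?case using W(1)[of k x "tk k"] W(2)[of x x "tk k" t] x t(2) by (simp add: ix_def)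
      qed
      have "(\<lambda>k. (C + D0) / 2 ^ k + Z * \<bar>tk k - t\<bar>) \<longlonglongrightarrow> 0 + Z * \<bar>t - t\<bar>"
        by (intro tendsto_intros p0 t(1))
      then show "(\<lambda>k. (C + D0) / 2 ^ k + Z * \<bar>tk k - t\<bar>) \<longlonglongrightarrow> 0" by simp
    qed
    then show ?thesis by (simp add: LIM_zero_iff)
  qed
  have convu: "(\<lambda>k. U (1 / 2 ^ k) (ix k x) (tk k)) \<longlonglongrightarrow> u x t"
    if "0 \<le> x" "x \<le> X" "tk \<longlonglongrightarrow> t" "0 \<le> t" "\<forall>\<^sub>F k in sequentially. 0 \<le> tk k" for x t tk
    using conv[of U u x tk t, OF u] that by simp
  have convv: "(\<lambda>k. V (1 / 2 ^ k) (ix k x) (tk k)) \<longlonglongrightarrow> v x t"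
    if "0 \<le> x" "x \<le> X" "tk \<longlonglongrightarrow> t" "0 \<le> t" "\<forall>\<^sub>F k in sequentially. 0 \<le> tk k" for x t tk
    using conv[of V v x tk t, OF v] that by simp
  have convu': "(\<lambda>k. U (1 / 2 ^ k) (ix k x) t) \<longlonglongrightarrow> u x t" and convv': "(\<lambda>k. V (1 / 2 ^ k) (ix k x) t) \<longlonglongrightarrow> v x t"
    if "0 \<le> x" "x \<le> X" "0 \<le> t" for x t
    using convu[of x "\<lambda>_. t" t] convv[of x "\<lambda>_. t" t] that by simp_all
  have u0: "u x 0 = u0 x" if "x \<in> {0..X}" for x
  proof (rule LIMSEQ_unique)
    show "(\<lambda>k. U (1 / 2 ^ k) (ix k x) 0) \<longlonglongrightarrow> u x 0" using that by (intro convu') auto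
    have "continuous_on UNIV u0"
      by (rule lipschitz_on_continuous_on[of L0]) (use u0_lip L00 in \<open>auto intro!: lipschitz_onI simp: dist_real_def\<close>)
    then have "isCont u0 x" by (simp add: continuous_on_eq_continuous_at)
    then have "(\<lambda>k. u0 (real (ix k x) / 2 ^ k)) \<longlonglongrightarrow> u0 x"
      using that by (intro isCont_tendsto_compose[OF _ ixl]) auto
    then show "(\<lambda>k. U (1 / 2 ^ k) (ix k x) 0) \<longlonglongrightarrow> u0 x" by (simp add: U_at_0)
  qed
  have u1: "u 0 t = ub t" and v1: "v 0 t = phi t" if "0 \<le> t" for t
  proof -
    have "ix k 0 = 0" for k by (simp add: ix_def)
    then show "u 0 t = ub t" "v 0 t = phi t"
      using convu'[of 0 t] convv'[of 0 t] X that by (simp_all add: LIMSEQ_const_iff)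
  qed
  have sup: "\<bar>u x t\<bar> \<le> exp (lf * x) * K0 \<and> \<bar>v x t\<bar> \<le> exp (lf * x) * K0" if x: "x \<in> {0..X}" and t: "0 \<le> t" for x t
  proof -
    \<comment> \<open>The bound of \<open>layer_bound\<close> on level k; its excess
      \<open>Z * l * d\<close> disappears with the mesh size.\<close>
    let ?b = "\<lambda>k. exp (lf * (real (ix k x) * (1 / 2 ^ k))) * (K0 + Z * l * (1 / 2 ^ k))"
    have "?b \<longlonglongrightarrow> exp (lf * x) * (K0 + Z * l * 0)"
      using ixl[of x] p0[of 1] x by (intro tendsto_intros) auto
    then have b: "?b \<longlonglongrightarrow> exp (lf * x) * K0" by simp
    have le: "\<bar>U (1 / 2 ^ k) (ix k x) t\<bar> \<le> ?b k \<and> \<bar>V (1 / 2 ^ k) (ix k x) t\<bar> \<le> ?b k" if k: "k0 \<le> k" for k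
    proof (rule layer_bound[of _ _ "ix k x"])
      fix i assume i: "i \<le> ix k x"
      have "real i / 2 ^ k \<le> real (ix k x) / 2 ^ k" using i by (simp add: divide_right_mono)
      also have "\<dots> \<le> X" using ix(1)[of x k] x by simp
      finally show "lip_nonneg (U (1 / 2 ^ k) i) Z \<and> lip_nonneg (V (1 / 2 ^ k) i) Z" using gl[OF k] by blast
    qed (use Z t in simp_all)
    show ?thesis
    proof
      show "\<bar>u x t\<bar> \<le> exp (lf * x) * K0"
        by (rule LIMSEQ_le[OF tendsto_rabs[OF convu'] b]) (use x t le in auto)
      show "\<bar>v x t\<bar> \<le> exp (lf * x) * K0"
        by (rule LIMSEQ_le[OF tendsto_rabs[OF convv'] b]) (use x t le in auto)
    qed
  qed
  have diff_ix: "ix k x + (ix k (x + h) - ix k x) = ix k (x + h)" if "0 \<le> x" "0 \<le> h" for k x h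
  proof -
    have "ix k x \<le> ix k (x + h)" unfolding ix_def using that by (intro nat_mono floor_mono mult_right_mono) auto
    then show ?thesis by simp
  qed
  have hl: "(\<lambda>k. real (ix k (x + h) - ix k x) * (1 / 2 ^ k)) \<longlonglongrightarrow> h" if "0 \<le> x" "0 \<le> h" for x h
  proof -
    have "real (ix k (x + h) - ix k x) * (1 / 2 ^ k) = real (ix k (x + h)) / 2 ^ k - real (ix k x) / 2 ^ k" for k
    proof -
      have "real (ix k (x + h) - ix k x) = real (ix k (x + h)) - real (ix k x)"
        using diff_ix[OF that, of k] by linarith
      then show ?thesis by (simp add: diff_divide_distrib)
    qed
    then show ?thesis using tendsto_diff[OF ixl[of "x + h"] ixl[of x]] that by simp
  qed
  have glN: "lip_nonneg (U (1 / 2 ^ k) i) Z \<and> lip_nonneg (V (1 / 2 ^ k) i) Z" if "k0 \<le> k" "0 \<le> y" "y \<le> X" "i \<le> ix k y" for k y i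
  proof -
    have "real i / 2 ^ k \<le> real (ix k y) / 2 ^ k" using that by (simp add: divide_right_mono)
    also have "\<dots> \<le> X" using ix(1)[of y k] that by simp
    finally show ?thesis using gl[OF that(1)] by blast
  qed
  have gsN: "\<bar>sl (1 / 2 ^ k) i\<bar> \<le> Z" if "k0 \<le> k" "0 \<le> y" "y \<le> X" "i < ix k y" for k y i
  proof -
    have "real (Suc i) / 2 ^ k \<le> real (ix k y) / 2 ^ k" using that by (intro divide_right_mono) auto
    also have "\<dots> \<le> X" using ix(1)[of y k] that by simp
    finally show ?thesis using gs[OF that(1)] by blast
  qed
  have consu: "\<bar>u (x + h) t - u x (t - 1 * h * Mu x (u x t) (v x t)) - 1 * h * Pu x (u x t) (v x t)\<bar> \<le> Cc Z * h\<^sup>2"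
    if xh: "0 \<le> x" "0 \<le> h" "x + h \<le> X" and t: "l * h < t" for x h t
  proof (rule LIMSEQ_le)
    let ?d = "\<lambda>k. 1 / 2 ^ k :: real" and ?i = "\<lambda>k. ix k (x + h) - ix k x"
    let ?hh = "\<lambda>k. real (?i k) * ?d k"
    let ?M = "\<lambda>k. Mu (real (ix k x) * ?d k) (U (?d k) (ix k x) t) (V (?d k) (ix k x) t)"
    let ?P = "\<lambda>k. Pu (real (ix k x) * ?d k) (U (?d k) (ix k x) t) (V (?d k) (ix k x) t)"
    have t0: "0 \<le> t" using t xh l_pos by (meson less_imp_le mult_nonneg_nonneg order_le_less_trans)
    have x': "0 \<le> x" "x \<le> X" using xh by auto
    have ixl': "(\<lambda>k. real (ix k x) * ?d k) \<longlonglongrightarrow> x" using ixl[OF x'(1)] by simp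
    note cv = ixl' convu'[OF x' t0] convv'[OF x' t0]
    have M: "?M \<longlonglongrightarrow> Mu x (u x t) (v x t)" "?P \<longlonglongrightarrow> Pu x (u x t) (v x t)"
      by (rule tendsto_coeff[OF _ cv], simp)+
    have xh0: "0 \<le> x + h" using xh by simp
    have hh: "?hh \<longlonglongrightarrow> h" using hl xh by blast
    \<comment> \<open>Being strict, the inequality \<open>l * h < t\<close> passes to the rounded
      step lengths for large \<open>k\<close>.\<close>
    have ev: "\<forall>\<^sub>F k in sequentially. l * ?hh k < t"
      using order_tendstoD(2)[OF tendsto_mult[OF tendsto_const hh] t] .
    have nn: "0 \<le> t - 1 * s * Mu a b c" if "l * s < t" "0 \<le> s" for s a b c
      using mult_left_mono[OF Mu_bounds(2) that(2), of a b c] that by (simp add: mult.commute)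
    show "(\<lambda>k. \<bar>U (?d k) (ix k (x + h)) t - U (?d k) (ix k x) (t - 1 * ?hh k * ?M k) - 1 * ?hh k * ?P k\<bar>)
      \<longlonglongrightarrow> \<bar>u (x + h) t - u x (t - 1 * h * Mu x (u x t) (v x t)) - 1 * h * Pu x (u x t) (v x t)\<bar>"
    proof (intro tendsto_intros convu' convu hh M)
      show "\<forall>\<^sub>F k in sequentially. 0 \<le> t - 1 * ?hh k * ?M k"
        using ev
      proof eventually_elim
        case (elim k)
        then show ?case by (rule nn) simp
      qed
      show "0 \<le> t - 1 * h * Mu x (u x t) (v x t)" using t xh by (intro nn)
    qed (use xh t0 in auto)
    show "(\<lambda>k. Cc Z * (?hh k)\<^sup>2) \<longlonglongrightarrow> Cc Z * h\<^sup>2" by (intro tendsto_intros hh)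
    have "\<forall>\<^sub>F k in sequentially. \<bar>U (?d k) (ix k (x + h)) t - U (?d k) (ix k x) (t - 1 * ?hh k * ?M k) - 1 * ?hh k * ?P k\<bar> \<le> Cc Z * (?hh k)\<^sup>2"
      using ev eventually_ge_at_top[of k0]
    proof eventually_elim
      case (elim k)
      have "\<bar>U (?d k) (ix k x + ?i k) t - U (?d k) (ix k x) (t - 1 * ?hh k * ?M k) - 1 * ?hh k * ?P k\<bar> \<le> Cc Z * (?hh k)\<^sup>2"
        by (rule layer_consistent(1)[OF _ Z glN[OF elim(2) xh0 xh(3)] gsN[OF elim(2) xh0 xh(3)]
              eq_refl[OF diff_ix[OF xh(1,2)]] t0 less_imp_le[OF elim(1)]]) simp
      then show ?case unfolding diff_ix[OF xh(1,2)] .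
    qed
    then show "\<exists>N. \<forall>k\<ge>N. \<bar>U (?d k) (ix k (x + h)) t - U (?d k) (ix k x) (t - 1 * ?hh k * ?M k) - 1 * ?hh k * ?P k\<bar> \<le> Cc Z * (?hh k)\<^sup>2"
      by (simp add: eventually_sequentially)
  qed
  have consv: "\<bar>v (x + h) t - v x (t - (-1) * h * Mv x (u x t) (v x t)) - (-1) * h * Pv x (u x t) (v x t)\<bar> \<le> Cc Z * h\<^sup>2"
    if xh: "0 \<le> x" "0 \<le> h" "x + h \<le> X" and t0: "0 \<le> t" for x h t
  proof (rule LIMSEQ_le)
    let ?d = "\<lambda>k. 1 / 2 ^ k :: real" and ?i = "\<lambda>k. ix k (x + h) - ix k x"
    let ?hh = "\<lambda>k. real (?i k) * ?d k"
    let ?M = "\<lambda>k. Mv (real (ix k x) * ?d k) (U (?d k) (ix k x) t) (V (?d k) (ix k x) t)"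
    let ?P = "\<lambda>k. Pv (real (ix k x) * ?d k) (U (?d k) (ix k x) t) (V (?d k) (ix k x) t)"
    have x': "0 \<le> x" "x \<le> X" using xh by auto
    have ixl': "(\<lambda>k. real (ix k x) * ?d k) \<longlonglongrightarrow> x" using ixl[OF x'(1)] by simp
    note cv = ixl' convu'[OF x' t0] convv'[OF x' t0]
    have M: "?M \<longlonglongrightarrow> Mv x (u x t) (v x t)" "?P \<longlonglongrightarrow> Pv x (u x t) (v x t)"
      by (rule tendsto_coeff[OF _ cv], simp)+
    have xh0: "0 \<le> x + h" using xh by simp
    have hh: "?hh \<longlonglongrightarrow> h" using hl xh by blast
    have nn: "0 \<le> t - (-1) * s * Mv a b c" if "0 \<le> s" for s a b c
      using mult_nonneg_nonneg[OF that Mv_bounds(1), of a b c] t0 by simp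
    show "(\<lambda>k. \<bar>V (?d k) (ix k (x + h)) t - V (?d k) (ix k x) (t - (-1) * ?hh k * ?M k) - (-1) * ?hh k * ?P k\<bar>)
      \<longlonglongrightarrow> \<bar>v (x + h) t - v x (t - (-1) * h * Mv x (u x t) (v x t)) - (-1) * h * Pv x (u x t) (v x t)\<bar>"
    proof (intro tendsto_intros convv' convv hh M)
      show "\<forall>\<^sub>F k in sequentially. 0 \<le> t - (-1) * ?hh k * ?M k"
        by (intro always_eventually allI nn) simp
      show "0 \<le> t - (-1) * h * Mv x (u x t) (v x t)" using xh by (intro nn)
    qed (use xh t0 in auto)
    show "(\<lambda>k. Cc Z * (?hh k)\<^sup>2) \<longlonglongrightarrow> Cc Z * h\<^sup>2" by (intro tendsto_intros hh)
    have "\<bar>V (?d k) (ix k (x + h)) t - V (?d k) (ix k x) (t - (-1) * ?hh k * ?M k) - (-1) * ?hh k * ?P k\<bar> \<le> Cc Z * (?hh k)\<^sup>2"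
      if "k0 \<le> k" for k
    proof -
      have "\<bar>V (?d k) (ix k x + ?i k) t - V (?d k) (ix k x) (t - (-1) * ?hh k * ?M k) - (-1) * ?hh k * ?P k\<bar> \<le> Cc Z * (?hh k)\<^sup>2"
        by (rule layer_consistent(2)[OF _ Z glN[OF that xh0 xh(3)] gsN[OF that xh0 xh(3)]
              eq_refl[OF diff_ix[OF xh(1,2)]] t0]) simp
      then show ?thesis unfolding diff_ix[OF xh(1,2)] .
    qed
    then show "\<exists>N. \<forall>k\<ge>N. \<bar>V (?d k) (ix k (x + h)) t - V (?d k) (ix k x) (t - (-1) * ?hh k * ?M k) - (-1) * ?hh k * ?P k\<bar> \<le> Cc Z * (?hh k)\<^sup>2"
      by blast
  qed
  have "limit_solution X Z u v"
    unfolding limit_solution_def C_def[symmetric]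
    by (intro conjI ballI allI impI max.boundedI)
      (assumption | rule u(2) v(2) u0 u1 v1 consu consv sup[THEN conjunct1] sup[THEN conjunct2])+
  moreover have "\<bar>V (1 / 2 ^ k) n t - v (real n / 2 ^ k) t\<bar> \<le> (C + D0) / 2 ^ k"
    if "k0 \<le> k" "real n / 2 ^ k \<le> X" "0 \<le> t" for k n t
    using v(1)[OF that(1) _ that(2,3)] by simp
  moreover have "0 \<le> C + D0" using C0 D0 by simp
  ultimately show ?thesis using that by blast
qed

end

section \<open>Riccati majorant and continuation in x\<close>

text \<open>The solution of \<open>y' = g (y + y\<^sup>2)\<close> with \<open>y(0) = exp (- g)\<close>, which stays finite up to \<open>x = 1\<close>;
  in terms of \<open>s = y / (1 + y)\<close> the equation is \<open>s' = g s\<close>.\<close>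

definition riccati :: "real \<Rightarrow> real \<Rightarrow> real" where
  "riccati g x = (let s = exp (g * (x - 1)) / (1 + exp (- g)) in s / (1 - s))"

lemma riccati_arg: "0 \<le> g \<Longrightarrow> x \<le> 1 \<Longrightarrow> 0 < exp (g * (x - 1)) / (1 + exp (- g))"
  "0 \<le> g \<Longrightarrow> x \<le> 1 \<Longrightarrow> exp (g * (x - 1)) / (1 + exp (- g)) < 1" for g x :: real
proof -
  show "0 < exp (g * (x - 1)) / (1 + exp (- g))" by (simp add: add_pos_pos)
  assume "0 \<le> g" "x \<le> 1"
  then have "exp (g * (x - 1)) \<le> 1" by (simp add: mult_nonneg_nonpos)
  also have "\<dots> < 1 + exp (- g)" by simp
  finally show "exp (g * (x - 1)) / (1 + exp (- g)) < 1" by (simp add: add_pos_pos)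
qed

lemma mesh_index_0: "n = 0" if "real n / 2 ^ k \<le> 0"
proof (rule ccontr)
  assume "n \<noteq> 0"
  then have "0 < real n / 2 ^ k" by simp
  then show False using that by linarith
qed

lemma mobius_mono: "s / (1 - s) \<le> s' / (1 - s')" if "s \<le> s'" "s' < 1" for s s' :: real
  using that by (simp add: divide_simps) (simp add: algebra_simps)

lemma riccati_mono: "0 \<le> g \<Longrightarrow> x \<le> y \<Longrightarrow> y \<le> 1 \<Longrightarrow> riccati g x \<le> riccati g y"
  unfolding riccati_def Let_def
  by (intro mobius_mono riccati_arg(2) divide_right_mono) (auto intro: mult_left_mono add_nonneg_nonneg)

lemma riccati_0: "riccati g 0 = exp (- g)"
proof -
  have "a / (1 + a) / (1 - a / (1 + a)) = a" if "0 < a" for a :: real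
    using that by (simp add: field_simps)
  from this[of "exp (- g)"] show ?thesis by (simp add: riccati_def Let_def)
qed

lemma riccati_1: "riccati g 1 = exp g"
proof -
  have "(1 + exp (- g)) \<noteq> 0" by (smt (verit) exp_gt_zero)
  then show ?thesis by (simp add: riccati_def Let_def exp_minus field_simps)
qed

text \<open>An Euler step stays below the exact solution: in the variable s it falls short because
  exp (g d) \<ge> 1 + g d, and s / (1 - s) is convex, so that its tangent lies below it.\<close>

lemma riccati_step:
  assumes g: "0 \<le> g" and d: "0 \<le> d" "x + d \<le> 1"
  shows "riccati g x + d * g * ((riccati g x)\<^sup>2 + riccati g x) \<le> riccati g (x + d)"
proof -
  define s where "s = exp (g * (x - 1)) / (1 + exp (- g))"
  define s' where "s' = exp (g * (x + d - 1)) / (1 + exp (- g))"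
  have s: "0 < s" "s < 1" "s' < 1" unfolding s_def s'_def using riccati_arg[OF g, of x] riccati_arg[OF g d(2)] d by auto
  have "s' = s * exp (g * d)" unfolding s_def s'_def by (simp add: exp_add[symmetric] algebra_simps)
  then have "s * (1 + g * d) \<le> s'" using s exp_ge_add_one_self[of "g * d"] by (simp add: mult_left_mono)
  then have e: "s + s * g * d \<le> s'" by (simp add: algebra_simps)
  let ?e = "s * g * d"
  have e0: "0 \<le> ?e" using s g d by simp
  have p: "0 < 1 - s" "0 < 1 - (s + ?e)" using s e by linarith+
  have "(s + ?e) / (1 - (s + ?e)) - s / (1 - s) = ?e / ((1 - s) * (1 - (s + ?e)))"
    using p by (simp add: diff_frac_eq) (simp add: algebra_simps)
  also have "?e / ((1 - s) * (1 - s)) \<le> ?e / ((1 - s) * (1 - (s + ?e)))"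
    using p e0 by (intro divide_left_mono mult_left_mono mult_pos_pos) auto
  finally have "s / (1 - s) + ?e / ((1 - s) * (1 - s)) \<le> (s + ?e) / (1 - (s + ?e))" by simp
  also have "\<dots> \<le> s' / (1 - s')" using e s by (intro mobius_mono) auto
  finally have 1: "s / (1 - s) + ?e / ((1 - s) * (1 - s)) \<le> s' / (1 - s')" .
  have "(s / (1 - s))\<^sup>2 + s / (1 - s) = s / ((1 - s) * (1 - s))"
  proof -
    have "(s / q)\<^sup>2 + s / q = s * (s + q) / (q * q)" if "q \<noteq> 0" for q
      using that by (simp add: field_simps power2_eq_square)
    from this[of "1 - s"] show ?thesis using p by simp
  qed
  then have "d * g * ((s / (1 - s))\<^sup>2 + s / (1 - s)) = ?e / ((1 - s) * (1 - s))" by (simp add: mult_ac)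
  then show ?thesis using 1 unfolding riccati_def Let_def s_def[symmetric] s'_def[symmetric] by simp
qed

text \<open>\<open>slope_v0\<close> bounds the discretised \<open>u_t(\<cdot>,0)\<close> by the data, up to the error made in replacing the
  computed value \<open>b\<close> of \<open>v(x,0)\<close> by \<open>v0 x\<close>.\<close>

locale x_problem_compat = x_problem +
  fixes v0 :: "real \<Rightarrow> real" and q0 Cs :: real
  assumes q0: "q0 < exp (- g)" and y0: "y0 \<le> exp (- g)" and Cs0: "0 \<le> Cs"
    and slope_v0: "\<And>d n b. 0 < d \<Longrightarrow> real (Suc n) * d \<le> 1 \<Longrightarrow>
      \<bar>slope d n (u0 (real n * d)) b\<bar> \<le> q0 + Cs * (d + \<bar>b - v0 (real n * d)\<bar>)"
    and compat: "\<And>X Z u v x. 0 < X \<Longrightarrow> X \<le> 1 \<Longrightarrow> 0 \<le> Z \<Longrightarrow> limit_solution X Z u v \<Longrightarrow> x \<in> {0..X} \<Longrightarrow> v x 0 = v0 x"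
    and phi_0: "phi 0 = v0 0"
begin

lemma trace_close:
  assumes good: "good X Z k0" and X: "0 \<le> X" "X \<le> 1"
  obtains D where "0 \<le> D" "\<And>k n. k0 \<le> k \<Longrightarrow> real n / 2 ^ k \<le> X \<Longrightarrow> \<bar>V (1 / 2 ^ k) n 0 - v0 (real n / 2 ^ k)\<bar> \<le> D / 2 ^ k"
proof (cases "X = 0")
  \<comment> \<open>\<open>compat\<close> speaks of positive \<open>X\<close>; for
    \<open>X = 0\<close> only layer 0 occurs, with trace \<open>phi 0 = v0 0\<close>.\<close>
  case True
  show ?thesis
  proof (rule that[of 0])
    fix k n :: nat assume "real n / 2 ^ k \<le> X"
    then have "n = 0" unfolding True by (rule mesh_index_0)
    then show "\<bar>V (1 / 2 ^ k) n 0 - v0 (real n / 2 ^ k)\<bar> \<le> 0 / 2 ^ k" by (simp add: phi_0)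
  qed simp
next
  case False
  obtain u v D where uv: "limit_solution X Z u v" "0 \<le> D"
    "\<And>k n t. k0 \<le> k \<Longrightarrow> real n / 2 ^ k \<le> X \<Longrightarrow> 0 \<le> t \<Longrightarrow> \<bar>V (1 / 2 ^ k) n t - v (real n / 2 ^ k) t\<bar> \<le> D / 2 ^ k"
    using limit_exists[OF good X] by blast
  have Z: "0 \<le> Z" using good by (simp add: good_def)
  show ?thesis
  proof (rule that[OF uv(2)])
    fix k n assume *: "k0 \<le> k" "real n / 2 ^ k \<le> X"
    have "v (real n / 2 ^ k) 0 = v0 (real n / 2 ^ k)"
      using * False X by (intro compat[OF _ X(2) Z uv(1)]) auto
    then show "\<bar>V (1 / 2 ^ k) n 0 - v0 (real n / 2 ^ k)\<bar> \<le> D / 2 ^ k" using uv(3)[OF *, of 0] by simp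
  qed
qed

text \<open>The given \<open>Z\<close> may be arbitrarily large: it serves to obtain a limit, whose
  trace is \<open>v0\<close> by \<open>compat\<close>. The discrete slopes are then at most
  \<open>q0\<close> plus a term of order 1/2^k, hence below \<open>exp (- g)\<close> on fine meshes,
  and the Riccati majorant applies. \<open>Z\<close> influences the threshold \<open>k1\<close>, not
  the new bound.\<close>

lemma good_riccati:
  assumes good: "good X Z k0" and X: "0 \<le> X" "X \<le> 1"
  shows "\<exists>k1. good X (exp g) k1"
proof -
  obtain D where D: "0 \<le> D" "\<And>k n. k0 \<le> k \<Longrightarrow> real n / 2 ^ k \<le> X \<Longrightarrow> \<bar>V (1 / 2 ^ k) n 0 - v0 (real n / 2 ^ k)\<bar> \<le> D / 2 ^ k"
    using trace_close[OF good X] by blast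
  have "(\<lambda>k. q0 + Cs * (1 + D) * (1 / 2) ^ k) \<longlonglongrightarrow> q0 + Cs * (1 + D) * 0"
    by (intro tendsto_intros LIMSEQ_power_zero) simp
  then have "\<forall>\<^sub>F k in sequentially. q0 + Cs * (1 + D) * (1 / 2) ^ k < exp (- g)"
    using q0 by (intro order_tendstoD(2)) auto
  then obtain k1 where k1: "\<And>k. k1 \<le> k \<Longrightarrow> q0 + Cs * (1 + D) * (1 / 2) ^ k < exp (- g)"
    by (auto simp: eventually_sequentially)
  have sl: "\<bar>sl (1 / 2 ^ k) n\<bar> \<le> exp (- g)" if k: "max k0 k1 \<le> k" and n: "real (Suc n) / 2 ^ k \<le> X" for k n
  proof -
    have nX: "real n / 2 ^ k \<le> X" by (rule order_trans[OF divide_right_mono n]) auto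
    have "real (Suc n) * (1 / 2 ^ k) \<le> 1" using order_trans[OF n X(2)] by (simp del: of_nat_Suc)
    then have "\<bar>sl (1 / 2 ^ k) n\<bar> \<le> q0 + Cs * (1 / 2 ^ k + \<bar>V (1 / 2 ^ k) n 0 - v0 (real n * (1 / 2 ^ k))\<bar>)"
      using slope_v0[of "1 / 2 ^ k" n "V (1 / 2 ^ k) n 0"] by (simp add: U_at_0)
    also have "\<dots> \<le> q0 + Cs * (1 / 2 ^ k + D / 2 ^ k)"
      using D(2)[OF _ nX] k Cs0 by (intro add_left_mono mult_left_mono) auto
    also have "\<dots> = q0 + Cs * (1 + D) * (1 / 2) ^ k" by (simp add: power_one_over field_simps)
    also have "\<dots> < exp (- g)" using k1 k by simp
    finally show ?thesis by simp
  qed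
  have lip: "lip_nonneg (U (1 / 2 ^ k) n) (riccati g (real n / 2 ^ k)) \<and> lip_nonneg (V (1 / 2 ^ k) n) (riccati g (real n / 2 ^ k))"
    if k: "max k0 k1 \<le> k" and n: "real n / 2 ^ k \<le> X" for k n
    using n
  proof (induction n)
    case 0
    show ?case using lip_nonneg_mono[OF ub_lip y0] lip_nonneg_mono[OF phi_lip y0] by (simp add: riccati_0)
  next
    case (Suc n)
    let ?x = "real n / 2 ^ k" and ?d = "1 / 2 ^ k :: real"
    let ?Y = "riccati g ?x"
    have nX: "?x \<le> X" by (rule order_trans[OF divide_right_mono Suc.prems]) auto
    have xd: "?x + ?d = real (Suc n) / 2 ^ k" by (simp add: add_divide_distrib)
    have Y: "exp (- g) \<le> ?Y" using riccati_mono[OF g0 _ order_trans[OF nX X(2)], of 0] by (simp add: riccati_0)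
    then have Y0: "0 \<le> ?Y" using exp_ge_zero[of "- g"] by linarith
    have "\<bar>sl ?d n\<bar> \<le> ?Y" using sl[OF k Suc.prems] Y by linarith
    from layer_lip_step[OF _ Y0 _ _ order_refl this] Suc.IH[OF nX]
    have "lip_nonneg (U ?d (Suc n)) (?Y + ?d * g * (?Y\<^sup>2 + ?Y))" "lip_nonneg (V ?d (Suc n)) (?Y + ?d * g * (?Y\<^sup>2 + ?Y))"
      by simp_all
    moreover have "?Y + ?d * g * (?Y\<^sup>2 + ?Y) \<le> riccati g (real (Suc n) / 2 ^ k)"
      using riccati_step[OF g0, of ?d ?x] order_trans[OF Suc.prems X(2)] unfolding xd by (simp del: of_nat_Suc)
    ultimately show ?case using lip_nonneg_mono by blast
  qed
  have "good X (exp g) (max k0 k1)"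
    unfolding good_def
  proof (intro conjI allI impI)
    fix k n assume k: "max k0 k1 \<le> k"
    { assume n: "real n / 2 ^ k \<le> X"
      have "riccati g (real n / 2 ^ k) \<le> exp g"
        using riccati_mono[OF g0 order_trans[OF n X(2)]] by (simp add: riccati_1)
      then show "lip_nonneg (U (1 / 2 ^ k) n) (exp g)" "lip_nonneg (V (1 / 2 ^ k) n) (exp g)"
        using lip[OF k n] lip_nonneg_mono by blast+ }
    assume "real (Suc n) / 2 ^ k \<le> X"
    then show "\<bar>sl (1 / 2 ^ k) n\<bar> \<le> exp g" using sl[OF k] g0 by (smt (verit) exp_le_cancel_iff)
  qed simp
  then show ?thesis by blast
qed

text \<open>Beyond \<open>X\<close> nothing is known about the trace of \<open>V\<close>, so the
  slopes are bounded by \<open>B\<close> only. The layers start with a constant at most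
  \<open>Y\<close> and are allowed to double; the distance over which this is guaranteed depends on
  \<open>Y\<close> and \<open>g\<close>, not on \<open>X\<close> or \<open>Z\<close>.\<close>

lemma good_extend:
  shows "\<exists>e>0. \<forall>X Z k0. good X Z k0 \<longrightarrow> 0 \<le> X \<longrightarrow> X \<le> 1 \<longrightarrow> (\<exists>Z' k1. good (min 1 (X + e)) Z' k1)"
proof -
  define Y where "Y = max B (exp g)"
  have Y0: "0 < Y" unfolding Y_def by (simp add: max.strict_coboundedI2)
  \<comment> \<open>While the constant is at most 2 Y it grows at rate at most
    \<open>g * (4 * Y\<^sup>2 + 2 * Y)\<close>, hence by at most \<open>Y\<close> over the length 2
    e. The factor 2 covers the rounding of \<open>X\<close> down to the mesh.\<close>
  define e where "e = 1 / (2 * (g * (4 * Y + 2) + 1))"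
  have den: "0 < g * (4 * Y + 2) + 1" using g0 Y0 by (simp add: add_nonneg_pos)
  have e0: "0 < e" using den by (simp add: e_def)
  have eY: "2 * e * (g * (4 * Y\<^sup>2 + 2 * Y)) \<le> Y"
  proof -
    have "2 * e * (g * (4 * Y\<^sup>2 + 2 * Y)) = Y * ((g * (4 * Y + 2)) / (g * (4 * Y + 2) + 1))"
      using den unfolding e_def by (simp add: divide_simps power2_eq_square) (simp add: algebra_simps)
    also have "\<dots> \<le> Y * 1" using den Y0 by (intro mult_left_mono) auto
    finally show ?thesis by simp
  qed
  have "\<exists>Z' k1. good (min 1 (X + e)) Z' k1" if good: "good X Z k0" and X: "0 \<le> X" "X \<le> 1" for X Z k0
  proof -
    obtain k1 where k1: "good X (exp g) k1" using good_riccati[OF good X] by blast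
    obtain k2 where k2: "(1 / 2) ^ k2 < e" using real_arch_pow_inv[OF e0, of "1/2"] by auto
    have "good (min 1 (X + e)) (2 * Y) (max k1 k2)"
      unfolding good_def
    proof (intro conjI allI impI)
      fix k n assume k: "max k1 k2 \<le> k"
      let ?d = "1 / 2 ^ k :: real"
      have d: "0 < ?d" by simp
      have de: "?d < e"
      proof -
        have "(1 / 2 :: real) ^ k \<le> (1 / 2) ^ k2" using k by (intro power_decreasing) auto
        then show ?thesis using k2 by (simp add: power_one_over)
      qed
      have slB: "\<bar>sl ?d i\<bar> \<le> Y" for i using slope_bound[OF d] unfolding Y_def by (meson max.coboundedI1)
      show "\<bar>sl ?d n\<bar> \<le> 2 * Y" using slB[of n] Y0 by linarith
      define n0 where "n0 = nat \<lfloor>X * 2 ^ k\<rfloor>"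
      have "0 \<le> X * 2 ^ k" using X by simp
      then have "real n0 = of_int \<lfloor>X * 2 ^ k\<rfloor>" unfolding n0_def by (simp add: of_nat_nat)
      then have n0: "real n0 \<le> X * 2 ^ k" "X * 2 ^ k < real n0 + 1" by linarith+
      have base: "lip_nonneg (U ?d i) Y \<and> lip_nonneg (V ?d i) Y" if "i \<le> n0" for i
      proof -
        have "real i \<le> X * 2 ^ k" using that n0(1) by (meson of_nat_le_iff order_trans)
        then have "real i / 2 ^ k \<le> X" by (simp add: pos_divide_le_eq)
        then have "lip_nonneg (U ?d i) (exp g) \<and> lip_nonneg (V ?d i) (exp g)" using k1 k by (auto simp: good_def)
        then show ?thesis unfolding Y_def by (meson lip_nonneg_mono max.cobounded2)
      qed
      let ?G = "g * (4 * Y\<^sup>2 + 2 * Y)"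
      have G0: "0 \<le> ?G" using g0 Y0 by simp
      have incr: "lip_nonneg (U ?d (n0 + i)) (Y + real i * ?d * ?G) \<and> lip_nonneg (V ?d (n0 + i)) (Y + real i * ?d * ?G)"
        if "real i * ?d \<le> 2 * e" for i
        using that
      proof (induction i)
        case 0
        then show ?case using base[of n0] by simp
      next
        case (Suc i)
        let ?Z = "Y + real i * ?d * ?G"
        have le: "real i * ?d \<le> 2 * e"
          using Suc.prems d by (simp add: add_divide_distrib) (smt (verit) divide_nonneg_nonneg zero_le_power)
        have Z: "Y \<le> ?Z" "?Z \<le> 2 * Y"
        proof -
          show "Y \<le> ?Z" using G0 by simp
          have "real i * ?d * ?G \<le> 2 * e * ?G" using le G0 by (rule mult_right_mono)
          then show "?Z \<le> 2 * Y" using eY by linarith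
        qed
        have Z0: "0 \<le> ?Z" using Z Y0 by linarith
        have "\<bar>sl ?d (n0 + i)\<bar> \<le> ?Z" using slB Z(1) order_trans by blast
        from layer_lip_step[OF d Z0 _ _ order_refl this] Suc.IH[OF le]
        have *: "lip_nonneg (U ?d (Suc (n0 + i))) (?Z + ?d * g * (?Z\<^sup>2 + ?Z))" "lip_nonneg (V ?d (Suc (n0 + i))) (?Z + ?d * g * (?Z\<^sup>2 + ?Z))"
          by blast+
        have "?Z\<^sup>2 \<le> (2 * Y)\<^sup>2" using Z Z0 by (intro power_mono)
        then have "?Z\<^sup>2 + ?Z \<le> 4 * Y\<^sup>2 + 2 * Y" using Z(2) by (simp add: power_mult_distrib)
        then have "?d * (g * (?Z\<^sup>2 + ?Z)) \<le> ?d * ?G" using g0 d by (intro mult_left_mono) auto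
        then have "?Z + ?d * g * (?Z\<^sup>2 + ?Z) \<le> Y + real (Suc i) * ?d * ?G"
          by (simp add: mult.assoc distrib_right add_divide_distrib)
        then show ?case unfolding add_Suc_right using lip_nonneg_mono[OF *(1)] lip_nonneg_mono[OF *(2)] by blast
      qed
      assume n: "real n / 2 ^ k \<le> min 1 (X + e)"
      have "lip_nonneg (U ?d n) (2 * Y) \<and> lip_nonneg (V ?d n) (2 * Y)"
      proof (cases "n \<le> n0")
        case True
        then show ?thesis using base[OF True] lip_nonneg_mono Y0 by (smt (verit))
      next
        case False
        define i where "i = n - n0"
        have ni: "n = n0 + i" using False by (simp add: i_def)
        have "real n \<le> (X + e) * 2 ^ k" using n by (simp add: pos_divide_le_eq)
        then have "real i \<le> e * 2 ^ k + 1" using n0(2) unfolding ni by (simp add: distrib_right)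
        then have "real i * ?d \<le> (e * 2 ^ k + 1) * ?d" using d by (intro mult_right_mono) auto
        also have "\<dots> = e + ?d" by (simp add: distrib_right add_divide_distrib)
        also have "\<dots> \<le> 2 * e" using de by simp
        finally have i: "real i * ?d \<le> 2 * e" .
        have "real i * ?d * ?G \<le> 2 * e * ?G" using i G0 by (rule mult_right_mono)
        then have "Y + real i * ?d * ?G \<le> 2 * Y" using eY by linarith
        then show ?thesis using incr[OF i] lip_nonneg_mono unfolding ni by blast
      qed
      then show "lip_nonneg (U ?d n) (2 * Y)" "lip_nonneg (V ?d n) (2 * Y)" by auto
    qed (use Y0 in simp)
    then show ?thesis by blast
  qed
  then show ?thesis using e0 by blast
qed

text \<open>The step \<open>e\<close> being uniform, finitely many extensions reach 1; a last
  application of \<open>good_riccati\<close> brings the constant back to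
  \<open>exp g\<close>.\<close>

lemma good_1: "\<exists>k. good 1 (exp g) k"
proof -
  obtain e where e: "0 < e" "\<And>X Z k0. good X Z k0 \<Longrightarrow> 0 \<le> X \<Longrightarrow> X \<le> 1 \<Longrightarrow> \<exists>Z' k1. good (min 1 (X + e)) Z' k1"
    using good_extend by blast
  have 1: "\<exists>Z k0. good (min 1 (real i * e)) Z k0" for i
  proof (induction i)
    case 0
    \<comment> \<open>Up to \<open>X = 0\<close> there is only the layer given by the data, and no
      step fits.\<close>
    have "good 0 y0 0"
      unfolding good_def
    proof (intro conjI allI impI)
      fix k n :: nat
      { assume "real n / 2 ^ k \<le> 0"
        then have "n = 0" by (rule mesh_index_0)
        then show "lip_nonneg (U (1 / 2 ^ k) n) y0" "lip_nonneg (V (1 / 2 ^ k) n) y0" using ub_lip phi_lip by simp_all }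
      assume "real (Suc n) / 2 ^ k \<le> 0"
      then show "\<bar>sl (1 / 2 ^ k) n\<bar> \<le> y0" using mesh_index_0 by blast
    qed (rule y00)
    then show ?case by auto
  next
    case (Suc i)
    then obtain Z k0 where "good (min 1 (real i * e)) Z k0" by blast
    from e(2)[OF this] e(1) obtain Z' k1 where *: "good (min 1 (min 1 (real i * e) + e)) Z' k1" by auto
    have "min 1 (min 1 (real i * e) + e) = min 1 (real (Suc i) * e)"
      using e(1) by (simp add: distrib_right min_def)
    then show ?case using * by auto
  qed
  obtain i :: nat where "1 / e < real i" using reals_Archimedean2 by blast
  then have "min 1 (real i * e) = 1" using e(1) by (simp add: divide_less_eq min_def)
  then obtain Z k0 where "good 1 Z k0" using 1[of i] by auto
  then show ?thesis using good_riccati by simp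
qed

lemma solution_up_to_1: "\<exists>u v. limit_solution 1 (exp g) u v"
  using good_1 limit_exists[of 1 "exp g"] by (metis order_refl zero_le_one)

end

section \<open>Broad solutions\<close>

text \<open>The expansion \<open>cons\<close> compares a point with the foot of a backward step
  whose slope is \<open>M\<close>; since \<open>M * sp = 1\<close>, that foot lies on the
  characteristic up to o(s - t). Division by s - t shows that \<open>w\<close> has derivative
  \<open>P * sp\<close> along the curve.\<close>

lemma integral_along_characteristic:
  fixes w M P sp :: "real \<Rightarrow> real \<Rightarrow> real" and \<sigma> :: real
  assumes \<sigma>: "\<sigma> = 1 \<or> \<sigma> = -1" and C: "0 \<le> C" and Z: "0 \<le> Z" and l: "0 < l"
    and wl: "\<And>x y t s. x \<in> {0..X} \<Longrightarrow> y \<in> {0..X} \<Longrightarrow> 0 \<le> t \<Longrightarrow> 0 \<le> s \<Longrightarrow> \<bar>w x t - w y s\<bar> \<le> C * \<bar>x - y\<bar> + Z * \<bar>t - s\<bar>"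
    and Ml: "\<And>x y t s. x \<in> {0..X} \<Longrightarrow> y \<in> {0..X} \<Longrightarrow> 0 \<le> t \<Longrightarrow> 0 \<le> s \<Longrightarrow> \<bar>M x t - M y s\<bar> \<le> A * (\<bar>x - y\<bar> + \<bar>t - s\<bar>)"
    and Pl: "\<And>x y t s. x \<in> {0..X} \<Longrightarrow> y \<in> {0..X} \<Longrightarrow> 0 \<le> t \<Longrightarrow> 0 \<le> s \<Longrightarrow> \<bar>P x t - P y s\<bar> \<le> A * (\<bar>x - y\<bar> + \<bar>t - s\<bar>)"
    and A: "0 \<le> A"
    and Mb: "\<And>x t. x \<in> {0..X} \<Longrightarrow> 0 \<le> t \<Longrightarrow> 0 \<le> M x t \<and> M x t \<le> l"
    and sp: "\<And>x t. x \<in> {0..X} \<Longrightarrow> 0 \<le> t \<Longrightarrow> 0 < sp x t \<and> M x t * sp x t = 1"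
    and cons: "\<And>x h t. 0 \<le> x \<Longrightarrow> 0 \<le> h \<Longrightarrow> x + h \<le> X \<Longrightarrow> l * h < t \<Longrightarrow>
        \<bar>w (x + h) t - w x (t - \<sigma> * h * M x t) - \<sigma> * h * P x t\<bar> \<le> K * h\<^sup>2"
    and ab: "0 \<le> a" "a \<le> b"
    and \<xi>: "\<And>t. t \<in> {a..b} \<Longrightarrow> \<xi> t \<in> {0..X} \<and> (\<xi> has_real_derivative \<sigma> * sp (\<xi> t) t) (at t within {a..b})"
  shows "((\<lambda>t. P (\<xi> t) t * sp (\<xi> t) t) has_integral (w (\<xi> b) b - w (\<xi> a) a)) {a..b}"
proof (rule fundamental_theorem_of_calculus_interior[OF ab(2)])
  have c\<xi>: "continuous_on {a..b} \<xi>"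
    using \<xi> by (intro DERIV_continuous_on) blast
  show "continuous_on {a..b} (\<lambda>t. w (\<xi> t) t)"
    unfolding continuous_on_def
  proof
    fix t assume t: "t \<in> {a..b}"
    have "((\<lambda>s. w (\<xi> s) s - w (\<xi> t) t) \<longlongrightarrow> 0) (at t within {a..b})"
    proof (rule Lim_null_comparison)
      show "\<forall>\<^sub>F s in at t within {a..b}. norm (w (\<xi> s) s - w (\<xi> t) t) \<le> C * \<bar>\<xi> s - \<xi> t\<bar> + Z * \<bar>s - t\<bar>"
        unfolding eventually_at_filter using \<xi> t ab by (intro always_eventually allI impI) (auto intro!: wl)
      have "(\<xi> \<longlongrightarrow> \<xi> t) (at t within {a..b})" using c\<xi> t by (auto simp: continuous_on_def)
      then have "((\<lambda>s. C * \<bar>\<xi> s - \<xi> t\<bar> + Z * \<bar>s - t\<bar>) \<longlongrightarrow> C * \<bar>\<xi> t - \<xi> t\<bar> + Z * \<bar>t - t\<bar>) (at t within {a..b})"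
        by (intro tendsto_intros)
      then show "((\<lambda>s. C * \<bar>\<xi> s - \<xi> t\<bar> + Z * \<bar>s - t\<bar>) \<longlongrightarrow> 0) (at t within {a..b})" by simp
    qed
    then show "((\<lambda>t. w (\<xi> t) t) \<longlongrightarrow> w (\<xi> t) t) (at t within {a..b})" by (simp add: LIM_zero_iff)
  qed
next
  \<comment> \<open>Interior times are positive, where \<open>cons\<close> is available for small
    steps; the end points are covered by continuity.\<close>
  fix t assume t: "t \<in> {a<..<b}"
  then have t': "t \<in> {a..b}" "0 < t" using ab by auto
  let ?x = "\<xi> t" and ?F = "at t"
  have x: "?x \<in> {0..X}" using \<xi>[OF t'(1)] by blast
  have D: "(\<xi> has_real_derivative \<sigma> * sp ?x t) ?F"
    using \<xi>[OF t'(1)] t at_within_Icc_at[of a t b] by auto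
  define Q where "Q = (\<lambda>s. (\<xi> s - ?x) / (s - t))"
  have Q: "(Q \<longlongrightarrow> \<sigma> * sp ?x t) ?F" using D by (simp add: has_field_derivative_iff Q_def)
  have c: "(\<xi> \<longlongrightarrow> ?x) ?F" using D by (meson DERIV_isCont isCont_def)
  \<comment> \<open>\<open>cons\<close> steps towards increasing x only. For \<open>s\<close> near
    \<open>t\<close>, \<open>lo s\<close> and \<open>hi s\<close> are the times of the smaller and
    the larger of the two positions, on whichever side \<open>s\<close> approaches
    \<open>t\<close>.\<close>
  define lo hi where "lo = (\<lambda>s. if 0 < \<sigma> * (s - t) then t else s)" and "hi = (\<lambda>s. if 0 < \<sigma> * (s - t) then s else t)"
  have ev1: "\<forall>\<^sub>F s in ?F. s \<in> {a<..<b}"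
    using eventually_nhds_in_open[of "{a<..<b}" t] t by (simp add: eventually_at_filter eventually_mono)
  have ev2: "\<forall>\<^sub>F s in ?F. s \<noteq> t" by (simp add: eventually_at_filter)
  have ev3: "\<forall>\<^sub>F s in ?F. 0 < \<sigma> * Q s"
  proof (rule order_tendstoD(1))
    show "((\<lambda>s. \<sigma> * Q s) \<longlongrightarrow> \<sigma> * (\<sigma> * sp ?x t)) ?F" by (intro tendsto_intros Q)
    show "0 < \<sigma> * (\<sigma> * sp ?x t)" using \<sigma> sp[OF x] t' by auto
  qed
  \<comment> \<open>Together with \<open>ev5\<close> this yields the condition of
    \<open>cons\<close> that the step be short compared with the evaluation time
    \<open>hi s\<close>.\<close>
  have ev4: "\<forall>\<^sub>F s in ?F. l * \<bar>\<xi> s - ?x\<bar> < t / 2"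
  proof (rule order_tendstoD(2))
    show "((\<lambda>s. l * \<bar>\<xi> s - ?x\<bar>) \<longlongrightarrow> l * \<bar>?x - ?x\<bar>) ?F" by (intro tendsto_intros c)
  qed (use t' in simp)
  have ev5: "\<forall>\<^sub>F s in ?F. t / 2 < s" using order_tendstoD(1)[OF tendsto_ident_at, of "t/2" t] t' by simp
  have lim: "((\<lambda>s. G (\<xi> (lo s)) (hi s)) \<longlongrightarrow> G ?x t) ?F"
    if G: "\<And>x y t s. x \<in> {0..X} \<Longrightarrow> y \<in> {0..X} \<Longrightarrow> 0 \<le> t \<Longrightarrow> 0 \<le> s \<Longrightarrow> \<bar>G x t - G y s\<bar> \<le> A * (\<bar>x - y\<bar> + \<bar>t - s\<bar>)" for G
  proof -
    have "((\<lambda>s. G (\<xi> (lo s)) (hi s) - G ?x t) \<longlongrightarrow> 0) ?F"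
    proof (rule Lim_null_comparison)
      show "\<forall>\<^sub>F s in ?F. norm (G (\<xi> (lo s)) (hi s) - G ?x t) \<le> A * (\<bar>\<xi> s - ?x\<bar> + \<bar>s - t\<bar>)"
        using ev1
      proof eventually_elim
        case (elim s)
        have "\<bar>G (\<xi> (lo s)) (hi s) - G ?x t\<bar> \<le> A * (\<bar>\<xi> (lo s) - ?x\<bar> + \<bar>hi s - t\<bar>)"
          using elim t' ab \<xi> x by (intro G) (auto simp: lo_def hi_def)
        also have "\<dots> \<le> A * (\<bar>\<xi> s - ?x\<bar> + \<bar>s - t\<bar>)" using A by (intro mult_left_mono) (auto simp: lo_def hi_def)
        finally show ?case by simp
      qed
      have "((\<lambda>s. A * (\<bar>\<xi> s - ?x\<bar> + \<bar>s - t\<bar>)) \<longlongrightarrow> A * (\<bar>?x - ?x\<bar> + \<bar>t - t\<bar>)) ?F" by (intro tendsto_intros c)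
      then show "((\<lambda>s. A * (\<bar>\<xi> s - ?x\<bar> + \<bar>s - t\<bar>)) \<longlongrightarrow> 0) ?F" by simp
    qed
    then show ?thesis by (simp add: LIM_zero_iff)
  qed
  let ?r = "\<lambda>s. w (\<xi> s) s"
  let ?P = "\<lambda>s. P (\<xi> (lo s)) (hi s)" and ?M = "\<lambda>s. M (\<xi> (lo s)) (hi s)"
  have "((\<lambda>s. (?r s - ?r t) / (s - t) - \<sigma> * Q s * ?P s) \<longlongrightarrow> 0) ?F"
  proof (rule Lim_null_comparison)
    \<comment> \<open>The first term is the quadratic error of \<open>cons\<close> divided by the
      elapsed time, the second the distance by which the foot misses the curve; the latter vanishes
      because \<open>\<sigma> * Q s\<close> tends to \<open>sp\<close> and
      \<open>M * sp = 1\<close>.\<close>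
    show "\<forall>\<^sub>F s in ?F. norm ((?r s - ?r t) / (s - t) - \<sigma> * Q s * ?P s) \<le> \<bar>K\<bar> * (Q s)\<^sup>2 * \<bar>s - t\<bar> + Z * \<bar>1 - \<sigma> * Q s * ?M s\<bar>"
      using ev1 ev2 ev3 ev4 ev5
    proof eventually_elim
      case (elim s)
      let ?h = "\<xi> (hi s) - \<xi> (lo s)" and ?d = "hi s - lo s"
      have d: "?d = s - t \<or> ?d = t - s" "\<bar>?d\<bar> = \<bar>s - t\<bar>" "?d \<noteq> 0" using elim by (auto simp: lo_def hi_def)
      have sd: "0 < \<sigma> * ?d" using elim \<sigma> by (auto simp: lo_def hi_def)
      have hQ: "?h = Q s * ?d" using elim(2) by (auto simp: Q_def lo_def hi_def field_simps)
      have rd: "?r (hi s) - ?r (lo s) = (?r s - ?r t) / (s - t) * ?d" using elim(2) by (auto simp: lo_def hi_def field_simps)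
      have "?h = (\<sigma> * Q s) * (\<sigma> * ?d)" using \<sigma> hQ by auto
      then have h0: "0 \<le> ?h" using elim(3) sd by simp
      have in_X: "\<xi> (lo s) \<in> {0..X}" "\<xi> (hi s) \<in> {0..X}" and nn: "0 \<le> lo s" "0 \<le> hi s"
        using elim \<xi> x t' ab by (auto simp: lo_def hi_def)
      have hs: "l * ?h < hi s" using elim(4,5) h0 t' by (auto simp: lo_def hi_def abs_if split: if_splits)
      have arg: "0 \<le> hi s - \<sigma> * ?h * ?M s"
      proof -
        have "?h * ?M s \<le> l * ?h" "0 \<le> ?h * ?M s"
          using Mb[OF in_X(1) nn(2)] h0 mult_right_mono[of "?M s" l ?h] by (simp_all add: mult.commute)
        moreover have "\<sigma> * ?h * ?M s = ?h * ?M s \<or> \<sigma> * ?h * ?M s = - (?h * ?M s)" using \<sigma> by auto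
        ultimately show ?thesis using hs nn by linarith
      qed
      have e1: "\<bar>?r (hi s) - w (\<xi> (lo s)) (hi s - \<sigma> * ?h * ?M s) - \<sigma> * ?h * ?P s\<bar> \<le> K * ?h\<^sup>2"
        using cons[of "\<xi> (lo s)" ?h "hi s"] in_X h0 hs by simp
      have e2: "\<bar>w (\<xi> (lo s)) (hi s - \<sigma> * ?h * ?M s) - ?r (lo s)\<bar> \<le> Z * \<bar>(hi s - \<sigma> * ?h * ?M s) - lo s\<bar>"
        using wl[OF in_X(1,1) arg nn(1)] by simp
      have m1: "(hi s - \<sigma> * ?h * ?M s) - lo s = (1 - \<sigma> * Q s * ?M s) * ?d" unfolding hQ by (simp add: algebra_simps)
      have e2': "\<bar>w (\<xi> (lo s)) (hi s - \<sigma> * ?h * ?M s) - ?r (lo s)\<bar> \<le> Z * (\<bar>1 - \<sigma> * Q s * ?M s\<bar> * \<bar>?d\<bar>)"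
        using e2 unfolding m1 abs_mult .
      have tri: "\<bar>x - z - p\<bar> \<le> \<alpha> + \<beta>" if "\<bar>x - y - p\<bar> \<le> \<alpha>" "\<bar>y - z\<bar> \<le> \<beta>" for x y z p \<alpha> \<beta> :: real
        using that by linarith
      have e3: "\<bar>(?r (hi s) - ?r (lo s)) - \<sigma> * ?h * ?P s\<bar> \<le> K * ?h\<^sup>2 + Z * (\<bar>1 - \<sigma> * Q s * ?M s\<bar> * \<bar>?d\<bar>)"
        by (rule tri[OF e1 e2'])
      have m2: "(?r (hi s) - ?r (lo s)) - \<sigma> * ?h * ?P s = ((?r s - ?r t) / (s - t) - \<sigma> * Q s * ?P s) * ?d"
        unfolding rd hQ by (simp add: algebra_simps)
      have b1: "\<bar>(?r s - ?r t) / (s - t) - \<sigma> * Q s * ?P s\<bar> * \<bar>?d\<bar> \<le> K * ?h\<^sup>2 + Z * (\<bar>1 - \<sigma> * Q s * ?M s\<bar> * \<bar>?d\<bar>)"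
        using e3 unfolding m2 abs_mult .
      have b2: "K * ?h\<^sup>2 \<le> \<bar>K\<bar> * ?h\<^sup>2" by (intro mult_right_mono) auto
      have b3: "\<bar>K\<bar> * ?h\<^sup>2 + Z * (\<bar>1 - \<sigma> * Q s * ?M s\<bar> * \<bar>?d\<bar>) = (\<bar>K\<bar> * (Q s)\<^sup>2 * \<bar>s - t\<bar> + Z * \<bar>1 - \<sigma> * Q s * ?M s\<bar>) * \<bar>?d\<bar>"
      proof -
        have "?h\<^sup>2 = (Q s)\<^sup>2 * (\<bar>?d\<bar> * \<bar>?d\<bar>)" unfolding hQ by (simp add: power_mult_distrib power2_eq_square)
        moreover have "k * (q * (\<delta> * \<delta>)) + Z * (\<mu> * \<delta>) = (k * q * \<delta> + Z * \<mu>) * \<delta>" for k q \<delta> \<mu> :: real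
          by (simp add: algebra_simps)
        ultimately show ?thesis unfolding d(2) by (simp only:)
      qed
      have "\<bar>(?r s - ?r t) / (s - t) - \<sigma> * Q s * ?P s\<bar> * \<bar>?d\<bar> \<le>
          (\<bar>K\<bar> * (Q s)\<^sup>2 * \<bar>s - t\<bar> + Z * \<bar>1 - \<sigma> * Q s * ?M s\<bar>) * \<bar>?d\<bar>"
        unfolding b3[symmetric] by (rule order_trans[OF b1 add_right_mono[OF b2]])
      then show ?case using d(3) by simp
    qed
    have "((\<lambda>s. \<bar>K\<bar> * (Q s)\<^sup>2 * \<bar>s - t\<bar> + Z * \<bar>1 - \<sigma> * Q s * ?M s\<bar>) \<longlongrightarrow>
      \<bar>K\<bar> * (\<sigma> * sp ?x t)\<^sup>2 * \<bar>t - t\<bar> + Z * \<bar>1 - \<sigma> * (\<sigma> * sp ?x t) * M ?x t\<bar>) ?F"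
      by (intro tendsto_intros Q lim Ml)
    moreover have "\<sigma> * (\<sigma> * sp ?x t) * M ?x t = 1" using \<sigma> sp[OF x] t' by (auto simp: mult.commute)
    ultimately show "((\<lambda>s. \<bar>K\<bar> * (Q s)\<^sup>2 * \<bar>s - t\<bar> + Z * \<bar>1 - \<sigma> * Q s * ?M s\<bar>) \<longlongrightarrow> 0) ?F" by simp
  qed
  moreover have "((\<lambda>s. \<sigma> * Q s * ?P s) \<longlongrightarrow> \<sigma> * (\<sigma> * sp ?x t) * P ?x t) ?F"
    by (intro tendsto_intros Q lim Pl)
  ultimately have "((\<lambda>s. ((?r s - ?r t) / (s - t) - \<sigma> * Q s * ?P s) + \<sigma> * Q s * ?P s) \<longlongrightarrow> 0 + \<sigma> * (\<sigma> * sp ?x t) * P ?x t) ?F"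
    by (rule tendsto_add)
  then have "((\<lambda>s. (?r s - ?r t) / (s - t)) \<longlongrightarrow> \<sigma> * (\<sigma> * sp ?x t) * P ?x t) ?F" by simp
  moreover have "\<sigma> * (\<sigma> * sp ?x t) * P ?x t = P ?x t * sp ?x t" using \<sigma> by auto
  ultimately have "(?r has_real_derivative P ?x t * sp ?x t) ?F" by (simp add: has_field_derivative_iff)
  then show "(?r has_vector_derivative P ?x t * sp ?x t) ?F" by (simp add: has_real_derivative_iff_has_vector_derivative)
qed

section \<open>Uniqueness\<close>

text \<open>A contraction on bounded continuous functions of the whole line; \<open>clamp\<close>
  extends the image of the integral operator from the interval.\<close>

lemma backward_picard:
  fixes F :: "real \<Rightarrow> real \<Rightarrow> real"
  assumes lip: "\<And>t s x y. \<bar>F t x - F s y\<bar> \<le> K * (\<bar>t - s\<bar> + \<bar>x - y\<bar>)" and K: "0 \<le> K"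
    and t: "t0 \<le> t1" "K * (t1 - t0) \<le> 1 / 2"
  shows "\<exists>\<xi>. \<xi> t1 = x1 \<and> (\<forall>t\<in>{t0..t1}. (\<xi> has_real_derivative F t (\<xi> t)) (at t within {t0..t1}))"
proof -
  have cF: "continuous_on S (\<lambda>s. F s (\<xi> s))" if "continuous_on S \<xi>" for S \<xi>
    unfolding continuous_on_def
  proof
    fix t assume "t \<in> S"
    then have c: "(\<xi> \<longlongrightarrow> \<xi> t) (at t within S)" using that by (auto simp: continuous_on_def)
    have "((\<lambda>s. F s (\<xi> s) - F t (\<xi> t)) \<longlongrightarrow> 0) (at t within S)"
    proof (rule Lim_null_comparison)
      show "\<forall>\<^sub>F s in at t within S. norm (F s (\<xi> s) - F t (\<xi> t)) \<le> K * (\<bar>s - t\<bar> + \<bar>\<xi> s - \<xi> t\<bar>)"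
        using lip by (intro always_eventually allI) simp
      have "((\<lambda>s. K * (\<bar>s - t\<bar> + \<bar>\<xi> s - \<xi> t\<bar>)) \<longlongrightarrow> K * (\<bar>t - t\<bar> + \<bar>\<xi> t - \<xi> t\<bar>)) (at t within S)"
        by (intro tendsto_intros c)
      then show "((\<lambda>s. K * (\<bar>s - t\<bar> + \<bar>\<xi> s - \<xi> t\<bar>)) \<longlongrightarrow> 0) (at t within S)" by simp
    qed
    then show "((\<lambda>s. F s (\<xi> s)) \<longlongrightarrow> F t (\<xi> t)) (at t within S)" by (simp add: LIM_zero_iff)
  qed
  define J where "J = (\<lambda>(\<xi> :: real \<Rightarrow>\<^sub>C real) t. x1 - integral {t..t1} (\<lambda>s. F s (\<xi> s)))"
  have D: "(J \<xi> has_real_derivative F t (\<xi> t)) (at t within {t0..t1})" if "t \<in> {t0..t1}" for \<xi> t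
  proof -
    have "((\<lambda>t. integral {t..t1} (\<lambda>s. F s (\<xi> s))) has_real_derivative - F t (\<xi> t)) (at t within {t0..t1})"
      using that by (intro integral_has_real_derivative' cF) auto
    then show ?thesis unfolding J_def by (auto intro!: derivative_eq_intros)
  qed
  have cJ: "continuous_on (cbox t0 t1) (J \<xi>)" for \<xi>
    unfolding cbox_interval by (rule DERIV_continuous_on[OF D])
  have "\<forall>\<xi>. \<exists>\<eta> :: real \<Rightarrow>\<^sub>C real. \<forall>x. \<eta> x = J \<xi> (clamp t0 t1 x)"
    using continuous_on_cbox_bcontfunE[OF cJ] by metis
  then obtain T :: "(real \<Rightarrow>\<^sub>C real) \<Rightarrow> (real \<Rightarrow>\<^sub>C real)" where T: "\<And>\<xi> x. T \<xi> x = J \<xi> (clamp t0 t1 x)"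
    by metis
  have "dist (T \<xi>) (T \<eta>) \<le> 1 / 2 * dist \<xi> \<eta>" for \<xi> \<eta>
  proof (rule dist_bound)
    fix x
    let ?t = "clamp t0 t1 x"
    have tt: "?t \<in> {t0..t1}" using clamp_in_interval[of t0 t1 x] t(1) by simp
    have "\<bar>integral {?t..t1} (\<lambda>s. F s (\<xi> s) - F s (\<eta> s))\<bar> \<le> (K * dist \<xi> \<eta>) * (t1 - ?t)"
    proof -
      have "norm (integral {?t..t1} (\<lambda>s. F s (\<xi> s) - F s (\<eta> s))) \<le> (K * dist \<xi> \<eta>) * (t1 - ?t)"
      proof (rule integral_bound)
        show "continuous_on {?t..t1} (\<lambda>s. F s (\<xi> s) - F s (\<eta> s))" by (intro continuous_on_diff cF) auto
        fix s
        have "\<bar>F s (\<xi> s) - F s (\<eta> s)\<bar> \<le> K * \<bar>\<xi> s - \<eta> s\<bar>" using lip[of s "\<xi> s" s "\<eta> s"] by simp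
        also have "\<dots> \<le> K * dist \<xi> \<eta>" using dist_bounded[of \<xi> s \<eta>] K by (intro mult_left_mono) (auto simp: dist_real_def)
        finally show "norm (F s (\<xi> s) - F s (\<eta> s)) \<le> K * dist \<xi> \<eta>" by simp
      qed (use tt in auto)
      then show ?thesis by simp
    qed
    also have "\<dots> \<le> (K * dist \<xi> \<eta>) * (t1 - t0)" using tt K by (intro mult_left_mono) auto
    also have "\<dots> = (K * (t1 - t0)) * dist \<xi> \<eta>" by (simp add: mult_ac)
    also have "\<dots> \<le> 1 / 2 * dist \<xi> \<eta>" using t(2) by (intro mult_right_mono) auto
    finally have 1: "\<bar>integral {?t..t1} (\<lambda>s. F s (\<xi> s) - F s (\<eta> s))\<bar> \<le> 1 / 2 * dist \<xi> \<eta>" .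
    have "integral {?t..t1} (\<lambda>s. F s (\<xi> s) - F s (\<eta> s)) = integral {?t..t1} (\<lambda>s. F s (\<xi> s)) - integral {?t..t1} (\<lambda>s. F s (\<eta> s))"
      by (intro Henstock_Kurzweil_Integration.integral_diff integrable_continuous_real cF) auto
    then show "dist (T \<xi> x) (T \<eta> x) \<le> 1 / 2 * dist \<xi> \<eta>" using 1 unfolding T J_def dist_real_def by linarith
  qed
  then have "\<exists>!\<xi>. T \<xi> = \<xi>" by (intro banach_fix_type[of "1/2"]) auto
  then obtain \<xi> where \<xi>: "T \<xi> = \<xi>" by blast
  have cl: "clamp t0 t1 x = x" if "x \<in> {t0..t1}" for x using that by (intro clamp_cancel_cbox) simp
  have eq: "\<xi> x = J \<xi> x" if "x \<in> {t0..t1}" for x using T[of \<xi> x] cl[OF that] \<xi> by simp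
  show ?thesis
  proof (intro exI[of _ "J \<xi>"] conjI ballI)
    show "J \<xi> t1 = x1" by (simp add: J_def)
    fix t assume "t \<in> {t0..t1}"
    then show "(J \<xi> has_real_derivative F t (J \<xi> t)) (at t within {t0..t1})" using D[of t \<xi>] eq[of t] by simp
  qed
qed

lemma real_mvt_within:
  fixes f :: "real \<Rightarrow> real"
  assumes "s < t" "a \<le> s" "t \<le> b" "\<And>x. x \<in> {a..b} \<Longrightarrow> (f has_real_derivative f' x) (at x within {a..b})"
  shows "\<exists>z\<in>{a..b}. f t - f s = f' z * (t - s)"
proof -
  have "\<exists>z\<in>{s<..<t}. f t - f s = (\<lambda>h. f' z * h) (t - s)"
  proof (rule mvt_simple[OF assms(1)])
    fix x assume "s \<le> x" "x \<le> t"
    then have "(f has_real_derivative f' x) (at x within {a..b})" using assms by auto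
    then have "(f has_real_derivative f' x) (at x within {s..t})" by (rule DERIV_subset) (use assms in auto)
    then show "(f has_derivative (\<lambda>h. f' x * h)) (at x within {s..t})" by (simp add: has_field_derivative_def)
  qed
  then show ?thesis using assms by (auto intro!: bexI)
qed

text \<open>The speed along a state, frozen outside the domain in both variables, so that
  characteristics can be solved for on a whole time slab before asking where they leave
  [0,1].\<close>

definition field_ext :: "(real \<Rightarrow> real \<Rightarrow> real \<Rightarrow> real) \<Rightarrow> (real \<Rightarrow> real \<Rightarrow> real) \<Rightarrow> (real \<Rightarrow> real \<Rightarrow> real) \<Rightarrow> real \<Rightarrow> real \<Rightarrow> real" where
  "field_ext l u v t x = l (max 0 (min 1 x)) (u (max 0 (min 1 x)) (max 0 t)) (v (max 0 (min 1 x)) (max 0 t))"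

section \<open>Stability along backward characteristics\<close>

locale lipschitz_states =
  fixes L c :: real and \<C> :: "(real \<Rightarrow> real \<Rightarrow> real \<Rightarrow> real) set" and \<S> :: "(real \<Rightarrow> real \<Rightarrow> real) set"
  assumes L: "0 \<le> L" and c: "0 \<le> c"
    and coeff: "F \<in> \<C> \<Longrightarrow> x \<in> {0..1} \<Longrightarrow> x' \<in> {0..1} \<Longrightarrow> \<bar>F x a b - F x' a' b'\<bar> \<le> L * (\<bar>x - x'\<bar> + \<bar>a - a'\<bar> + \<bar>b - b'\<bar>)"
    and state: "w \<in> \<S> \<Longrightarrow> x \<in> {0..1} \<Longrightarrow> y \<in> {0..1} \<Longrightarrow> 0 \<le> t \<Longrightarrow> 0 \<le> s \<Longrightarrow> \<bar>w x t - w y s\<bar> \<le> c * (\<bar>x - y\<bar> + \<bar>t - s\<bar>)"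
begin

definition "K = L * (1 + 2 * c)"

lemma K_nonneg: "0 \<le> K" using L c by (simp add: K_def)

lemma coeff_state:
  assumes F: "F \<in> \<C>" and uv: "u \<in> \<S>" "v \<in> \<S>" and xt: "x \<in> {0..1}" "y \<in> {0..1}" "0 \<le> t" "0 \<le> s"
  shows "\<bar>F x (u x t) (v x t) - F y (u y s) (v y s)\<bar> \<le> K * (\<bar>t - s\<bar> + \<bar>x - y\<bar>)"
proof -
  have "\<bar>F x (u x t) (v x t) - F y (u y s) (v y s)\<bar> \<le> L * (\<bar>x - y\<bar> + \<bar>u x t - u y s\<bar> + \<bar>v x t - v y s\<bar>)"
    by (rule coeff[OF F xt(1,2)])
  also have "\<dots> \<le> L * (\<bar>x - y\<bar> + c * (\<bar>x - y\<bar> + \<bar>t - s\<bar>) + c * (\<bar>x - y\<bar> + \<bar>t - s\<bar>))"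
    using L by (intro mult_left_mono add_mono state uv xt order_refl)
  also have "\<dots> \<le> L * ((1 + 2 * c) * (\<bar>t - s\<bar> + \<bar>x - y\<bar>))"
    using L by (intro mult_left_mono) (auto simp: algebra_simps)
  finally show ?thesis by (simp add: K_def mult.assoc)
qed

lemma field_ext_lip:
  assumes F: "F \<in> \<C>" and uv: "u \<in> \<S>" "v \<in> \<S>" and \<sigma>: "\<bar>\<sigma>\<bar> = 1"
  shows "\<bar>\<sigma> * field_ext F u v t x - \<sigma> * field_ext F u v s y\<bar> \<le> K * (\<bar>t - s\<bar> + \<bar>x - y\<bar>)"
proof -
  have "\<bar>\<sigma> * field_ext F u v t x - \<sigma> * field_ext F u v s y\<bar> = \<bar>field_ext F u v t x - field_ext F u v s y\<bar>"
    using \<sigma> by (simp add: right_diff_distrib[symmetric] abs_mult)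
  also have "\<dots> \<le> K * (\<bar>max 0 t - max 0 s\<bar> + \<bar>max 0 (min 1 x) - max 0 (min 1 y)\<bar>)"
    unfolding field_ext_def by (intro coeff_state F uv) auto
  also have "\<dots> \<le> K * (\<bar>t - s\<bar> + \<bar>x - y\<bar>)"
  proof (intro mult_left_mono add_mono K_nonneg abs_clamp_le)
    show "\<bar>max 0 t - max 0 s\<bar> \<le> \<bar>t - s\<bar>" by (auto simp: max_def)
  qed
  finally show ?thesis .
qed

lemma backward_characteristic:
  assumes F: "F \<in> \<C>" and uv: "u \<in> \<S>" "v \<in> \<S>" and \<sigma>: "\<sigma> = 1 \<or> \<sigma> = -1"
    and pos: "\<And>x a b. x \<in> {0..1} \<Longrightarrow> 0 < F x a b"
    and t: "0 \<le> t0" "t0 \<le> t1" "K * (t1 - t0) \<le> 1 / 2" and x1: "x1 \<in> {0..1}"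
  obtains \<xi> a where "\<xi> t1 = x1" "\<And>t. t \<in> {t0..t1} \<Longrightarrow> (\<xi> has_real_derivative \<sigma> * field_ext F u v t (\<xi> t)) (at t within {t0..t1})"
    "t0 \<le> a" "a \<le> t1" "\<And>t. t \<in> {a..t1} \<Longrightarrow> \<xi> t \<in> {0..1}" "a = t0 \<or> \<xi> a = (if \<sigma> = 1 then 0 else 1)"
proof -
  have s1: "\<bar>\<sigma>\<bar> = 1" using \<sigma> by auto
  obtain \<xi> where \<xi>: "\<xi> t1 = x1" "\<And>t. t \<in> {t0..t1} \<Longrightarrow> (\<xi> has_real_derivative \<sigma> * field_ext F u v t (\<xi> t)) (at t within {t0..t1})"
    using backward_picard[of "\<lambda>t x. \<sigma> * field_ext F u v t x" K t0 t1 x1, OF field_ext_lip[OF F uv s1] K_nonneg t(2,3)] by blast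
  \<comment> \<open>The distance from the inflow boundary, which is x = 0 for
    \<open>\<sigma> = 1\<close> and x = 1 otherwise. It is nondecreasing in time, so traced
    backwards the curve either stays inside down to \<open>t0\<close> or meets the inflow boundary
    at a time \<open>a\<close> and is inside afterwards.\<close>
  define y where "y = (\<lambda>s. if \<sigma> = 1 then \<xi> s else 1 - \<xi> s)"
  have fp: "0 < field_ext F u v t x" for t x unfolding field_ext_def by (intro pos) auto
  have mono: "y s \<le> y t" if "t0 \<le> s" "s \<le> t" "t \<le> t1" for s t
  proof (cases "s = t")
    case False
    then have st: "s < t" "t0 \<le> s" "t \<le> t1" using that by simp_all
    obtain z where z: "\<xi> t - \<xi> s = \<sigma> * field_ext F u v z (\<xi> z) * (t - s)"
      using real_mvt_within[OF st \<xi>(2)] by blast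
    have "0 \<le> field_ext F u v z (\<xi> z) * (t - s)" using fp that by (simp add: less_imp_le)
    moreover have "y t - y s = field_ext F u v z (\<xi> z) * (t - s)" using \<sigma> z by (auto simp: y_def)
    ultimately show ?thesis by linarith
  qed simp
  have yt: "y t1 \<in> {0..1}" using x1 \<xi>(1) by (auto simp: y_def)
  have cy: "continuous_on {t0..t1} y"
  proof -
    have "continuous_on {t0..t1} \<xi>" using \<xi>(2) by (rule DERIV_continuous_on)
    then show ?thesis unfolding y_def by (cases "\<sigma> = 1") (auto intro!: continuous_intros)
  qed
  obtain a where a: "t0 \<le> a" "a \<le> t1" "0 \<le> y a" "a = t0 \<or> y a = 0"
  proof (cases "0 \<le> y t0")
    case True
    then show ?thesis using that[of t0] t(2) by simp
  next
    case False
    then show ?thesis using IVT'[of y t0 0 t1] yt t(2) cy that by auto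
  qed
  show ?thesis
  proof (rule that[OF \<xi> a(1,2)])
    fix t assume tt: "t \<in> {a..t1}"
    have "y a \<le> y t" "y t \<le> y t1" using mono[of a t] mono[of t t1] tt a by auto
    then have "y t \<in> {0..1}" using a(3) yt by auto
    then show "\<xi> t \<in> {0..1}" by (auto simp: y_def split: if_splits)
  next
    show "a = t0 \<or> \<xi> a = (if \<sigma> = 1 then 0 else 1)" using a(4) by (auto simp: y_def)
  qed
qed

lemma field_ext_eq: "x \<in> {0..1} \<Longrightarrow> 0 \<le> t \<Longrightarrow> field_ext F u v t x = F x (u x t) (v x t)"
  by (simp add: field_ext_def)

lemma field_ext_diff:
  assumes F: "F \<in> \<C>" and uv: "u \<in> \<S>" "v \<in> \<S>" and t: "0 \<le> t"
    and E: "\<And>x. x \<in> {0..1} \<Longrightarrow> \<bar>u x t - u' x t\<bar> \<le> E \<and> \<bar>v x t - v' x t\<bar> \<le> E"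
  shows "\<bar>field_ext F u v t x - field_ext F u' v' t y\<bar> \<le> K * \<bar>x - y\<bar> + 2 * L * E"
proof -
  have "\<bar>field_ext F u v t x - field_ext F u v t y\<bar> \<le> K * \<bar>x - y\<bar>"
    using field_ext_lip[OF F uv, of 1 t x t y] by simp
  moreover have "\<bar>field_ext F u v t y - field_ext F u' v' t y\<bar> \<le> L * (E + E)"
  proof -
    let ?y = "max 0 (min 1 y)"
    have y: "?y \<in> {0..1}" by auto
    have "\<bar>field_ext F u v t y - field_ext F u' v' t y\<bar> \<le> L * (\<bar>?y - ?y\<bar> + \<bar>u ?y t - u' ?y t\<bar> + \<bar>v ?y t - v' ?y t\<bar>)"
      unfolding field_ext_def max_absorb2[OF t] by (rule coeff[OF F y y])
    also have "\<dots> \<le> L * (0 + E + E)" using E[OF y] L by (intro mult_left_mono add_mono) auto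
    finally show ?thesis by simp
  qed
  moreover have "L * (E + E) = 2 * L * E" by simp
  ultimately show ?thesis
    using abs_triangle_ineq[of "field_ext F u v t x - field_ext F u v t y" "field_ext F u v t y - field_ext F u' v' t y"] by simp
qed

text \<open>In place of Gronwall, the mean value theorem is used at the time of maximal distance:
  \<open>K * (t1 - t0) \<le> 1 / 2\<close> absorbs half of that distance, which turns 2 L E into 4 L
  E.\<close>

lemma characteristics_close:
  assumes F: "F \<in> \<C>" and uv: "u \<in> \<S>" "v \<in> \<S>" and \<sigma>: "\<bar>\<sigma>\<bar> = 1"
    and t: "0 \<le> t0" "t0 \<le> t1" "K * (t1 - t0) \<le> 1 / 2"
    and E: "\<And>x t. x \<in> {0..1} \<Longrightarrow> t \<in> {t0..t1} \<Longrightarrow> \<bar>u x t - u' x t\<bar> \<le> E \<and> \<bar>v x t - v' x t\<bar> \<le> E"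
    and \<xi>: "\<And>t. t \<in> {t0..t1} \<Longrightarrow> (\<xi> has_real_derivative \<sigma> * field_ext F u v t (\<xi> t)) (at t within {t0..t1})"
    and \<xi>': "\<And>t. t \<in> {t0..t1} \<Longrightarrow> (\<xi>' has_real_derivative \<sigma> * field_ext F u' v' t (\<xi>' t)) (at t within {t0..t1})"
    and eq: "\<xi> t1 = \<xi>' t1" and s: "s \<in> {t0..t1}"
  shows "\<bar>\<xi> s - \<xi>' s\<bar> \<le> 4 * L * E * (t1 - t0)"
proof -
  let ?d = "\<lambda>s. \<xi> s - \<xi>' s"
  have D: "(?d has_real_derivative \<sigma> * field_ext F u v t (\<xi> t) - \<sigma> * field_ext F u' v' t (\<xi>' t)) (at t within {t0..t1})"
    if "t \<in> {t0..t1}" for t using \<xi>[OF that] \<xi>'[OF that] by (rule DERIV_diff)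
  have "continuous_on {t0..t1} (\<lambda>s. \<bar>?d s\<bar>)"
    using D by (intro continuous_on_rabs DERIV_continuous_on)
  then obtain m where m: "m \<in> {t0..t1}" "\<And>s. s \<in> {t0..t1} \<Longrightarrow> \<bar>?d s\<bar> \<le> \<bar>?d m\<bar>"
    using continuous_attains_sup[of "{t0..t1}" "\<lambda>s. \<bar>?d s\<bar>"] t(2) by auto
  have "\<bar>u 0 t0 - u' 0 t0\<bar> \<le> E" using E[of 0 t0] t(2) by simp
  then have E0: "0 \<le> E" using abs_ge_zero order_trans by blast
  have "\<bar>?d m\<bar> \<le> 4 * L * E * (t1 - t0)"
  proof (cases "m = t1")
    case True
    then show ?thesis using eq L E0 t(2) by simp
  next
    case False
    then have "m < t1" using m(1) by simp
    then obtain z where z: "z \<in> {t0..t1}"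
      "?d t1 - ?d m = (\<sigma> * field_ext F u v z (\<xi> z) - \<sigma> * field_ext F u' v' z (\<xi>' z)) * (t1 - m)"
      using real_mvt_within[of m t1 t0 t1 ?d, OF _ _ _ D] m(1) by auto
    have "\<bar>?d m\<bar> = \<bar>field_ext F u v z (\<xi> z) - field_ext F u' v' z (\<xi>' z)\<bar> * (t1 - m)"
    proof -
      have "- ?d m = \<sigma> * (field_ext F u v z (\<xi> z) - field_ext F u' v' z (\<xi>' z)) * (t1 - m)"
        using z(2) eq by (simp add: right_diff_distrib)
      then have "\<bar>- ?d m\<bar> = \<bar>\<sigma>\<bar> * \<bar>field_ext F u v z (\<xi> z) - field_ext F u' v' z (\<xi>' z)\<bar> * \<bar>t1 - m\<bar>"
        by (simp only: abs_mult)
      then show ?thesis using \<sigma> \<open>m < t1\<close> unfolding abs_minus_cancel by simp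
    qed
    also have "\<dots> \<le> (K * \<bar>?d m\<bar> + 2 * L * E) * (t1 - t0)"
    proof (rule mult_mono)
      have "\<bar>field_ext F u v z (\<xi> z) - field_ext F u' v' z (\<xi>' z)\<bar> \<le> K * \<bar>?d z\<bar> + 2 * L * E"
        using z(1) t(1) E by (intro field_ext_diff F uv) auto
      also have "\<dots> \<le> K * \<bar>?d m\<bar> + 2 * L * E" using m(2)[OF z(1)] K_nonneg by (intro add_right_mono mult_left_mono)
      finally show "\<bar>field_ext F u v z (\<xi> z) - field_ext F u' v' z (\<xi>' z)\<bar> \<le> K * \<bar>?d m\<bar> + 2 * L * E" .
    qed (use m(1) K_nonneg L E0 in auto)
    also have "\<dots> = (K * (t1 - t0)) * \<bar>?d m\<bar> + 2 * L * E * (t1 - t0)" by (simp add: algebra_simps)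
    also have "\<dots> \<le> 1 / 2 * \<bar>?d m\<bar> + 2 * L * E * (t1 - t0)" using t(3) by (intro add_right_mono mult_right_mono) auto
    finally show ?thesis by simp
  qed
  then show ?thesis using m(2)[OF s] by linarith
qed

text \<open>Each solution is followed along its own characteristic back to the later of the two
  entry times, before which one of the curves may be outside the domain. There both solutions are
  compared at the position of the curve that fixed this time; moving the other foot to it costs
  \<open>c\<close> times the distance of the curves.\<close>

lemma component_estimate:
  assumes F: "F \<in> \<C>" and f: "f \<in> \<C>" and S: "u \<in> \<S>" "v \<in> \<S>" "u' \<in> \<S>" "v' \<in> \<S>" "w \<in> \<S>" "w' \<in> \<S>"
    and \<sigma>: "\<sigma> = 1 \<or> \<sigma> = -1" and pos: "\<And>x a b. x \<in> {0..1} \<Longrightarrow> 0 < F x a b"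
    and t: "0 \<le> t0" "t0 \<le> t1" "K * (t1 - t0) \<le> 1 / 2" "t1 - t0 \<le> 1" and x1: "x1 \<in> {0..1}"
    and E: "\<And>x t. x \<in> {0..1} \<Longrightarrow> t \<in> {t0..t1} \<Longrightarrow> \<bar>u x t - u' x t\<bar> \<le> E \<and> \<bar>v x t - v' x t\<bar> \<le> E"
    and int: "\<And>\<xi> a b. characteristic 1 (\<lambda>x a b. \<sigma> * F x a b) u v \<xi> a b \<Longrightarrow>
        ((\<lambda>t. f (\<xi> t) (u (\<xi> t) t) (v (\<xi> t) t)) has_integral (w (\<xi> b) b - w (\<xi> a) a)) {a..b}"
    and int': "\<And>\<xi> a b. characteristic 1 (\<lambda>x a b. \<sigma> * F x a b) u' v' \<xi> a b \<Longrightarrow>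
        ((\<lambda>t. f (\<xi> t) (u' (\<xi> t) t) (v' (\<xi> t) t)) has_integral (w' (\<xi> b) b - w' (\<xi> a) a)) {a..b}"
  shows "\<exists>p a. p \<in> {0..1} \<and> a \<in> {t0..t1} \<and> (a = t0 \<or> p = (if \<sigma> = 1 then 0 else 1)) \<and>
    \<bar>w x1 t1 - w' x1 t1\<bar> \<le> \<bar>w p a - w' p a\<bar> + (4 * c * L + K * (4 * L) + 2 * L) * E * (t1 - t0)"
proof -
  have s1: "\<bar>\<sigma>\<bar> = 1" using \<sigma> by auto
  have "\<bar>u 0 t0 - u' 0 t0\<bar> \<le> E" using E[of 0 t0] t(2) by simp
  then have E0: "0 \<le> E" using abs_ge_zero order_trans by blast
  obtain \<xi> a where \<xi>: "\<xi> t1 = x1" "\<And>t. t \<in> {t0..t1} \<Longrightarrow> (\<xi> has_real_derivative \<sigma> * field_ext F u v t (\<xi> t)) (at t within {t0..t1})"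
    "t0 \<le> a" "a \<le> t1" "\<And>t. t \<in> {a..t1} \<Longrightarrow> \<xi> t \<in> {0..1}" "a = t0 \<or> \<xi> a = (if \<sigma> = 1 then 0 else 1)"
    using backward_characteristic[OF F S(1,2) \<sigma> pos t(1-3) x1] by blast
  obtain \<xi>' a' where \<xi>': "\<xi>' t1 = x1" "\<And>t. t \<in> {t0..t1} \<Longrightarrow> (\<xi>' has_real_derivative \<sigma> * field_ext F u' v' t (\<xi>' t)) (at t within {t0..t1})"
    "t0 \<le> a'" "a' \<le> t1" "\<And>t. t \<in> {a'..t1} \<Longrightarrow> \<xi>' t \<in> {0..1}" "a' = t0 \<or> \<xi>' a' = (if \<sigma> = 1 then 0 else 1)"
    using backward_characteristic[OF F S(3,4) \<sigma> pos t(1-3) x1] by blast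
  have close: "\<bar>\<xi> s - \<xi>' s\<bar> \<le> 4 * L * E * (t1 - t0)" if "s \<in> {t0..t1}" for s
    using characteristics_close[OF F S(1,2) s1 t(1-3) E \<xi>(2) \<xi>'(2) _ that] \<xi>(1) \<xi>'(1) by simp
  let ?T = "t1 - t0"
  have close1: "\<bar>\<xi> s - \<xi>' s\<bar> \<le> 4 * L * E" if "s \<in> {t0..t1}" for s
    using close[OF that] mult_left_mono[OF t(4), of "4 * L * E"] L E0 by simp
  define b where "b = max a a'"
  have b: "t0 \<le> b" "b \<le> t1" "a \<le> b" "a' \<le> b" using \<xi> \<xi>' by (auto simp: b_def)
  have char: "characteristic 1 (\<lambda>x a b. \<sigma> * F x a b) u v \<xi> b t1"
    unfolding characteristic_def
  proof (intro conjI ballI)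
    fix s assume s: "s \<in> {b..t1}"
    show "\<xi> s \<in> {0..1}" using \<xi>(5) s b by auto
    then show "(\<xi> has_real_derivative \<sigma> * F (\<xi> s) (u (\<xi> s) s) (v (\<xi> s) s)) (at s within {b..t1})"
      using DERIV_subset[OF \<xi>(2), of s "{b..t1}"] s b t(1) by (simp add: field_ext_eq)
  qed (use b t in auto)
  have char': "characteristic 1 (\<lambda>x a b. \<sigma> * F x a b) u' v' \<xi>' b t1"
    unfolding characteristic_def
  proof (intro conjI ballI)
    fix s assume s: "s \<in> {b..t1}"
    show "\<xi>' s \<in> {0..1}" using \<xi>'(5) s b by auto
    then show "(\<xi>' has_real_derivative \<sigma> * F (\<xi>' s) (u' (\<xi>' s) s) (v' (\<xi>' s) s)) (at s within {b..t1})"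
      using DERIV_subset[OF \<xi>'(2), of s "{b..t1}"] s b t(1) by (simp add: field_ext_eq)
  qed (use b t in auto)
  have hi: "((\<lambda>s. f (\<xi> s) (u (\<xi> s) s) (v (\<xi> s) s) - f (\<xi>' s) (u' (\<xi>' s) s) (v' (\<xi>' s) s)) has_integral
      ((w x1 t1 - w (\<xi> b) b) - (w' x1 t1 - w' (\<xi>' b) b))) {b..t1}"
    using has_integral_diff[OF int[OF char] int'[OF char']] \<xi>(1) \<xi>'(1) by simp
  have "norm ((w x1 t1 - w (\<xi> b) b) - (w' x1 t1 - w' (\<xi>' b) b)) \<le> (K * (4 * L * E) + 2 * L * E) * Henstock_Kurzweil_Integration.content (cbox b t1)"
  proof (rule has_integral_bound[OF _ hi[folded box_real]])
    show "0 \<le> K * (4 * L * E) + 2 * L * E" using K_nonneg L E0 by simp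
    fix s assume "s \<in> cbox b t1"
    then have s: "s \<in> {b..t1}" "s \<in> {t0..t1}" "0 \<le> s" using b t by auto
    have in1: "\<xi> s \<in> {0..1}" "\<xi>' s \<in> {0..1}" using s b \<xi>(5) \<xi>'(5) by auto
    have "\<bar>field_ext f u v s (\<xi> s) - field_ext f u' v' s (\<xi>' s)\<bar> \<le> K * \<bar>\<xi> s - \<xi>' s\<bar> + 2 * L * E"
      using E s by (intro field_ext_diff f S) auto
    also have "\<dots> \<le> K * (4 * L * E) + 2 * L * E" using close1[OF s(2)] K_nonneg by (intro add_right_mono mult_left_mono)
    finally show "norm (f (\<xi> s) (u (\<xi> s) s) (v (\<xi> s) s) - f (\<xi>' s) (u' (\<xi>' s) s) (v' (\<xi>' s) s)) \<le> K * (4 * L * E) + 2 * L * E"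
      using in1 s by (simp add: field_ext_eq)
  qed
  also have "\<dots> \<le> (K * (4 * L * E) + 2 * L * E) * ?T"
    using b K_nonneg L E0 by (intro mult_left_mono) auto
  finally have I: "\<bar>(w x1 t1 - w (\<xi> b) b) - (w' x1 t1 - w' (\<xi>' b) b)\<bar> \<le> (K * (4 * L * E) + 2 * L * E) * ?T" by simp
  have bt: "b \<in> {t0..t1}" and b0: "0 \<le> b" using b t by auto
  have inb: "\<xi> b \<in> {0..1}" "\<xi>' b \<in> {0..1}" using b \<xi>(5) \<xi>'(5) by auto
  have cc: "c * \<bar>\<xi> b - \<xi>' b\<bar> \<le> c * (4 * L * E * ?T)" using close[OF bt] c by (rule mult_left_mono)
  have w1: "\<bar>w (\<xi> b) b - w (\<xi>' b) b\<bar> \<le> c * (4 * L * E * ?T)"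
    using state[OF S(5) inb b0 b0] cc by simp
  have w2: "\<bar>w' (\<xi> b) b - w' (\<xi>' b) b\<bar> \<le> c * (4 * L * E * ?T)"
    using state[OF S(6) inb b0 b0] cc by simp
  have tot: "c * (4 * L * E * ?T) + (K * (4 * L * E) + 2 * L * E) * ?T = (4 * c * L + K * (4 * L) + 2 * L) * E * ?T"
    by (simp add: algebra_simps)
  consider "b = a" | "b = a'" by (metis b_def max_def)
  then obtain p where p: "p \<in> {0..1}" "p = \<xi> b \<or> p = \<xi>' b" "b = t0 \<or> p = (if \<sigma> = 1 then 0 else 1)"
  proof cases
    case 1
    then show ?thesis using that[of "\<xi> b"] inb \<xi>(6) by auto
  next
    case 2
    then show ?thesis using that[of "\<xi>' b"] inb \<xi>'(6) by auto
  qed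
  have tri1: "\<bar>X - X'\<bar> \<le> \<bar>y - y'\<bar> + (k + m)" if "\<bar>(X - y) - (X' - z')\<bar> \<le> m" "\<bar>y' - z'\<bar> \<le> k" for X X' y y' z' k m :: real
    using that by linarith
  have tri2: "\<bar>X - X'\<bar> \<le> \<bar>z - z'\<bar> + (k + m)" if "\<bar>(X - y) - (X' - z')\<bar> \<le> m" "\<bar>y - z\<bar> \<le> k" for X X' y z z' k m :: real
    using that by linarith
  have "\<bar>w x1 t1 - w' x1 t1\<bar> \<le> \<bar>w p b - w' p b\<bar> + (4 * c * L + K * (4 * L) + 2 * L) * E * ?T"
    using p(2) tri1[OF I w2] tri2[OF I w1] unfolding tot by auto
  then show ?thesis using p bt by blast
qed

end

section \<open>Contraction on time slabs\<close>

locale two_solutions = lipschitz_states L c "{lu, lv, fu, fv}" "{u, v, u', v'}"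
  for L c :: real and lu lv fu fv u v u' v' +
  fixes g :: "real \<Rightarrow> real \<Rightarrow> real" and G R :: real
  assumes lu_pos: "\<And>x a b. x \<in> {0..1} \<Longrightarrow> 0 < lu x a b" and lv_pos: "\<And>x a b. x \<in> {0..1} \<Longrightarrow> 0 < lv x a b"
    and broad: "broad_solution lu lv fu fv 1 u v" and broad': "broad_solution lu lv fu fv 1 u' v'"
    and g: "\<And>a b t. 0 \<le> t \<Longrightarrow> \<bar>g a t - g b t\<bar> \<le> G * \<bar>a - b\<bar>" and G: "0 \<le> G"
    and bu: "\<And>t. 0 \<le> t \<Longrightarrow> u 0 t = g (v 0 t) t" "\<And>t. 0 \<le> t \<Longrightarrow> u' 0 t = g (v' 0 t) t"
    and bv: "\<And>t. 0 \<le> t \<Longrightarrow> v 1 t = v' 1 t"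
    and R: "\<And>w x t. w \<in> {u, v, u', v'} \<Longrightarrow> x \<in> {0..1} \<Longrightarrow> 0 \<le> t \<Longrightarrow> \<bar>w x t\<bar> \<le> R"
begin

text \<open>The three terms of \<open>K3\<close> stem from the distance of the feet, the distance of
  the curves inside the source, and the difference of the states inside the source. The slab length
  \<open>\<tau>\<close> is chosen to meet the conditions of \<open>tau\<close> at once.\<close>

definition "K3 = 4 * c * L + K * (4 * L) + 2 * L"
definition "\<tau> = 1 / (2 * ((G + 1) * K3 + K + 1))"

lemma K3_nonneg: "0 \<le> K3" using c L K_nonneg by (simp add: K3_def)

lemma tau: "0 < \<tau>" "K * \<tau> \<le> 1 / 2" "\<tau> \<le> 1" "(G + 1) * K3 * \<tau> \<le> 1 / 2"
proof -
  have n: "0 \<le> (G + 1) * K3" "0 \<le> K" using G K3_nonneg K_nonneg by simp_all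
  then have d: "0 < (G + 1) * K3 + K + 1" by linarith
  have q: "x / (2 * y) \<le> 1 / 2" if "x \<le> y" "0 < y" for x y :: real
    using that by (simp add: field_simps)
  show "0 < \<tau>" using d by (simp add: \<tau>_def)
  show "K * \<tau> \<le> 1 / 2" "(G + 1) * K3 * \<tau> \<le> 1 / 2"
    using q[of K, OF _ d] q[of "(G + 1) * K3", OF _ d] n by (simp_all add: \<tau>_def)
  show "\<tau> \<le> 1" using q[of 1, OF _ d] n by (simp add: \<tau>_def)
qed

text \<open>\<open>v\<close> comes first: its inflow value at x = 1 is common to both solutions. At
  x = 0 the boundary condition passes the error of \<open>v\<close> on to \<open>u\<close> with
  factor \<open>G\<close>, hence \<open>G + 1\<close>.\<close>

lemma slab_contraction:
  assumes t0: "0 \<le> t0" and i: "\<And>x. x \<in> {0..1} \<Longrightarrow> u x t0 = u' x t0 \<and> v x t0 = v' x t0"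
    and E: "\<And>x t. x \<in> {0..1} \<Longrightarrow> t \<in> {t0..t0 + \<tau>} \<Longrightarrow> \<bar>u x t - u' x t\<bar> \<le> E \<and> \<bar>v x t - v' x t\<bar> \<le> E"
    and x: "x \<in> {0..1}" and t: "t \<in> {t0..t0 + \<tau>}"
  shows "\<bar>u x t - u' x t\<bar> \<le> E / 2 \<and> \<bar>v x t - v' x t\<bar> \<le> E / 2"
proof -
  have E0: "0 \<le> E" using E[OF x t] abs_ge_zero[of "u x t - u' x t"] by linarith
  have tt: "t0 \<le> s" "K * (s - t0) \<le> 1 / 2" "s - t0 \<le> 1" "K3 * E * (s - t0) \<le> K3 * E * \<tau>" if "s \<in> {t0..t0 + \<tau>}" for s
  proof -
    show "t0 \<le> s" "s - t0 \<le> 1" using that tau(3) by auto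
    have "K * (s - t0) \<le> K * \<tau>" using that K_nonneg by (intro mult_left_mono) auto
    then show "K * (s - t0) \<le> 1 / 2" using tau(2) by linarith
    show "K3 * E * (s - t0) \<le> K3 * E * \<tau>" using that K3_nonneg E0 by (intro mult_left_mono) auto
  qed
  have V: "\<bar>v y s - v' y s\<bar> \<le> K3 * E * \<tau>" if y: "y \<in> {0..1}" and s: "s \<in> {t0..t0 + \<tau>}" for y s
  proof -
    have "\<exists>p a. p \<in> {0..1} \<and> a \<in> {t0..s} \<and> (a = t0 \<or> p = (if (-1::real) = 1 then 0 else 1)) \<and>
      \<bar>v y s - v' y s\<bar> \<le> \<bar>v p a - v' p a\<bar> + (4 * c * L + K * (4 * L) + 2 * L) * E * (s - t0)"
    proof (rule component_estimate[of lv fv u v u' v' v v' "-1" t0 s y E])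
      show "((\<lambda>t. fv (\<xi> t) (u (\<xi> t) t) (v (\<xi> t) t)) has_integral (v (\<xi> b) b - v (\<xi> a) a)) {a..b}"
        if "characteristic 1 (\<lambda>x a b. -1 * lv x a b) u v \<xi> a b" for \<xi> a b
        using broad that unfolding broad_solution_def by simp
      show "((\<lambda>t. fv (\<xi> t) (u' (\<xi> t) t) (v' (\<xi> t) t)) has_integral (v' (\<xi> b) b - v' (\<xi> a) a)) {a..b}"
        if "characteristic 1 (\<lambda>x a b. -1 * lv x a b) u' v' \<xi> a b" for \<xi> a b
        using broad' that unfolding broad_solution_def by simp
      show "\<bar>u x t - u' x t\<bar> \<le> E \<and> \<bar>v x t - v' x t\<bar> \<le> E" if "x \<in> {0..1}" "t \<in> {t0..s}" for x t
        using E that s by auto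
    qed (use t0 tt[OF s] y lv_pos in auto)
    then obtain p a where p: "p \<in> {0..1}" "a \<in> {t0..s}" "a = t0 \<or> p = 1"
      "\<bar>v y s - v' y s\<bar> \<le> \<bar>v p a - v' p a\<bar> + K3 * E * (s - t0)" by (auto simp: K3_def)
    have "v p a = v' p a" using p i bv t0 by auto
    then show ?thesis using p(4) tt(4)[OF s] by simp
  qed
  have U: "\<bar>u y s - u' y s\<bar> \<le> (G + 1) * K3 * \<tau> * E" if y: "y \<in> {0..1}" and s: "s \<in> {t0..t0 + \<tau>}" for y s
  proof -
    have "\<exists>p a. p \<in> {0..1} \<and> a \<in> {t0..s} \<and> (a = t0 \<or> p = (if (1::real) = 1 then 0 else 1)) \<and>
      \<bar>u y s - u' y s\<bar> \<le> \<bar>u p a - u' p a\<bar> + (4 * c * L + K * (4 * L) + 2 * L) * E * (s - t0)"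
    proof (rule component_estimate[of lu fu u v u' v' u u' 1 t0 s y E])
      show "((\<lambda>t. fu (\<xi> t) (u (\<xi> t) t) (v (\<xi> t) t)) has_integral (u (\<xi> b) b - u (\<xi> a) a)) {a..b}"
        if "characteristic 1 (\<lambda>x a b. 1 * lu x a b) u v \<xi> a b" for \<xi> a b
        using broad that unfolding broad_solution_def by simp
      show "((\<lambda>t. fu (\<xi> t) (u' (\<xi> t) t) (v' (\<xi> t) t)) has_integral (u' (\<xi> b) b - u' (\<xi> a) a)) {a..b}"
        if "characteristic 1 (\<lambda>x a b. 1 * lu x a b) u' v' \<xi> a b" for \<xi> a b
        using broad' that unfolding broad_solution_def by simp
      show "\<bar>u x t - u' x t\<bar> \<le> E \<and> \<bar>v x t - v' x t\<bar> \<le> E" if "x \<in> {0..1}" "t \<in> {t0..s}" for x t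
        using E that s by auto
    qed (use t0 tt[OF s] y lu_pos in auto)
    then obtain p a where p: "p \<in> {0..1}" "a \<in> {t0..s}" "a = t0 \<or> p = 0"
      "\<bar>u y s - u' y s\<bar> \<le> \<bar>u p a - u' p a\<bar> + K3 * E * (s - t0)" by (auto simp: K3_def)
    have "\<bar>u p a - u' p a\<bar> \<le> G * (K3 * E * \<tau>)"
      using p(3)
    proof
      assume "a = t0"
      then show ?thesis using i[OF p(1)] G K3_nonneg E0 tau(1) by simp
    next
      assume "p = 0"
      have a: "0 \<le> a" "a \<in> {t0..t0 + \<tau>}" using p(2) s t0 by auto
      have "\<bar>u p a - u' p a\<bar> \<le> G * \<bar>v 0 a - v' 0 a\<bar>" unfolding \<open>p = 0\<close> bu(1)[OF a(1)] bu(2)[OF a(1)] by (rule g[OF a(1)])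
      also have "\<dots> \<le> G * (K3 * E * \<tau>)" using V[OF _ a(2), of 0] G by (intro mult_left_mono) auto
      finally show ?thesis .
    qed
    moreover have "(G + 1) * K3 * \<tau> * E = G * (K3 * E * \<tau>) + K3 * E * \<tau>" by (simp add: algebra_simps)
    ultimately show ?thesis using p(4) tt(4)[OF s] by linarith
  qed
  have half: "(G + 1) * K3 * \<tau> * E \<le> E / 2" using mult_right_mono[OF tau(4) E0] by simp
  have "K3 * E * \<tau> \<le> (G + 1) * K3 * \<tau> * E"
    using G K3_nonneg E0 tau(1) by (simp add: algebra_simps)
  then show ?thesis using U[OF x t] V[OF x t] half by linarith
qed

text \<open>Starting from the global bound 2 R, the contraction halves the difference
  indefinitely.\<close>

lemma slab_unique:
  assumes t0: "0 \<le> t0" and i: "\<And>x. x \<in> {0..1} \<Longrightarrow> u x t0 = u' x t0 \<and> v x t0 = v' x t0"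
    and x: "x \<in> {0..1}" and t: "t \<in> {t0..t0 + \<tau>}"
  shows "u x t = u' x t \<and> v x t = v' x t"
proof -
  have "\<bar>u x t - u' x t\<bar> \<le> 2 * R * (1 / 2) ^ n \<and> \<bar>v x t - v' x t\<bar> \<le> 2 * R * (1 / 2) ^ n"
    if "x \<in> {0..1}" "t \<in> {t0..t0 + \<tau>}" for n x t
    using that
  proof (induction n arbitrary: x t)
    case 0
    then have "0 \<le> t" using t0 by simp
    then have "\<bar>u x t\<bar> \<le> R" "\<bar>u' x t\<bar> \<le> R" "\<bar>v x t\<bar> \<le> R" "\<bar>v' x t\<bar> \<le> R"
      using R[of u x t] R[of u' x t] R[of v x t] R[of v' x t] 0 by auto
    then have "\<bar>u x t - u' x t\<bar> \<le> 2 * R" "\<bar>v x t - v' x t\<bar> \<le> 2 * R" by linarith+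
    then show ?case by simp
  next
    case (Suc n)
    show ?case using slab_contraction[OF t0 i Suc.IH Suc.prems] by simp
  qed
  then have b: "\<bar>u x t - u' x t\<bar> \<le> 2 * R * (1 / 2) ^ n" "\<bar>v x t - v' x t\<bar> \<le> 2 * R * (1 / 2) ^ n" for n using x t by blast+
  have "(\<lambda>n. 2 * R * (1 / 2) ^ n) \<longlonglongrightarrow> 2 * R * 0" by (intro tendsto_intros LIMSEQ_power_zero) simp
  then have lim: "(\<lambda>n. 2 * R * (1 / 2) ^ n) \<longlonglongrightarrow> 0" by simp
  have "\<bar>u x t - u' x t\<bar> \<le> 0" "\<bar>v x t - v' x t\<bar> \<le> 0"
    using LIMSEQ_le_const[OF lim, of "\<bar>u x t - u' x t\<bar>"] LIMSEQ_le_const[OF lim, of "\<bar>v x t - v' x t\<bar>"] b by blast+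
  then show ?thesis by simp
qed

lemma unique:
  assumes i: "\<And>x. x \<in> {0..1} \<Longrightarrow> u x 0 = u' x 0 \<and> v x 0 = v' x 0" and x: "x \<in> {0..1}" and t: "0 \<le> t"
  shows "u x t = u' x t \<and> v x t = v' x t"
proof -
  have "u x t = u' x t \<and> v x t = v' x t" if "x \<in> {0..1}" "0 \<le> t" "t \<le> real n * \<tau>" for n x t
    using that
  proof (induction n arbitrary: x t)
    case 0
    then show ?case using i by simp
  next
    case (Suc n)
    show ?case
    proof (cases "t \<le> real n * \<tau>")
      case True
      then show ?thesis using Suc by blast
    next
      case False
      have n0: "0 \<le> real n * \<tau>" using tau(1) by simp
      show ?thesis
      proof (rule slab_unique[OF n0 _ Suc.prems(1)])
        show "u y (real n * \<tau>) = u' y (real n * \<tau>) \<and> v y (real n * \<tau>) = v' y (real n * \<tau>)" if "y \<in> {0..1}" for y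
          using Suc.IH[OF that n0] by simp
        show "t \<in> {real n * \<tau>..real n * \<tau> + \<tau>}" using False Suc.prems(3) by (simp add: algebra_simps)
      qed
    qed
  qed
  moreover obtain n :: nat where "t / \<tau> < real n" using reals_Archimedean2 by blast
  then have "t \<le> real n * \<tau>" using tau(1) by (simp add: pos_divide_less_eq less_imp_le)
  ultimately show ?thesis using x t by blast
qed

end

section \<open>Existence\<close>

lemma abs_clamp_self_le: "0 \<le> R \<Longrightarrow> \<bar>max (-R) (min R a)\<bar> \<le> \<bar>a\<bar>" "0 \<le> R \<Longrightarrow> \<bar>max (-R) (min R a)\<bar> \<le> R" for R a :: real
  by auto

text \<open>\<open>lg\<close> stands for \<open>l_gu g\<close> as a bare number: the constants of
  the theorem are fixed before the boundary function \<open>g\<close> is given.\<close>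

locale pde_coeffs =
  fixes lu lv fu fv :: "real \<Rightarrow> real \<Rightarrow> real \<Rightarrow> real" and ct lg :: real
  assumes lips: "lipschitz_coeff lu" "lipschitz_coeff lv" "lipschitz_coeff fu" "lipschitz_coeff fv"
    and pos: "\<And>x a b. x \<in> {0..1} \<Longrightarrow> 0 < lu x a b \<and> 0 < lv x a b"
    and bdd: "bdd_above (inv_Lambda_norm lu lv ` ({0..1} \<times> UNIV))"
    and zero: "\<And>x. x \<in> {0..1} \<Longrightarrow> fu x 0 0 = 0 \<and> fv x 0 0 = 0"
    and ct0: "0 \<le> ct"
begin

text \<open>By the growth estimate solutions stay in \<open>[-R, R]\<close>, so clamping the state does not affect them.\<close>

definition "R = kappa1 lu lv fu fv lg * ct"
definition "ell = l_inv_Lambda lu lv"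
definition "lF = l_F fu fv"
definition "gam = gamma2 lu lv fu fv R"
definition "Mu = clamp_coeff R (\<lambda>x a b. 1 / lu x a b)"
definition "Mv = clamp_coeff R (\<lambda>x a b. 1 / lv x a b)"
definition "Pu = clamp_coeff R (\<lambda>x a b. fu x a b / lu x a b)"
definition "Pv = clamp_coeff R (\<lambda>x a b. fv x a b / lv x a b)"
definition "K0 = max 1 lg * ct"
definition "Pm = lF * ell * R"
definition "ct' = 1 / (2 * max 1 lg) * exp (- gam)"
text \<open>Bounds the x-derivatives, from u_x = P - M u_t with |u_t| \<le> exp gam, and likewise
  for v.\<close>

definition "Lx = exp gam * ell + Pm"

lemma recip_le: "x \<in> {0..1} \<Longrightarrow> 1 / lu x a b \<le> ell" "x \<in> {0..1} \<Longrightarrow> 1 / lv x a b \<le> ell"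
proof -
  assume x: "x \<in> {0..1}"
  have "inv_Lambda_norm lu lv (x, a, b) \<le> ell"
    unfolding ell_def l_inv_Lambda_def using x by (intro cSUP_upper bdd) auto
  then have "max \<bar>1 / lu x a b\<bar> \<bar>1 / lv x a b\<bar> \<le> ell" by (simp add: inv_Lambda_norm_def)
  then show "1 / lu x a b \<le> ell" "1 / lv x a b \<le> ell" by (meson abs_le_D1 max.bounded_iff)+
qed

lemma lF_nonneg: "0 \<le> lF"
  unfolding lF_def using lipschitz_l_F(3)[OF lips(3,4), of 0] by simp

lemma ell_pos: "0 < ell"
  by (rule less_le_trans[OF _ recip_le(1)[of 0 0 0]]) (use pos[of 0 0 0] in auto)

lemma K0_nonneg: "0 \<le> K0" "ct \<le> K0"
  using ct0 mult_right_mono[of 1 "max 1 lg" ct] by (auto simp: K0_def)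

text \<open>\<open>K0\<close> bounds the data at x = 0, including u(0, .) = g(v(0, .), .), and the
  exponential is the Gronwall factor for 0 \<le> x \<le> 1.\<close>

lemma R_eq: "R = exp (lF * ell) * K0"
  by (simp add: R_def K0_def kappa1_def lF_def ell_def)

lemma R_ge: "K0 \<le> R" "0 \<le> R"
proof -
  have "1 \<le> exp (lF * ell)" using lF_nonneg ell_pos by simp
  from mult_right_mono[OF this K0_nonneg(1)] show "K0 \<le> R" by (simp add: R_eq)
  then show "0 \<le> R" using K0_nonneg by simp
qed

lemma speed_sources: "speed_source lu fu ell R" "speed_source lv fv ell R"
  using lips pos recip_le R_ge by (auto simp: speed_source_def)

lemma gam_nonneg: "0 \<le> gam"
  unfolding gam_def by (rule lipschitz_gamma2(1)[OF speed_sources])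

lemma clamp01: "max 0 (min 1 x) \<in> {0..1}" for x :: real by auto

lemma coeff_cases: "F \<in> {Mu, Mv, Pu, Pv} \<Longrightarrow> \<exists>H\<in>{\<lambda>x a b. 1 / lu x a b, \<lambda>x a b. 1 / lv x a b, \<lambda>x a b. fu x a b / lu x a b, \<lambda>x a b. fv x a b / lv x a b}. F = clamp_coeff R H"
  unfolding Mu_def Mv_def Pu_def Pv_def by blast

text \<open>The clamp is 1-Lipschitz in each component of the state, so the constant valid on the
  box holds globally.\<close>

lemma coeff_gam:
  assumes "F \<in> {Mu, Mv, Pu, Pv}"
  shows "\<bar>F x a b - F x a' b'\<bar> \<le> gam * max \<bar>a - a'\<bar> \<bar>b - b'\<bar>"
proof -
  obtain H where H: "H \<in> {\<lambda>x a b. 1 / lu x a b, \<lambda>x a b. 1 / lv x a b, \<lambda>x a b. fu x a b / lu x a b, \<lambda>x a b. fv x a b / lv x a b}"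
    "F = clamp_coeff R H" using coeff_cases[OF assms] by blast
  let ?c = "\<lambda>a. max (-R) (min R a)"
  have "\<bar>F x a b - F x a' b'\<bar> \<le> gam * max \<bar>?c a - ?c a'\<bar> \<bar>?c b - ?c b'\<bar>"
    unfolding H(2) clamp_coeff_def gam_def
    by (rule lipschitz_gamma2(2)[OF speed_sources H(1) clamp01]) (use R_ge in \<open>auto intro!: abs_clamp_self_le(2)\<close>)
  also have "\<dots> \<le> gam * max \<bar>a - a'\<bar> \<bar>b - b'\<bar>"
    using gam_nonneg by (intro mult_left_mono max.mono abs_clamp_le)
  finally show ?thesis .
qed

lemma coeff_lipschitz: "\<exists>A\<ge>0. \<forall>F\<in>{Mu, Mv, Pu, Pv}. \<forall>x a b x' a' b'. \<bar>F x a b - F x' a' b'\<bar> \<le> A * (\<bar>x - x'\<bar> + \<bar>a - a'\<bar> + \<bar>b - b'\<bar>)"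
proof -
  obtain A1 A2 A3 A4 where A: "lipschitz3 Mu A1" "lipschitz3 Mv A2" "lipschitz3 Pu A3" "lipschitz3 Pv A4"
    unfolding Mu_def Mv_def Pu_def Pv_def
    using speed_source.clamp_coeff_lipschitz3[OF speed_sources(1)] speed_source.clamp_coeff_lipschitz3[OF speed_sources(2)] by blast
  note n = A[THEN lipschitz3.A_nonneg]
  define A where "A = A1 + A2 + A3 + A4"
  have mono: "\<bar>F x a b - F x' a' b'\<bar> \<le> A * (\<bar>x - x'\<bar> + \<bar>a - a'\<bar> + \<bar>b - b'\<bar>)" if "lipschitz3 F B" "B \<le> A" for F B x a b x' a' b'
    by (rule order_trans[OF lipschitz3.lip3[OF that(1)] mult_right_mono[OF that(2)]]) simp
  have le: "A1 \<le> A" "A2 \<le> A" "A3 \<le> A" "A4 \<le> A" using n by (simp_all add: A_def)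
  have "\<forall>F\<in>{Mu, Mv, Pu, Pv}. \<forall>x a b x' a' b'. \<bar>F x a b - F x' a' b'\<bar> \<le> A * (\<bar>x - x'\<bar> + \<bar>a - a'\<bar> + \<bar>b - b'\<bar>)"
  proof (intro ballI allI)
    fix F x a b x' a' b' assume "F \<in> {Mu, Mv, Pu, Pv}"
    then obtain B where "lipschitz3 F B" "B \<le> A" using A le by blast
    then show "\<bar>F x a b - F x' a' b'\<bar> \<le> A * (\<bar>x - x'\<bar> + \<bar>a - a'\<bar> + \<bar>b - b'\<bar>)" by (rule mono)
  qed
  moreover have "0 \<le> A" using n by (simp add: A_def)
  ultimately show ?thesis by blast
qed

text \<open>A Lipschitz speed may be unbounded, but on the box it is bounded, and clamping confines
  the arguments to the box.\<close>

lemma Mu_lower: "\<exists>m>0. \<forall>x a b. m \<le> Mu x a b"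
proof -
  obtain L where L: "0 \<le> L" "\<And>x a b x' a' b'. x \<in> {0..1} \<Longrightarrow> x' \<in> {0..1} \<Longrightarrow>
      \<bar>lu x a b - lu x' a' b'\<bar> \<le> L * (\<bar>x - x'\<bar> + \<bar>a - a'\<bar> + \<bar>b - b'\<bar>)"
    using lipschitz_coeff_imp_lipschitz3[OF lips(1)] by metis
  define S where "S = lu 0 0 0 + L * (1 + R + R)"
  have S: "lu x a b \<le> S" if "x \<in> {0..1}" "\<bar>a\<bar> \<le> R" "\<bar>b\<bar> \<le> R" for x a b
  proof -
    have "\<bar>lu x a b - lu 0 0 0\<bar> \<le> L * (\<bar>x - 0\<bar> + \<bar>a - 0\<bar> + \<bar>b - 0\<bar>)" using that by (intro L) auto
    also have "\<dots> \<le> L * (1 + R + R)" using that L(1) by (intro mult_left_mono add_mono) auto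
    finally show ?thesis by (simp add: S_def)
  qed
  have S0: "0 < S" using S[of 0 0 0] pos[of 0 0 0] R_ge by simp
  have "1 / S \<le> Mu x a b" for x a b
    unfolding Mu_def clamp_coeff_def using S0 R_ge clamp01 pos
    by (intro frac_le S abs_clamp_self_le(2)) auto
  then show ?thesis using S0 by (intro exI[of _ "1 / S"]) auto
qed

lemma M_upper: "Mu x a b \<le> ell" "0 \<le> Mv x a b" "Mv x a b \<le> ell"
  unfolding Mu_def Mv_def clamp_coeff_def using recip_le[OF clamp01] pos[OF clamp01] by (auto simp: less_imp_le)

text \<open>The sources vanish at the zero state, so \<open>lF\<close> bounds them linearly in the
  state; division by the speed contributes \<open>ell\<close>. The product is the exponent in
  \<open>kappa1\<close>.\<close>

lemma P_growth: "\<bar>Pu x a b\<bar> \<le> lF * ell * max \<bar>a\<bar> \<bar>b\<bar>" "\<bar>Pv x a b\<bar> \<le> lF * ell * max \<bar>a\<bar> \<bar>b\<bar>"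
  and P_bound: "\<bar>Pu x a b\<bar> \<le> Pm" "\<bar>Pv x a b\<bar> \<le> Pm"
proof -
  let ?c = "\<lambda>a. max (-R) (min R a)" and ?x = "max 0 (min 1 x)"
  have *: "\<bar>f ?x (?c a) (?c b) / l ?x (?c a) (?c b)\<bar> \<le> lF * ell * max \<bar>?c a\<bar> \<bar>?c b\<bar>"
    if f: "\<bar>f ?x (?c a) (?c b) - f ?x 0 0\<bar> \<le> lF * max \<bar>?c a - 0\<bar> \<bar>?c b - 0\<bar>" "f ?x 0 0 = 0"
      and l: "0 < l ?x (?c a) (?c b)" "1 / l ?x (?c a) (?c b) \<le> ell" for f l :: "real \<Rightarrow> real \<Rightarrow> real \<Rightarrow> real"
  proof -
    have "\<bar>f ?x (?c a) (?c b) / l ?x (?c a) (?c b)\<bar> = \<bar>f ?x (?c a) (?c b)\<bar> * (1 / l ?x (?c a) (?c b))"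
      using l by (simp add: abs_divide)
    also have "\<dots> \<le> (lF * max \<bar>?c a\<bar> \<bar>?c b\<bar>) * ell"
    proof (rule mult_mono[OF _ l(2)])
      show "\<bar>f ?x (?c a) (?c b)\<bar> \<le> lF * max \<bar>?c a\<bar> \<bar>?c b\<bar>" using f(1) unfolding f(2) diff_zero .
      show "0 \<le> lF * max \<bar>?c a\<bar> \<bar>?c b\<bar>" by (intro mult_nonneg_nonneg lF_nonneg max.coboundedI1 abs_ge_zero)
      show "0 \<le> 1 / l ?x (?c a) (?c b)" using l(1) by simp
    qed
    also have "\<dots> = lF * ell * max \<bar>?c a\<bar> \<bar>?c b\<bar>" by (simp only: mult.assoc mult.commute[of ell])
    finally show ?thesis .
  qed
  have u: "\<bar>Pu x a b\<bar> \<le> lF * ell * max \<bar>?c a\<bar> \<bar>?c b\<bar>"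
    unfolding Pu_def clamp_coeff_def
    by (rule *) (use lipschitz_l_F(1)[OF lips(3,4) clamp01, folded lF_def] zero[OF clamp01] pos[OF clamp01] recip_le(1)[OF clamp01] in blast)+
  have v: "\<bar>Pv x a b\<bar> \<le> lF * ell * max \<bar>?c a\<bar> \<bar>?c b\<bar>"
    unfolding Pv_def clamp_coeff_def
    by (rule *) (use lipschitz_l_F(2)[OF lips(3,4) clamp01, folded lF_def] zero[OF clamp01] pos[OF clamp01] recip_le(2)[OF clamp01] in blast)+
  have le: "lF * ell * max \<bar>?c a\<bar> \<bar>?c b\<bar> \<le> lF * ell * max \<bar>a\<bar> \<bar>b\<bar>" "lF * ell * max \<bar>?c a\<bar> \<bar>?c b\<bar> \<le> Pm"
  proof -
    have "0 \<le> lF * ell" using lF_nonneg ell_pos by simp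
    then show "lF * ell * max \<bar>?c a\<bar> \<bar>?c b\<bar> \<le> lF * ell * max \<bar>a\<bar> \<bar>b\<bar>" "lF * ell * max \<bar>?c a\<bar> \<bar>?c b\<bar> \<le> Pm"
      unfolding Pm_def by (intro mult_left_mono max.mono max.boundedI abs_clamp_self_le R_ge(2); assumption)+
  qed
  show "\<bar>Pu x a b\<bar> \<le> lF * ell * max \<bar>a\<bar> \<bar>b\<bar>" "\<bar>Pv x a b\<bar> \<le> lF * ell * max \<bar>a\<bar> \<bar>b\<bar>"
    "\<bar>Pu x a b\<bar> \<le> Pm" "\<bar>Pv x a b\<bar> \<le> Pm" using u v le by linarith+
qed

lemma Pm_nonneg: "0 \<le> Pm" using lF_nonneg ell_pos R_ge by (simp add: Pm_def)

text \<open>The factor 2 in the denominator makes \<open>ct'\<close> strictly smaller than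
  \<open>exp (- gam)\<close>, which leaves room for mesh errors in the slopes; the product identity
  is consumed by the Lipschitz constant of \<open>ub\<close>.\<close>

lemma ct'_props: "0 < ct'" "ct' < exp (- gam)" "2 * max 1 lg * ct' = exp (- gam)"
proof -
  have m: "1 \<le> max 1 lg" by simp
  show "0 < ct'" using m by (simp add: ct'_def)
  show eq: "2 * max 1 lg * ct' = exp (- gam)" using m by (simp add: ct'_def)
  have "1 * ct' < (2 * max 1 lg) * ct'" using m \<open>0 < ct'\<close> by (intro mult_strict_right_mono) auto
  then show "ct' < exp (- gam)" using eq by simp
qed

end

section \<open>Existence and uniqueness for given data\<close>

locale pde_instance = pde_coeffs +
  fixes g :: "real \<Rightarrow> real \<Rightarrow> real" and u0 v0 U phi :: "real \<Rightarrow> real" and A m L0 Lv :: real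
  assumes A0: "0 \<le> A"
    and A_lip: "\<And>F x a b x' a' b'. F \<in> {Mu, Mv, Pu, Pv} \<Longrightarrow> \<bar>F x a b - F x' a' b'\<bar> \<le> A * (\<bar>x - x'\<bar> + \<bar>a - a'\<bar> + \<bar>b - b'\<bar>)"
    and m: "0 < m" "\<And>x a b. m \<le> Mu x a b"
    and g_lip: "\<exists>L. L-lipschitz_on (UNIV \<times> {0..}) (\<lambda>(b, t). g b t)" and lg: "l_gu g = lg"
    and g0: "\<And>t. 0 \<le> t \<Longrightarrow> g 0 t = 0"
    and u0_lip: "L0-lipschitz_on {0..1} u0" and v0_lip: "Lv-lipschitz_on {0..1} v0"
    and phi_lip: "\<exists>L. L-lipschitz_on {0..} phi"
    and compatible: "compatible_data lu lv fu fv g u0 v0 U phi"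
    and data_bound: "\<And>x. x \<in> {0..1} \<Longrightarrow> max \<bar>u0 x\<bar> \<bar>v0 x\<bar> \<le> ct" and phi_bound: "\<And>t. 0 \<le> t \<Longrightarrow> \<bar>phi t\<bar> \<le> ct"
    and ut_small: "ess_sup_on {0..1} (ut_initial lu fu u0 v0) \<le> ct'"
    and gt_small: "dt_gu_norm g \<le> ct'" and phit_small: "ess_sup_on {0..} (deriv phi) \<le> ct'"
begin

definition "u0x x = u0 (max 0 (min 1 x))"
definition "ub t = g (phi t) t"

lemma L0_nonneg: "0 \<le> L0" using u0_lip by (rule lipschitz_on_nonneg)
lemma Lv_nonneg: "0 \<le> Lv" using v0_lip by (rule lipschitz_on_nonneg)

lemma u0_lip': "x \<in> {0..1} \<Longrightarrow> y \<in> {0..1} \<Longrightarrow> \<bar>u0 x - u0 y\<bar> \<le> L0 * \<bar>x - y\<bar>"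
  and v0_lip': "x \<in> {0..1} \<Longrightarrow> y \<in> {0..1} \<Longrightarrow> \<bar>v0 x - v0 y\<bar> \<le> Lv * \<bar>x - y\<bar>"
  using lipschitz_onD[OF u0_lip] lipschitz_onD[OF v0_lip] by (auto simp: dist_real_def)

lemma u0x_lip: "\<bar>u0x x - u0x y\<bar> \<le> L0 * \<bar>x - y\<bar>"
proof -
  have "\<bar>u0x x - u0x y\<bar> \<le> L0 * \<bar>max 0 (min 1 x) - max 0 (min 1 y)\<bar>"
    unfolding u0x_def by (intro u0_lip' clamp01)
  also have "\<dots> \<le> L0 * \<bar>x - y\<bar>" using L0_nonneg by (intro mult_left_mono abs_clamp_le)
  finally show ?thesis .
qed

lemma u0x_eq: "x \<in> {0..1} \<Longrightarrow> u0x x = u0 x" by (simp add: u0x_def)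

lemma lg_nonneg: "0 \<le> lg" using g_lip lg boundary_lipschitz(1) by blast

lemma phi_lip': "0 \<le> t \<Longrightarrow> 0 \<le> s \<Longrightarrow> \<bar>phi t - phi s\<bar> \<le> ct' * \<bar>t - s\<bar>"
proof -
  assume ts: "0 \<le> t" "0 \<le> s"
  obtain L where "L-lipschitz_on {0..} phi" using phi_lip by blast
  from trace_lipschitz[OF this ts] mult_right_mono[OF phit_small, of "\<bar>t - s\<bar>"]
  show ?thesis by linarith
qed

lemma g_lips: "0 \<le> t \<Longrightarrow> \<bar>g b t - g b' t\<bar> \<le> lg * \<bar>b - b'\<bar>"
  "0 \<le> t \<Longrightarrow> 0 \<le> s \<Longrightarrow> \<bar>g b t - g b s\<bar> \<le> ct' * \<bar>t - s\<bar>"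
proof -
  obtain L where L: "L-lipschitz_on (UNIV \<times> {0..}) (\<lambda>(b, t). g b t)" using g_lip by blast
  show "0 \<le> t \<Longrightarrow> \<bar>g b t - g b' t\<bar> \<le> lg * \<bar>b - b'\<bar>"
    using boundary_lipschitz(3)[OF L, of t b b'] lg by simp
  show "0 \<le> t \<Longrightarrow> 0 \<le> s \<Longrightarrow> \<bar>g b t - g b s\<bar> \<le> ct' * \<bar>t - s\<bar>"
    using boundary_lipschitz(4)[OF L, of t s b] mult_right_mono[OF gt_small, of "\<bar>t - s\<bar>"] by linarith
qed

text \<open>The boundary value depends on time through \<open>phi\<close> and directly, with
  constants \<open>lg * ct'\<close> and \<open>ct'\<close>; the sum is at most
  \<open>2 * max 1 lg * ct'\<close>. This explains the denominator in \<open>ct'\<close>.\<close>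

lemma ub_lip: "lip_nonneg ub (exp (- gam))"
  unfolding lip_nonneg_def ub_def
proof (intro allI impI)
  fix t s :: real assume ts: "0 \<le> t" "0 \<le> s"
  have "lg * \<bar>phi t - phi s\<bar> \<le> lg * (ct' * \<bar>t - s\<bar>)" using phi_lip'[OF ts] lg_nonneg by (rule mult_left_mono)
  then have "\<bar>g (phi t) t - g (phi s) s\<bar> \<le> lg * (ct' * \<bar>t - s\<bar>) + ct' * \<bar>t - s\<bar>"
    using g_lips(1)[OF ts(1), of "phi t" "phi s"] g_lips(2)[OF ts, of "phi s"] by linarith
  also have "\<dots> = (lg + 1) * ct' * \<bar>t - s\<bar>" by (simp add: algebra_simps)
  also have "\<dots> \<le> 2 * max 1 lg * ct' * \<bar>t - s\<bar>"
    using ct'_props(1) by (intro mult_right_mono) auto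
  finally show "\<bar>g (phi t) t - g (phi s) s\<bar> \<le> exp (- gam) * \<bar>t - s\<bar>" unfolding ct'_props(3) .
qed

lemma phi_lip_nonneg: "lip_nonneg phi (exp (- gam))"
  by (rule lip_nonneg_mono[of _ ct']) (use phi_lip' ct'_props in \<open>auto simp: lip_nonneg_def\<close>)

lemma ub_bound: "0 \<le> t \<Longrightarrow> \<bar>ub t\<bar> \<le> K0"
proof -
  assume t: "0 \<le> t"
  have "\<bar>ub t\<bar> \<le> lg * \<bar>phi t\<bar>" using g_lips(1)[OF t, of "phi t" 0] g0[OF t] by (simp add: ub_def)
  also have "\<dots> \<le> max 1 lg * ct" using phi_bound[OF t] lg_nonneg by (intro mult_mono) auto
  finally show ?thesis by (simp add: K0_def)
qed

sublocale xp: x_problem Mu Mv Pu Pv A gam m ell Pm "lF * ell" K0 "exp (- gam)" L0 u0x ub phi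
proof
  show "\<bar>F x a b - F x' a' b'\<bar> \<le> A * (\<bar>x - x'\<bar> + \<bar>a - a'\<bar> + \<bar>b - b'\<bar>)" if "F \<in> {Mu, Mv, Pu, Pv}" for F x a b x' a' b'
    using A_lip[OF that] .
  show "\<bar>F x a b - F x a' b'\<bar> \<le> gam * max \<bar>a - a'\<bar> \<bar>b - b'\<bar>" if "F \<in> {Mu, Mv, Pu, Pv}" for F x a b a' b'
    using coeff_gam[OF that] .
  show "\<bar>u0x x\<bar> \<le> K0" for x
    unfolding u0x_def using data_bound[OF clamp01, of x] K0_nonneg by simp
  show "\<bar>phi t\<bar> \<le> K0" if "0 \<le> t" for t using phi_bound[OF that] K0_nonneg by simp
  show "ub 0 = u0x 0"
    using compatible by (simp add: ub_def u0x_def compatible_data_def)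
qed (use A0 gam_nonneg m Pm_nonneg lF_nonneg ell_pos K0_nonneg L0_nonneg M_upper P_bound P_growth u0x_lip ub_lip phi_lip_nonneg ub_bound in auto)

lemma unclamped: "x \<in> {0..1} \<Longrightarrow> \<bar>a\<bar> \<le> R \<Longrightarrow> \<bar>b\<bar> \<le> R \<Longrightarrow> Mu x a b = 1 / lu x a b"
  "x \<in> {0..1} \<Longrightarrow> \<bar>a\<bar> \<le> R \<Longrightarrow> \<bar>b\<bar> \<le> R \<Longrightarrow> Mv x a b = 1 / lv x a b"
  "x \<in> {0..1} \<Longrightarrow> \<bar>a\<bar> \<le> R \<Longrightarrow> \<bar>b\<bar> \<le> R \<Longrightarrow> Pu x a b = fu x a b / lu x a b"
  "x \<in> {0..1} \<Longrightarrow> \<bar>a\<bar> \<le> R \<Longrightarrow> \<bar>b\<bar> \<le> R \<Longrightarrow> Pv x a b = fv x a b / lv x a b"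
  unfolding Mu_def Mv_def Pu_def Pv_def by (simp_all add: clamp_coeff_eq)

text \<open>By the differential equation u_t(x, 0) = lu (P - u0'), so the bound \<open>ct'\<close>
  on it, divided by the speed, measures how far \<open>u0\<close> is from satisfying u0' =
  P.\<close>

lemma AE_initial_slope:
  "AE x in lborel. x \<in> {0<..<1} \<longrightarrow> u0 field_differentiable at x \<and>
    \<bar>deriv u0 x - Pu x (u0 x) (v0 x)\<bar> \<le> ct' * Mu x (u0 x) (v0 x)"
proof -
  have dx: "deriv u0x x = deriv u0 x" "u0x field_differentiable at x \<longleftrightarrow> u0 field_differentiable at x" if "x \<in> {0<..<1}" for x
  proof -
    have ev: "eventually (\<lambda>s. u0x s = u0 s) (nhds x)"
      using that by (intro eventually_nhds[THEN iffD2] exI[of _ "{0<..<1}"]) (auto simp: u0x_eq)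
    show "deriv u0x x = deriv u0 x" by (rule deriv_cong_ev[OF ev refl])
    show "u0x field_differentiable at x \<longleftrightarrow> u0 field_differentiable at x"
      unfolding field_differentiable_def using DERIV_cong_ev[OF refl ev refl] by blast
  qed
  have ball: "\<bar>u0 x\<bar> \<le> R" "\<bar>v0 x\<bar> \<le> R" if "x \<in> {0..1}" for x
    using data_bound[OF that] K0_nonneg R_ge by auto
  \<comment> \<open>Essential boundedness comes first; it is what allows the essential supremum to
    be used as a bound almost everywhere.\<close>
  obtain D where D: "AE x in lborel. x \<in> {0..1} \<longrightarrow> \<bar>ut_initial lu fu u0 v0 x\<bar> \<le> D"
  proof
    let ?D = "L0 / m + Pm / m"
    have ae: "AE x in lborel. x \<in> {0<..<1} \<longrightarrow> \<bar>ut_initial lu fu u0 v0 x\<bar> \<le> ?D"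
      using Lipschitz_AE_differentiable[OF u0x_lip]
    proof eventually_elim
      case (elim x)
      show ?case
      proof
        assume x: "x \<in> {0<..<1}"
        then have x': "x \<in> {0..1}" by simp
        note b = ball[OF x']
        have l: "0 < lu x (u0 x) (v0 x)" using pos[OF x'] by blast
        have lm: "lu x (u0 x) (v0 x) \<le> 1 / m"
          using m(2)[of x "u0 x" "v0 x"] m(1) l unfolding unclamped(1)[OF x' b] by (simp add: field_simps)
        have d: "\<bar>deriv u0 x\<bar> \<le> L0" using abs_deriv_le_Lipschitz[OF u0x_lip elim] dx(1)[OF x] by simp
        have "fu x (u0 x) (v0 x) = Pu x (u0 x) (v0 x) * lu x (u0 x) (v0 x)" using l unfolding unclamped(3)[OF x' b] by simp
        then have "ut_initial lu fu u0 v0 x = lu x (u0 x) (v0 x) * (Pu x (u0 x) (v0 x) - deriv u0 x)"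
          by (simp add: ut_initial_def algebra_simps)
        then have "\<bar>ut_initial lu fu u0 v0 x\<bar> = lu x (u0 x) (v0 x) * \<bar>Pu x (u0 x) (v0 x) - deriv u0 x\<bar>"
          using l by (simp add: abs_mult)
        also have "\<dots> \<le> 1 / m * (Pm + L0)"
          using lm l d P_bound(1)[of x "u0 x" "v0 x"] m(1) by (intro mult_mono) auto
        finally show "\<bar>ut_initial lu fu u0 v0 x\<bar> \<le> ?D" by (simp add: add_divide_distrib add.commute)
      qed
    qed
    show "AE x in lborel. x \<in> {0..1} \<longrightarrow> \<bar>ut_initial lu fu u0 v0 x\<bar> \<le> ?D"
      using ae AE_lborel_singleton[of "0::real"] AE_lborel_singleton[of "1::real"] by eventually_elim auto
  qed
  show ?thesis
    using AE_le_ess_sup_on[OF D] Lipschitz_AE_differentiable[OF u0x_lip]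
  proof eventually_elim
    case (elim x)
    show ?case
    proof
      assume x: "x \<in> {0<..<1}"
      then have x': "x \<in> {0..1}" by simp
      note b = ball[OF x']
      have l: "0 < lu x (u0 x) (v0 x)" using pos[OF x'] by blast
      have le: "\<bar>ut_initial lu fu u0 v0 x\<bar> \<le> ct'" using elim x' ut_small by auto
      have "deriv u0 x - Pu x (u0 x) (v0 x) = - ut_initial lu fu u0 v0 x * (1 / lu x (u0 x) (v0 x))"
        unfolding unclamped(3)[OF x' b] ut_initial_def using l by (simp add: field_simps)
      then have "\<bar>deriv u0 x - Pu x (u0 x) (v0 x)\<bar> = \<bar>ut_initial lu fu u0 v0 x\<bar> * (1 / lu x (u0 x) (v0 x))"
        using l by (simp add: abs_mult)
      also have "\<dots> \<le> ct' * Mu x (u0 x) (v0 x)"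
        unfolding unclamped(1)[OF x' b] using le l by (intro mult_right_mono) auto
      finally show "u0 field_differentiable at x \<and> \<bar>deriv u0 x - Pu x (u0 x) (v0 x)\<bar> \<le> ct' * Mu x (u0 x) (v0 x)"
        using elim dx(2)[OF x] by blast
    qed
  qed
qed

definition "Cs = (ct' + 1) * (A * (1 + L0 + Lv)) / m"

text \<open>The difference quotient of \<open>u0\<close> averages u0' over the cell, where it
  differs from \<open>Pu\<close> by at most \<open>ct' * Mu\<close> almost everywhere. Freezing the
  coefficients at the left end and at the computed value \<open>b\<close> costs multiples of
  \<open>\<eta>\<close>, and division by \<open>Mu\<close> gives back \<open>ct'\<close>.\<close>

lemma slope_v0:
  assumes d: "0 < d" and n: "real (Suc n) * d \<le> 1"
  shows "\<bar>xp.slope d n (u0x (real n * d)) b\<bar> \<le> ct' + Cs * (d + \<bar>b - v0 (real n * d)\<bar>)"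
proof -
  define x0 where "x0 = real n * d"
  let ?x = x0
  have nd: "real (Suc n) * d = ?x + d" by (simp add: x0_def algebra_simps)
  have "0 \<le> x0" using d by (simp add: x0_def)
  then have x: "?x \<in> {0..1}" "?x + d \<in> {0..1}" using d n unfolding nd by auto
  let ?P = "Pu ?x (u0 ?x) b" and ?M = "Mu ?x (u0 ?x) b"
  \<comment> \<open>Bounds the variation of all four coefficients over the cell when
    \<open>v0\<close> is replaced by the constant \<open>b\<close>.\<close>
  define \<eta> where "\<eta> = A * (1 + L0 + Lv) * (d + \<bar>b - v0 ?x\<bar>)"
  have near: "\<bar>F y (u0 y) (v0 y) - F ?x (u0 ?x) b\<bar> \<le> \<eta>" if F: "F \<in> {Mu, Mv, Pu, Pv}" and y: "y \<in> {?x..?x + d}" for F y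
  proof -
    have y1: "y \<in> {0..1}" "\<bar>y - ?x\<bar> \<le> d" using y x by auto
    have "\<bar>u0 y - u0 ?x\<bar> \<le> L0 * d"
      using u0_lip'[OF y1(1) x(1)] mult_left_mono[OF y1(2) L0_nonneg] by linarith
    moreover have "\<bar>v0 y - b\<bar> \<le> Lv * d + \<bar>b - v0 ?x\<bar>"
      using v0_lip'[OF y1(1) x(1)] mult_left_mono[OF y1(2) Lv_nonneg] by linarith
    ultimately have "\<bar>y - ?x\<bar> + \<bar>u0 y - u0 ?x\<bar> + \<bar>v0 y - b\<bar> \<le> d + L0 * d + (Lv * d + \<bar>b - v0 ?x\<bar>)"
      using y1(2) by linarith
    also have "\<dots> \<le> (1 + L0 + Lv) * (d + \<bar>b - v0 ?x\<bar>)"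
      using L0_nonneg Lv_nonneg by (simp add: algebra_simps)
    finally have "A * (\<bar>y - ?x\<bar> + \<bar>u0 y - u0 ?x\<bar> + \<bar>v0 y - b\<bar>) \<le> A * ((1 + L0 + Lv) * (d + \<bar>b - v0 ?x\<bar>))"
      using A0 by (rule mult_left_mono)
    then show ?thesis using A_lip[OF F, of y "u0 y" "v0 y" ?x "u0 ?x" b] unfolding \<eta>_def by (simp add: mult.assoc)
  qed
  have c0: "0 \<le> ct'" using ct'_props by simp
  let ?k = "\<lambda>y. u0 y - ?P * y"
  have "\<bar>?k (?x + d) - ?k ?x\<bar> \<le> (ct' * ?M + (ct' + 1) * \<eta>) * ((?x + d) - ?x)"
  proof (rule Lipschitz_if_AE_deriv_bounded[where L = "L0 + \<bar>?P\<bar>"])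
    fix y z assume "y \<in> {?x..?x + d}" "z \<in> {?x..?x + d}"
    then have "\<bar>u0 y - u0 z\<bar> \<le> L0 * \<bar>y - z\<bar>" using x by (intro u0_lip') auto
    moreover have "\<bar>?P * y - ?P * z\<bar> = \<bar>?P\<bar> * \<bar>y - z\<bar>" by (simp add: right_diff_distrib[symmetric] abs_mult)
    ultimately show "\<bar>?k y - ?k z\<bar> \<le> (L0 + \<bar>?P\<bar>) * \<bar>y - z\<bar>" by (simp add: distrib_right)
  next
    show "AE y in lborel. y \<in> {?x<..<?x + d} \<longrightarrow> \<bar>deriv ?k y\<bar> \<le> ct' * ?M + (ct' + 1) * \<eta>"
      using AE_initial_slope
    proof eventually_elim
      case (elim y)
      show ?case
      proof
        assume y: "y \<in> {?x<..<?x + d}"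
        then have y': "y \<in> {0<..<1}" "y \<in> {?x..?x + d}" using x by auto
        have "(u0 has_real_derivative deriv u0 y) (at y)" using elim y' by (simp add: DERIV_deriv_iff_field_differentiable)
        then have "(?k has_real_derivative deriv u0 y - ?P * 1) (at y)"
          by (intro DERIV_diff DERIV_cmult DERIV_ident)
        then have dk: "deriv ?k y = deriv u0 y - ?P" by (simp add: DERIV_imp_deriv)
        have a: "\<bar>deriv u0 y - Pu y (u0 y) (v0 y)\<bar> \<le> ct' * Mu y (u0 y) (v0 y)" using elim y' by blast
        have b1: "\<bar>Pu y (u0 y) (v0 y) - ?P\<bar> \<le> \<eta>" and b2: "\<bar>Mu y (u0 y) (v0 y) - ?M\<bar> \<le> \<eta>"
          by (rule near[OF _ y'(2)], simp)+
        have "ct' * Mu y (u0 y) (v0 y) \<le> ct' * (?M + \<eta>)" using b2 c0 by (intro mult_left_mono) auto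
        then show "\<bar>deriv ?k y\<bar> \<le> ct' * ?M + (ct' + 1) * \<eta>"
          unfolding dk using a b1 by (simp add: algebra_simps)
      qed
    qed
  qed (use d in simp)
  then have "\<bar>(u0 (?x + d) - u0 ?x) - ?P * d\<bar> \<le> (ct' * ?M + (ct' + 1) * \<eta>) * d" by (simp add: algebra_simps)
  then have "\<bar>?P - (u0 (?x + d) - u0 ?x) / d\<bar> * d \<le> (ct' * ?M + (ct' + 1) * \<eta>) * d"
  proof -
    assume le: "\<bar>(u0 (?x + d) - u0 ?x) - ?P * d\<bar> \<le> (ct' * ?M + (ct' + 1) * \<eta>) * d"
    have "w - p * d = - ((p - w / d) * d)" for w p using d by (simp add: left_diff_distrib)
    from this[of "u0 (?x + d) - u0 ?x" ?P] show ?thesis using le d by (simp add: abs_mult)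
  qed
  then have num: "\<bar>?P - (u0 (?x + d) - u0 ?x) / d\<bar> \<le> ct' * ?M + (ct' + 1) * \<eta>" using d by simp
  have M0: "0 < ?M" using m(1) m(2)[of ?x "u0 ?x" b] by linarith
  have \<eta>0: "0 \<le> \<eta>" using A0 L0_nonneg Lv_nonneg d by (simp add: \<eta>_def)
  have "\<bar>xp.slope d n (u0x ?x) b\<bar> = \<bar>?P - (u0 (?x + d) - u0 ?x) / d\<bar> / ?M"
    unfolding xp.slope_def nd x0_def[symmetric] u0x_eq[OF x(1)] u0x_eq[OF x(2)] using M0 by (simp add: abs_divide)
  also have "\<dots> \<le> (ct' * ?M + (ct' + 1) * \<eta>) / ?M" using num M0 by (intro divide_right_mono) auto
  also have "\<dots> = ct' + (ct' + 1) * \<eta> / ?M" using M0 by (simp add: add_divide_distrib)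
  also have "\<dots> \<le> ct' + (ct' + 1) * \<eta> / m"
    using m(1) m(2)[of ?x "u0 ?x" b] c0 \<eta>0 by (intro add_left_mono divide_left_mono) auto
  also have "(ct' + 1) * \<eta> / m = Cs * (d + \<bar>b - v0 ?x\<bar>)" by (simp add: Cs_def \<eta>_def)
  finally show ?thesis unfolding x0_def .
qed

text \<open>The growth bound holds for the clamped problem and stays within the clamping radius,
  which is what allows the clamps to be removed afterwards.\<close>

lemma limit_in_ball:
  assumes lim: "xp.limit_solution X Z u v" and X: "X \<le> 1" and xt: "x \<in> {0..X}" "0 \<le> t"
  shows "\<bar>u x t\<bar> \<le> R" "\<bar>v x t\<bar> \<le> R"
proof -
  have "max \<bar>u x t\<bar> \<bar>v x t\<bar> \<le> exp (lF * ell * x) * K0" by (rule xp.limit_solutionD(5)[OF lim xt])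
  also have "\<dots> \<le> exp (lF * ell) * K0"
    using xt X lF_nonneg ell_pos K0_nonneg by (intro mult_right_mono) (auto simp: mult_left_le)
  finally show "\<bar>u x t\<bar> \<le> R" "\<bar>v x t\<bar> \<le> R" by (auto simp: R_eq)
qed

text \<open>In the ball of radius \<open>R\<close> the clamps act as the identity, so
  \<open>Mu\<close> and \<open>Mv\<close> are reciprocals of the true speeds, and multiplying
  \<open>Pu\<close> and \<open>Pv\<close> by these speeds returns the true sources.\<close>

lemma limit_x_solution:
  assumes lim: "xp.limit_solution X Z u v" and Z: "0 \<le> Z" and X: "0 < X" "X \<le> 1"
  shows "x_solution lu lv fu fv g u0 phi X u v"
proof -
  let ?C = "Z * ell + Pm"
  have C: "0 \<le> ?C" using Z ell_pos Pm_nonneg by simp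
  have lipu: "\<bar>u x t - u y s\<bar> \<le> ?C * \<bar>x - y\<bar> + Z * \<bar>t - s\<bar>" and lipv: "\<bar>v x t - v y s\<bar> \<le> ?C * \<bar>x - y\<bar> + Z * \<bar>t - s\<bar>"
    if "x \<in> {0..X}" "y \<in> {0..X}" "0 \<le> t" "0 \<le> s" for x y t s
    using xp.limit_solutionD(1,2)[OF lim that] by auto
  have x1: "x \<in> {0..1}" if "x \<in> {0..X}" for x using that X by auto
  have L: "(2 * (?C + Z))-lipschitz_on ({0..X} \<times> {0..}) (\<lambda>(x, t). (u x t, v x t))"
  proof (rule lipschitz_onI)
    fix p q :: "real \<times> real" assume "p \<in> {0..X} \<times> {0..}" "q \<in> {0..X} \<times> {0..}"
    then obtain x t y s where pq: "p = (x, t)" "q = (y, s)" "x \<in> {0..X}" "y \<in> {0..X}" "0 \<le> t" "0 \<le> s" by auto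
    have "dist (u x t, v x t) (u y s, v y s) \<le> \<bar>u x t - u y s\<bar> + \<bar>v x t - v y s\<bar>"
      unfolding dist_Pair_Pair dist_real_def using sqrt_sum_squares_le_sum_abs[of "\<bar>u x t - u y s\<bar>" "\<bar>v x t - v y s\<bar>"] by simp
    also have "\<dots> \<le> 2 * (?C * \<bar>x - y\<bar> + Z * \<bar>t - s\<bar>)" unfolding mult_2 by (rule add_mono[OF lipu[OF pq(3-6)] lipv[OF pq(3-6)]])
    also have "\<dots> \<le> 2 * (?C * dist p q + Z * dist p q)"
      using C Z dist_fst_le[of p q] dist_snd_le[of p q] unfolding pq
      by (intro mult_left_mono add_mono) (auto simp: dist_real_def)
    also have "\<dots> = 2 * (?C + Z) * dist p q" by (simp add: algebra_simps)
    finally show "dist (case p of (x, t) \<Rightarrow> (u x t, v x t)) (case q of (x, t) \<Rightarrow> (u x t, v x t)) \<le> 2 * (?C + Z) * dist p q"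
      by (simp add: pq)
  qed (use C Z in simp)
  have Fl: "\<bar>F x (u x t) (v x t) - F y (u y s) (v y s)\<bar> \<le> (A * (1 + 2 * ?C + 2 * Z)) * (\<bar>x - y\<bar> + \<bar>t - s\<bar>)"
    if F: "F \<in> {Mu, Mv, Pu, Pv}" and xy: "x \<in> {0..X}" "y \<in> {0..X}" "0 \<le> t" "0 \<le> s" for F x y t s
  proof -
    have aux: "p + (c * p + z * q) + (c * p + z * q) \<le> (1 + 2 * c + 2 * z) * (p + q)"
      if "0 \<le> p" "0 \<le> q" "0 \<le> c" "0 \<le> z" for p q c z :: real
      using that by (simp add: algebra_simps)
    have "\<bar>F x (u x t) (v x t) - F y (u y s) (v y s)\<bar> \<le> A * (\<bar>x - y\<bar> + \<bar>u x t - u y s\<bar> + \<bar>v x t - v y s\<bar>)"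
      by (rule A_lip[OF F])
    also have "\<dots> \<le> A * (\<bar>x - y\<bar> + (?C * \<bar>x - y\<bar> + Z * \<bar>t - s\<bar>) + (?C * \<bar>x - y\<bar> + Z * \<bar>t - s\<bar>))"
      using A0 by (intro mult_left_mono add_mono lipu lipv xy order_refl)
    also have "\<dots> \<le> A * ((1 + 2 * ?C + 2 * Z) * (\<bar>x - y\<bar> + \<bar>t - s\<bar>))"
      using A0 C Z by (intro mult_left_mono aux) auto
    finally show ?thesis by (simp add: mult.assoc)
  qed
  have AC: "0 \<le> A * (1 + 2 * ?C + 2 * Z)" using A0 C Z by simp
  have ball: "\<bar>u x t\<bar> \<le> R" "\<bar>v x t\<bar> \<le> R" if "x \<in> {0..X}" "0 \<le> t" for x t
    using limit_in_ball[OF lim X(2) that] by auto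
  have intu: "((\<lambda>t. fu (\<xi> t) (u (\<xi> t) t) (v (\<xi> t) t)) has_integral (u (\<xi> b) b - u (\<xi> a) a)) {a..b}"
    if ch: "characteristic X lu u v \<xi> a b" for \<xi> a b
  proof -
    have in_X: "\<xi> t \<in> {0..X}" "0 \<le> t" if "t \<in> {a..b}" for t using ch that by (auto simp: characteristic_def)
    have "((\<lambda>t. Pu (\<xi> t) (u (\<xi> t) t) (v (\<xi> t) t) * lu (\<xi> t) (u (\<xi> t) t) (v (\<xi> t) t)) has_integral (u (\<xi> b) b - u (\<xi> a) a)) {a..b}"
    proof (rule integral_along_characteristic[where \<sigma> = 1 and w = u and M = "\<lambda>x t. Mu x (u x t) (v x t)"
          and P = "\<lambda>x t. Pu x (u x t) (v x t)" and sp = "\<lambda>x t. lu x (u x t) (v x t)" and C = ?C and Z = Z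
          and l = ell and X = X and K = "xp.Cc Z", OF _ C Z ell_pos lipu Fl Fl AC])
      show "0 < lu x (u x t) (v x t) \<and> Mu x (u x t) (v x t) * lu x (u x t) (v x t) = 1" if "x \<in> {0..X}" "0 \<le> t" for x t
        using unclamped(1)[OF x1[OF that(1)] ball[OF that]] pos[OF x1[OF that(1)], of "u x t" "v x t"] by simp
      show "0 \<le> Mu x (u x t) (v x t) \<and> Mu x (u x t) (v x t) \<le> ell" for x t
        using m M_upper by (meson less_imp_le order_trans)
      show "\<bar>u (x + h) t - u x (t - 1 * h * Mu x (u x t) (v x t)) - 1 * h * Pu x (u x t) (v x t)\<bar> \<le> xp.Cc Z * h\<^sup>2"
        if "0 \<le> x" "0 \<le> h" "x + h \<le> X" "ell * h < t" for x h t
        by (rule xp.limit_solutionD(6)[OF lim that])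
      show "0 \<le> a" "a \<le> b" using ch by (auto simp: characteristic_def)
      show "\<xi> t \<in> {0..X} \<and> (\<xi> has_real_derivative 1 * lu (\<xi> t) (u (\<xi> t) t) (v (\<xi> t) t)) (at t within {a..b})" if "t \<in> {a..b}" for t
        using ch that by (simp add: characteristic_def)
    qed simp_all
    then show ?thesis
    proof (rule has_integral_eq[rotated])
      fix t assume t: "t \<in> {a..b}"
      note i = in_X[OF t]
      show "Pu (\<xi> t) (u (\<xi> t) t) (v (\<xi> t) t) * lu (\<xi> t) (u (\<xi> t) t) (v (\<xi> t) t) = fu (\<xi> t) (u (\<xi> t) t) (v (\<xi> t) t)"
        using unclamped(3)[OF x1[OF i(1)] ball[OF i]] pos[OF x1[OF i(1)], of "u (\<xi> t) t" "v (\<xi> t) t"] by simp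
    qed
  qed
  have intv: "((\<lambda>t. fv (\<xi> t) (u (\<xi> t) t) (v (\<xi> t) t)) has_integral (v (\<xi> b) b - v (\<xi> a) a)) {a..b}"
    if ch: "characteristic X (\<lambda>x a b. - lv x a b) u v \<xi> a b" for \<xi> a b
  proof -
    have in_X: "\<xi> t \<in> {0..X}" "0 \<le> t" if "t \<in> {a..b}" for t using ch that by (auto simp: characteristic_def)
    have "((\<lambda>t. Pv (\<xi> t) (u (\<xi> t) t) (v (\<xi> t) t) * lv (\<xi> t) (u (\<xi> t) t) (v (\<xi> t) t)) has_integral (v (\<xi> b) b - v (\<xi> a) a)) {a..b}"
    proof (rule integral_along_characteristic[where \<sigma> = "-1" and w = v and M = "\<lambda>x t. Mv x (u x t) (v x t)"
          and P = "\<lambda>x t. Pv x (u x t) (v x t)" and sp = "\<lambda>x t. lv x (u x t) (v x t)" and C = ?C and Z = Z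
          and l = ell and X = X and K = "xp.Cc Z", OF _ C Z ell_pos lipv Fl Fl AC])
      show "0 < lv x (u x t) (v x t) \<and> Mv x (u x t) (v x t) * lv x (u x t) (v x t) = 1" if "x \<in> {0..X}" "0 \<le> t" for x t
        using unclamped(2)[OF x1[OF that(1)] ball[OF that]] pos[OF x1[OF that(1)], of "u x t" "v x t"] by simp
      show "0 \<le> Mv x (u x t) (v x t) \<and> Mv x (u x t) (v x t) \<le> ell" for x t
        using M_upper by blast
      show "\<bar>v (x + h) t - v x (t - (-1) * h * Mv x (u x t) (v x t)) - (-1) * h * Pv x (u x t) (v x t)\<bar> \<le> xp.Cc Z * h\<^sup>2"
        if "0 \<le> x" "0 \<le> h" "x + h \<le> X" "ell * h < t" for x h t
      proof -
        have "0 \<le> t" using that(2,4) ell_pos by (meson less_imp_le mult_nonneg_nonneg order_trans)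
        then show ?thesis by (rule xp.limit_solutionD(7)[OF lim that(1-3)])
      qed
      show "0 \<le> a" "a \<le> b" using ch by (auto simp: characteristic_def)
      show "\<xi> t \<in> {0..X} \<and> (\<xi> has_real_derivative -1 * lv (\<xi> t) (u (\<xi> t) t) (v (\<xi> t) t)) (at t within {a..b})" if "t \<in> {a..b}" for t
        using ch that by (simp add: characteristic_def)
    qed simp_all
    then show ?thesis
    proof (rule has_integral_eq[rotated])
      fix t assume t: "t \<in> {a..b}"
      note i = in_X[OF t]
      show "Pv (\<xi> t) (u (\<xi> t) t) (v (\<xi> t) t) * lv (\<xi> t) (u (\<xi> t) t) (v (\<xi> t) t) = fv (\<xi> t) (u (\<xi> t) t) (v (\<xi> t) t)"
        using unclamped(4)[OF x1[OF i(1)] ball[OF i]] pos[OF x1[OF i(1)], of "u (\<xi> t) t" "v (\<xi> t) t"] by simp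
    qed
  qed
  have "broad_solution lu lv fu fv X u v"
    unfolding broad_solution_def using L intu intv by blast
  moreover have "\<forall>t\<ge>0. v 0 t = phi t \<and> u 0 t = g (phi t) t"
    using xp.limit_solutionD(4)[OF lim] by (simp add: ub_def)
  moreover have "\<forall>x\<in>{0..X}. u x 0 = u0 x"
    using xp.limit_solutionD(3)[OF lim] x1 u0x_eq by simp
  ultimately show ?thesis unfolding x_solution_def by blast
qed

text \<open>Compatibility of the data enters through \<open>compat\<close>: every limit on [0, X],
  however short, is a solution of the problem in the x-direction, so its trace at t = 0 is
  \<open>v0\<close>.\<close>

sublocale xpc: x_problem_compat Mu Mv Pu Pv A gam m ell Pm "lF * ell" K0 "exp (- gam)" L0 u0x ub phi v0 ct' Cs
proof
  show "ct' < exp (- gam)" by (rule ct'_props)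
  show "0 \<le> Cs" unfolding Cs_def using ct'_props A0 L0_nonneg Lv_nonneg m by simp
  show "\<bar>xp.slope d n (u0x (real n * d)) b\<bar> \<le> ct' + Cs * (d + \<bar>b - v0 (real n * d)\<bar>)"
    if "0 < d" "real (Suc n) * d \<le> 1" for d n b using slope_v0[OF that] .
  show "v x 0 = v0 x" if "0 < X" "X \<le> 1" "0 \<le> Z" "xp.limit_solution X Z u v" "x \<in> {0..X}" for X Z u v x
    using limit_x_solution[OF that(4,3,1,2)] compatible that unfolding compatible_data_def by blast
  show "phi 0 = v0 0" using compatible by (simp add: compatible_data_def)
qed simp

lemma solution_exists_unique:
  shows "\<exists>u v. in_X R (Lx + exp gam) u v \<and> system_solution lu lv fu fv g u0 v0 U u v \<and> (\<forall>t\<ge>0. v 0 t = phi t) \<and>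
    (\<forall>u' v'. in_X R (Lx + exp gam) u' v' \<and> system_solution lu lv fu fv g u0 v0 U u' v' \<longrightarrow>
      (\<forall>x\<in>{0..1}. \<forall>t\<ge>0. u' x t = u x t \<and> v' x t = v x t))"
proof -
  obtain u v where lim: "xp.limit_solution 1 (exp gam) u v" using xpc.solution_up_to_1 by blast
  have xs: "x_solution lu lv fu fv g u0 phi 1 u v"
    by (rule limit_x_solution[OF lim]) simp_all
  \<comment> \<open>At X = 1 compatibility supplies both the initial value of \<open>v\<close> and
    the input \<open>U\<close> at x = 1.\<close>
  have "(\<forall>x\<in>{0..1}. v x 0 = v0 x) \<and> ((1::real) = 1 \<longrightarrow> (\<forall>t\<ge>0. v 1 t = U t))"
    using xs compatible zero_less_one[where ?'a = real] order_refl[of "1::real"] unfolding compatible_data_def by blast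
  then have cmp: "\<forall>x\<in>{0..1}. v x 0 = v0 x" "\<forall>t\<ge>0. v 1 t = U t" by simp_all
  have Lx0: "0 \<le> Lx" using ell_pos Pm_nonneg by (simp add: Lx_def)
  let ?c = "Lx + exp gam"
  have lips': "\<bar>u x t - u y s\<bar> \<le> Lx * \<bar>x - y\<bar> + exp gam * \<bar>t - s\<bar>" "\<bar>v x t - v y s\<bar> \<le> Lx * \<bar>x - y\<bar> + exp gam * \<bar>t - s\<bar>"
    if "x \<in> {0..1}" "y \<in> {0..1}" "0 \<le> t" "0 \<le> s" for x y t s
    unfolding Lx_def by (rule xp.limit_solutionD(1)[OF lim that], rule xp.limit_solutionD(2)[OF lim that])
  have comb: "Lx * p + exp gam * q \<le> ?c * max p q" for p q
  proof -
    have "Lx * p \<le> Lx * max p q" "exp gam * q \<le> exp gam * max p q" using Lx0 by (auto intro: mult_left_mono)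
    then show ?thesis unfolding distrib_right by (rule add_mono)
  qed
  have inX: "in_X R ?c u v"
    unfolding in_X_def
  proof (intro conjI ballI allI impI)
    fix x t :: real assume "x \<in> {0..1}" "0 \<le> t"
    then show "max \<bar>u x t\<bar> \<bar>v x t\<bar> \<le> R" using limit_in_ball[OF lim order_refl] by simp
  next
    fix x y t s :: real assume *: "x \<in> {0..1}" "y \<in> {0..1}" "0 \<le> t" "0 \<le> s"
    show "max \<bar>u x t - u y s\<bar> \<bar>v x t - v y s\<bar> \<le> ?c * max \<bar>x - y\<bar> \<bar>t - s\<bar>"
      by (rule max.boundedI; rule order_trans[OF lips'(1)[OF *] comb] order_trans[OF lips'(2)[OF *] comb])
  qed
  have sys: "system_solution lu lv fu fv g u0 v0 U u v"
    using xs cmp unfolding system_solution_def x_solution_def by auto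
  \<comment> \<open>The competitor lies in the same class, so one Lipschitz constant and one bound
    serve all four components in \<open>two_solutions\<close>.\<close>
  have "u' x t = u x t \<and> v' x t = v x t"
    if X': "in_X R ?c u' v'" and S': "system_solution lu lv fu fv g u0 v0 U u' v'" and x: "x \<in> {0..1}" and t: "0 \<le> t" for u' v' x t
  proof -
    obtain L1 where L1: "0 \<le> L1" "\<And>x a b x' a' b'. x \<in> {0..1} \<Longrightarrow> x' \<in> {0..1} \<Longrightarrow> \<bar>lu x a b - lu x' a' b'\<bar> \<le> L1 * (\<bar>x - x'\<bar> + \<bar>a - a'\<bar> + \<bar>b - b'\<bar>)"
      using lipschitz_coeff_imp_lipschitz3[OF lips(1)] by metis
    obtain L2 where L2: "0 \<le> L2" "\<And>x a b x' a' b'. x \<in> {0..1} \<Longrightarrow> x' \<in> {0..1} \<Longrightarrow> \<bar>lv x a b - lv x' a' b'\<bar> \<le> L2 * (\<bar>x - x'\<bar> + \<bar>a - a'\<bar> + \<bar>b - b'\<bar>)"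
      using lipschitz_coeff_imp_lipschitz3[OF lips(2)] by metis
    obtain L3 where L3: "0 \<le> L3" "\<And>x a b x' a' b'. x \<in> {0..1} \<Longrightarrow> x' \<in> {0..1} \<Longrightarrow> \<bar>fu x a b - fu x' a' b'\<bar> \<le> L3 * (\<bar>x - x'\<bar> + \<bar>a - a'\<bar> + \<bar>b - b'\<bar>)"
      using lipschitz_coeff_imp_lipschitz3[OF lips(3)] by metis
    obtain L4 where L4: "0 \<le> L4" "\<And>x a b x' a' b'. x \<in> {0..1} \<Longrightarrow> x' \<in> {0..1} \<Longrightarrow> \<bar>fv x a b - fv x' a' b'\<bar> \<le> L4 * (\<bar>x - x'\<bar> + \<bar>a - a'\<bar> + \<bar>b - b'\<bar>)"
      using lipschitz_coeff_imp_lipschitz3[OF lips(4)] by metis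
    let ?L = "L1 + L2 + L3 + L4"
    have c0: "0 \<le> ?c" using Lx0 by simp
    have st: "\<bar>w x t - w y s\<bar> \<le> ?c * (\<bar>x - y\<bar> + \<bar>t - s\<bar>)"
      if "w \<in> {u, v, u', v'}" "x \<in> {0..1}" "y \<in> {0..1}" "0 \<le> t" "0 \<le> s" for w x y t s
    proof -
      have "\<bar>w x t - w y s\<bar> \<le> ?c * max \<bar>x - y\<bar> \<bar>t - s\<bar>"
        using that(1)
      proof (elim insertE emptyE)
        assume "w = u" then show ?thesis using inX that unfolding in_X_def by (meson max.bounded_iff)
      next
        assume "w = v" then show ?thesis using inX that unfolding in_X_def by (meson max.bounded_iff)
      next
        assume "w = u'" then show ?thesis using X' that unfolding in_X_def by (meson max.bounded_iff)
      next
        assume "w = v'" then show ?thesis using X' that unfolding in_X_def by (meson max.bounded_iff)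
      qed
      also have "\<dots> \<le> ?c * (\<bar>x - y\<bar> + \<bar>t - s\<bar>)" using c0 by (intro mult_left_mono) auto
      finally show ?thesis .
    qed
    interpret two_solutions ?L ?c lu lv fu fv u v u' v' g lg R
    proof
      show "\<bar>F x a b - F x' a' b'\<bar> \<le> ?L * (\<bar>x - x'\<bar> + \<bar>a - a'\<bar> + \<bar>b - b'\<bar>)"
        if F: "F \<in> {lu, lv, fu, fv}" and xx: "x \<in> {0..1}" "x' \<in> {0..1}" for F x x' a b a' b'
      proof -
        have mono: "M \<le> ?L \<Longrightarrow> M * (\<bar>x - x'\<bar> + \<bar>a - a'\<bar> + \<bar>b - b'\<bar>) \<le> ?L * (\<bar>x - x'\<bar> + \<bar>a - a'\<bar> + \<bar>b - b'\<bar>)" for M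
          by (rule mult_right_mono) simp_all
        have k: "L1 \<le> ?L" "L2 \<le> ?L" "L3 \<le> ?L" "L4 \<le> ?L" using L1(1) L2(1) L3(1) L4(1) by simp_all
        note b = order_trans[OF L1(2)[OF xx] mono[OF k(1)]] order_trans[OF L2(2)[OF xx] mono[OF k(2)]]
          order_trans[OF L3(2)[OF xx] mono[OF k(3)]] order_trans[OF L4(2)[OF xx] mono[OF k(4)]]
        consider "F = lu" | "F = lv" | "F = fu" | "F = fv" using F by blast
        then show ?thesis
        proof cases
          case 1 show ?thesis unfolding 1 by (rule b(1))
        next
          case 2 show ?thesis unfolding 2 by (rule b(2))
        next
          case 3 show ?thesis unfolding 3 by (rule b(3))
        next
          case 4 show ?thesis unfolding 4 by (rule b(4))
        qed
      qed
      show "\<bar>w x t\<bar> \<le> R" if "w \<in> {u, v, u', v'}" "x \<in> {0..1}" "0 \<le> t" for w x t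
        using that inX X' unfolding in_X_def by auto
      show "broad_solution lu lv fu fv 1 u v" "broad_solution lu lv fu fv 1 u' v'"
        using sys S' by (auto simp: system_solution_def)
      show "u 0 t = g (v 0 t) t" "u' 0 t = g (v' 0 t) t" "v 1 t = v' 1 t" if "0 \<le> t" for t
        using sys S' that by (auto simp: system_solution_def)
    qed (use L1(1) L2(1) L3(1) L4(1) c0 st pos g_lips lg_nonneg in auto)
    have "u y 0 = u' y 0 \<and> v y 0 = v' y 0" if "y \<in> {0..1}" for y
      using sys S' that by (simp add: system_solution_def)
    from unique[OF this x t] show ?thesis by simp
  qed
  moreover have "\<forall>t\<ge>0. v 0 t = phi t" using xs by (simp add: x_solution_def)
  ultimately show ?thesis using inX sys by blast
qed

end

theorem theorem4:
  fixes lu lv fu fv :: "real \<Rightarrow> real \<Rightarrow> real \<Rightarrow> real" and ct lg :: real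
  assumes "lipschitz_coeff lu" "lipschitz_coeff lv" "lipschitz_coeff fu" "lipschitz_coeff fv"
    and "\<And>x a b. x \<in> {0..1} \<Longrightarrow> 0 < lu x a b \<and> 0 < lv x a b"
    and "bdd_above (inv_Lambda_norm lu lv ` ({0..1} \<times> UNIV))"
    and "\<And>x. x \<in> {0..1} \<Longrightarrow> fu x 0 0 = 0 \<and> fv x 0 0 = 0"
  shows "\<exists>ct'>0. \<exists>c'>0.
    1 / (2 * max 1 lg) * exp (- gamma2 lu lv fu fv (kappa1 lu lv fu fv lg * ct)) \<le> ct' \<and>
    (\<forall>(g :: real \<Rightarrow> real \<Rightarrow> real) (u0 :: real \<Rightarrow> real) (v0 :: real \<Rightarrow> real)
       (U :: real \<Rightarrow> real) (phi :: real \<Rightarrow> real).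
      (\<exists>L. L-lipschitz_on (UNIV \<times> {0..}) (\<lambda>(b, t). g b t)) \<and> l_gu g = lg \<and>
      (\<forall>t\<ge>0. g 0 t = 0) \<and>
      (\<exists>L. L-lipschitz_on {0..1} u0) \<and> (\<exists>L. L-lipschitz_on {0..1} v0) \<and>
      (\<exists>L. L-lipschitz_on {0..} U) \<and> (\<exists>L. L-lipschitz_on {0..} phi) \<and>
      compatible_data lu lv fu fv g u0 v0 U phi \<and>
      (\<forall>x\<in>{0..1}. max \<bar>u0 x\<bar> \<bar>v0 x\<bar> \<le> ct) \<and> (\<forall>t\<ge>0. \<bar>phi t\<bar> \<le> ct) \<and>
      ess_sup_on {0..1} (ut_initial lu fu u0 v0) \<le> ct' \<and>
      dt_gu_norm g \<le> ct' \<and>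
      ess_sup_on {0..} (deriv phi) \<le> ct'
      \<longrightarrow>
      (\<exists>u v. in_X (kappa1 lu lv fu fv lg * ct) c' u v \<and>
         system_solution lu lv fu fv g u0 v0 U u v \<and> (\<forall>t\<ge>0. v 0 t = phi t) \<and>
         (\<forall>u' v'. in_X (kappa1 lu lv fu fv lg * ct) c' u' v' \<and>
            system_solution lu lv fu fv g u0 v0 U u' v' \<longrightarrow>
            (\<forall>x\<in>{0..1}. \<forall>t\<ge>0. u' x t = u x t \<and> v' x t = v x t))))"
proof (cases "0 \<le> ct")
  \<comment> \<open>For negative \<open>ct\<close> no initial data satisfy the supremum bound, so
    the claim about them is vacuous; the conservative estimate itself and 1 are taken as
    constants.\<close>
  case False
  have neg: "\<not> (\<forall>x\<in>{0..1}. max \<bar>u0 x\<bar> \<bar>v0 x\<bar> \<le> ct)" for u0 v0 :: "real \<Rightarrow> real"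
  proof
    assume "\<forall>x\<in>{0..1}. max \<bar>u0 x\<bar> \<bar>v0 x\<bar> \<le> ct"
    then have "\<bar>u0 0\<bar> \<le> ct" by auto
    then show False using False by linarith
  qed
  have p: "0 < 1 / (2 * max 1 lg) * exp (- gamma2 lu lv fu fv (kappa1 lu lv fu fv lg * ct))" by simp
  show ?thesis
    by (rule exI, rule conjI[OF p], rule exI[of _ 1], rule conjI[OF zero_less_one], rule conjI[OF order_refl],
        intro allI impI, elim conjE, rule notE[OF neg])
next
  case True
  interpret pde_coeffs lu lv fu fv ct lg using assms True by unfold_locales
  obtain A where A: "0 \<le> A" "\<And>F x a b x' a' b'. F \<in> {Mu, Mv, Pu, Pv} \<Longrightarrow> \<bar>F x a b - F x' a' b'\<bar> \<le> A * (\<bar>x - x'\<bar> + \<bar>a - a'\<bar> + \<bar>b - b'\<bar>)"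
    using coeff_lipschitz by blast
  obtain m where m: "0 < m" "\<And>x a b. m \<le> Mu x a b" using Mu_lower by blast
  \<comment> \<open>The sum of the Lipschitz constants in x and in t is a constant for the maximum
    norm of (x, t).\<close>
  have c': "0 < Lx + exp gam" using ell_pos Pm_nonneg by (simp add: Lx_def add_nonneg_pos)
  have eq: "kappa1 lu lv fu fv lg * ct = R" "gamma2 lu lv fu fv R = gam" "1 / (2 * max 1 lg) * exp (- gam) = ct'"
    by (simp_all add: R_def gam_def ct'_def)
  show ?thesis
    unfolding eq
  proof (rule exI[of _ ct'], rule conjI[OF ct'_props(1)], rule exI[of _ "Lx + exp gam"], rule conjI[OF c'],
      rule conjI[OF order_refl], intro allI impI, elim conjE exE)
    fix g :: "real \<Rightarrow> real \<Rightarrow> real" and u0 v0 U phi :: "real \<Rightarrow> real" and Lg L0 Lv LU Lp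
    assume *: "Lg-lipschitz_on (UNIV \<times> {0..}) (\<lambda>(b, t). g b t)" "l_gu g = lg" "\<forall>t\<ge>0. g 0 t = 0"
      "L0-lipschitz_on {0..1} u0" "Lv-lipschitz_on {0..1} v0" "LU-lipschitz_on {0..} U" "Lp-lipschitz_on {0..} phi"
      "compatible_data lu lv fu fv g u0 v0 U phi"
      "\<forall>x\<in>{0..1}. max \<bar>u0 x\<bar> \<bar>v0 x\<bar> \<le> ct" "\<forall>t\<ge>0. \<bar>phi t\<bar> \<le> ct"
      "ess_sup_on {0..1} (ut_initial lu fu u0 v0) \<le> ct'" "dt_gu_norm g \<le> ct'" "ess_sup_on {0..} (deriv phi) \<le> ct'"
    interpret pde_instance lu lv fu fv ct lg g u0 v0 U phi A m L0 Lv
      by unfold_locales (use * A m in \<open>blast+\<close>)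
    show "\<exists>u v. in_X R (Lx + exp gam) u v \<and> system_solution lu lv fu fv g u0 v0 U u v \<and> (\<forall>t\<ge>0. v 0 t = phi t) \<and>
       (\<forall>u' v'. in_X R (Lx + exp gam) u' v' \<and> system_solution lu lv fu fv g u0 v0 U u' v' \<longrightarrow>
          (\<forall>x\<in>{0..1}. \<forall>t\<ge>0. u' x t = u x t \<and> v' x t = v x t))"
      by (rule solution_exists_unique)
  qed
qed

end
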